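(* Let $k$ be a commutative ring and $d\ge 1$. Let $\mathcal{F}\colon \mathsf{Rep}\,\Gamma^d_k\to k\mathfrak{S}_d\text{-}\mathsf{Mod}$ be the Schur functor and $\mathcal{G}_{\mathrm{Hom}}$ its right adjoint. Then there is an isomorphism, natural in $X\in\mathsf{Rep}\,\Gamma^d_k$, \[\mathcal{G}_{\mathrm{Hom}}\mathcal{F}(X)\cong \mathcal{H}om_{\Gamma^d_k}(S^d,X),\] where $\mathcal{H}om_{\Gamma^d_k}$ is the internal hom of strict polynomial functors.
   Context: $k$ is a commutative ring, $\mathsf{P}_k$ the category of finitely generated projective $k$-modules, $\mathsf{M}_k$ the category of all $k$-modules, $\mathfrak{S}_d$ the symmetric group on $d$ letters. For $V\in\mathsf{P}_k$, $\mathfrak{S}_d$ acts on the right on $V^{\otimes d}$ by permuting factors; $\Gamma^dV$ is the module of invariants and $S^dV$ the module of coinvariants of $V^{\otimes d}$. The category $\Gamma^d\mathsf{P}_k$ has the same objects as $\mathsf{P}_k$ and morphisms $\mathrm{Hom}_{\Gamma^d\mathsf{P}_k}(V,W)=\Gamma^d\mathrm{Hom}_k(V,W)=(\mathrm{Hom}_k(V,W)^{\otimes d})^{\mathfrak{S}_d}$ (identified with the $\mathfrak{S}_d$-equivariant $k$-linear maps $V^{\otimes d}\to W^{\otimes d}$, composed as such). The category of strict polynomial functors is $\mathsf{Rep}\,\Gamma^d_k=\mathrm{Fun}_k(\Gamma^d\mathsf{P}_k,\mathsf{M}_k)$ ($k$-linear functors), with morphisms written $\mathrm{Hom}_{\Gamma^d_k}$.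 The functors $\Gamma^d$, $S^d$ and $\Gamma^\omega\colon V\mapsto V^{\otimes d}$ (with $\omega=(1,\dots,1)$, $d$ entries) belong to it. Representable functors are $\Gamma^{d,V}=\mathrm{Hom}_{\Gamma^d\mathsf{P}_k}(V,-)$. Internal tensor product and hom: $\otimes_{\Gamma^d_k}$ is the Day convolution product on $\mathsf{Rep}\,\Gamma^d_k$, i.e. the bifunctor preserving colimits in each variable with $\Gamma^{d,V}\otimes_{\Gamma^d_k}\Gamma^{d,W}=\Gamma^{d,V\otimes_k W}$, functorially in $V,W\in\Gamma^d\mathsf{P}_k$, where $\Gamma^d\mathsf{P}_k$ carries the tensor product given on objects by $V\otimes_kW$ and on morphisms by $\Gamma^d\mathrm{Hom}(V,V')\times\Gamma^d\mathrm{Hom}(W,W')\to\Gamma^d(\mathrm{Hom}(V,V')\otimes\mathrm{Hom}(W,W'))\cong\Gamma^d\mathrm{Hom}(V\otimes W,V'\otimes W')$. The internal hom $\mathcal{H}om_{\Gamma^d_k}$ is characterized by the natural adjunction $\mathrm{Hom}_{\Gamma^d_k}(X\otimes_{\Gamma^d_k}Y,Z)\cong\mathrm{Hom}_{\Gamma^d_k}(X,\mathcal{H}om_{\Gamma^d_k}(Y,Z))$; on representables $\mathcal{H}om_{\Gamma^d_k}(\Gamma^{d,V},\Gamma^{d,W})=\Gamma^{d,\mathrm{Hom}(V,W)}$. Schur functor: $\mathcal{F}=\mathrm{Hom}_{\Gamma^d_k}(\Gamma^\omega,-)$, with values in right $\mathrm{End}_{\Gamma^d_k}(\Gamma^\omega)$-modules,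 identified with left $k\mathfrak{S}_d$-modules via $\mathrm{End}_{\Gamma^d_k}(\Gamma^\omega)\cong (k\mathfrak{S}_d)^{\mathrm{op}}$ (coming from the right permutation action of $\mathfrak{S}_d$ on $V^{\otimes d}$). Its right adjoint is $\mathcal{G}_{\mathrm{Hom}}(N)=\bigl(V\mapsto \mathrm{Hom}_{k\mathfrak{S}_d}(\mathcal{F}(\Gamma^{d,V}),N)\bigr)$. *)

theory Defs
  imports "HOL-Algebra.Module" "HOL-Algebra.AbelCoset" "HOL-Algebra.Sym_Groups"
begin

section \<open>Linear algebra over a commutative ring\<close>

text \<open>
  A module in HOL-Algebra is a record extending rings; the multiplicative fields
  play no role and are left unspecified below. Linear maps that are elements of a
  Hom module are normalised to be \<^const>\<open>extensional\<close> on the carrier of their source,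
  so that equality of morphisms is equality in HOL.
\<close>

definition linear_map ::
  "('a, 'r) ring_scheme \<Rightarrow> ('a, 'm, 's) module_scheme \<Rightarrow> ('a, 'n, 't) module_scheme \<Rightarrow> ('m \<Rightarrow> 'n) \<Rightarrow> bool"
  where "linear_map R M N f \<longleftrightarrow>
    f \<in> carrier M \<rightarrow> carrier N \<and>
    (\<forall>x\<in>carrier M. \<forall>y\<in>carrier M. f (x \<oplus>\<^bsub>M\<^esub> y) = f x \<oplus>\<^bsub>N\<^esub> f y) \<and>
    (\<forall>a\<in>carrier R. \<forall>x\<in>carrier M. f (a \<odot>\<^bsub>M\<^esub> x) = a \<odot>\<^bsub>N\<^esub> f x)"

definition linear_iso ::
  "('a, 'r) ring_scheme \<Rightarrow> ('a, 'm, 's) module_scheme \<Rightarrow> ('a, 'n, 't) module_scheme \<Rightarrow> ('m \<Rightarrow> 'n) \<Rightarrow> bool"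
  where "linear_iso R M N f \<longleftrightarrow> linear_map R M N f \<and> bij_betw f (carrier M) (carrier N)"

definition hom_module ::
  "('a, 'r) ring_scheme \<Rightarrow> ('a, 'm, 's) module_scheme \<Rightarrow> ('a, 'n, 't) module_scheme \<Rightarrow> ('a, 'm \<Rightarrow> 'n) module"
  where "hom_module R M N =
    \<lparr>carrier = {f \<in> extensional (carrier M). linear_map R M N f},
     monoid.mult = undefined, monoid.one = undefined,
     ring.zero = (\<lambda>x\<in>carrier M. \<zero>\<^bsub>N\<^esub>),
     ring.add = (\<lambda>f g. \<lambda>x\<in>carrier M. f x \<oplus>\<^bsub>N\<^esub> g x),
     module.smult = (\<lambda>a f. \<lambda>x\<in>carrier M. a \<odot>\<^bsub>N\<^esub> f x)\<rparr>"

definition submodule_span ::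
  "('a, 'r) ring_scheme \<Rightarrow> ('a, 'm, 's) module_scheme \<Rightarrow> 'm set \<Rightarrow> 'm set"
  where "submodule_span R M A = \<Inter>{N. submodule N R M \<and> A \<subseteq> N}"

definition quot_module :: "('a, 'm, 's) module_scheme \<Rightarrow> 'm set \<Rightarrow> ('a, 'm set) module"
  where "quot_module M N =
    \<lparr>carrier = a_rcosets\<^bsub>M\<^esub> N,
     monoid.mult = undefined, monoid.one = undefined,
     ring.zero = N,
     ring.add = (\<lambda>K L. K <+>\<^bsub>M\<^esub> L),
     module.smult = (\<lambda>a K. \<Union>x\<in>K. N +>\<^bsub>M\<^esub> (a \<odot>\<^bsub>M\<^esub> x))\<rparr>"

text \<open>The map induced by \<open>f\<close> from a quotient \<open>Q\<close> to the quotient of \<open>M'\<close> by \<open>N'\<close>.\<close>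

definition quot_map ::
  "('a, 'm set) module \<Rightarrow> ('a, 'n, 't) module_scheme \<Rightarrow> 'n set \<Rightarrow> ('m \<Rightarrow> 'n) \<Rightarrow> 'm set \<Rightarrow> 'n set"
  where "quot_map Q M' N' f = (\<lambda>K\<in>carrier Q. the_elem ((\<lambda>x. N' +>\<^bsub>M'\<^esub> f x) ` K))"

definition free_module :: "('a, 'r) ring_scheme \<Rightarrow> 'g set \<Rightarrow> ('a, 'g \<Rightarrow> 'a) module"
  where "free_module R S =
    \<lparr>carrier = {c. (\<forall>s\<in>S. c s \<in> carrier R) \<and> (\<forall>s. s \<notin> S \<longrightarrow> c s = \<zero>\<^bsub>R\<^esub>) \<and> finite {s. c s \<noteq> \<zero>\<^bsub>R\<^esub>}},
     monoid.mult = undefined, monoid.one = undefined,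
     ring.zero = (\<lambda>_. \<zero>\<^bsub>R\<^esub>),
     ring.add = (\<lambda>b c. \<lambda>s. b s \<oplus>\<^bsub>R\<^esub> c s),
     module.smult = (\<lambda>a c. \<lambda>s. a \<otimes>\<^bsub>R\<^esub> c s)\<rparr>"

definition basis_vec :: "('a, 'r) ring_scheme \<Rightarrow> 'g \<Rightarrow> 'g \<Rightarrow> 'a"
  where "basis_vec R s = (\<lambda>t. if t = s then \<one>\<^bsub>R\<^esub> else \<zero>\<^bsub>R\<^esub>)"

text \<open>Modules presented by generators and relations.\<close>

definition pres_module ::
  "('a, 'r) ring_scheme \<Rightarrow> 'g set \<Rightarrow> ('g \<Rightarrow> 'a) set \<Rightarrow> ('a, ('g \<Rightarrow> 'a) set) module"
  where "pres_module R S Rel = quot_module (free_module R S) (submodule_span R (free_module R S) Rel)"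

definition pres_gen ::
  "('a, 'r) ring_scheme \<Rightarrow> 'g set \<Rightarrow> ('g \<Rightarrow> 'a) set \<Rightarrow> 'g \<Rightarrow> ('g \<Rightarrow> 'a) set"
  where "pres_gen R S Rel s =
    submodule_span R (free_module R S) Rel +>\<^bsub>free_module R S\<^esub> basis_vec R s"

text \<open>
  The linear map from a presented module \<open>Q\<close> to \<open>N\<close> that sends the class of each generator
  \<open>s\<close> to \<open>g s\<close>; it is only used for \<open>g\<close> compatible with the relations, where all
  representatives of a class have the same image.
\<close>

definition pres_lift ::
  "('a, 'r) ring_scheme \<Rightarrow> ('a, ('g \<Rightarrow> 'a) set) module \<Rightarrow> ('a, 'n, 't) module_scheme
    \<Rightarrow> ('g \<Rightarrow> 'n) \<Rightarrow> ('g \<Rightarrow> 'a) set \<Rightarrow> 'n"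
  where "pres_lift R Q N g =
    (\<lambda>K\<in>carrier Q. the_elem ((\<lambda>c. \<Oplus>\<^bsub>N\<^esub>s\<in>{s. c s \<noteq> \<zero>\<^bsub>R\<^esub>}. c s \<odot>\<^bsub>N\<^esub> g s) ` K))"


subsection \<open>Tensor products of two modules\<close>

definition tensor_rels ::
  "('a, 'r) ring_scheme \<Rightarrow> ('a, 'm, 's) module_scheme \<Rightarrow> ('a, 'n, 't) module_scheme \<Rightarrow> ('m \<times> 'n \<Rightarrow> 'a) set"
  where "tensor_rels R M N =
    (let F = free_module R (carrier M \<times> carrier N); e = basis_vec R in
      {e (x \<oplus>\<^bsub>M\<^esub> x', y) \<ominus>\<^bsub>F\<^esub> (e (x, y) \<oplus>\<^bsub>F\<^esub> e (x', y)) | x x' y.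
         x \<in> carrier M \<and> x' \<in> carrier M \<and> y \<in> carrier N} \<union>
      {e (x, y \<oplus>\<^bsub>N\<^esub> y') \<ominus>\<^bsub>F\<^esub> (e (x, y) \<oplus>\<^bsub>F\<^esub> e (x, y')) | x y y'.
         x \<in> carrier M \<and> y \<in> carrier N \<and> y' \<in> carrier N} \<union>
      {e (a \<odot>\<^bsub>M\<^esub> x, y) \<ominus>\<^bsub>F\<^esub> (a \<odot>\<^bsub>F\<^esub> e (x, y)) | a x y.
         a \<in> carrier R \<and> x \<in> carrier M \<and> y \<in> carrier N} \<union>
      {e (x, a \<odot>\<^bsub>N\<^esub> y) \<ominus>\<^bsub>F\<^esub> (a \<odot>\<^bsub>F\<^esub> e (x, y)) | a x y.
         a \<in> carrier R \<and> x \<in> carrier M \<and> y \<in> carrier N})"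

definition tensor_module ::
  "('a, 'r) ring_scheme \<Rightarrow> ('a, 'm, 's) module_scheme \<Rightarrow> ('a, 'n, 't) module_scheme
    \<Rightarrow> ('a, ('m \<times> 'n \<Rightarrow> 'a) set) module"
  where "tensor_module R M N = pres_module R (carrier M \<times> carrier N) (tensor_rels R M N)"

definition pure_tensor ::
  "('a, 'r) ring_scheme \<Rightarrow> ('a, 'm, 's) module_scheme \<Rightarrow> ('a, 'n, 't) module_scheme
    \<Rightarrow> 'm \<Rightarrow> 'n \<Rightarrow> ('m \<times> 'n \<Rightarrow> 'a) set"
  where "pure_tensor R M N x y = pres_gen R (carrier M \<times> carrier N) (tensor_rels R M N) (x, y)"

definition tensor_map ::
  "('a, 'r) ring_scheme \<Rightarrow> ('a, 'm, 's) module_scheme \<Rightarrow> ('a, 'n, 't) module_scheme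
    \<Rightarrow> ('a, 'm2, 's2) module_scheme \<Rightarrow> ('a, 'n2, 't2) module_scheme
    \<Rightarrow> ('m \<Rightarrow> 'm2) \<Rightarrow> ('n \<Rightarrow> 'n2) \<Rightarrow> ('m \<times> 'n \<Rightarrow> 'a) set \<Rightarrow> ('m2 \<times> 'n2 \<Rightarrow> 'a) set"
  where "tensor_map R M N M' N' f g =
    pres_lift R (tensor_module R M N) (tensor_module R M' N')
      (\<lambda>(x, y). pure_tensor R M' N' (f x) (g y))"


subsection \<open>Tensor powers and the symmetric group\<close>

text \<open>The factors are numbered from \<open>1\<close> to \<open>d\<close>, to match \<^const>\<open>sym_group\<close>.\<close>

definition tpow_gens :: "nat \<Rightarrow> ('a, 'v, 's) module_scheme \<Rightarrow> (nat \<Rightarrow> 'v) set"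
  where "tpow_gens d V = (\<Pi>\<^sub>E i\<in>{1..d}. carrier V)"

definition tpow_rels ::
  "('a, 'r) ring_scheme \<Rightarrow> nat \<Rightarrow> ('a, 'v, 's) module_scheme \<Rightarrow> ((nat \<Rightarrow> 'v) \<Rightarrow> 'a) set"
  where "tpow_rels R d V =
    (let F = free_module R (tpow_gens d V); e = basis_vec R in
      {e (v(i := x \<oplus>\<^bsub>V\<^esub> y)) \<ominus>\<^bsub>F\<^esub> (e (v(i := x)) \<oplus>\<^bsub>F\<^esub> e (v(i := y))) | v i x y.
         v \<in> tpow_gens d V \<and> i \<in> {1..d} \<and> x \<in> carrier V \<and> y \<in> carrier V} \<union>
      {e (v(i := a \<odot>\<^bsub>V\<^esub> x)) \<ominus>\<^bsub>F\<^esub> (a \<odot>\<^bsub>F\<^esub> e (v(i := x))) | v i a x.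
         v \<in> tpow_gens d V \<and> i \<in> {1..d} \<and> a \<in> carrier R \<and> x \<in> carrier V})"

definition tpow ::
  "('a, 'r) ring_scheme \<Rightarrow> nat \<Rightarrow> ('a, 'v, 's) module_scheme \<Rightarrow> ('a, ((nat \<Rightarrow> 'v) \<Rightarrow> 'a) set) module"
  where "tpow R d V = pres_module R (tpow_gens d V) (tpow_rels R d V)"

definition tpow_pure ::
  "('a, 'r) ring_scheme \<Rightarrow> nat \<Rightarrow> ('a, 'v, 's) module_scheme \<Rightarrow> (nat \<Rightarrow> 'v) \<Rightarrow> ((nat \<Rightarrow> 'v) \<Rightarrow> 'a) set"
  where "tpow_pure R d V v = pres_gen R (tpow_gens d V) (tpow_rels R d V) v"

text \<open>
  The right action of the symmetric group: \<open>\<sigma>\<close> sends \<open>v\<^sub>1 \<otimes> \<dots> \<otimes> v\<^sub>d\<close> to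
  \<open>v\<^bsub>\<sigma> 1\<^esub> \<otimes> \<dots> \<otimes> v\<^bsub>\<sigma> d\<^esub>\<close>. Elements of \<^const>\<open>sym_group\<close> fix every number outside
  \<open>{1..d}\<close>, so \<open>v \<circ> \<sigma>\<close> is again extensional.
\<close>

definition tpow_perm ::
  "('a, 'r) ring_scheme \<Rightarrow> nat \<Rightarrow> ('a, 'v, 's) module_scheme \<Rightarrow> (nat \<Rightarrow> nat)
    \<Rightarrow> ((nat \<Rightarrow> 'v) \<Rightarrow> 'a) set \<Rightarrow> ((nat \<Rightarrow> 'v) \<Rightarrow> 'a) set"
  where "tpow_perm R d V \<sigma> = pres_lift R (tpow R d V) (tpow R d V) (\<lambda>v. tpow_pure R d V (v \<circ> \<sigma>))"

text \<open>
  The isomorphism from the tensor product of the \<open>d\<close>-th tensor powers of \<open>V\<close> and \<open>W\<close> to the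
  \<open>d\<close>-th tensor power of \<open>V \<otimes> W\<close>, sending
  \<open>(v\<^sub>1 \<otimes> \<dots> \<otimes> v\<^sub>d) \<otimes> (w\<^sub>1 \<otimes> \<dots> \<otimes> w\<^sub>d)\<close> to \<open>(v\<^sub>1 \<otimes> w\<^sub>1) \<otimes> \<dots> \<otimes> (v\<^sub>d \<otimes> w\<^sub>d)\<close>.
\<close>

definition interchange ::
  "('a, 'r) ring_scheme \<Rightarrow> nat \<Rightarrow> ('a, 'v, 's) module_scheme \<Rightarrow> ('a, 'w, 't) module_scheme
    \<Rightarrow> (((nat \<Rightarrow> 'v) \<Rightarrow> 'a) set \<times> ((nat \<Rightarrow> 'w) \<Rightarrow> 'a) set \<Rightarrow> 'a) set
    \<Rightarrow> ((nat \<Rightarrow> ('v \<times> 'w \<Rightarrow> 'a) set) \<Rightarrow> 'a) set"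
  where "interchange R d V W =
    (let T = tpow R d (tensor_module R V W) in
      pres_lift R (tensor_module R (tpow R d V) (tpow R d W)) T
        (\<lambda>(s, t). pres_lift R (tpow R d V) T
          (\<lambda>v. pres_lift R (tpow R d W) T
            (\<lambda>w. tpow_pure R d (tensor_module R V W) (\<lambda>i\<in>{1..d}. pure_tensor R V W (v i) (w i)))
            t)
          s))"


section \<open>Divided powers of the category of finitely generated projective modules\<close>

text \<open>
  HOL has no type of all modules, so we use a small model of the category of finitely
  generated projective modules: its objects are the finitely generated projective modules
  (with an arbitrary module structure) whose elements are sequences in the type of the base
  ring. Every finitely generated projective module, being a direct summand of a free
  module of finite rank, is isomorphic to one of these.
\<close>

type_synonym 'a obj = "('a, nat \<Rightarrow> 'a) module"
type_synonym 'a opow = "((nat \<Rightarrow> (nat \<Rightarrow> 'a)) \<Rightarrow> 'a) set"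
type_synonym 'a mor = "'a opow \<Rightarrow> 'a opow"

definition fg_projective :: "('a, 'r) ring_scheme \<Rightarrow> ('a, 'v, 's) module_scheme \<Rightarrow> bool"
  where "fg_projective R V \<longleftrightarrow> module R V \<and>
    (\<exists>(n::nat) i p. linear_map R V (free_module R {..<n}) i \<and>
       linear_map R (free_module R {..<n}) V p \<and> (\<forall>x\<in>carrier V. p (i x) = x))"

definition fgproj :: "('a, 'r) ring_scheme \<Rightarrow> 'a obj set"
  where "fgproj R = {V. fg_projective R V}"

text \<open>
  Morphisms are the equivariant linear maps between tensor powers, under the identification
  of the invariants in the \<open>d\<close>-th tensor power of \<open>Hom(V, W)\<close> with these. The source and target
  are not required to lie in \<^const>\<open>fgproj\<close>, so that \<open>V \<otimes> W\<close>, whose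
  elements have another type, can be used as a source.
\<close>

definition gam_hom ::
  "('a, 'r) ring_scheme \<Rightarrow> nat \<Rightarrow> ('a, 'v, 's) module_scheme \<Rightarrow> ('a, 'w, 't) module_scheme
    \<Rightarrow> ('a, ((nat \<Rightarrow> 'v) \<Rightarrow> 'a) set \<Rightarrow> ((nat \<Rightarrow> 'w) \<Rightarrow> 'a) set) module"
  where "gam_hom R d V W =
    (hom_module R (tpow R d V) (tpow R d W))
      \<lparr>carrier := {f \<in> carrier (hom_module R (tpow R d V) (tpow R d W)).
         \<forall>\<sigma>\<in>carrier (sym_group d). \<forall>t\<in>carrier (tpow R d V).
           f (tpow_perm R d V \<sigma> t) = tpow_perm R d W \<sigma> (f t)}\<rparr>"

definition gam_id ::
  "('a, 'r) ring_scheme \<Rightarrow> nat \<Rightarrow> ('a, 'v, 's) module_scheme \<Rightarrow> ((nat \<Rightarrow> 'v) \<Rightarrow> 'a) set \<Rightarrow> ((nat \<Rightarrow> 'v) \<Rightarrow> 'a) set"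
  where "gam_id R d V = (\<lambda>t\<in>carrier (tpow R d V). t)"

text \<open>\<open>gam_comp R d V g f\<close> is the composite of \<open>f\<close>, with source \<open>V\<close>, and \<open>g\<close>.\<close>

definition gam_comp ::
  "('a, 'r) ring_scheme \<Rightarrow> nat \<Rightarrow> ('a, 'v, 's) module_scheme \<Rightarrow> ('x \<Rightarrow> 'y)
    \<Rightarrow> (((nat \<Rightarrow> 'v) \<Rightarrow> 'a) set \<Rightarrow> 'x) \<Rightarrow> ((nat \<Rightarrow> 'v) \<Rightarrow> 'a) set \<Rightarrow> 'y"
  where "gam_comp R d V g f = compose (carrier (tpow R d V)) g f"

text \<open>
  The tensor product of two morphisms \<open>f\<close> from \<open>V\<close> to \<open>V'\<close> and \<open>g\<close> from \<open>W\<close> to \<open>W'\<close>.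
  For \<open>f = \<phi> \<otimes> \<dots> \<otimes> \<phi>\<close> and \<open>g = \<psi> \<otimes> \<dots> \<otimes> \<psi>\<close> it is \<open>(\<phi> \<otimes> \<psi>) \<otimes> \<dots> \<otimes> (\<phi> \<otimes> \<psi>)\<close>.
\<close>

definition gam_tensor ::
  "('a, 'r) ring_scheme \<Rightarrow> nat \<Rightarrow> ('a, 'v, 's) module_scheme \<Rightarrow> ('a, 'w, 't) module_scheme
    \<Rightarrow> ('a, 'v2, 's2) module_scheme \<Rightarrow> ('a, 'w2, 't2) module_scheme
    \<Rightarrow> (((nat \<Rightarrow> 'v) \<Rightarrow> 'a) set \<Rightarrow> ((nat \<Rightarrow> 'v2) \<Rightarrow> 'a) set)
    \<Rightarrow> (((nat \<Rightarrow> 'w) \<Rightarrow> 'a) set \<Rightarrow> ((nat \<Rightarrow> 'w2) \<Rightarrow> 'a) set)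
    \<Rightarrow> ((nat \<Rightarrow> ('v \<times> 'w \<Rightarrow> 'a) set) \<Rightarrow> 'a) set \<Rightarrow> ((nat \<Rightarrow> ('v2 \<times> 'w2 \<Rightarrow> 'a) set) \<Rightarrow> 'a) set"
  where "gam_tensor R d V W V' W' f g =
    (\<lambda>u\<in>carrier (tpow R d (tensor_module R V W)).
      interchange R d V' W'
        (tensor_map R (tpow R d V) (tpow R d W) (tpow R d V') (tpow R d W') f g
          (inv_into (carrier (tensor_module R (tpow R d V) (tpow R d W))) (interchange R d V W) u)))"


section \<open>Strict polynomial functors\<close>

text \<open>
  The type \<open>'m\<close> of the elements of the values is a parameter; the target of a functor
  consists of all modules on that type. Since a morphism does not determine its source and
  target, these are passed to \<open>ar\<close> explicitly. The action on a morphism is required to be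
  extensional, like all elements of Hom modules.
\<close>

record ('a, 'm) spf =
  ob :: "'a obj \<Rightarrow> ('a, 'm) module"
  ar :: "'a obj \<Rightarrow> 'a obj \<Rightarrow> 'a mor \<Rightarrow> 'm \<Rightarrow> 'm"

locale strict_polynomial_functor =
  fixes R :: "('a, 'r) ring_scheme" and d :: nat and F :: "('a, 'm) spf"
  assumes ob_module: "V \<in> fgproj R \<Longrightarrow> module R (ob F V)"
    and ar_linear: "\<lbrakk>V \<in> fgproj R; W \<in> fgproj R\<rbrakk> \<Longrightarrow>
      linear_map R (gam_hom R d V W) (hom_module R (ob F V) (ob F W)) (ar F V W)"
    and ar_id: "\<lbrakk>V \<in> fgproj R; x \<in> carrier (ob F V)\<rbrakk> \<Longrightarrow> ar F V V (gam_id R d V) x = x"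
    and ar_comp: "\<lbrakk>U \<in> fgproj R; V \<in> fgproj R; W \<in> fgproj R;
      f \<in> carrier (gam_hom R d U V); g \<in> carrier (gam_hom R d V W); x \<in> carrier (ob F U)\<rbrakk> \<Longrightarrow>
      ar F U W (gam_comp R d U g f) x = ar F V W g (ar F U V f x)"

type_synonym ('a, 'm, 'n) trans = "'a obj \<Rightarrow> 'm \<Rightarrow> 'n"

definition nat_module ::
  "('a, 'r) ring_scheme \<Rightarrow> nat \<Rightarrow> ('a, 'm) spf \<Rightarrow> ('a, 'n) spf \<Rightarrow> ('a, ('a, 'm, 'n) trans) module"
  where "nat_module R d F G =
    \<lparr>carrier = {\<eta> \<in> (\<Pi>\<^sub>E V\<in>fgproj R. carrier (hom_module R (ob F V) (ob G V))).
       \<forall>V\<in>fgproj R. \<forall>W\<in>fgproj R. \<forall>f\<in>carrier (gam_hom R d V W). \<forall>x\<in>carrier (ob F V).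
         \<eta> W (ar F V W f x) = ar G V W f (\<eta> V x)},
     monoid.mult = undefined, monoid.one = undefined,
     ring.zero = (\<lambda>V\<in>fgproj R. \<zero>\<^bsub>hom_module R (ob F V) (ob G V)\<^esub>),
     ring.add = (\<lambda>\<eta> \<theta>. \<lambda>V\<in>fgproj R. \<eta> V \<oplus>\<^bsub>hom_module R (ob F V) (ob G V)\<^esub> \<theta> V),
     module.smult = (\<lambda>a \<eta>. \<lambda>V\<in>fgproj R. a \<odot>\<^bsub>hom_module R (ob F V) (ob G V)\<^esub> \<eta> V)\<rparr>"

definition nat_id :: "('a, 'r) ring_scheme \<Rightarrow> ('a, 'm) spf \<Rightarrow> ('a, 'm, 'm) trans"
  where "nat_id R F = (\<lambda>V\<in>fgproj R. \<lambda>x\<in>carrier (ob F V). x)"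

text \<open>\<open>nat_comp R F \<beta> \<alpha>\<close> is the composite of \<open>\<alpha>\<close>, with source \<open>F\<close>, and \<open>\<beta>\<close>.\<close>

definition nat_comp ::
  "('a, 'r) ring_scheme \<Rightarrow> ('a, 'm) spf \<Rightarrow> ('a, 'n, 'p) trans \<Rightarrow> ('a, 'm, 'n) trans \<Rightarrow> ('a, 'm, 'p) trans"
  where "nat_comp R F \<beta> \<alpha> = (\<lambda>V\<in>fgproj R. compose (carrier (ob F V)) (\<beta> V) (\<alpha> V))"

definition nat_iso ::
  "('a, 'r) ring_scheme \<Rightarrow> nat \<Rightarrow> ('a, 'm) spf \<Rightarrow> ('a, 'n) spf \<Rightarrow> ('a, 'm, 'n) trans \<Rightarrow> bool"
  where "nat_iso R d F G \<eta> \<longleftrightarrow> \<eta> \<in> carrier (nat_module R d F G) \<and>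
    (\<forall>V\<in>fgproj R. bij_betw (\<eta> V) (carrier (ob F V)) (carrier (ob G V)))"


subsection \<open>Representable functors, tensor powers and symmetric powers\<close>

text \<open>The representable functors, contravariant in the representing object.\<close>

definition gam_repr :: "('a, 'r) ring_scheme \<Rightarrow> nat \<Rightarrow> 'a obj \<Rightarrow> ('a, 'a mor) spf"
  where "gam_repr R d V =
    \<lparr>ob = (\<lambda>W. gam_hom R d V W),
     ar = (\<lambda>W W' g. \<lambda>f\<in>carrier (gam_hom R d V W). gam_comp R d V g f)\<rparr>"

definition gam_repr_map ::
  "('a, 'r) ring_scheme \<Rightarrow> nat \<Rightarrow> 'a obj \<Rightarrow> 'a obj \<Rightarrow> 'a mor \<Rightarrow> ('a, 'a mor, 'a mor) trans"
  where "gam_repr_map R d V W f =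
    (\<lambda>U\<in>fgproj R. \<lambda>g\<in>carrier (gam_hom R d W U). gam_comp R d V g f)"

text \<open>The functor sending \<open>V\<close> to its \<open>d\<close>-th tensor power.\<close>

definition gam_omega :: "('a, 'r) ring_scheme \<Rightarrow> nat \<Rightarrow> ('a, 'a opow) spf"
  where "gam_omega R d = \<lparr>ob = (\<lambda>V. tpow R d V), ar = (\<lambda>V W f. f)\<rparr>"

definition gam_omega_perm ::
  "('a, 'r) ring_scheme \<Rightarrow> nat \<Rightarrow> (nat \<Rightarrow> nat) \<Rightarrow> ('a, 'a opow, 'a opow) trans"
  where "gam_omega_perm R d \<sigma> = (\<lambda>V\<in>fgproj R. tpow_perm R d V \<sigma>)"

text \<open>The symmetric power: coinvariants of the tensor power.\<close>

definition coinv_sub ::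
  "('a, 'r) ring_scheme \<Rightarrow> nat \<Rightarrow> ('a, 'v, 's) module_scheme \<Rightarrow> ((nat \<Rightarrow> 'v) \<Rightarrow> 'a) set set"
  where "coinv_sub R d V = submodule_span R (tpow R d V)
    {tpow_perm R d V \<sigma> t \<ominus>\<^bsub>tpow R d V\<^esub> t | \<sigma> t. \<sigma> \<in> carrier (sym_group d) \<and> t \<in> carrier (tpow R d V)}"

definition sym_power :: "('a, 'r) ring_scheme \<Rightarrow> nat \<Rightarrow> ('a, 'a opow set) spf"
  where "sym_power R d =
    \<lparr>ob = (\<lambda>V. quot_module (tpow R d V) (coinv_sub R d V)),
     ar = (\<lambda>V W f. quot_map (quot_module (tpow R d V) (coinv_sub R d V))
                      (tpow R d W) (coinv_sub R d W) f)\<rparr>"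


section \<open>Day convolution and internal hom\<close>

text \<open>
  The Day convolution is given by the usual coend formula: \<open>(X \<otimes> Y)(U)\<close> is the coend over
  \<open>V, W\<close> of \<open>Hom(V \<otimes> W, U) \<otimes> X(V) \<otimes> Y(W)\<close>, with \<open>Hom\<close> taken in the divided power category.
  A generator \<open>(V, W, f, x, y)\<close> stands for \<open>f \<otimes> x \<otimes> y\<close> in the summand of \<open>(V, W)\<close>.
\<close>

type_synonym 'a tmor =
  "((nat \<Rightarrow> ((nat \<Rightarrow> 'a) \<times> (nat \<Rightarrow> 'a) \<Rightarrow> 'a) set) \<Rightarrow> 'a) set \<Rightarrow> 'a opow"

type_synonym ('a, 'x, 'y) dgen = "'a obj \<times> 'a obj \<times> 'a tmor \<times> 'x \<times> 'y"
type_synonym ('a, 'x, 'y) day = "(('a, 'x, 'y) dgen \<Rightarrow> 'a) set"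

definition day_gens ::
  "('a, 'r) ring_scheme \<Rightarrow> nat \<Rightarrow> ('a, 'x) spf \<Rightarrow> ('a, 'y) spf \<Rightarrow> 'a obj \<Rightarrow> ('a, 'x, 'y) dgen set"
  where "day_gens R d X Y U =
    {(V, W, f, x, y). V \<in> fgproj R \<and> W \<in> fgproj R \<and>
       f \<in> carrier (gam_hom R d (tensor_module R V W) U) \<and> x \<in> carrier (ob X V) \<and> y \<in> carrier (ob Y W)}"

definition day_multilinear_rels ::
  "('a, 'r) ring_scheme \<Rightarrow> nat \<Rightarrow> ('a, 'x) spf \<Rightarrow> ('a, 'y) spf \<Rightarrow> 'a obj \<Rightarrow> (('a, 'x, 'y) dgen \<Rightarrow> 'a) set"
  where "day_multilinear_rels R d X Y U =
    (let S = day_gens R d X Y U; F = free_module R S; e = basis_vec R;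
         H = (\<lambda>V W. gam_hom R d (tensor_module R V W) U) in
      {e (V, W, f \<oplus>\<^bsub>H V W\<^esub> f', x, y) \<ominus>\<^bsub>F\<^esub> (e (V, W, f, x, y) \<oplus>\<^bsub>F\<^esub> e (V, W, f', x, y)) | V W f f' x y.
         (V, W, f, x, y) \<in> S \<and> (V, W, f', x, y) \<in> S} \<union>
      {e (V, W, f, x \<oplus>\<^bsub>ob X V\<^esub> x', y) \<ominus>\<^bsub>F\<^esub> (e (V, W, f, x, y) \<oplus>\<^bsub>F\<^esub> e (V, W, f, x', y)) | V W f x x' y.
         (V, W, f, x, y) \<in> S \<and> (V, W, f, x', y) \<in> S} \<union>
      {e (V, W, f, x, y \<oplus>\<^bsub>ob Y W\<^esub> y') \<ominus>\<^bsub>F\<^esub> (e (V, W, f, x, y) \<oplus>\<^bsub>F\<^esub> e (V, W, f, x, y')) | V W f x y y'.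
         (V, W, f, x, y) \<in> S \<and> (V, W, f, x, y') \<in> S} \<union>
      {e (V, W, a \<odot>\<^bsub>H V W\<^esub> f, x, y) \<ominus>\<^bsub>F\<^esub> (a \<odot>\<^bsub>F\<^esub> e (V, W, f, x, y)) | a V W f x y.
         a \<in> carrier R \<and> (V, W, f, x, y) \<in> S} \<union>
      {e (V, W, f, a \<odot>\<^bsub>ob X V\<^esub> x, y) \<ominus>\<^bsub>F\<^esub> (a \<odot>\<^bsub>F\<^esub> e (V, W, f, x, y)) | a V W f x y.
         a \<in> carrier R \<and> (V, W, f, x, y) \<in> S} \<union>
      {e (V, W, f, x, a \<odot>\<^bsub>ob Y W\<^esub> y) \<ominus>\<^bsub>F\<^esub> (a \<odot>\<^bsub>F\<^esub> e (V, W, f, x, y)) | a V W f x y.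
         a \<in> carrier R \<and> (V, W, f, x, y) \<in> S})"

definition day_coend_rels ::
  "('a, 'r) ring_scheme \<Rightarrow> nat \<Rightarrow> ('a, 'x) spf \<Rightarrow> ('a, 'y) spf \<Rightarrow> 'a obj \<Rightarrow> (('a, 'x, 'y) dgen \<Rightarrow> 'a) set"
  where "day_coend_rels R d X Y U =
    (let F = free_module R (day_gens R d X Y U); e = basis_vec R in
      {e (V, W, gam_comp R d (tensor_module R V W) f (gam_tensor R d V W V' W' g h), x, y)
         \<ominus>\<^bsub>F\<^esub> e (V', W', f, ar X V V' g x, ar Y W W' h y) | V W V' W' f g h x y.
         V \<in> fgproj R \<and> W \<in> fgproj R \<and> V' \<in> fgproj R \<and> W' \<in> fgproj R \<and>
         f \<in> carrier (gam_hom R d (tensor_module R V' W') U) \<and>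
         g \<in> carrier (gam_hom R d V V') \<and> h \<in> carrier (gam_hom R d W W') \<and>
         x \<in> carrier (ob X V) \<and> y \<in> carrier (ob Y W)})"

definition day_rels ::
  "('a, 'r) ring_scheme \<Rightarrow> nat \<Rightarrow> ('a, 'x) spf \<Rightarrow> ('a, 'y) spf \<Rightarrow> 'a obj \<Rightarrow> (('a, 'x, 'y) dgen \<Rightarrow> 'a) set"
  where "day_rels R d X Y U = day_multilinear_rels R d X Y U \<union> day_coend_rels R d X Y U"

definition day_module ::
  "('a, 'r) ring_scheme \<Rightarrow> nat \<Rightarrow> ('a, 'x) spf \<Rightarrow> ('a, 'y) spf \<Rightarrow> 'a obj \<Rightarrow> ('a, ('a, 'x, 'y) day) module"
  where "day_module R d X Y U = pres_module R (day_gens R d X Y U) (day_rels R d X Y U)"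

definition day_gen ::
  "('a, 'r) ring_scheme \<Rightarrow> nat \<Rightarrow> ('a, 'x) spf \<Rightarrow> ('a, 'y) spf \<Rightarrow> 'a obj \<Rightarrow> ('a, 'x, 'y) dgen
    \<Rightarrow> ('a, 'x, 'y) day"
  where "day_gen R d X Y U = pres_gen R (day_gens R d X Y U) (day_rels R d X Y U)"

definition day_tensor ::
  "('a, 'r) ring_scheme \<Rightarrow> nat \<Rightarrow> ('a, 'x) spf \<Rightarrow> ('a, 'y) spf \<Rightarrow> ('a, ('a, 'x, 'y) day) spf"
  where "day_tensor R d X Y =
    \<lparr>ob = (\<lambda>U. day_module R d X Y U),
     ar = (\<lambda>U U' g. pres_lift R (day_module R d X Y U) (day_module R d X Y U')
       (\<lambda>(V, W, f, x, y). day_gen R d X Y U' (V, W, gam_comp R d (tensor_module R V W) g f, x, y)))\<rparr>"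

text \<open>The action of the Day convolution on \<open>\<xi>\<close> from \<open>X\<close> to \<open>X'\<close> and \<open>\<upsilon>\<close> from \<open>Y\<close> to \<open>Y'\<close>.\<close>

definition day_tensor_map ::
  "('a, 'r) ring_scheme \<Rightarrow> nat \<Rightarrow> ('a, 'x) spf \<Rightarrow> ('a, 'y) spf \<Rightarrow> ('a, 'x2) spf \<Rightarrow> ('a, 'y2) spf
    \<Rightarrow> ('a, 'x, 'x2) trans \<Rightarrow> ('a, 'y, 'y2) trans
    \<Rightarrow> ('a, ('a, 'x, 'y) day, ('a, 'x2, 'y2) day) trans"
  where "day_tensor_map R d X Y X' Y' \<xi> \<upsilon> =
    (\<lambda>U\<in>fgproj R. pres_lift R (day_module R d X Y U) (day_module R d X' Y' U)
      (\<lambda>(V, W, f, x, y). day_gen R d X' Y' U (V, W, f, \<xi> V x, \<upsilon> W y)))"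

text \<open>
  An internal hom: a bifunctor, contravariant in the first and covariant in the second
  argument, with an isomorphism \<open>Hom(X \<otimes> Y, Z) \<cong> Hom(X, \<H>om(Y, Z))\<close> natural in \<open>X\<close>, \<open>Y\<close>
  and \<open>Z\<close>. HOL fixes the types of the values of \<open>X\<close>, \<open>Y\<close>, \<open>Z\<close>; for \<open>X\<close> we take the type in
  which the representable functors live. By Yoneda these suffice to determine the
  internal hom up to isomorphism, and one with the adjunction for \<open>X\<close> of any type is
  \<open>V \<mapsto> Hom(\<Gamma>\<^bsup>d,V\<^esup> \<otimes> Y, Z)\<close>.
\<close>

locale internal_hom =
  fixes R :: "('a, 'r) ring_scheme" and d :: nat
    and ihom :: "('a, 'y) spf \<Rightarrow> ('a, 'z) spf \<Rightarrow> ('a, 'h) spf"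
    and ihom_map :: "('a, 'y) spf \<Rightarrow> ('a, 'y) spf \<Rightarrow> ('a, 'z) spf \<Rightarrow> ('a, 'z) spf
      \<Rightarrow> ('a, 'y, 'y) trans \<Rightarrow> ('a, 'z, 'z) trans \<Rightarrow> ('a, 'h, 'h) trans"
    and adj :: "('a, 'a mor) spf \<Rightarrow> ('a, 'y) spf \<Rightarrow> ('a, 'z) spf
      \<Rightarrow> ('a, ('a, 'a mor, 'y) day, 'z) trans \<Rightarrow> ('a, 'a mor, 'h) trans"
  assumes ihom_functor:
    "\<lbrakk>strict_polynomial_functor R d Y; strict_polynomial_functor R d Z\<rbrakk> \<Longrightarrow>
      strict_polynomial_functor R d (ihom Y Z)"
    and ihom_map_nat:
    "\<lbrakk>strict_polynomial_functor R d Y; strict_polynomial_functor R d Y';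
      strict_polynomial_functor R d Z; strict_polynomial_functor R d Z';
      \<upsilon> \<in> carrier (nat_module R d Y' Y); \<zeta> \<in> carrier (nat_module R d Z Z')\<rbrakk> \<Longrightarrow>
      ihom_map Y Y' Z Z' \<upsilon> \<zeta> \<in> carrier (nat_module R d (ihom Y Z) (ihom Y' Z'))"
    and ihom_map_id:
    "\<lbrakk>strict_polynomial_functor R d Y; strict_polynomial_functor R d Z\<rbrakk> \<Longrightarrow>
      ihom_map Y Y Z Z (nat_id R Y) (nat_id R Z) = nat_id R (ihom Y Z)"
    and ihom_map_comp:
    "\<lbrakk>strict_polynomial_functor R d Y; strict_polynomial_functor R d Y'; strict_polynomial_functor R d Y'';
      strict_polynomial_functor R d Z; strict_polynomial_functor R d Z'; strict_polynomial_functor R d Z'';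
      \<upsilon> \<in> carrier (nat_module R d Y' Y); \<upsilon>' \<in> carrier (nat_module R d Y'' Y');
      \<zeta> \<in> carrier (nat_module R d Z Z'); \<zeta>' \<in> carrier (nat_module R d Z' Z'')\<rbrakk> \<Longrightarrow>
      ihom_map Y Y'' Z Z'' (nat_comp R Y'' \<upsilon> \<upsilon>') (nat_comp R Z \<zeta>' \<zeta>) =
      nat_comp R (ihom Y Z) (ihom_map Y' Y'' Z' Z'' \<upsilon>' \<zeta>') (ihom_map Y Y' Z Z' \<upsilon> \<zeta>)"
    and adj_iso:
    "\<lbrakk>strict_polynomial_functor R d X; strict_polynomial_functor R d Y; strict_polynomial_functor R d Z\<rbrakk> \<Longrightarrow>
      linear_iso R (nat_module R d (day_tensor R d X Y) Z) (nat_module R d X (ihom Y Z)) (adj X Y Z)"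
    and adj_natural:
    "\<lbrakk>strict_polynomial_functor R d X; strict_polynomial_functor R d X';
      strict_polynomial_functor R d Y; strict_polynomial_functor R d Y';
      strict_polynomial_functor R d Z; strict_polynomial_functor R d Z';
      \<xi> \<in> carrier (nat_module R d X' X); \<upsilon> \<in> carrier (nat_module R d Y' Y);
      \<zeta> \<in> carrier (nat_module R d Z Z'); \<phi> \<in> carrier (nat_module R d (day_tensor R d X Y) Z)\<rbrakk> \<Longrightarrow>
      adj X' Y' Z' (nat_comp R (day_tensor R d X' Y') (nat_comp R (day_tensor R d X Y) \<zeta> \<phi>)
                      (day_tensor_map R d X' Y' X Y \<xi> \<upsilon>)) =
      nat_comp R X' (ihom_map Y Y' Z Z' \<upsilon> \<zeta>) (nat_comp R X' (adj X Y Z \<phi>) \<xi>)"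


section \<open>The Schur functor and its right adjoint\<close>

text \<open>
  A left module over the group algebra of the symmetric group is a module over the base
  ring with a linear left action \<open>act\<close> of the symmetric group.
\<close>

record ('a, 'm) sym_module = "('a, 'm) module" +
  act :: "(nat \<Rightarrow> nat) \<Rightarrow> 'm \<Rightarrow> 'm"

definition sym_hom_module ::
  "('a, 'r) ring_scheme \<Rightarrow> nat \<Rightarrow> ('a, 'm) sym_module \<Rightarrow> ('a, 'n) sym_module \<Rightarrow> ('a, 'm \<Rightarrow> 'n) module"
  where "sym_hom_module R d M N =
    (hom_module R M N)
      \<lparr>carrier := {f \<in> carrier (hom_module R M N).
         \<forall>\<sigma>\<in>carrier (sym_group d). \<forall>x\<in>carrier M. f (act M \<sigma> x) = act N \<sigma> (f x)}\<rparr>"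

text \<open>
  The right action of the symmetric group on tensor powers makes \<open>\<Gamma>\<^sup>\<omega>\<close> a right module,
  hence precomposition is a left action on \<open>Hom(\<Gamma>\<^sup>\<omega>, X)\<close>.
\<close>

definition schur ::
  "('a, 'r) ring_scheme \<Rightarrow> nat \<Rightarrow> ('a, 'm) spf \<Rightarrow> ('a, ('a, 'a opow, 'm) trans) sym_module"
  where "schur R d X =
    module.extend (nat_module R d (gam_omega R d) X)
      (sym_module.fields (\<lambda>\<sigma> \<eta>. nat_comp R (gam_omega R d) \<eta> (gam_omega_perm R d \<sigma>)))"

definition schur_map ::
  "('a, 'r) ring_scheme \<Rightarrow> nat \<Rightarrow> ('a, 'm) spf \<Rightarrow> ('a, 'm, 'n) trans
    \<Rightarrow> ('a, 'a opow, 'm) trans \<Rightarrow> ('a, 'a opow, 'n) trans"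
  where "schur_map R d X \<alpha> = (\<lambda>\<eta>\<in>carrier (schur R d X). nat_comp R (gam_omega R d) \<alpha> \<eta>)"

definition g_hom ::
  "('a, 'r) ring_scheme \<Rightarrow> nat \<Rightarrow> ('a, 'n) sym_module
    \<Rightarrow> ('a, ('a, 'a opow, 'a mor) trans \<Rightarrow> 'n) spf"
  where "g_hom R d N =
    \<lparr>ob = (\<lambda>V. sym_hom_module R d (schur R d (gam_repr R d V)) N),
     ar = (\<lambda>V W f. \<lambda>\<phi>\<in>carrier (sym_hom_module R d (schur R d (gam_repr R d V)) N).
       compose (carrier (schur R d (gam_repr R d W))) \<phi>
         (schur_map R d (gam_repr R d W) (gam_repr_map R d V W f)))\<rparr>"

definition g_hom_map ::
  "('a, 'r) ring_scheme \<Rightarrow> nat \<Rightarrow> ('a, 'n) sym_module \<Rightarrow> ('n \<Rightarrow> 'p)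
    \<Rightarrow> ('a, ('a, 'a opow, 'a mor) trans \<Rightarrow> 'n, ('a, 'a opow, 'a mor) trans \<Rightarrow> 'p) trans"
  where "g_hom_map R d N u =
    (\<lambda>V\<in>fgproj R. \<lambda>\<phi>\<in>carrier (ob (g_hom R d N) V).
      compose (carrier (schur R d (gam_repr R d V))) u \<phi>)"

end

theory Submission
  imports Defs
begin

text \<open>
  Let \<open>e = e\<^sub>1 \<otimes> \<dots> \<otimes> e\<^sub>d\<close> in the \<open>d\<close>-th tensor power of a free module \<open>E\<close> with basis containing
  \<open>e\<^sub>1, \<dots>, e\<^sub>d\<close>. By Yoneda and adjunction, \<open>\<H>om(S\<^sup>d, X)(V)\<close> is \<open>Hom(\<Gamma>\<^bsup>d,V\<^esup> \<otimes> S\<^sup>d, X)\<close>. The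
  Schur functor, applied to a morphism \<open>\<phi>\<close> in the latter, gives an equivariant map
  \<open>\<F>(\<Gamma>\<^bsup>d,V\<^esup>) \<rightarrow> \<F>(X)\<close>: it sends \<open>\<eta>\<close> to the transformation
  \<open>u \<mapsto> \<phi>(D\<^sub>u \<otimes> \<eta>(e) \<otimes> [e])\<close>, where \<open>D\<^sub>u\<close> from \<open>E \<otimes> E\<close> to \<open>U\<close> kills the off-diagonal basis vectors
  and sends the diagonal copy of \<open>e\<close> to \<open>u\<close>.

  For the inverse, \<open>\<F>(\<Gamma>\<^bsup>d,V\<^esup>)\<close> is identified with the linear forms on the \<open>d\<close>-th tensor power of
  \<open>V\<close>, a form \<open>c\<close> corresponding to \<open>\<eta>\<^sub>c(u)(v) = \<Sum>\<^sub>\<sigma> c(v\<sigma>\<^sup>-\<^sup>1) u\<sigma>\<close>. With a finite dual basis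
  \<open>(p\<^sub>j, \<xi>\<^sub>j)\<close> of that tensor power, an equivariant map \<open>h\<close> gives
  \<open>f \<otimes> g \<otimes> [w] \<mapsto> \<Sum>\<^sub>j h(\<eta>\<^bsub>\<xi>\<^sub>j\<^esub>)(f(g(p\<^sub>j) \<otimes> w))\<close>. This is well defined on coinvariants because the
  canonical element \<open>\<Sum>\<^sub>j \<xi>\<^sub>j \<otimes> p\<^sub>j\<close> is invariant.
\<close>


section \<open>Linear maps, quotients and presentations\<close>

text \<open>The functor V \<mapsto> T^d V is in general not representable, but \<open>e\<close>
  serves as a generator: every \<open>u\<close> in T^d U is the image of \<open>e\<close> under a
  morphism E \<rightarrow> U. The obvious candidate t \<mapsto> \<epsilon>(t) u, with \<epsilon> the
  coordinate form of \<open>e\<close>, is not equivariant, so it is summed over its conjugates by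
  all permutations; \<eta>_c and D_u arise likewise from \<open>c\<close> and from \<epsilon>
  \<otimes> \<epsilon>. The sum over \<open>j\<close> in the inverse is forced. The coend relations
  and the dual basis give f \<otimes> g \<otimes> [w] = \<Sum>_j D_{u_j} \<otimes>
  \<eta>_{\<xi>_j}(e) \<otimes> [e] with u_j = f(g(p_j) \<otimes> w), so a morphism can be recovered
  from its image. An obstacle is that tensor products of morphisms are defined through the inverse
  of the interchange map. Its bijectivity is obtained from dual bases; afterwards morphisms out of V
  \<otimes> W are compared only on images of elements s \<otimes> t.\<close>

lemma linear_mapI:
  assumes "\<And>x. x \<in> carrier M \<Longrightarrow> f x \<in> carrier N"
    and "\<And>x y. \<lbrakk>x \<in> carrier M; y \<in> carrier M\<rbrakk> \<Longrightarrow> f (x \<oplus>\<^bsub>M\<^esub> y) = f x \<oplus>\<^bsub>N\<^esub> f y"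
    and "\<And>a x. \<lbrakk>a \<in> carrier R; x \<in> carrier M\<rbrakk> \<Longrightarrow> f (a \<odot>\<^bsub>M\<^esub> x) = a \<odot>\<^bsub>N\<^esub> f x"
  shows "linear_map R M N f"
  using assms by (auto simp: linear_map_def)

lemma linear_mapD:
  assumes "linear_map R M N f"
  shows "x \<in> carrier M \<Longrightarrow> f x \<in> carrier N"
    and "\<lbrakk>x \<in> carrier M; y \<in> carrier M\<rbrakk> \<Longrightarrow> f (x \<oplus>\<^bsub>M\<^esub> y) = f x \<oplus>\<^bsub>N\<^esub> f y"
    and "\<lbrakk>a \<in> carrier R; x \<in> carrier M\<rbrakk> \<Longrightarrow> f (a \<odot>\<^bsub>M\<^esub> x) = a \<odot>\<^bsub>N\<^esub> f x"
  using assms by (auto simp: linear_map_def)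

lemma (in abelian_group) minus_zero [simp]: "\<ominus> \<zero> = \<zero>"
  by (rule minus_equality) auto

lemma (in abelian_group) a_minus_eq_zero_iff:
  "\<lbrakk>x \<in> carrier G; y \<in> carrier G\<rbrakk> \<Longrightarrow> x \<ominus> y = \<zero> \<longleftrightarrow> x = y"
  by (metis a_minus_def add.inv_closed add.inv_equality minus_minus r_neg)

lemma linear_map_zero:
  assumes "module R M" "module R N" "linear_map R M N f"
  shows "f \<zero>\<^bsub>M\<^esub> = \<zero>\<^bsub>N\<^esub>"
proof -
  interpret M: module R M by fact
  interpret N: module R N by fact
  have "f (\<zero>\<^bsub>R\<^esub> \<odot>\<^bsub>M\<^esub> \<zero>\<^bsub>M\<^esub>) = \<zero>\<^bsub>R\<^esub> \<odot>\<^bsub>N\<^esub> f \<zero>\<^bsub>M\<^esub>"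
    using linear_mapD[OF assms(3)] by blast
  then show ?thesis using linear_mapD(1)[OF assms(3)] by simp
qed

lemma (in module) smult_minus_one: "x \<in> carrier M \<Longrightarrow> (\<ominus> \<one>) \<odot>\<^bsub>M\<^esub> x = \<ominus>\<^bsub>M\<^esub> x"
  by (simp add: smult_l_minus)

lemma linear_map_a_inv:
  assumes "module R M" "module R N" "linear_map R M N f" "x \<in> carrier M"
  shows "f (\<ominus>\<^bsub>M\<^esub> x) = \<ominus>\<^bsub>N\<^esub> f x"
proof -
  interpret M: module R M by fact
  interpret N: module R N by fact
  show ?thesis
    using linear_mapD[OF assms(3)] assms(4)
    by (metis M.R.a_inv_closed M.R.one_closed M.smult_minus_one N.smult_minus_one)
qed

lemma linear_map_minus:
  assumes "module R M" "module R N" "linear_map R M N f" "x \<in> carrier M" "y \<in> carrier M"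
  shows "f (x \<ominus>\<^bsub>M\<^esub> y) = f x \<ominus>\<^bsub>N\<^esub> f y"
proof -
  interpret M: module R M by fact
  interpret N: module R N by fact
  show ?thesis
    using linear_mapD[OF assms(3)] assms(4,5) linear_map_a_inv[OF assms(1-3)]
    by (simp add: a_minus_def)
qed

lemma linear_map_finsum:
  assumes "module R M" "module R N" "linear_map R M N f" "finite A" "\<And>i. i \<in> A \<Longrightarrow> g i \<in> carrier M"
  shows "f (\<Oplus>\<^bsub>M\<^esub>i\<in>A. g i) = (\<Oplus>\<^bsub>N\<^esub>i\<in>A. f (g i))"
proof -
  interpret M: module R M by fact
  interpret N: module R N by fact
  show ?thesis
    using assms(4,5)
  proof (induction A rule: finite_induct)
    case empty
    then show ?case by (simp add: linear_map_zero[OF assms(1-3)])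
  next
    case (insert i A)
    then have "(\<Oplus>\<^bsub>M\<^esub>i\<in>A. g i) \<in> carrier M" by (intro M.finsum_closed) auto
    then show ?case
      using insert linear_mapD[OF assms(3)] by (simp add: Pi_def)
  qed
qed

lemma linear_map_comp:
  assumes "linear_map R M N f" "linear_map R N P g"
  shows "linear_map R M P (\<lambda>x. g (f x))"
  using linear_mapD[OF assms(1)] linear_mapD[OF assms(2)] by (intro linear_mapI) auto

lemma linear_map_cong:
  assumes "module R M" "linear_map R M N f" "\<And>x. x \<in> carrier M \<Longrightarrow> g x = f x"
  shows "linear_map R M N g"
proof -
  interpret M: module R M by fact
  show ?thesis using linear_mapD[OF assms(2)] assms(3) by (intro linear_mapI) auto
qed

lemma linear_map_id: "linear_map R M M (\<lambda>x. x)"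
  by (auto intro: linear_mapI)

lemma linear_map_const_zero:
  assumes "module R N"
  shows "linear_map R M N (\<lambda>x. \<zero>\<^bsub>N\<^esub>)"
proof -
  interpret N: module R N by fact
  show ?thesis by (intro linear_mapI) auto
qed

lemma linear_map_add:
  assumes "module R N" "linear_map R M N f" "linear_map R M N g"
  shows "linear_map R M N (\<lambda>x. f x \<oplus>\<^bsub>N\<^esub> g x)"
proof -
  interpret N: module R N by fact
  show ?thesis
    using linear_mapD[OF assms(2)] linear_mapD[OF assms(3)]
    by (intro linear_mapI) (auto simp: N.smult_r_distr N.a_ac)
qed

lemma linear_map_smult:
  assumes "module R N" "linear_map R M N f" "a \<in> carrier R"
  shows "linear_map R M N (\<lambda>x. a \<odot>\<^bsub>N\<^esub> f x)"
proof -
  interpret N: module R N by fact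
  show ?thesis
    using linear_mapD[OF assms(2)] assms(3)
    by (intro linear_mapI)
      (auto simp: N.smult_r_distr N.R.m_comm simp flip: N.smult_assoc1)
qed

lemma linear_map_sum:
  assumes "module R N" "finite A" "\<And>i. i \<in> A \<Longrightarrow> linear_map R M N (\<lambda>x. f x i)"
  shows "linear_map R M N (\<lambda>x. \<Oplus>\<^bsub>N\<^esub>i\<in>A. f x i)"
proof -
  interpret N: module R N by fact
  show ?thesis
  proof (intro linear_mapI)
    show "(\<Oplus>\<^bsub>N\<^esub>i\<in>A. f x i) \<in> carrier N" if "x \<in> carrier M" for x
      using linear_mapD[OF assms(3)] that by (intro N.finsum_closed) auto
    show "(\<Oplus>\<^bsub>N\<^esub>i\<in>A. f (x \<oplus>\<^bsub>M\<^esub> y) i) = (\<Oplus>\<^bsub>N\<^esub>i\<in>A. f x i) \<oplus>\<^bsub>N\<^esub> (\<Oplus>\<^bsub>N\<^esub>i\<in>A. f y i)"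
      if "x \<in> carrier M" "y \<in> carrier M" for x y
    proof -
      have "(\<Oplus>\<^bsub>N\<^esub>i\<in>A. f (x \<oplus>\<^bsub>M\<^esub> y) i) = (\<Oplus>\<^bsub>N\<^esub>i\<in>A. f x i \<oplus>\<^bsub>N\<^esub> f y i)"
        using linear_mapD[OF assms(3)] that by (intro N.finsum_cong') auto
      then show ?thesis
        using linear_mapD[OF assms(3)] that by (simp add: N.finsum_addf Pi_def)
    qed
    show "(\<Oplus>\<^bsub>N\<^esub>i\<in>A. f (a \<odot>\<^bsub>M\<^esub> x) i) = a \<odot>\<^bsub>N\<^esub> (\<Oplus>\<^bsub>N\<^esub>i\<in>A. f x i)"
      if "a \<in> carrier R" "x \<in> carrier M" for a x
      using linear_mapD[OF assms(3)] that assms(2)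
      by (subst N.finsum_smult_ldistr) (auto intro!: N.finsum_cong')
  qed
qed

lemma linear_isoD:
  assumes "linear_iso R M N f"
  shows "linear_map R M N f" "bij_betw f (carrier M) (carrier N)"
  using assms by (auto simp: linear_iso_def)

lemma linear_iso_inv_into:
  assumes "module R M" "linear_iso R M N f"
  shows "linear_iso R N M (inv_into (carrier M) f)"
proof -
  interpret M: module R M by fact
  note f = linear_mapD[OF linear_isoD(1)[OF assms(2)]]
  have b: "bij_betw f (carrier M) (carrier N)" using linear_isoD(2)[OF assms(2)] .
  let ?g = "inv_into (carrier M) f"
  have g: "?g y \<in> carrier M" "f (?g y) = y" if "y \<in> carrier N" for y
    using that b by (auto simp: bij_betw_def inv_into_into f_inv_into_f)
  have gf: "?g (f x) = x" if "x \<in> carrier M" for x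
    using that b by (simp add: bij_betw_inv_into_left)
  have "linear_map R N M ?g"
  proof (intro linear_mapI)
    show "?g y \<in> carrier M" if "y \<in> carrier N" for y using g that by auto
    show "?g (x \<oplus>\<^bsub>N\<^esub> y) = ?g x \<oplus>\<^bsub>M\<^esub> ?g y" if "x \<in> carrier N" "y \<in> carrier N" for x y
      using gf[of "?g x \<oplus>\<^bsub>M\<^esub> ?g y"] g[OF that(1)] g[OF that(2)] f by simp
    show "?g (a \<odot>\<^bsub>N\<^esub> x) = a \<odot>\<^bsub>M\<^esub> ?g x" if "a \<in> carrier R" "x \<in> carrier N" for a x
      using gf[of "a \<odot>\<^bsub>M\<^esub> ?g x"] g[OF that(2)] f that by simp
  qed
  then show ?thesis using b bij_betw_inv_into by (auto simp: linear_iso_def)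
qed

lemma linear_iso_comp:
  assumes "linear_iso R M N f" "linear_iso R N P g"
  shows "linear_iso R M P (\<lambda>x. g (f x))"
  using linear_map_comp[of R M N f P g] bij_betw_trans[of f "carrier M" "carrier N" g "carrier P"] assms
  by (auto simp: linear_iso_def comp_def)

text \<open>A \<open>ring_scheme\<close> has no \<open>smult\<close> field and so cannot be the
  target of a \<open>linear_map\<close>; linear forms take their values in this copy
  instead.\<close>

definition self_module :: "('a, 'r) ring_scheme \<Rightarrow> ('a, 'a) module"
  where "self_module R =
    \<lparr>carrier = carrier R, monoid.mult = monoid.mult R, monoid.one = \<one>\<^bsub>R\<^esub>,
     ring.zero = \<zero>\<^bsub>R\<^esub>, ring.add = ring.add R, module.smult = monoid.mult R\<rparr>"

lemma self_module_simps [simp]: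
  "carrier (self_module R) = carrier R" "\<zero>\<^bsub>self_module R\<^esub> = \<zero>\<^bsub>R\<^esub>"
  "x \<oplus>\<^bsub>self_module R\<^esub> y = x \<oplus>\<^bsub>R\<^esub> y" "a \<odot>\<^bsub>self_module R\<^esub> x = a \<otimes>\<^bsub>R\<^esub> x"
  by (simp_all add: self_module_def)

lemma finsum_self_module: "finsum (self_module R) f A = finsum R f A"
  by (simp add: finsum_def finprod_def self_module_def)

lemma self_module_module:
  assumes "cring R" shows "module R (self_module R)"
proof -
  interpret cring R by fact
  show ?thesis
    by (intro moduleI abelian_groupI cring_axioms)
      (auto simp: a_ac m_ac l_distr r_distr intro!: bexI[of _ "\<ominus>\<^bsub>R\<^esub> _"] l_neg)
qed

subsection \<open>Hom modules\<close>

lemma hom_module_simps [simp]: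
  "\<zero>\<^bsub>hom_module R M N\<^esub> = (\<lambda>x\<in>carrier M. \<zero>\<^bsub>N\<^esub>)"
  "f \<oplus>\<^bsub>hom_module R M N\<^esub> g = (\<lambda>x\<in>carrier M. f x \<oplus>\<^bsub>N\<^esub> g x)"
  "a \<odot>\<^bsub>hom_module R M N\<^esub> f = (\<lambda>x\<in>carrier M. a \<odot>\<^bsub>N\<^esub> f x)"
  by (simp_all add: hom_module_def)

lemma hom_module_carrier:
  "f \<in> carrier (hom_module R M N) \<longleftrightarrow> f \<in> extensional (carrier M) \<and> linear_map R M N f"
  by (auto simp: hom_module_def)

lemma hom_module_module:
  assumes "module R M" "module R N"
  shows "module R (hom_module R M N)"
proof -
  interpret M: module R M by fact
  interpret N: module R N by fact
  note [simp] = hom_module_carrier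
  have lin: "linear_map R M N (restrict f (carrier M))" if "linear_map R M N f" for f
    using that by (rule linear_map_cong[OF assms(1)]) auto
  note L = lin[OF linear_map_add[OF assms(2)]] lin[OF linear_map_smult[OF assms(2)]]
    lin[OF linear_map_const_zero[OF assms(2)]]
  have ext: "f = g" if "f \<in> extensional (carrier M)" "g \<in> extensional (carrier M)"
    "\<And>x. x \<in> carrier M \<Longrightarrow> f x = g x" for f g :: "'c \<Rightarrow> 'e"
    using that by (rule extensionalityI)
  show ?thesis
  proof (intro moduleI abelian_groupI M.R.cring_axioms)
    fix f assume f: "f \<in> carrier (hom_module R M N)"
    let ?g = "\<lambda>x\<in>carrier M. (\<ominus>\<^bsub>R\<^esub> \<one>\<^bsub>R\<^esub>) \<odot>\<^bsub>N\<^esub> f x"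
    show "\<exists>g\<in>carrier (hom_module R M N). g \<oplus>\<^bsub>hom_module R M N\<^esub> f = \<zero>\<^bsub>hom_module R M N\<^esub>"
    proof (rule bexI[of _ ?g])
      show "?g \<in> carrier (hom_module R M N)" using f L by simp
      show "?g \<oplus>\<^bsub>hom_module R M N\<^esub> f = \<zero>\<^bsub>hom_module R M N\<^esub>"
        using f by (auto intro!: ext simp: linear_mapD(1) N.smult_minus_one N.l_neg)
    qed
  qed (use L in \<open>auto intro!: ext simp: linear_mapD(1) N.a_ac N.smult_l_distr N.smult_r_distr
      N.smult_assoc1\<close>)
qed

subsection \<open>Quotients\<close>

context
  fixes R :: "('a, 'r) ring_scheme" and M :: "('a, 'm, 's) module_scheme" and N
  assumes M: "module R M" and N: "submodule N R M"
begin

interpretation M: module R M by (fact M)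

private lemma abelian_subgroup_N: "abelian_subgroup N M"
proof (rule abelian_subgroupI3)
  show "additive_subgroup N M"
    using N by (simp add: submodule_def additive_subgroup_def)
  show "abelian_group M" ..
qed

interpretation N: abelian_subgroup N M by (fact abelian_subgroup_N)

lemma quot_module_carrier: "carrier (quot_module M N) = (\<lambda>x. N +>\<^bsub>M\<^esub> x) ` carrier M"
  by (auto simp: quot_module_def A_RCOSETS_def')

lemma quot_module_zero: "\<zero>\<^bsub>quot_module M N\<^esub> = N +>\<^bsub>M\<^esub> \<zero>\<^bsub>M\<^esub>"
  by (simp add: quot_module_def N.a_subset)

lemma quot_module_add:
  "\<lbrakk>x \<in> carrier M; y \<in> carrier M\<rbrakk> \<Longrightarrow>
    (N +>\<^bsub>M\<^esub> x) \<oplus>\<^bsub>quot_module M N\<^esub> (N +>\<^bsub>M\<^esub> y) = N +>\<^bsub>M\<^esub> (x \<oplus>\<^bsub>M\<^esub> y)"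
  by (simp add: quot_module_def N.a_rcos_sum)

private lemma coset_mem_iff:
  assumes "x \<in> carrier M" "y \<in> carrier M"
  shows "x \<in> N +>\<^bsub>M\<^esub> y \<longleftrightarrow> x \<ominus>\<^bsub>M\<^esub> y \<in> N"
  using N.a_rcos_module[OF assms(2,1)] by (simp add: a_minus_def)

lemma quot_coset_eq_iff:
  assumes "x \<in> carrier M" "y \<in> carrier M"
  shows "N +>\<^bsub>M\<^esub> x = N +>\<^bsub>M\<^esub> y \<longleftrightarrow> x \<ominus>\<^bsub>M\<^esub> y \<in> N"
  using N.a_repr_independence'[OF _ assms(2), of x] N.a_rcos_self[OF assms(1)] coset_mem_iff[OF assms]
  by auto

lemma quot_coset_eq_zero_iff:
  assumes "x \<in> carrier M"
  shows "N +>\<^bsub>M\<^esub> x = \<zero>\<^bsub>quot_module M N\<^esub> \<longleftrightarrow> x \<in> N"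
  using quot_coset_eq_iff[OF assms, of "\<zero>\<^bsub>M\<^esub>"] assms
  by (simp add: quot_module_zero a_minus_def M.minus_zero)

text \<open>The operation on \<open>quot_module\<close> is a union over all representatives. It
  collapses to a single coset because \<open>N\<close> is closed under scalars, so representatives
  of one class stay congruent after scaling.\<close>

lemma quot_module_smult:
  assumes "a \<in> carrier R" "x \<in> carrier M"
  shows "a \<odot>\<^bsub>quot_module M N\<^esub> (N +>\<^bsub>M\<^esub> x) = N +>\<^bsub>M\<^esub> (a \<odot>\<^bsub>M\<^esub> x)"
proof -
  have eq: "N +>\<^bsub>M\<^esub> (a \<odot>\<^bsub>M\<^esub> z) = N +>\<^bsub>M\<^esub> (a \<odot>\<^bsub>M\<^esub> x)" if "z \<in> N +>\<^bsub>M\<^esub> x" for z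
  proof -
    have z: "z \<in> carrier M" using that assms(2) N.a_elemrcos_carrier by blast
    have "z \<ominus>\<^bsub>M\<^esub> x \<in> N"
      using that assms(2) z coset_mem_iff by blast
    then have "a \<odot>\<^bsub>M\<^esub> (z \<ominus>\<^bsub>M\<^esub> x) \<in> N"
      using N assms(1) by (simp add: submodule.smult_closed)
    then have "a \<odot>\<^bsub>M\<^esub> z \<ominus>\<^bsub>M\<^esub> a \<odot>\<^bsub>M\<^esub> x \<in> N"
      using assms z by (simp add: a_minus_def M.smult_r_distr M.smult_r_minus)
    then show ?thesis using assms z by (simp add: quot_coset_eq_iff)
  qed
  have x: "x \<in> N +>\<^bsub>M\<^esub> x" using assms N.a_rcos_self by blast
  have "(\<Union>z\<in>N +>\<^bsub>M\<^esub> x. N +>\<^bsub>M\<^esub> (a \<odot>\<^bsub>M\<^esub> z)) = N +>\<^bsub>M\<^esub> (a \<odot>\<^bsub>M\<^esub> x)"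
    by (rule UN_constant_eq[OF x ballI[OF eq]])
  then show ?thesis by (simp add: quot_module_def)
qed

lemma quot_module_module: "module R (quot_module M N)"
  using M.R.cring_axioms
proof (intro moduleI abelian_groupI)
  fix K assume "K \<in> carrier (quot_module M N)"
  then obtain x where x: "x \<in> carrier M" "K = N +>\<^bsub>M\<^esub> x" by (auto simp: quot_module_carrier)
  show "\<exists>L\<in>carrier (quot_module M N). L \<oplus>\<^bsub>quot_module M N\<^esub> K = \<zero>\<^bsub>quot_module M N\<^esub>"
    by (rule bexI[of _ "N +>\<^bsub>M\<^esub> (\<ominus>\<^bsub>M\<^esub> x)"])
      (use x in \<open>auto simp: quot_module_carrier quot_module_zero quot_module_add M.l_neg\<close>)
qed (auto simp: quot_module_carrier quot_module_zero quot_module_add quot_module_smult M.a_ac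
    M.smult_l_distr M.smult_r_distr M.smult_assoc1)

lemma quot_proj_linear: "linear_map R M (quot_module M N) (\<lambda>x. N +>\<^bsub>M\<^esub> x)"
  by (intro linear_mapI) (auto simp: quot_module_carrier quot_module_add quot_module_smult)

text \<open>The operators \<open>quot_map\<close> and \<open>pres_lift\<close> read off a value with
  \<open>the_elem\<close> from the image of a whole coset. A linear map killing \<open>N\<close> is
  constant on cosets, so that image has exactly one element.\<close>

lemma quot_image_singleton:
  assumes "module R P" "linear_map R M P f" "\<And>x. x \<in> N \<Longrightarrow> f x = \<zero>\<^bsub>P\<^esub>" "x \<in> carrier M"
  shows "f ` (N +>\<^bsub>M\<^esub> x) = {f x}"
proof -
  interpret P: module R P by fact
  note f = linear_mapD[OF assms(2)]
  have "f z = f x" if "z \<in> N +>\<^bsub>M\<^esub> x" for z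
  proof -
    have z: "z \<in> carrier M" using that assms(4) N.a_elemrcos_carrier by blast
    have "z \<ominus>\<^bsub>M\<^esub> x \<in> N"
      using that assms(4) z coset_mem_iff by blast
    then have "f z \<ominus>\<^bsub>P\<^esub> f x = \<zero>\<^bsub>P\<^esub>"
      using assms(3) linear_map_minus[OF M assms(1,2) z assms(4)] by simp
    then show ?thesis using f(1) z assms(4) by (simp add: P.a_minus_eq_zero_iff)
  qed
  moreover have "x \<in> N +>\<^bsub>M\<^esub> x" using assms N.a_rcos_self by blast
  ultimately show ?thesis by blast
qed

lemma linear_map_from_quot:
  assumes "linear_map R M P (\<lambda>x. f (N +>\<^bsub>M\<^esub> x))"
  shows "linear_map R (quot_module M N) P f"
  using linear_mapD[OF assms]
  by (intro linear_mapI) (auto simp: quot_module_carrier quot_module_add quot_module_smult)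

end

lemma linear_map_kernel_submodule:
  assumes "module R M" "module R N" "linear_map R M N f"
  shows "submodule {x \<in> carrier M. f x = \<zero>\<^bsub>N\<^esub>} R M"
proof -
  interpret M: module R M by fact
  interpret N: module R N by fact
  note f = linear_mapD[OF assms(3)] linear_map_zero[OF assms] linear_map_a_inv[OF assms]
  show ?thesis by (intro M.submoduleI) (auto simp: f)
qed

lemma submodule_span_submodule:
  assumes "module R M" "A \<subseteq> carrier M"
  shows "submodule (submodule_span R M A) R M"
proof -
  interpret M: module R M by fact
  \<comment> \<open>Submodules lie in \<open>carrier M\<close>, so for \<open>A\<close> outside the
    carrier the intersected family would be empty and the span would be \<open>UNIV\<close>; the
    carrier itself shows that the family is inhabited.\<close>
  have c: "carrier M \<in> {N. submodule N R M \<and> A \<subseteq> N}" using assms(2) M.carrier_is_submodule by blast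
  show ?thesis
  proof (intro M.submoduleI)
    show "submodule_span R M A \<subseteq> carrier M" using c by (auto simp: submodule_span_def)
    show "\<zero>\<^bsub>M\<^esub> \<in> submodule_span R M A"
      by (auto simp: submodule_span_def submodule_def additive_subgroup_def
          intro: additive_subgroup.zero_closed)
  qed (auto simp: submodule_span_def M.submoduleE)
qed

lemma submodule_span_superset: "A \<subseteq> submodule_span R M A"
  by (auto simp: submodule_span_def)

lemma submodule_span_minimal:
  "submodule N R M \<Longrightarrow> A \<subseteq> N \<Longrightarrow> submodule_span R M A \<subseteq> N"
  by (auto simp: submodule_span_def)

text \<open>The kernel is a submodule containing \<open>A\<close>, and the span is the least
  such.\<close>

lemma linear_map_zero_on_span:
  assumes "module R M" "module R N" "linear_map R M N f" "A \<subseteq> carrier M"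
    and "\<And>x. x \<in> A \<Longrightarrow> f x = \<zero>\<^bsub>N\<^esub>" "x \<in> submodule_span R M A"
  shows "f x = \<zero>\<^bsub>N\<^esub>"
  using submodule_span_minimal[OF linear_map_kernel_submodule[OF assms(1-3)], of A] assms(4-6) by auto

subsection \<open>Free modules and presentations\<close>

lemma free_module_simps [simp]:
  "\<zero>\<^bsub>free_module R S\<^esub> = (\<lambda>_. \<zero>\<^bsub>R\<^esub>)"
  "b \<oplus>\<^bsub>free_module R S\<^esub> c = (\<lambda>s. b s \<oplus>\<^bsub>R\<^esub> c s)"
  "a \<odot>\<^bsub>free_module R S\<^esub> c = (\<lambda>s. a \<otimes>\<^bsub>R\<^esub> c s)"
  by (simp_all add: free_module_def)

lemma free_module_carrier:
  "c \<in> carrier (free_module R S) \<longleftrightarrow> (\<forall>s\<in>S. c s \<in> carrier R) \<and> (\<forall>s. s \<notin> S \<longrightarrow> c s = \<zero>\<^bsub>R\<^esub>) \<and>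
    finite {s. c s \<noteq> \<zero>\<^bsub>R\<^esub>}"
  by (simp add: free_module_def)

text \<open>The expression that \<open>pres_lift\<close> evaluates on a representative, named so
  that its linearity can be shown before passing to the quotient.\<close>

definition free_ext ::
  "('a, 'r) ring_scheme \<Rightarrow> ('a, 'n, 't) module_scheme \<Rightarrow> ('g \<Rightarrow> 'n) \<Rightarrow> ('g \<Rightarrow> 'a) \<Rightarrow> 'n"
  where "free_ext R N g c = (\<Oplus>\<^bsub>N\<^esub>s\<in>{s. c s \<noteq> \<zero>\<^bsub>R\<^esub>}. c s \<odot>\<^bsub>N\<^esub> g s)"

context
  fixes R :: "('a, 'r) ring_scheme" and S :: "'g set"
  assumes R: "cring R"
begin

interpretation R: cring R by (fact R)

lemma free_module_value_closed: "c \<in> carrier (free_module R S) \<Longrightarrow> c s \<in> carrier R"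
  by (cases "s \<in> S") (auto simp: free_module_carrier)

lemma free_module_module: "module R (free_module R S)"
proof (intro moduleI abelian_groupI R)
  note [simp] = free_module_value_closed
  show "b \<oplus>\<^bsub>free_module R S\<^esub> c \<in> carrier (free_module R S)"
    if "b \<in> carrier (free_module R S)" "c \<in> carrier (free_module R S)" for b c
  proof -
    have "{s. b s \<oplus>\<^bsub>R\<^esub> c s \<noteq> \<zero>\<^bsub>R\<^esub>} \<subseteq> {s. b s \<noteq> \<zero>\<^bsub>R\<^esub>} \<union> {s. c s \<noteq> \<zero>\<^bsub>R\<^esub>}" by auto
    then show ?thesis using that by (auto simp: free_module_carrier intro: finite_subset)
  qed
  show *: "a \<odot>\<^bsub>free_module R S\<^esub> c \<in> carrier (free_module R S)"
    if "a \<in> carrier R" "c \<in> carrier (free_module R S)" for a c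
  proof -
    have "{s. a \<otimes>\<^bsub>R\<^esub> c s \<noteq> \<zero>\<^bsub>R\<^esub>} \<subseteq> {s. c s \<noteq> \<zero>\<^bsub>R\<^esub>}" using that(1) by auto
    then show ?thesis using that by (auto simp: free_module_carrier intro: finite_subset)
  qed
  show "\<exists>b\<in>carrier (free_module R S). b \<oplus>\<^bsub>free_module R S\<^esub> c = \<zero>\<^bsub>free_module R S\<^esub>"
    if "c \<in> carrier (free_module R S)" for c
    using that by (intro bexI[of _ "(\<ominus>\<^bsub>R\<^esub> \<one>\<^bsub>R\<^esub>) \<odot>\<^bsub>free_module R S\<^esub> c"] *)
      (auto simp: R.l_minus R.l_neg)
qed (auto simp: free_module_value_closed R.a_ac R.m_ac R.l_distr R.r_distr, auto simp: free_module_carrier)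

interpretation F: module R "free_module R S" by (fact free_module_module)

lemma basis_vec_closed: "s \<in> S \<Longrightarrow> basis_vec R s \<in> carrier (free_module R S)"
  by (auto simp: free_module_carrier basis_vec_def)

text \<open>The induction runs over a finite set containing the support, since clearing one
  coordinate of \<open>c\<close> splits off a multiple of one basis vector. The set may exceed the
  support, so a vanishing coordinate is simply dropped.\<close>

lemma free_module_induct [consumes 1, case_names zero add]:
  assumes "c \<in> carrier (free_module R S)"
    and "P (\<zero>\<^bsub>free_module R S\<^esub>)"
    and "\<And>a s c. \<lbrakk>a \<in> carrier R; s \<in> S; c \<in> carrier (free_module R S); P c\<rbrakk> \<Longrightarrow>
      P (a \<odot>\<^bsub>free_module R S\<^esub> basis_vec R s \<oplus>\<^bsub>free_module R S\<^esub> c)"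
  shows "P c"
proof -
  have "P c" if "finite A" "c \<in> carrier (free_module R S)" "{s. c s \<noteq> \<zero>\<^bsub>R\<^esub>} \<subseteq> A" for A c
    using that
  proof (induction A arbitrary: c rule: finite_induct)
    case empty
    then have "c = \<zero>\<^bsub>free_module R S\<^esub>" by auto
    then show ?case using assms(2) by simp
  next
    case (insert s A)
    show ?case
    proof (cases "c s = \<zero>\<^bsub>R\<^esub>")
      case True
      then show ?thesis using insert by blast
    next
      case False
      let ?c = "c(s := \<zero>\<^bsub>R\<^esub>)"
      have "{t. ?c t \<noteq> \<zero>\<^bsub>R\<^esub>} \<subseteq> {t. c t \<noteq> \<zero>\<^bsub>R\<^esub>}" by auto
      then have c: "?c \<in> carrier (free_module R S)"
        using insert.prems(1) by (auto simp: free_module_carrier intro: finite_subset)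
      moreover have "{t. ?c t \<noteq> \<zero>\<^bsub>R\<^esub>} \<subseteq> A" using insert.prems(2) by auto
      ultimately have "P ?c" using insert.IH by blast
      moreover have "s \<in> S" using insert.prems(1) False by (auto simp: free_module_carrier)
      moreover have "c s \<odot>\<^bsub>free_module R S\<^esub> basis_vec R s \<oplus>\<^bsub>free_module R S\<^esub> ?c = c"
        using free_module_value_closed[OF insert.prems(1)] by (auto simp: basis_vec_def)
      ultimately show ?thesis
        using assms(3)[OF free_module_value_closed[OF insert.prems(1)] _ c] by metis
    qed
  qed
  then show ?thesis using assms(1) by (auto simp: free_module_carrier)
qed

context
  fixes N :: "('a, 'n, 't) module_scheme" and g :: "'g \<Rightarrow> 'n"
  assumes N: "module R N" and g: "\<And>s. s \<in> S \<Longrightarrow> g s \<in> carrier N"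
begin

interpretation N: module R N by (fact N)

text \<open>Cancellation may make the support of a sum smaller than the union of the supports.
  Summing over a common finite superset lets \<open>free_ext_linear\<close> compare coefficients
  termwise.\<close>

lemma free_ext_superset:
  assumes "c \<in> carrier (free_module R S)" "finite A" "{s. c s \<noteq> \<zero>\<^bsub>R\<^esub>} \<subseteq> A" "A \<subseteq> S"
  shows "free_ext R N g c = (\<Oplus>\<^bsub>N\<^esub>s\<in>A. c s \<odot>\<^bsub>N\<^esub> g s)"
  unfolding free_ext_def
  using assms g free_module_value_closed[OF assms(1)]
  by (intro N.add.finprod_mono_neutral_cong_left) (auto intro: N.smult_l_null)

lemma free_ext_linear: "linear_map R (free_module R S) N (free_ext R N g)"
proof (intro linear_mapI)
  note v = free_module_value_closed
  show "free_ext R N g c \<in> carrier N" if "c \<in> carrier (free_module R S)" for c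
    unfolding free_ext_def
    using that g v[OF that] by (intro N.finsum_closed) (auto simp: free_module_carrier)
  show "free_ext R N g (b \<oplus>\<^bsub>free_module R S\<^esub> c) = free_ext R N g b \<oplus>\<^bsub>N\<^esub> free_ext R N g c"
    if bc: "b \<in> carrier (free_module R S)" "c \<in> carrier (free_module R S)" for b c
  proof -
    let ?A = "{s. b s \<noteq> \<zero>\<^bsub>R\<^esub>} \<union> {s. c s \<noteq> \<zero>\<^bsub>R\<^esub>}"
    have A: "finite ?A" "?A \<subseteq> S" using bc by (auto simp: free_module_carrier)
    have gA: "g s \<in> carrier N" if "s \<in> ?A" for s using that A g by blast
    have "free_ext R N g (b \<oplus>\<^bsub>free_module R S\<^esub> c) =
        (\<Oplus>\<^bsub>N\<^esub>s\<in>?A. (b \<oplus>\<^bsub>free_module R S\<^esub> c) s \<odot>\<^bsub>N\<^esub> g s)"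
      using A F.a_closed[OF bc] by (intro free_ext_superset) auto
    also have "\<dots> = (\<Oplus>\<^bsub>N\<^esub>s\<in>?A. b s \<odot>\<^bsub>N\<^esub> g s \<oplus>\<^bsub>N\<^esub> c s \<odot>\<^bsub>N\<^esub> g s)"
      using gA v[OF bc(1)] v[OF bc(2)]
      by (intro N.finsum_cong') (auto simp: N.smult_l_distr)
    also have "\<dots> = (\<Oplus>\<^bsub>N\<^esub>s\<in>?A. b s \<odot>\<^bsub>N\<^esub> g s) \<oplus>\<^bsub>N\<^esub> (\<Oplus>\<^bsub>N\<^esub>s\<in>?A. c s \<odot>\<^bsub>N\<^esub> g s)"
      using gA v[OF bc(1)] v[OF bc(2)] by (intro N.finsum_addf) auto
    also have "\<dots> = free_ext R N g b \<oplus>\<^bsub>N\<^esub> free_ext R N g c"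
      using free_ext_superset[OF bc(1) A(1) _ A(2)] free_ext_superset[OF bc(2) A(1) _ A(2)] by simp
    finally show ?thesis .
  qed
  show "free_ext R N g (a \<odot>\<^bsub>free_module R S\<^esub> c) = a \<odot>\<^bsub>N\<^esub> free_ext R N g c"
    if ac: "a \<in> carrier R" "c \<in> carrier (free_module R S)" for a c
  proof -
    let ?A = "{s. c s \<noteq> \<zero>\<^bsub>R\<^esub>}"
    have A: "finite ?A" "?A \<subseteq> S" using ac by (auto simp: free_module_carrier)
    have gA: "g s \<in> carrier N" if "s \<in> ?A" for s using that A g by blast
    have "free_ext R N g (a \<odot>\<^bsub>free_module R S\<^esub> c) =
        (\<Oplus>\<^bsub>N\<^esub>s\<in>?A. (a \<odot>\<^bsub>free_module R S\<^esub> c) s \<odot>\<^bsub>N\<^esub> g s)"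
      using A ac F.smult_closed[OF ac] by (intro free_ext_superset) auto
    also have "\<dots> = (\<Oplus>\<^bsub>N\<^esub>s\<in>?A. a \<odot>\<^bsub>N\<^esub> (c s \<odot>\<^bsub>N\<^esub> g s))"
      using gA v[OF ac(2)] ac by (intro N.finsum_cong') (auto simp: N.smult_assoc1)
    also have "\<dots> = a \<odot>\<^bsub>N\<^esub> free_ext R N g c"
      unfolding free_ext_def
      using gA v[OF ac(2)] A ac by (intro N.finsum_smult_ldistr[symmetric]) auto
    finally show ?thesis .
  qed
qed

lemma free_ext_basis_vec:
  assumes "s \<in> S" shows "free_ext R N g (basis_vec R s) = g s"
proof -
  have "free_ext R N g (basis_vec R s) = (\<Oplus>\<^bsub>N\<^esub>t\<in>{s}. basis_vec R s t \<odot>\<^bsub>N\<^esub> g t)"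
    using assms by (intro free_ext_superset basis_vec_closed) (auto simp: basis_vec_def)
  also have "\<dots> = g s" using g[OF assms] by (simp add: basis_vec_def)
  finally show ?thesis .
qed

text \<open>The relations of tensor products, tensor powers and Day convolutions come in three
  shapes, x - (y + z), x - a y and x - y. This and the next two lemmas reduce their vanishing under
  \<open>free_ext\<close> to an identity between values of \<open>g\<close>.\<close>

lemma free_ext_add_rel:
  assumes "s \<in> S" "t \<in> S" "u \<in> S" "g s = g t \<oplus>\<^bsub>N\<^esub> g u"
  shows "free_ext R N g (basis_vec R s \<ominus>\<^bsub>free_module R S\<^esub>
    (basis_vec R t \<oplus>\<^bsub>free_module R S\<^esub> basis_vec R u)) = \<zero>\<^bsub>N\<^esub>"
  using assms linear_map_minus[OF free_module_module N free_ext_linear]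
    linear_mapD[OF free_ext_linear] g F.a_closed
  by (simp del: free_module_simps add: basis_vec_closed free_ext_basis_vec N.a_minus_eq_zero_iff)

lemma free_ext_smult_rel:
  assumes "s \<in> S" "t \<in> S" "a \<in> carrier R" "g s = a \<odot>\<^bsub>N\<^esub> g t"
  shows "free_ext R N g (basis_vec R s \<ominus>\<^bsub>free_module R S\<^esub>
    (a \<odot>\<^bsub>free_module R S\<^esub> basis_vec R t)) = \<zero>\<^bsub>N\<^esub>"
  using assms linear_map_minus[OF free_module_module N free_ext_linear]
    linear_mapD[OF free_ext_linear] g F.smult_closed
  by (simp del: free_module_simps add: basis_vec_closed free_ext_basis_vec N.a_minus_eq_zero_iff)

lemma free_ext_eq_rel:
  assumes "s \<in> S" "t \<in> S" "g s = g t"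
  shows "free_ext R N g (basis_vec R s \<ominus>\<^bsub>free_module R S\<^esub> basis_vec R t) = \<zero>\<^bsub>N\<^esub>"
  using assms linear_map_minus[OF free_module_module N free_ext_linear]
    linear_mapD[OF free_ext_linear] g
  by (simp del: free_module_simps add: basis_vec_closed free_ext_basis_vec N.a_minus_eq_zero_iff)

end

context
  fixes Rel :: "('g \<Rightarrow> 'a) set"
  assumes Rel: "Rel \<subseteq> carrier (free_module R S)"
begin

private abbreviation "Q \<equiv> pres_module R S Rel"
private abbreviation "\<gamma> \<equiv> pres_gen R S Rel"

private lemma span_submodule: "submodule (submodule_span R (free_module R S) Rel) R (free_module R S)"
  by (rule submodule_span_submodule[OF free_module_module Rel])

private lemmas quot_facts = free_module_module span_submodule

lemma pres_module_module: "module R Q"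
  unfolding pres_module_def by (rule quot_module_module[OF quot_facts])

private abbreviation "pr c \<equiv> submodule_span R (free_module R S) Rel +>\<^bsub>free_module R S\<^esub> c"

lemma pres_proj_linear: "linear_map R (free_module R S) Q pr"
  unfolding pres_module_def by (rule quot_proj_linear[OF quot_facts])

lemma pres_gen_closed: "s \<in> S \<Longrightarrow> \<gamma> s \<in> carrier Q"
  unfolding pres_gen_def by (intro linear_mapD(1)[OF pres_proj_linear] basis_vec_closed)

lemma pres_module_induct [consumes 1, case_names zero add]:
  assumes "K \<in> carrier Q" "P \<zero>\<^bsub>Q\<^esub>"
    and "\<And>a s L. \<lbrakk>a \<in> carrier R; s \<in> S; L \<in> carrier Q; P L\<rbrakk> \<Longrightarrow> P (a \<odot>\<^bsub>Q\<^esub> \<gamma> s \<oplus>\<^bsub>Q\<^esub> L)"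
  shows "P K"
proof -
  note pr = linear_mapD[OF pres_proj_linear] linear_map_zero[OF free_module_module pres_module_module pres_proj_linear]
  have "P (pr c)" if "c \<in> carrier (free_module R S)" for c
    using that
  proof (induction c rule: free_module_induct)
    case zero
    then show ?case using pr(4) assms(2) by simp
  next
    case (add a s c)
    then show ?case
      using assms(3)[of a s "pr c"] pr basis_vec_closed F.smult_closed
      by (simp del: free_module_simps add: pres_gen_def)
  qed
  then show ?thesis
    using assms(1) by (auto simp: pres_module_def quot_module_carrier[OF quot_facts])
qed

lemma pres_module_linear_eqI:
  assumes "module R N" "linear_map R Q N f" "linear_map R Q N g" "\<And>s. s \<in> S \<Longrightarrow> f (\<gamma> s) = g (\<gamma> s)"
    and "K \<in> carrier Q"
  shows "f K = g K"
proof -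
  interpret Q: module R Q by (fact pres_module_module)
  show ?thesis
    using assms(5)
  proof (induction K rule: pres_module_induct)
    case zero
    then show ?case
      using linear_map_zero[OF pres_module_module assms(1)] assms(2,3) by metis
  next
    case (add a s L)
    then show ?case
      using assms(4) pres_gen_closed[of s]
      by (simp add: linear_mapD[OF assms(2)] linear_mapD[OF assms(3)])
  qed
qed

private lemma rel_zero: "r \<in> Rel \<Longrightarrow> pr r = \<zero>\<^bsub>Q\<^esub>"
  unfolding pres_module_def
  using Rel submodule_span_superset[of Rel R "free_module R S"]
  by (subst quot_coset_eq_zero_iff[OF quot_facts]) auto

lemma pres_gen_add:
  assumes "basis_vec R s \<ominus>\<^bsub>free_module R S\<^esub> (basis_vec R t \<oplus>\<^bsub>free_module R S\<^esub> basis_vec R u) \<in> Rel"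
    and "s \<in> S" "t \<in> S" "u \<in> S"
  shows "\<gamma> s = \<gamma> t \<oplus>\<^bsub>Q\<^esub> \<gamma> u"
proof -
  interpret Q: module R Q by (fact pres_module_module)
  have "\<gamma> s \<ominus>\<^bsub>Q\<^esub> (\<gamma> t \<oplus>\<^bsub>Q\<^esub> \<gamma> u) = \<zero>\<^bsub>Q\<^esub>"
    using rel_zero[OF assms(1)] assms(2-) basis_vec_closed F.a_closed
      linear_map_minus[OF free_module_module pres_module_module pres_proj_linear]
      linear_mapD[OF pres_proj_linear]
    by (simp del: free_module_simps add: pres_gen_def)
  then show ?thesis using assms(2-) pres_gen_closed by (simp add: Q.a_minus_eq_zero_iff)
qed

lemma pres_gen_smult:
  assumes "basis_vec R s \<ominus>\<^bsub>free_module R S\<^esub> (a \<odot>\<^bsub>free_module R S\<^esub> basis_vec R t) \<in> Rel"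
    and "s \<in> S" "t \<in> S" "a \<in> carrier R"
  shows "\<gamma> s = a \<odot>\<^bsub>Q\<^esub> \<gamma> t"
proof -
  interpret Q: module R Q by (fact pres_module_module)
  have "\<gamma> s \<ominus>\<^bsub>Q\<^esub> (a \<odot>\<^bsub>Q\<^esub> \<gamma> t) = \<zero>\<^bsub>Q\<^esub>"
    using rel_zero[OF assms(1)] assms(2-) basis_vec_closed F.smult_closed
      linear_map_minus[OF free_module_module pres_module_module pres_proj_linear]
      linear_mapD[OF pres_proj_linear]
    by (simp del: free_module_simps add: pres_gen_def)
  then show ?thesis using assms(2-) pres_gen_closed by (simp add: Q.a_minus_eq_zero_iff)
qed

lemma pres_gen_eq:
  assumes "basis_vec R s \<ominus>\<^bsub>free_module R S\<^esub> basis_vec R t \<in> Rel" "s \<in> S" "t \<in> S"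
  shows "\<gamma> s = \<gamma> t"
proof -
  interpret Q: module R Q by (fact pres_module_module)
  have "\<gamma> s \<ominus>\<^bsub>Q\<^esub> \<gamma> t = \<zero>\<^bsub>Q\<^esub>"
    using rel_zero[OF assms(1)] assms(2-) basis_vec_closed
      linear_map_minus[OF free_module_module pres_module_module pres_proj_linear]
      linear_mapD[OF pres_proj_linear]
    by (simp del: free_module_simps add: pres_gen_def)
  then show ?thesis using assms(2-) pres_gen_closed by (simp add: Q.a_minus_eq_zero_iff)
qed

text \<open>Universal property of a presentation: a linear extension that kills \<open>Rel\<close>
  kills its span, hence is constant on each coset, and the \<open>the_elem\<close> in
  \<open>pres_lift\<close> picks its only value.\<close>

lemma pres_lift_linear_gen:
  assumes N: "module R N" and g: "\<And>s. s \<in> S \<Longrightarrow> g s \<in> carrier N"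
    and rel: "\<And>r. r \<in> Rel \<Longrightarrow> free_ext R N g r = \<zero>\<^bsub>N\<^esub>"
  shows "linear_map R Q N (pres_lift R Q N g)"
    and "\<And>s. s \<in> S \<Longrightarrow> pres_lift R Q N g (\<gamma> s) = g s"
proof -
  have ext: "linear_map R (free_module R S) N (free_ext R N g)"
    using free_ext_linear[OF N, of g] g by blast
  have z: "free_ext R N g c = \<zero>\<^bsub>N\<^esub>" if "c \<in> submodule_span R (free_module R S) Rel" for c
    using linear_map_zero_on_span[OF free_module_module N ext Rel] rel that by blast
  have *: "pres_lift R Q N g (pr c) = free_ext R N g c" if "c \<in> carrier (free_module R S)" for c
    using that linear_mapD(1)[OF pres_proj_linear that]
      quot_image_singleton[OF quot_facts N ext z that]
    by (simp add: pres_lift_def flip: free_ext_def)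
  have "linear_map R (free_module R S) N (\<lambda>c. pres_lift R Q N g (pr c))"
    by (rule linear_map_cong[OF free_module_module ext]) (rule *)
  then show "linear_map R Q N (pres_lift R Q N g)"
    unfolding pres_module_def by (rule linear_map_from_quot[OF quot_facts])
  show "pres_lift R Q N g (\<gamma> s) = g s" if "s \<in> S" for s
    using that * basis_vec_closed free_ext_basis_vec[OF N, of g] g by (simp add: pres_gen_def)
qed

end

end

section \<open>Tensor products and dual bases\<close>

definition bilinear_map ::
  "('a, 'r) ring_scheme \<Rightarrow> ('a, 'm, 's) module_scheme \<Rightarrow> ('a, 'n, 't) module_scheme
    \<Rightarrow> ('a, 'p, 'u) module_scheme \<Rightarrow> ('m \<Rightarrow> 'n \<Rightarrow> 'p) \<Rightarrow> bool"
  where "bilinear_map R M N P b \<longleftrightarrow>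
    (\<forall>x\<in>carrier M. linear_map R N P (b x)) \<and> (\<forall>y\<in>carrier N. linear_map R M P (\<lambda>x. b x y))"

lemma bilinear_mapI:
  assumes "\<And>x. x \<in> carrier M \<Longrightarrow> linear_map R N P (b x)"
    and "\<And>y. y \<in> carrier N \<Longrightarrow> linear_map R M P (\<lambda>x. b x y)"
  shows "bilinear_map R M N P b"
  using assms by (simp add: bilinear_map_def)

lemma bilinear_mapD:
  assumes "bilinear_map R M N P b"
  shows "x \<in> carrier M \<Longrightarrow> linear_map R N P (b x)"
    and "y \<in> carrier N \<Longrightarrow> linear_map R M P (\<lambda>x. b x y)"
  using assms by (auto simp: bilinear_map_def)

lemma bilinear_map_closed:
  "\<lbrakk>bilinear_map R M N P b; x \<in> carrier M; y \<in> carrier N\<rbrakk> \<Longrightarrow> b x y \<in> carrier P"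
  using bilinear_mapD(1) linear_mapD(1) by metis

lemma bilinear_map_comp:
  assumes "bilinear_map R M N P b" "linear_map R M' M f" "linear_map R N' N g" "linear_map R P P' h"
  shows "bilinear_map R M' N' P' (\<lambda>x y. h (b (f x) (g y)))"
proof (rule bilinear_mapI)
  show "linear_map R N' P' (\<lambda>y. h (b (f x) (g y)))" if "x \<in> carrier M'" for x
    using linear_map_comp[OF linear_map_comp[OF assms(3) bilinear_mapD(1)[OF assms(1)]] assms(4)]
      linear_mapD(1)[OF assms(2) that] by simp
  show "linear_map R M' P' (\<lambda>x. h (b (f x) (g y)))" if "y \<in> carrier N'" for y
    using linear_map_comp[OF linear_map_comp[OF assms(2) bilinear_mapD(2)[OF assms(1)]] assms(4)]
      linear_mapD(1)[OF assms(3) that] by simp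
qed

lemma bilinear_map_mult:
  assumes "cring R" "linear_map R M (self_module R) f" "linear_map R N (self_module R) g"
  shows "bilinear_map R M N (self_module R) (\<lambda>x y. f x \<otimes>\<^bsub>R\<^esub> g y)"
proof -
  interpret cring R by fact
  show ?thesis
    using linear_mapD[OF assms(2)] linear_mapD[OF assms(3)]
    by (intro bilinear_mapI linear_mapI) (auto simp: r_distr l_distr m_ac)
qed

lemma linear_map_smult_vector:
  assumes "module R N" "linear_map R M (self_module R) f" "y \<in> carrier N"
  shows "linear_map R M N (\<lambda>x. f x \<odot>\<^bsub>N\<^esub> y)"
proof -
  interpret N: module R N by fact
  show ?thesis
    using linear_mapD[OF assms(2)] assms(3)
    by (intro linear_mapI) (auto simp: N.smult_l_distr N.smult_assoc1)
qed

section \<open>Iterated finite sums and dual bases\<close>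

lemma (in abelian_monoid) finsum_Sigma:
  assumes "finite A" "finite B" "\<And>a b. a \<in> A \<Longrightarrow> b \<in> B \<Longrightarrow> f a b \<in> carrier G"
  shows "(\<Oplus>a\<in>A. \<Oplus>b\<in>B. f a b) = finsum G (\<lambda>(a, b). f a b) (A \<times> B)"
  using assms(1,3)
proof (induction A rule: finite_induct)
  case (insert a A)
  have 1: "finsum G (\<lambda>(a, b). f a b) ({a} \<times> B) = (\<Oplus>b\<in>B. f a b)"
  proof -
    have "finsum G (\<lambda>(a, b). f a b) ({a} \<times> B) = (\<Oplus>c\<in>Pair a ` B. case c of (a, b) \<Rightarrow> f a b)"
      by (rule arg_cong[of _ _ "finsum G _"]) auto
    also have "\<dots> = (\<Oplus>b\<in>B. f a b)"
      using insert.prems by (subst finsum_reindex) (auto simp: inj_on_def)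
    finally show ?thesis .
  qed
  have "finsum G (\<lambda>(a, b). f a b) (insert a A \<times> B) = finsum G (\<lambda>(a, b). f a b) ({a} \<times> B \<union> A \<times> B)"
    by (rule arg_cong[of _ _ "finsum G _"]) auto
  also have "\<dots> = finsum G (\<lambda>(a, b). f a b) ({a} \<times> B) \<oplus> finsum G (\<lambda>(a, b). f a b) (A \<times> B)"
    using insert assms(2) by (intro finsum_Un_disjoint) auto
  also have "\<dots> = (\<Oplus>b\<in>B. f a b) \<oplus> (\<Oplus>a\<in>A. \<Oplus>b\<in>B. f a b)"
    using insert by (simp add: 1)
  also have "\<dots> = (\<Oplus>a\<in>insert a A. \<Oplus>b\<in>B. f a b)"
    using insert by (subst finsum_insert) (auto intro!: finsum_closed)
  finally show ?case by simp
qed simp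

text \<open>Reindexing along \<open>(J, a)\<close> \<mapsto> \<open>J(i := a)\<close>; it absorbs
  the expansion of one more tensor slot into a sum over multi-indices. The pair is determined by its
  image because functions in the extensional product over \<open>D\<close> are
  \<open>undefined\<close> at \<open>i\<close>.\<close>

lemma (in abelian_monoid) finsum_PiE_insert:
  assumes "finite D" "i \<notin> D" "finite A" "\<And>J. J \<in> insert i D \<rightarrow>\<^sub>E A \<Longrightarrow> f J \<in> carrier G"
  shows "(\<Oplus>J\<in>D \<rightarrow>\<^sub>E A. \<Oplus>a\<in>A. f (J(i := a))) = (\<Oplus>J\<in>insert i D \<rightarrow>\<^sub>E A. f J)"
proof -
  have fin: "finite (D \<rightarrow>\<^sub>E A)" using assms by (intro finite_PiE) auto
  have inj: "inj_on (\<lambda>(J, a). J(i := a)) ((D \<rightarrow>\<^sub>E A) \<times> A)"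
  proof (rule inj_onI, clarify)
    fix J a J' a' assume *: "J \<in> D \<rightarrow>\<^sub>E A" "J' \<in> D \<rightarrow>\<^sub>E A" "J(i := a) = J'(i := a')"
    have "J k = J' k" for k
    proof (cases "k = i")
      case True
      then show ?thesis using PiE_arb[OF *(1) assms(2)] PiE_arb[OF *(2) assms(2)] by simp
    next
      case False
      then show ?thesis using fun_cong[OF *(3), of k] by simp
    qed
    then show "J = J' \<and> a = a'" using fun_cong[OF *(3), of i] by auto
  qed
  have img: "(\<lambda>(J, a). J(i := a)) ` ((D \<rightarrow>\<^sub>E A) \<times> A) = insert i D \<rightarrow>\<^sub>E A"
    unfolding PiE_insert_eq by force
  have cl: "f (J(i := a)) \<in> carrier G" if "J \<in> D \<rightarrow>\<^sub>E A" "a \<in> A" for J a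
    using that by (intro assms(4)) (auto simp: PiE_iff extensional_def)
  have "(\<Oplus>J\<in>D \<rightarrow>\<^sub>E A. \<Oplus>a\<in>A. f (J(i := a))) = finsum G (\<lambda>(J, a). f (J(i := a))) ((D \<rightarrow>\<^sub>E A) \<times> A)"
    using fin assms(3) cl by (rule finsum_Sigma)
  also have "\<dots> = (\<Oplus>c\<in>(D \<rightarrow>\<^sub>E A) \<times> A. f ((\<lambda>(J, a). J(i := a)) c))"
    by (simp add: case_prod_unfold)
  also have "\<dots> = (\<Oplus>J\<in>insert i D \<rightarrow>\<^sub>E A. f J)"
    unfolding img[symmetric] using inj cl by (intro finsum_reindex[symmetric]) auto
  finally show ?thesis .
qed

text \<open>Not a basis in general: the generators \<open>p a\<close> may satisfy relations and
  \<open>\<xi> a (p b)\<close> need not be a Kronecker delta. This is the dual basis criterion for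
  finitely generated projective modules, the form in which projectivity is used.\<close>

definition dual_basis ::
  "('a, 'r) ring_scheme \<Rightarrow> ('a, 'm, 's) module_scheme \<Rightarrow> 'i set \<Rightarrow> ('i \<Rightarrow> 'm) \<Rightarrow> ('i \<Rightarrow> 'm \<Rightarrow> 'a) \<Rightarrow> bool"
  where "dual_basis R M A p \<xi> \<longleftrightarrow> finite A \<and> (\<forall>a\<in>A. p a \<in> carrier M) \<and>
    (\<forall>a\<in>A. linear_map R M (self_module R) (\<xi> a)) \<and>
    (\<forall>x\<in>carrier M. (\<Oplus>\<^bsub>M\<^esub>a\<in>A. \<xi> a x \<odot>\<^bsub>M\<^esub> p a) = x)"

lemma dual_basisD:
  assumes "dual_basis R M A p \<xi>"
  shows "finite A" "a \<in> A \<Longrightarrow> p a \<in> carrier M" "a \<in> A \<Longrightarrow> linear_map R M (self_module R) (\<xi> a)"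
    "x \<in> carrier M \<Longrightarrow> (\<Oplus>\<^bsub>M\<^esub>a\<in>A. \<xi> a x \<odot>\<^bsub>M\<^esub> p a) = x"
  using assms by (auto simp: dual_basis_def)

lemma dual_basis_value_closed:
  "\<lbrakk>dual_basis R M A p \<xi>; a \<in> A; x \<in> carrier M\<rbrakk> \<Longrightarrow> \<xi> a x \<in> carrier R"
  using linear_mapD(1)[OF dual_basisD(3)] by fastforce

text \<open>Used in both directions: to expand a value of \<open>f\<close>, and to collapse a sum
  over the dual basis back to \<open>f x\<close>.\<close>

lemma dual_basis_linear:
  assumes "module R M" "module R N" "dual_basis R M A p \<xi>" "linear_map R M N f" "x \<in> carrier M"
  shows "f x = (\<Oplus>\<^bsub>N\<^esub>a\<in>A. \<xi> a x \<odot>\<^bsub>N\<^esub> f (p a))"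
proof -
  interpret M: module R M by fact
  interpret N: module R N by fact
  note D = dual_basisD[OF assms(3)] dual_basis_value_closed[OF assms(3)]
  have "f x = f (\<Oplus>\<^bsub>M\<^esub>a\<in>A. \<xi> a x \<odot>\<^bsub>M\<^esub> p a)" using D(4) assms(5) by simp
  also have "\<dots> = (\<Oplus>\<^bsub>N\<^esub>a\<in>A. f (\<xi> a x \<odot>\<^bsub>M\<^esub> p a))"
    using D assms by (intro linear_map_finsum[OF assms(1,2,4)]) auto
  also have "\<dots> = (\<Oplus>\<^bsub>N\<^esub>a\<in>A. \<xi> a x \<odot>\<^bsub>N\<^esub> f (p a))"
    using D assms(5) linear_mapD[OF assms(4)] by (intro N.finsum_cong') auto
  finally show ?thesis .
qed

lemma dual_basisI:
  assumes "finite A" "\<And>a. a \<in> A \<Longrightarrow> p a \<in> carrier M"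
    and "\<And>a. a \<in> A \<Longrightarrow> linear_map R M (self_module R) (\<xi> a)"
    and "\<And>x. x \<in> carrier M \<Longrightarrow> (\<Oplus>\<^bsub>M\<^esub>a\<in>A. \<xi> a x \<odot>\<^bsub>M\<^esub> p a) = x"
  shows "dual_basis R M A p \<xi>"
  using assms by (simp add: dual_basis_def)

lemma dual_basis_expansion_linear:
  assumes "module R M" "finite A" "\<And>a. a \<in> A \<Longrightarrow> p a \<in> carrier M"
    and "\<And>a. a \<in> A \<Longrightarrow> linear_map R M (self_module R) (\<xi> a)"
  shows "linear_map R M M (\<lambda>x. \<Oplus>\<^bsub>M\<^esub>a\<in>A. \<xi> a x \<odot>\<^bsub>M\<^esub> p a)"
  using assms by (intro linear_map_sum linear_map_smult_vector)

text \<open>Forms \<open>\<chi> a\<close> on the target that pull back to the coordinates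
  \<open>\<xi> a\<close> let the coordinates of \<open>x\<close> be read off from
  \<open>f x\<close>, and these determine \<open>x\<close>.\<close>

lemma dual_basis_injective:
  assumes "module R M" "dual_basis R M A p \<xi>" "\<And>a x. \<lbrakk>a \<in> A; x \<in> carrier M\<rbrakk> \<Longrightarrow> \<chi> a (f x) = \<xi> a x"
  shows "inj_on f (carrier M)"
proof (rule inj_onI)
  interpret M: module R M by fact
  fix x y assume xy: "x \<in> carrier M" "y \<in> carrier M" "f x = f y"
  have "\<xi> a x = \<xi> a y" if "a \<in> A" for a using assms(3)[OF that] xy by metis
  then have "(\<Oplus>\<^bsub>M\<^esub>a\<in>A. \<xi> a x \<odot>\<^bsub>M\<^esub> p a) = (\<Oplus>\<^bsub>M\<^esub>a\<in>A. \<xi> a y \<odot>\<^bsub>M\<^esub> p a)"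
    using dual_basisD[OF assms(2)] dual_basis_value_closed[OF assms(2)] xy
    by (intro M.finsum_cong') auto
  then show "x = y" using dual_basisD(4)[OF assms(2)] xy by simp
qed

text \<open>Preimages of the finitely many generators suffice: weighted with the coordinates of
  \<open>y\<close> they add up to a preimage of \<open>y\<close>.\<close>

lemma dual_basis_surjective:
  assumes "module R M" "module R N" "dual_basis R N A p \<xi>" "linear_map R M N f"
    and "\<And>a. a \<in> A \<Longrightarrow> p a \<in> f ` carrier M"
  shows "f ` carrier M = carrier N"
proof -
  interpret M: module R M by fact
  interpret N: module R N by fact
  obtain q where q: "\<And>a. a \<in> A \<Longrightarrow> q a \<in> carrier M \<and> f (q a) = p a"
    using assms(5) unfolding image_iff by metis
  have "y \<in> f ` carrier M" if "y \<in> carrier N" for y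
  proof -
    note v = dual_basis_value_closed[OF assms(3) _ that] and f = linear_mapD[OF assms(4)]
    have "f (\<Oplus>\<^bsub>M\<^esub>a\<in>A. \<xi> a y \<odot>\<^bsub>M\<^esub> q a) = (\<Oplus>\<^bsub>N\<^esub>a\<in>A. f (\<xi> a y \<odot>\<^bsub>M\<^esub> q a))"
      using q v dual_basisD[OF assms(3)] by (intro linear_map_finsum[OF assms(1,2,4)]) auto
    also have "\<dots> = (\<Oplus>\<^bsub>N\<^esub>a\<in>A. \<xi> a y \<odot>\<^bsub>N\<^esub> p a)"
      using q v f dual_basisD[OF assms(3)] by (intro N.finsum_cong') auto
    also have "\<dots> = y" using dual_basisD(4)[OF assms(3) that] .
    finally have e: "f (\<Oplus>\<^bsub>M\<^esub>a\<in>A. \<xi> a y \<odot>\<^bsub>M\<^esub> q a) = y" .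
    have "(\<Oplus>\<^bsub>M\<^esub>a\<in>A. \<xi> a y \<odot>\<^bsub>M\<^esub> q a) \<in> carrier M"
      using q v by (intro M.finsum_closed) auto
    then show ?thesis by (rule image_eqI[where f = f, OF e[symmetric]])
  qed
  then show ?thesis using linear_mapD(1)[OF assms(4)] by blast
qed

text \<open>A retraction of a free module provides the data: the generators are the images of the
  basis vectors, and the forms are the coordinates after the section \<open>i\<close>.\<close>

lemma fg_projective_dual_basis:
  assumes "fg_projective R V"
  obtains n :: nat and p \<xi> where "dual_basis R V {..<n} p \<xi>"
proof -
  obtain n i p where V: "module R V" and ip: "linear_map R V (free_module R {..<n::nat}) i"
    "linear_map R (free_module R {..<n}) V p" "\<And>x. x \<in> carrier V \<Longrightarrow> p (i x) = x"
    using assms unfolding fg_projective_def by blast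
  interpret V: module R V by (fact V)
  have R: "cring R" ..
  note F = free_module_module[OF R, of "{..<n}"]
  interpret F: module R "free_module R {..<n}" by (fact F)
  note b = basis_vec_closed[OF R, of _ "{..<n}"]
  have pb: "p (basis_vec R a) \<in> carrier V" if "a < n" for a using linear_mapD(1)[OF ip(2)] b that by simp
  let ?g = "\<lambda>a. p (basis_vec R a)"
  \<comment> \<open>A linear map on a free module is determined by its values on basis vectors; in
    this form the identity \<open>p (i x) = x\<close> becomes the expansion of
    \<open>x\<close>.\<close>
  have pg: "p c = free_ext R V ?g c" if "c \<in> carrier (free_module R {..<n})" for c
    using that
  proof (induction c rule: free_module_induct[OF R, consumes 1, case_names zero add])
    case zero
    then show ?case
      using linear_map_zero[OF F V ip(2)] linear_map_zero[OF F V free_ext_linear[OF R V, of _ ?g]] pb by simp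
  next
    case (add a s c)
    then show ?case
      using linear_mapD[OF ip(2)] linear_mapD[OF free_ext_linear[OF R V, of "{..<n}" ?g]] pb b
        free_ext_basis_vec[OF R V, of "{..<n}" ?g] F.smult_closed
      by (simp del: free_module_simps)
  qed
  have "dual_basis R V {..<n} ?g (\<lambda>a x. i x a)"
  proof (rule dual_basisI)
    show "linear_map R V (self_module R) (\<lambda>x. i x a)" if "a \<in> {..<n}" for a
      using linear_mapD[OF ip(1)] free_module_value_closed[OF R, of _ "{..<n}"] by (intro linear_mapI) auto
    show "(\<Oplus>\<^bsub>V\<^esub>a\<in>{..<n}. i x a \<odot>\<^bsub>V\<^esub> ?g a) = x" if "x \<in> carrier V" for x
    proof -
      have ix: "i x \<in> carrier (free_module R {..<n})" using linear_mapD(1)[OF ip(1)] that .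
      have "free_ext R V ?g (i x) = (\<Oplus>\<^bsub>V\<^esub>a\<in>{..<n}. i x a \<odot>\<^bsub>V\<^esub> ?g a)"
        using ix pb by (intro free_ext_superset[OF R V, where S = "{..<n}"]) (auto simp: free_module_carrier)
      then show ?thesis using pg[OF ix] ip(3)[OF that] by simp
    qed
  qed (use pb in auto)
  then show thesis by (rule that)
qed

section \<open>The tensor product of two modules\<close>

context
  fixes R :: "('a, 'r) ring_scheme" and M :: "('a, 'm, 's) module_scheme" and N :: "('a, 'n, 't) module_scheme"
  assumes M: "module R M" and N: "module R N"
begin

interpretation M: module R M by (fact M)
interpretation N: module R N by (fact N)

private lemma tensor_cring: "cring R" ..

interpretation F: module R "free_module R (carrier M \<times> carrier N)"
  by (rule free_module_module[OF tensor_cring])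

private lemma tensor_rels_closed: "tensor_rels R M N \<subseteq> carrier (free_module R (carrier M \<times> carrier N))"
  unfolding tensor_rels_def Let_def
  by (auto simp del: free_module_simps intro!: F.minus_closed F.a_closed F.smult_closed basis_vec_closed[OF tensor_cring])

private lemmas tensor_pres = tensor_cring tensor_rels_closed

lemma tensor_module_module: "module R (tensor_module R M N)"
  unfolding tensor_module_def by (rule pres_module_module[OF tensor_pres])

lemma pure_tensor_closed:
  "\<lbrakk>x \<in> carrier M; y \<in> carrier N\<rbrakk> \<Longrightarrow> pure_tensor R M N x y \<in> carrier (tensor_module R M N)"
  unfolding tensor_module_def pure_tensor_def by (rule pres_gen_closed[OF tensor_pres]) auto

lemma pure_tensor_bilinear: "bilinear_map R M N (tensor_module R M N) (pure_tensor R M N)"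
proof (intro bilinear_mapI linear_mapI)
  fix x y y' assume *: "x \<in> carrier M" "y \<in> carrier N" "y' \<in> carrier N"
  show "pure_tensor R M N x (y \<oplus>\<^bsub>N\<^esub> y') =
      pure_tensor R M N x y \<oplus>\<^bsub>tensor_module R M N\<^esub> pure_tensor R M N x y'"
    unfolding tensor_module_def pure_tensor_def
  proof (rule pres_gen_add[OF tensor_pres])
    show "basis_vec R (x, y \<oplus>\<^bsub>N\<^esub> y') \<ominus>\<^bsub>free_module R (carrier M \<times> carrier N)\<^esub>
       (basis_vec R (x, y) \<oplus>\<^bsub>free_module R (carrier M \<times> carrier N)\<^esub> basis_vec R (x, y')) \<in> tensor_rels R M N"
      unfolding tensor_rels_def Let_def by (rule UnI1, rule UnI1, rule UnI2) (use * in blast)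
  qed (use * in auto)
next
  fix a x y assume *: "x \<in> carrier M" "y \<in> carrier N" "a \<in> carrier R"
  show "pure_tensor R M N x (a \<odot>\<^bsub>N\<^esub> y) = a \<odot>\<^bsub>tensor_module R M N\<^esub> pure_tensor R M N x y"
    unfolding tensor_module_def pure_tensor_def
  proof (rule pres_gen_smult[OF tensor_pres])
    show "basis_vec R (x, a \<odot>\<^bsub>N\<^esub> y) \<ominus>\<^bsub>free_module R (carrier M \<times> carrier N)\<^esub>
       (a \<odot>\<^bsub>free_module R (carrier M \<times> carrier N)\<^esub> basis_vec R (x, y)) \<in> tensor_rels R M N"
      unfolding tensor_rels_def Let_def by (rule UnI2) (use * in blast)
  qed (use * in auto)
  show "pure_tensor R M N (a \<odot>\<^bsub>M\<^esub> x) y = a \<odot>\<^bsub>tensor_module R M N\<^esub> pure_tensor R M N x y"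
    unfolding tensor_module_def pure_tensor_def
  proof (rule pres_gen_smult[OF tensor_pres])
    show "basis_vec R (a \<odot>\<^bsub>M\<^esub> x, y) \<ominus>\<^bsub>free_module R (carrier M \<times> carrier N)\<^esub>
       (a \<odot>\<^bsub>free_module R (carrier M \<times> carrier N)\<^esub> basis_vec R (x, y)) \<in> tensor_rels R M N"
      unfolding tensor_rels_def Let_def by (rule UnI1, rule UnI2) (use * in blast)
  qed (use * in auto)
next
  fix x x' y assume *: "x \<in> carrier M" "x' \<in> carrier M" "y \<in> carrier N"
  show "pure_tensor R M N (x \<oplus>\<^bsub>M\<^esub> x') y =
      pure_tensor R M N x y \<oplus>\<^bsub>tensor_module R M N\<^esub> pure_tensor R M N x' y"
    unfolding tensor_module_def pure_tensor_def
  proof (rule pres_gen_add[OF tensor_pres])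
    show "basis_vec R (x \<oplus>\<^bsub>M\<^esub> x', y) \<ominus>\<^bsub>free_module R (carrier M \<times> carrier N)\<^esub>
       (basis_vec R (x, y) \<oplus>\<^bsub>free_module R (carrier M \<times> carrier N)\<^esub> basis_vec R (x', y)) \<in> tensor_rels R M N"
      unfolding tensor_rels_def Let_def by (rule UnI1, rule UnI1, rule UnI1) (use * in blast)
  qed (use * in auto)
qed (auto intro: pure_tensor_closed)

lemma tensor_linear_eqI:
  assumes "module R P" "linear_map R (tensor_module R M N) P f" "linear_map R (tensor_module R M N) P g"
    and "\<And>x y. \<lbrakk>x \<in> carrier M; y \<in> carrier N\<rbrakk> \<Longrightarrow> f (pure_tensor R M N x y) = g (pure_tensor R M N x y)"
    and "t \<in> carrier (tensor_module R M N)"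
  shows "f t = g t"
  using assms(2-) unfolding tensor_module_def pure_tensor_def
  by (intro pres_module_linear_eqI[OF tensor_pres assms(1), of f g t]) auto

lemma tensor_lift:
  assumes P: "module R P" and b: "bilinear_map R M N P b"
  shows "linear_map R (tensor_module R M N) P (pres_lift R (tensor_module R M N) P (\<lambda>(x, y). b x y))"
    and "\<And>x y. \<lbrakk>x \<in> carrier M; y \<in> carrier N\<rbrakk> \<Longrightarrow>
      pres_lift R (tensor_module R M N) P (\<lambda>(x, y). b x y) (pure_tensor R M N x y) = b x y"
proof -
  let ?g = "\<lambda>(x, y). b x y"
  have cl: "?g s \<in> carrier P" if "s \<in> carrier M \<times> carrier N" for s
    using that bilinear_map_closed[OF b] by auto
  note l = linear_mapD[OF bilinear_mapD(1)[OF b]] linear_mapD[OF bilinear_mapD(2)[OF b]]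
  have rel: "\<And>r. r \<in> tensor_rels R M N \<Longrightarrow> free_ext R P ?g r = \<zero>\<^bsub>P\<^esub>"
    unfolding tensor_rels_def Let_def
    by (elim UnE CollectE exE conjE; hypsubst;
        intro free_ext_add_rel[OF tensor_cring P cl] free_ext_smult_rel[OF tensor_cring P cl]) (auto simp: l)
  note * = pres_lift_linear_gen[OF tensor_pres P cl rel]
  show "linear_map R (tensor_module R M N) P (pres_lift R (tensor_module R M N) P ?g)"
    unfolding tensor_module_def using *(1) .
  show "pres_lift R (tensor_module R M N) P ?g (pure_tensor R M N x y) = b x y"
    if "x \<in> carrier M" "y \<in> carrier N" for x y
    unfolding tensor_module_def pure_tensor_def using *(2)[of "(x, y)"] that by simp
qed

text \<open>Generators are tensored and coordinate forms multiplied. By linearity the expansion is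
  needed on x \<otimes> y only, where it results from expanding \<open>x\<close> and then
  \<open>y\<close>.\<close>

lemma dual_basis_tensor:
  assumes "dual_basis R M A p \<xi>" "dual_basis R N B q \<zeta>"
  shows "dual_basis R (tensor_module R M N) (A \<times> B) (\<lambda>(a, b). pure_tensor R M N (p a) (q b))
    (\<lambda>(a, b). pres_lift R (tensor_module R M N) (self_module R) (\<lambda>(x, y). \<xi> a x \<otimes>\<^bsub>R\<^esub> \<zeta> b y))"
    (is "dual_basis R ?T _ ?r ?\<chi>")
proof (rule dual_basisI)
  interpret T: module R ?T by (rule tensor_module_module)
  note A = dual_basisD[OF assms(1)] dual_basis_value_closed[OF assms(1)]
  note B = dual_basisD[OF assms(2)] dual_basis_value_closed[OF assms(2)]
  show fin: "finite (A \<times> B)" using A(1) B(1) by simp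
  show r: "?r c \<in> carrier ?T" if "c \<in> A \<times> B" for c
    using that A(2) B(2) by (auto intro: pure_tensor_closed)
  note lift = tensor_lift[OF self_module_module[OF tensor_cring] bilinear_map_mult[OF tensor_cring A(3) B(3)]]
  show \<chi>: "linear_map R ?T (self_module R) (?\<chi> c)" if "c \<in> A \<times> B" for c
    using that lift(1) by auto
  show "(\<Oplus>\<^bsub>?T\<^esub>c\<in>A \<times> B. ?\<chi> c t \<odot>\<^bsub>?T\<^esub> ?r c) = t" if "t \<in> carrier ?T" for t
  proof (rule tensor_linear_eqI[OF tensor_module_module _ linear_map_id _ that])
    show "linear_map R ?T ?T (\<lambda>t. \<Oplus>\<^bsub>?T\<^esub>c\<in>A \<times> B. ?\<chi> c t \<odot>\<^bsub>?T\<^esub> ?r c)"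
      by (rule dual_basis_expansion_linear[OF tensor_module_module fin r \<chi>])
    fix x y assume xy: "x \<in> carrier M" "y \<in> carrier N"
    note b = bilinear_mapD[OF pure_tensor_bilinear]
    have "pure_tensor R M N x y = (\<Oplus>\<^bsub>?T\<^esub>a\<in>A. \<xi> a x \<odot>\<^bsub>?T\<^esub> pure_tensor R M N (p a) y)"
      using dual_basis_linear[OF M tensor_module_module assms(1) b(2)] xy by simp
    also have "\<dots> = (\<Oplus>\<^bsub>?T\<^esub>a\<in>A. \<Oplus>\<^bsub>?T\<^esub>b\<in>B. (\<xi> a x \<otimes>\<^bsub>R\<^esub> \<zeta> b y) \<odot>\<^bsub>?T\<^esub> pure_tensor R M N (p a) (q b))"
    proof (rule T.finsum_cong', simp)
      show "(\<lambda>a. \<Oplus>\<^bsub>?T\<^esub>b\<in>B. (\<xi> a x \<otimes>\<^bsub>R\<^esub> \<zeta> b y) \<odot>\<^bsub>?T\<^esub> pure_tensor R M N (p a) (q b)) \<in> A \<rightarrow> carrier ?T"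
        using A B xy pure_tensor_closed by (auto intro!: T.finsum_closed)
      fix a assume a: "a \<in> A"
      have "\<xi> a x \<odot>\<^bsub>?T\<^esub> pure_tensor R M N (p a) y =
          \<xi> a x \<odot>\<^bsub>?T\<^esub> (\<Oplus>\<^bsub>?T\<^esub>b\<in>B. \<zeta> b y \<odot>\<^bsub>?T\<^esub> pure_tensor R M N (p a) (q b))"
        using dual_basis_linear[OF N tensor_module_module assms(2) b(1)] xy A(2)[OF a] by simp
      also have "\<dots> = (\<Oplus>\<^bsub>?T\<^esub>b\<in>B. \<xi> a x \<odot>\<^bsub>?T\<^esub> (\<zeta> b y \<odot>\<^bsub>?T\<^esub> pure_tensor R M N (p a) (q b)))"
        using A B xy a
        by (intro T.finsum_smult_ldistr) (auto intro!: pure_tensor_closed T.smult_closed)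
      also have "\<dots> = (\<Oplus>\<^bsub>?T\<^esub>b\<in>B. (\<xi> a x \<otimes>\<^bsub>R\<^esub> \<zeta> b y) \<odot>\<^bsub>?T\<^esub> pure_tensor R M N (p a) (q b))"
        using A B xy a by (intro T.finsum_cong') (auto simp: T.smult_assoc1 pure_tensor_closed)
      finally show "\<xi> a x \<odot>\<^bsub>?T\<^esub> pure_tensor R M N (p a) y =
        (\<Oplus>\<^bsub>?T\<^esub>b\<in>B. (\<xi> a x \<otimes>\<^bsub>R\<^esub> \<zeta> b y) \<odot>\<^bsub>?T\<^esub> pure_tensor R M N (p a) (q b))" .
    qed
    also have "\<dots> = finsum ?T (\<lambda>(a, b). (\<xi> a x \<otimes>\<^bsub>R\<^esub> \<zeta> b y) \<odot>\<^bsub>?T\<^esub> pure_tensor R M N (p a) (q b)) (A \<times> B)"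
      using A B xy by (intro T.finsum_Sigma) (auto simp: pure_tensor_closed)
    also have "\<dots> = (\<Oplus>\<^bsub>?T\<^esub>c\<in>A \<times> B. ?\<chi> c (pure_tensor R M N x y) \<odot>\<^bsub>?T\<^esub> ?r c)"
      using A B xy
      by (intro T.finsum_cong') (auto simp: lift(2) pure_tensor_closed)
    finally show "(\<Oplus>\<^bsub>?T\<^esub>c\<in>A \<times> B. ?\<chi> c (pure_tensor R M N x y) \<odot>\<^bsub>?T\<^esub> ?r c) =
      pure_tensor R M N x y" by simp
  qed
qed

end

lemma tensor_map_pure:
  assumes "module R M" "module R N" "module R M'" "module R N'"
    and "linear_map R M M' f" "linear_map R N N' g"
  shows "linear_map R (tensor_module R M N) (tensor_module R M' N') (tensor_map R M N M' N' f g)"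
    and "\<And>x y. \<lbrakk>x \<in> carrier M; y \<in> carrier N\<rbrakk> \<Longrightarrow>
      tensor_map R M N M' N' f g (pure_tensor R M N x y) = pure_tensor R M' N' (f x) (g y)"
proof -
  have "bilinear_map R M N (tensor_module R M' N') (\<lambda>x y. pure_tensor R M' N' (f x) (g y))"
    by (rule bilinear_map_comp[OF pure_tensor_bilinear[OF assms(3,4)] assms(5,6) linear_map_id])
  note * = tensor_lift[OF assms(1,2) tensor_module_module[OF assms(3,4)] this]
  show "linear_map R (tensor_module R M N) (tensor_module R M' N') (tensor_map R M N M' N' f g)"
    unfolding tensor_map_def by (rule *(1))
  show "tensor_map R M N M' N' f g (pure_tensor R M N x y) = pure_tensor R M' N' (f x) (g y)"
    if "x \<in> carrier M" "y \<in> carrier N" for x y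
    unfolding tensor_map_def by (rule *(2)[OF that])
qed

section \<open>Tensor powers\<close>

declare One_nat_def [simp del]

definition multilinear_map ::
  "('a, 'r) ring_scheme \<Rightarrow> nat \<Rightarrow> ('a, 'v, 's) module_scheme \<Rightarrow> ('a, 'p, 'u) module_scheme
    \<Rightarrow> ((nat \<Rightarrow> 'v) \<Rightarrow> 'p) \<Rightarrow> bool"
  where "multilinear_map R d V P m \<longleftrightarrow> (\<forall>v\<in>tpow_gens d V. m v \<in> carrier P \<and>
    (\<forall>i\<in>{1..d}. linear_map R V P (\<lambda>x. m (v(i := x)))))"

lemma multilinear_mapI:
  assumes "\<And>v. v \<in> tpow_gens d V \<Longrightarrow> m v \<in> carrier P"
    and "\<And>v i. v \<in> tpow_gens d V \<Longrightarrow> i \<in> {1..d} \<Longrightarrow> linear_map R V P (\<lambda>x. m (v(i := x)))"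
  shows "multilinear_map R d V P m"
  using assms by (simp add: multilinear_map_def)

lemma multilinear_mapD:
  assumes "multilinear_map R d V P m" "v \<in> tpow_gens d V"
  shows "m v \<in> carrier P" "i \<in> {1..d} \<Longrightarrow> linear_map R V P (\<lambda>x. m (v(i := x)))"
  using assms by (auto simp: multilinear_map_def)

lemma tpow_gens_upd: "\<lbrakk>v \<in> tpow_gens d V; i \<in> {1..d}; x \<in> carrier V\<rbrakk> \<Longrightarrow> v(i := x) \<in> tpow_gens d V"
  by (auto simp: tpow_gens_def PiE_iff extensional_def)

lemma tpow_gens_value: "\<lbrakk>v \<in> tpow_gens d V; i \<in> {1..d}\<rbrakk> \<Longrightarrow> v i \<in> carrier V"
  by (auto simp: tpow_gens_def)

lemma tpow_gens_restrict:
  "(\<And>i. i \<in> {1..d} \<Longrightarrow> f i \<in> carrier V) \<Longrightarrow> (\<lambda>i\<in>{1..d}. f i) \<in> tpow_gens d V"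
  by (auto simp: tpow_gens_def)

lemma tpow_gens_perm:
  assumes "v \<in> tpow_gens d V" "\<sigma> permutes {1..d}"
  shows "v \<circ> \<sigma> \<in> tpow_gens d V"
  using assms permutes_in_image[OF assms(2)] permutes_not_in[OF assms(2)]
  by (auto simp: tpow_gens_def PiE_iff extensional_def)

text \<open>Precomposition moves the entry at \<open>i\<close> to the position that \<sigma> sends
  to \<open>i\<close>; so linearity in slot \<open>i\<close> after permuting is linearity in slot
  \<open>inv' \<sigma> i\<close>.\<close>

lemma fun_upd_perm:
  assumes "\<sigma> permutes S"
  shows "(v(i := x)) \<circ> \<sigma> = (v \<circ> \<sigma>)(inv' \<sigma> i := x)"
  using permutes_inverses[OF assms] by (auto simp: fun_eq_iff)

lemma multilinear_map_perm:
  assumes "multilinear_map R d V P m" "\<sigma> permutes {1..d}"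
  shows "multilinear_map R d V P (\<lambda>v. m (v \<circ> \<sigma>))"
proof (rule multilinear_mapI)
  fix v assume v: "v \<in> tpow_gens d V"
  note v' = tpow_gens_perm[OF v assms(2)]
  show "m (v \<circ> \<sigma>) \<in> carrier P" using multilinear_mapD(1)[OF assms(1) v'] .
  show "linear_map R V P (\<lambda>x. m (v(i := x) \<circ> \<sigma>))" if "i \<in> {1..d}" for i
    using multilinear_mapD(2)[OF assms(1) v', of "inv' \<sigma> i"] that permutes_in_image[OF permutes_inv[OF assms(2)]]
    by (simp add: fun_upd_perm[OF assms(2)])
qed

lemma multilinear_map_prod:
  assumes "module R V" "\<And>i. i \<in> {1..d} \<Longrightarrow> linear_map R V (self_module R) (c i)"
  shows "multilinear_map R d V (self_module R) (\<lambda>v. \<Otimes>\<^bsub>R\<^esub>i\<in>{1..d}. c i (v i))"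
proof (rule multilinear_mapI)
  interpret V: module R V by fact
  fix v assume v: "v \<in> tpow_gens d V"
  have cl: "c i x \<in> carrier R" if "i \<in> {1..d}" "x \<in> carrier V" for i x
    using linear_mapD(1)[OF assms(2)] that by fastforce
  note cv = cl[OF _ tpow_gens_value[OF v]]
  show "(\<Otimes>\<^bsub>R\<^esub>i\<in>{1..d}. c i (v i)) \<in> carrier (self_module R)"
    using cv by (auto intro!: V.R.finprod_closed)
  show "linear_map R V (self_module R) (\<lambda>x. \<Otimes>\<^bsub>R\<^esub>i\<in>{1..d}. c i ((v(j := x)) i))" if j: "j \<in> {1..d}" for j
  proof -
    let ?p = "\<Otimes>\<^bsub>R\<^esub>i\<in>{1..d} - {j}. c i (v i)"
    have p: "?p \<in> carrier R" using cv by (intro V.R.finprod_closed) auto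
    have *: "(\<Otimes>\<^bsub>R\<^esub>i\<in>{1..d}. c i ((v(j := x)) i)) = c j x \<otimes>\<^bsub>R\<^esub> ?p" if "x \<in> carrier V" for x
    proof -
      have "(\<Otimes>\<^bsub>R\<^esub>i\<in>{1..d}. c i ((v(j := x)) i)) = (\<Otimes>\<^bsub>R\<^esub>i\<in>insert j ({1..d} - {j}). c i ((v(j := x)) i))"
        using j by (simp add: insert_absorb)
      also have "\<dots> = c j x \<otimes>\<^bsub>R\<^esub> (\<Otimes>\<^bsub>R\<^esub>i\<in>{1..d} - {j}. c i ((v(j := x)) i))"
        using cv cl j that by (subst V.R.finprod_insert) auto
      also have "(\<Otimes>\<^bsub>R\<^esub>i\<in>{1..d} - {j}. c i ((v(j := x)) i)) = ?p"
        using cv by (intro V.R.finprod_cong') auto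
      finally show ?thesis .
    qed
    have "linear_map R V (self_module R) (\<lambda>x. c j x \<odot>\<^bsub>self_module R\<^esub> ?p)"
      using assms(2)[OF j] p V.R.cring_axioms by (intro linear_map_smult_vector self_module_module) auto
    then show ?thesis by (rule linear_map_cong[OF assms(1)]) (simp add: * del: fun_upd_apply)
  qed
qed

section \<open>Tensor powers: universal property, permutations and dual bases\<close>

context
  fixes R :: "('a, 'r) ring_scheme" and d :: nat and V :: "('a, 'v, 's) module_scheme"
  assumes V: "module R V"
begin

interpretation V: module R V by (fact V)

private lemma tpow_cring: "cring R" ..

interpretation F: module R "free_module R (tpow_gens d V)"
  by (rule free_module_module[OF tpow_cring])

private abbreviation "F \<equiv> free_module R (tpow_gens d V)"

private lemma tpow_rels_closed: "tpow_rels R d V \<subseteq> carrier F"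
  unfolding tpow_rels_def Let_def
  by (auto simp del: free_module_simps fun_upd_apply
      intro!: F.minus_closed F.a_closed F.smult_closed basis_vec_closed[OF tpow_cring] tpow_gens_upd)

private lemmas tpow_pres = tpow_cring tpow_rels_closed

lemma tpow_module: "module R (tpow R d V)"
  unfolding tpow_def by (rule pres_module_module[OF tpow_pres])

interpretation T: module R "tpow R d V" by (rule tpow_module)

lemma tpow_pure_closed: "v \<in> tpow_gens d V \<Longrightarrow> tpow_pure R d V v \<in> carrier (tpow R d V)"
  unfolding tpow_def tpow_pure_def by (rule pres_gen_closed[OF tpow_pres])

lemma tpow_pure_multilinear: "multilinear_map R d V (tpow R d V) (tpow_pure R d V)"
proof (intro multilinear_mapI linear_mapI)
  fix v i x y assume *: "v \<in> tpow_gens d V" "i \<in> {1..d}" "x \<in> carrier V" "y \<in> carrier V"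
  show "tpow_pure R d V (v(i := x \<oplus>\<^bsub>V\<^esub> y)) =
      tpow_pure R d V (v(i := x)) \<oplus>\<^bsub>tpow R d V\<^esub> tpow_pure R d V (v(i := y))"
    unfolding tpow_def tpow_pure_def
  proof (rule pres_gen_add[OF tpow_pres])
    show "basis_vec R (v(i := x \<oplus>\<^bsub>V\<^esub> y)) \<ominus>\<^bsub>F\<^esub>
       (basis_vec R (v(i := x)) \<oplus>\<^bsub>F\<^esub> basis_vec R (v(i := y))) \<in> tpow_rels R d V"
      unfolding tpow_rels_def Let_def by (rule UnI1) (use * in blast)
  qed (use * in \<open>auto intro: tpow_gens_upd simp del: fun_upd_apply\<close>)
next
  fix v i x a assume *: "v \<in> tpow_gens d V" "i \<in> {1..d}" "x \<in> carrier V" "a \<in> carrier R"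
  show "tpow_pure R d V (v(i := a \<odot>\<^bsub>V\<^esub> x)) = a \<odot>\<^bsub>tpow R d V\<^esub> tpow_pure R d V (v(i := x))"
    unfolding tpow_def tpow_pure_def
  proof (rule pres_gen_smult[OF tpow_pres])
    show "basis_vec R (v(i := a \<odot>\<^bsub>V\<^esub> x)) \<ominus>\<^bsub>F\<^esub> (a \<odot>\<^bsub>F\<^esub> basis_vec R (v(i := x))) \<in> tpow_rels R d V"
      unfolding tpow_rels_def Let_def by (rule UnI2) (use * in blast)
  qed (use * in \<open>auto intro: tpow_gens_upd simp del: fun_upd_apply\<close>)
qed (rule tpow_pure_closed, (rule tpow_gens_upd)?, assumption+)+

lemma tpow_linear_eqI:
  assumes "module R P" "linear_map R (tpow R d V) P f" "linear_map R (tpow R d V) P g"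
    and "\<And>v. v \<in> tpow_gens d V \<Longrightarrow> f (tpow_pure R d V v) = g (tpow_pure R d V v)"
    and "t \<in> carrier (tpow R d V)"
  shows "f t = g t"
  using assms(2-) unfolding tpow_def tpow_pure_def
  by (intro pres_module_linear_eqI[OF tpow_pres assms(1), of f g t]) auto

lemma tpow_lift:
  assumes P: "module R P" and m: "multilinear_map R d V P m"
  shows "linear_map R (tpow R d V) P (pres_lift R (tpow R d V) P m)"
    and "\<And>v. v \<in> tpow_gens d V \<Longrightarrow> pres_lift R (tpow R d V) P m (tpow_pure R d V v) = m v"
proof -
  note cl = multilinear_mapD(1)[OF m]
  note l = linear_mapD[OF multilinear_mapD(2)[OF m]]
  have rel: "\<And>r. r \<in> tpow_rels R d V \<Longrightarrow> free_ext R P m r = \<zero>\<^bsub>P\<^esub>"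
    unfolding tpow_rels_def Let_def
    by (elim UnE CollectE exE conjE; hypsubst;
        intro free_ext_add_rel[OF tpow_cring P cl] free_ext_smult_rel[OF tpow_cring P cl])
      (auto simp: l intro: tpow_gens_upd simp del: fun_upd_apply)
  note * = pres_lift_linear_gen[OF tpow_pres P cl rel]
  show "linear_map R (tpow R d V) P (pres_lift R (tpow R d V) P m)"
    unfolding tpow_def using *(1) .
  show "pres_lift R (tpow R d V) P m (tpow_pure R d V v) = m v" if "v \<in> tpow_gens d V" for v
    unfolding tpow_def tpow_pure_def using *(2)[of v] that by simp
qed

lemma tpow_perm_linear_pure:
  assumes "\<sigma> permutes {1..d}"
  shows "linear_map R (tpow R d V) (tpow R d V) (tpow_perm R d V \<sigma>)"
    and "\<And>v. v \<in> tpow_gens d V \<Longrightarrow> tpow_perm R d V \<sigma> (tpow_pure R d V v) = tpow_pure R d V (v \<circ> \<sigma>)"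
  unfolding tpow_perm_def
  using tpow_lift[OF tpow_module multilinear_map_perm[OF tpow_pure_multilinear assms]] by blast+

lemma tpow_perm_closed:
  "\<lbrakk>\<sigma> permutes {1..d}; t \<in> carrier (tpow R d V)\<rbrakk> \<Longrightarrow> tpow_perm R d V \<sigma> t \<in> carrier (tpow R d V)"
  using linear_mapD(1)[OF tpow_perm_linear_pure(1)] .

lemma tpow_perm_perm:
  assumes "\<sigma> permutes {1..d}" "\<tau> permutes {1..d}" "t \<in> carrier (tpow R d V)"
  shows "tpow_perm R d V \<tau> (tpow_perm R d V \<sigma> t) = tpow_perm R d V (\<sigma> \<circ> \<tau>) t"
proof (rule tpow_linear_eqI[OF tpow_module _ _ _ assms(3)])
  note perm = tpow_perm_linear_pure
  have c: "\<sigma> \<circ> \<tau> permutes {1..d}" using permutes_compose[OF assms(2,1)] .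
  show "linear_map R (tpow R d V) (tpow R d V) (\<lambda>t. tpow_perm R d V \<tau> (tpow_perm R d V \<sigma> t))"
    using linear_map_comp[OF perm(1)[OF assms(1)] perm(1)[OF assms(2)]] .
  show "linear_map R (tpow R d V) (tpow R d V) (tpow_perm R d V (\<sigma> \<circ> \<tau>))" by (rule perm(1)[OF c])
  show "tpow_perm R d V \<tau> (tpow_perm R d V \<sigma> (tpow_pure R d V v)) = tpow_perm R d V (\<sigma> \<circ> \<tau>) (tpow_pure R d V v)"
    if "v \<in> tpow_gens d V" for v
    using perm(2)[OF assms(1) that] perm(2)[OF assms(2) tpow_gens_perm[OF that assms(1)]] perm(2)[OF c that]
    by (simp add: comp_assoc)
qed

lemma tpow_perm_id: "t \<in> carrier (tpow R d V) \<Longrightarrow> tpow_perm R d V id t = t"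
  by (rule tpow_linear_eqI[OF tpow_module tpow_perm_linear_pure(1) linear_map_id])
    (auto simp: permutes_id tpow_perm_linear_pure(2))

lemma tpow_perm_inv:
  assumes "\<sigma> permutes {1..d}" "t \<in> carrier (tpow R d V)"
  shows "tpow_perm R d V \<sigma> (tpow_perm R d V (inv' \<sigma>) t) = t"
    and "tpow_perm R d V (inv' \<sigma>) (tpow_perm R d V \<sigma> t) = t"
  using assms
  by (simp_all add: tpow_perm_perm permutes_inv permutes_inv_o tpow_perm_id)

text \<open>Only the slots in \<open>D\<close> are expanded, which makes induction on
  \<open>D\<close> possible: the new slot is expanded by \<open>dual_basis_linear\<close> with the
  others held fixed, and \<open>finsum_PiE_insert\<close> absorbs the new index.\<close>

lemma tpow_pure_expansion:
  assumes "dual_basis R V A p \<xi>" "finite D" "D \<subseteq> {1..d}" "v \<in> tpow_gens d V"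
  shows "tpow_pure R d V v = (\<Oplus>\<^bsub>tpow R d V\<^esub>J\<in>D \<rightarrow>\<^sub>E A. (\<Otimes>\<^bsub>R\<^esub>i\<in>D. \<xi> (J i) (v i)) \<odot>\<^bsub>tpow R d V\<^esub>
    tpow_pure R d V (\<lambda>i. if i \<in> D then p (J i) else v i))"
  using assms(2,3)
proof (induction D rule: finite_induct)
  case empty
  then show ?case using tpow_pure_closed[OF assms(4)] by simp
next
  case (insert k D)
  let ?T = "tpow R d V" and ?w = "\<lambda>D J i. if i \<in> D then p (J i) else v i"
  note A = dual_basisD[OF assms(1)] and val = dual_basis_value_closed[OF assms(1)]
  note vi = tpow_gens_value[OF assms(4)]
  have wg: "?w D' J \<in> tpow_gens d V" if "D' \<subseteq> {1..d}" "J \<in> D' \<rightarrow>\<^sub>E A" for D' J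
  proof -
    have "p (J i) \<in> carrier V" if "i \<in> D'" for i using \<open>J \<in> D' \<rightarrow>\<^sub>E A\<close> A(2) that by blast
    then show ?thesis using assms(4) that(1) by (auto simp: tpow_gens_def PiE_iff extensional_def)
  qed
  have sc: "(\<Otimes>\<^bsub>R\<^esub>i\<in>D'. \<xi> (J i) (v i)) \<in> carrier R" if "D' \<subseteq> {1..d}" "J \<in> D' \<rightarrow>\<^sub>E A" for D' J
    using that val vi by (intro V.R.finprod_closed) blast
  have k: "k \<in> {1..d}" and D: "D \<subseteq> {1..d}" using insert by auto
  have "tpow_pure R d V v = (\<Oplus>\<^bsub>?T\<^esub>J\<in>D \<rightarrow>\<^sub>E A. (\<Otimes>\<^bsub>R\<^esub>i\<in>D. \<xi> (J i) (v i)) \<odot>\<^bsub>?T\<^esub> tpow_pure R d V (?w D J))"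
    using insert.IH D by simp
  also have "\<dots> = (\<Oplus>\<^bsub>?T\<^esub>J\<in>D \<rightarrow>\<^sub>E A. \<Oplus>\<^bsub>?T\<^esub>a\<in>A. (\<Otimes>\<^bsub>R\<^esub>i\<in>insert k D. \<xi> ((J(k := a)) i) (v i)) \<odot>\<^bsub>?T\<^esub>
    tpow_pure R d V (?w (insert k D) (J(k := a))))"
  proof (rule T.finsum_cong', simp)
    have ins: "J(k := a) \<in> insert k D \<rightarrow>\<^sub>E A" if "J \<in> D \<rightarrow>\<^sub>E A" "a \<in> A" for J a
      using that by (auto simp: PiE_iff extensional_def)
    note cl = tpow_pure_closed[OF wg[OF insert.prems ins]] sc[OF insert.prems ins]
    show "(\<lambda>J. \<Oplus>\<^bsub>?T\<^esub>a\<in>A. (\<Otimes>\<^bsub>R\<^esub>i\<in>insert k D. \<xi> ((J(k := a)) i) (v i)) \<odot>\<^bsub>?T\<^esub>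
        tpow_pure R d V (?w (insert k D) (J(k := a)))) \<in> (D \<rightarrow>\<^sub>E A) \<rightarrow> carrier ?T"
      by (intro Pi_I T.finsum_closed T.smult_closed cl)
    fix J assume J: "J \<in> D \<rightarrow>\<^sub>E A"
    let ?c = "\<Otimes>\<^bsub>R\<^esub>i\<in>D. \<xi> (J i) (v i)"
    have c: "?c \<in> carrier R" using sc[OF D J] .
    have w: "?w D J \<in> tpow_gens d V" using wg[OF D J] .
    have Jk: "?w (insert k D) (J(k := a)) = (?w D J)(k := p a)" for a by auto
    have prod: "(\<Otimes>\<^bsub>R\<^esub>i\<in>insert k D. \<xi> ((J(k := a)) i) (v i)) = ?c \<otimes>\<^bsub>R\<^esub> \<xi> a (v k)" if "a \<in> A" for a
    proof -
      have Di: "\<xi> (J i) (v i) \<in> carrier R" if "i \<in> D" for i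
        using J that D vi val by blast
      have eq: "(\<Otimes>\<^bsub>R\<^esub>i\<in>D. \<xi> ((J(k := a)) i) (v i)) = ?c"
        using Di insert.hyps(2) by (intro V.R.finprod_cong') auto
      have "(\<Otimes>\<^bsub>R\<^esub>i\<in>insert k D. \<xi> ((J(k := a)) i) (v i)) =
          \<xi> a (v k) \<otimes>\<^bsub>R\<^esub> (\<Otimes>\<^bsub>R\<^esub>i\<in>D. \<xi> ((J(k := a)) i) (v i))"
        using insert.hyps Di val[OF that vi[OF k]] by (subst V.R.finprod_insert) auto
      then show ?thesis using eq c val[OF that vi[OF k]] by (simp add: V.R.m_comm)
    qed
    have lin: "linear_map R V ?T (\<lambda>x. tpow_pure R d V ((?w D J)(k := x)))"
      using multilinear_mapD(2)[OF tpow_pure_multilinear w k] .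
    \<comment> \<open>Slot \<open>k\<close> still holds \<open>v k\<close>, since \<open>k\<close>
      is not in \<open>D\<close>; so linearity in that slot applies to the partially expanded
      tensor.\<close>
    have "(?w D J)(k := v k) = ?w D J" using insert.hyps(2) by auto
    then have "tpow_pure R d V (?w D J) =
        (\<Oplus>\<^bsub>?T\<^esub>a\<in>A. \<xi> a (v k) \<odot>\<^bsub>?T\<^esub> tpow_pure R d V ((?w D J)(k := p a)))"
      using dual_basis_linear[OF V tpow_module assms(1) lin vi[OF k]] by simp
    then have "?c \<odot>\<^bsub>?T\<^esub> tpow_pure R d V (?w D J) =
        (\<Oplus>\<^bsub>?T\<^esub>a\<in>A. ?c \<odot>\<^bsub>?T\<^esub> (\<xi> a (v k) \<odot>\<^bsub>?T\<^esub> tpow_pure R d V ((?w D J)(k := p a))))"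
      using c A val[OF _ vi[OF k]] linear_mapD(1)[OF lin] by (simp add: T.finsum_smult_ldistr Pi_def)
    also have "\<dots> = (\<Oplus>\<^bsub>?T\<^esub>a\<in>A. (\<Otimes>\<^bsub>R\<^esub>i\<in>insert k D. \<xi> ((J(k := a)) i) (v i)) \<odot>\<^bsub>?T\<^esub>
        tpow_pure R d V (?w (insert k D) (J(k := a))))"
      unfolding Jk using c A(2) val[OF _ vi[OF k]] linear_mapD(1)[OF lin]
      by (intro T.finsum_cong') (auto simp: prod T.smult_assoc1 simp del: fun_upd_apply)
    finally show "?c \<odot>\<^bsub>?T\<^esub> tpow_pure R d V (?w D J) =
        (\<Oplus>\<^bsub>?T\<^esub>a\<in>A. (\<Otimes>\<^bsub>R\<^esub>i\<in>insert k D. \<xi> ((J(k := a)) i) (v i)) \<odot>\<^bsub>?T\<^esub>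
        tpow_pure R d V (?w (insert k D) (J(k := a))))" .
  qed
  also have "\<dots> = (\<Oplus>\<^bsub>?T\<^esub>J\<in>insert k D \<rightarrow>\<^sub>E A. (\<Otimes>\<^bsub>R\<^esub>i\<in>insert k D. \<xi> (J i) (v i)) \<odot>\<^bsub>?T\<^esub>
    tpow_pure R d V (?w (insert k D) J))"
    using tpow_pure_closed[OF wg[OF insert.prems]] sc[OF insert.prems]
    by (intro T.finsum_PiE_insert insert.hyps A(1)) auto
  finally show ?case .
qed

lemma tpow_functional:
  assumes "\<And>i. i \<in> {1..d} \<Longrightarrow> linear_map R V (self_module R) (c i)"
  shows "linear_map R (tpow R d V) (self_module R)
      (pres_lift R (tpow R d V) (self_module R) (\<lambda>v. \<Otimes>\<^bsub>R\<^esub>i\<in>{1..d}. c i (v i)))"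
    and "\<And>v. v \<in> tpow_gens d V \<Longrightarrow>
      pres_lift R (tpow R d V) (self_module R) (\<lambda>v. \<Otimes>\<^bsub>R\<^esub>i\<in>{1..d}. c i (v i)) (tpow_pure R d V v) =
      (\<Otimes>\<^bsub>R\<^esub>i\<in>{1..d}. c i (v i))"
  using tpow_lift[OF self_module_module[OF tpow_cring] multilinear_map_prod[OF V, of d c]] assms by blast+

text \<open>The full expansion of all \<open>d\<close> slots, checked on pure tensors by linearity.
  In particular the tensor powers of finitely generated projective modules have finite dual bases
  again.\<close>

lemma dual_basis_tpow:
  assumes "dual_basis R V A p \<xi>"
  shows "dual_basis R (tpow R d V) ({1..d} \<rightarrow>\<^sub>E A) (\<lambda>J. tpow_pure R d V (\<lambda>i\<in>{1..d}. p (J i)))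
    (\<lambda>J. pres_lift R (tpow R d V) (self_module R) (\<lambda>v. \<Otimes>\<^bsub>R\<^esub>i\<in>{1..d}. \<xi> (J i) (v i)))"
    (is "dual_basis R ?T ?A ?p ?\<xi>")
proof (rule dual_basisI)
  note A = dual_basisD[OF assms(1)] and val = dual_basis_value_closed[OF assms(1)]
  show fin: "finite ?A" using A(1) by (intro finite_PiE) auto
  have J: "J i \<in> A" if "J \<in> ?A" "i \<in> {1..d}" for J i using that by blast
  show p: "?p J \<in> carrier ?T" if "J \<in> ?A" for J
    using A(2)[OF J[OF that]] by (intro tpow_pure_closed tpow_gens_restrict)
  have lift: "linear_map R ?T (self_module R) (?\<xi> J)"
    "\<And>v. v \<in> tpow_gens d V \<Longrightarrow> ?\<xi> J (tpow_pure R d V v) = (\<Otimes>\<^bsub>R\<^esub>i\<in>{1..d}. \<xi> (J i) (v i))"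
    if "J \<in> ?A" for J
    using tpow_functional[of "\<lambda>i. \<xi> (J i)"] A(3)[OF J[OF that]] by blast+
  show \<xi>: "linear_map R ?T (self_module R) (?\<xi> J)" if "J \<in> ?A" for J using lift(1)[OF that] .
  show "(\<Oplus>\<^bsub>?T\<^esub>J\<in>?A. ?\<xi> J t \<odot>\<^bsub>?T\<^esub> ?p J) = t" if "t \<in> carrier ?T" for t
  proof (rule tpow_linear_eqI[OF tpow_module _ linear_map_id _ that])
    show "linear_map R ?T ?T (\<lambda>t. \<Oplus>\<^bsub>?T\<^esub>J\<in>?A. ?\<xi> J t \<odot>\<^bsub>?T\<^esub> ?p J)"
      by (rule dual_basis_expansion_linear[OF tpow_module fin p \<xi>])
    fix v assume v: "v \<in> tpow_gens d V"
    have eq: "(\<lambda>i. if i \<in> {1..d} then p (J i) else v i) = (\<lambda>i\<in>{1..d}. p (J i))" for J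
      using v by (auto simp: tpow_gens_def fun_eq_iff)
    have "(\<Oplus>\<^bsub>?T\<^esub>J\<in>?A. ?\<xi> J (tpow_pure R d V v) \<odot>\<^bsub>?T\<^esub> ?p J) =
       (\<Oplus>\<^bsub>?T\<^esub>J\<in>?A. (\<Otimes>\<^bsub>R\<^esub>i\<in>{1..d}. \<xi> (J i) (v i)) \<odot>\<^bsub>?T\<^esub> ?p J)"
      using p lift(2)[OF _ v] linear_mapD(1)[OF \<xi> tpow_pure_closed[OF v]]
      by (intro T.finsum_cong') auto
    also have "\<dots> = tpow_pure R d V v"
      using tpow_pure_expansion[OF assms, of "{1..d}" v, unfolded eq] v by simp
    finally show "(\<Oplus>\<^bsub>?T\<^esub>J\<in>?A. ?\<xi> J (tpow_pure R d V v) \<odot>\<^bsub>?T\<^esub> ?p J) = tpow_pure R d V v" .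
  qed
qed

end

subsection \<open>The tensor power of a tensor product\<close>

context
  fixes R :: "('a, 'r) ring_scheme" and d :: nat
    and V :: "('a, 'v, 's) module_scheme" and W :: "('a, 'w, 't) module_scheme"
  assumes V: "module R V" and W: "module R W"
begin

interpretation V: module R V by (fact V)
interpretation W: module R W by (fact W)

private lemma pair_cring: "cring R" ..

private abbreviation "VW \<equiv> tensor_module R V W"

private lemmas mod_VW = tensor_module_module[OF V W]
private lemmas mod_T = tpow_module[OF mod_VW, of d]
private lemmas mod_TV = tpow_module[OF V, of d]
private lemmas mod_TW = tpow_module[OF W, of d]

interpretation T: module R "tpow R d VW" by (rule mod_T)

text \<open>The tensor s \<otimes> t, seen inside the tensor power of V \<otimes> W. Working with
  these elements instead of with \<open>interchange\<close> keeps the inverse of the latter out of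
  later computations.\<close>

definition tpow_pair :: "((nat \<Rightarrow> 'v) \<Rightarrow> 'a) set \<Rightarrow> ((nat \<Rightarrow> 'w) \<Rightarrow> 'a) set \<Rightarrow> ((nat \<Rightarrow> ('v \<times> 'w \<Rightarrow> 'a) set) \<Rightarrow> 'a) set"
  where "tpow_pair s t = interchange R d V W (pure_tensor R (tpow R d V) (tpow R d W) s t)"

private abbreviation "vw v w \<equiv> (\<lambda>i\<in>{1..d}. pure_tensor R V W (v i) (w i))"
private abbreviation "inner v \<equiv> pres_lift R (tpow R d W) (tpow R d VW) (\<lambda>w. tpow_pure R d VW (vw v w))"
private abbreviation "outer s t \<equiv> pres_lift R (tpow R d V) (tpow R d VW) (\<lambda>v. inner v t) s"

private lemma vw_closed: "\<lbrakk>v \<in> tpow_gens d V; w \<in> tpow_gens d W\<rbrakk> \<Longrightarrow> vw v w \<in> tpow_gens d VW"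
  by (intro tpow_gens_restrict pure_tensor_closed[OF V W] tpow_gens_value)

private lemma pure_vw_linear:
  assumes "v \<in> tpow_gens d V" "w \<in> tpow_gens d W" "i \<in> {1..d}"
  shows "linear_map R W (tpow R d VW) (\<lambda>x. tpow_pure R d VW (vw v (w(i := x))))"
    and "linear_map R V (tpow R d VW) (\<lambda>x. tpow_pure R d VW (vw (v(i := x)) w))"
proof -
  note m = multilinear_mapD(2)[OF tpow_pure_multilinear[OF mod_VW] vw_closed[OF assms(1,2)] assms(3)]
  note b = bilinear_mapD[OF pure_tensor_bilinear[OF V W]]
  have eq: "vw v (w(i := x)) = (vw v w)(i := pure_tensor R V W (v i) x)"
    "vw (v(i := y)) w = (vw v w)(i := pure_tensor R V W y (w i))" for x y
    using assms(3) by (auto simp: fun_eq_iff)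
  show "linear_map R W (tpow R d VW) (\<lambda>x. tpow_pure R d VW (vw v (w(i := x))))"
    unfolding eq by (rule linear_map_comp[OF b(1) m]) (rule tpow_gens_value[OF assms(1,3)])
  show "linear_map R V (tpow R d VW) (\<lambda>x. tpow_pure R d VW (vw (v(i := x)) w))"
    unfolding eq by (rule linear_map_comp[OF b(2) m]) (rule tpow_gens_value[OF assms(2,3)])
qed

private lemma inner:
  assumes "v \<in> tpow_gens d V"
  shows "linear_map R (tpow R d W) (tpow R d VW) (inner v)"
    and "\<And>w. w \<in> tpow_gens d W \<Longrightarrow> inner v (tpow_pure R d W w) = tpow_pure R d VW (vw v w)"
proof -
  have "multilinear_map R d W (tpow R d VW) (\<lambda>w. tpow_pure R d VW (vw v w))"
    by (rule multilinear_mapI)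
      (blast intro: pure_vw_linear(1)[OF assms] tpow_pure_closed[OF mod_VW] vw_closed[OF assms])+
  note tpow_lift[OF W mod_T this]
  then show "linear_map R (tpow R d W) (tpow R d VW) (inner v)"
    "\<And>w. w \<in> tpow_gens d W \<Longrightarrow> inner v (tpow_pure R d W w) = tpow_pure R d VW (vw v w)"
    by blast+
qed

private lemma inner_multilinear:
  assumes t: "t \<in> carrier (tpow R d W)"
  shows "multilinear_map R d V (tpow R d VW) (\<lambda>v. inner v t)"
proof (intro multilinear_mapI linear_mapI)
  show "inner v t \<in> carrier (tpow R d VW)" if "v \<in> tpow_gens d V" for v
    using linear_mapD(1)[OF inner(1)[OF that] t] .
  fix v i assume v: "v \<in> tpow_gens d V" "i \<in> {1..d}"
  note up = tpow_gens_upd[OF v]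
  show "inner (v(i := x)) t \<in> carrier (tpow R d VW)" if "x \<in> carrier V" for x
    using linear_mapD(1)[OF inner(1)[OF up[OF that]] t] .
  show "inner (v(i := x \<oplus>\<^bsub>V\<^esub> y)) t = inner (v(i := x)) t \<oplus>\<^bsub>tpow R d VW\<^esub> inner (v(i := y)) t"
    if xy: "x \<in> carrier V" "y \<in> carrier V" for x y
    by (rule tpow_linear_eqI[OF W mod_T inner(1) linear_map_add[OF mod_T inner(1) inner(1)] _ t])
      (use up xy inner(2) linear_mapD(2)[OF pure_vw_linear(2)[OF v(1) _ v(2)] xy] in
        \<open>auto simp del: fun_upd_apply\<close>)
  show "inner (v(i := a \<odot>\<^bsub>V\<^esub> x)) t = a \<odot>\<^bsub>tpow R d VW\<^esub> inner (v(i := x)) t"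
    if ax: "a \<in> carrier R" "x \<in> carrier V" for a x
    by (rule tpow_linear_eqI[OF W mod_T inner(1) linear_map_smult[OF mod_T inner(1)] _ t])
      (use up ax inner(2) linear_mapD(3)[OF pure_vw_linear(2)[OF v(1) _ v(2)] ax] in
        \<open>auto simp del: fun_upd_apply\<close>)
qed

private lemma outer_pure:
  "\<lbrakk>v \<in> tpow_gens d V; t \<in> carrier (tpow R d W)\<rbrakk> \<Longrightarrow> outer (tpow_pure R d V v) t = inner v t"
  using tpow_lift(2)[OF V mod_T inner_multilinear] by blast

private lemma outer_linear1:
  "t \<in> carrier (tpow R d W) \<Longrightarrow> linear_map R (tpow R d V) (tpow R d VW) (\<lambda>s. outer s t)"
  using tpow_lift(1)[OF V mod_T inner_multilinear] by blast

text \<open>Linearity in \<open>s\<close> is built into the lift. Linearity in \<open>t\<close> is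
  checked on pure \<open>s\<close>, where \<open>outer\<close> reduces to \<open>inner\<close>,
  which is linear in \<open>t\<close>.\<close>

private lemma outer_bilinear: "bilinear_map R (tpow R d V) (tpow R d W) (tpow R d VW) (\<lambda>s t. outer s t)"
proof (rule bilinear_mapI[OF _ outer_linear1])
  interpret mod_TW: module R "tpow R d W" by (rule mod_TW)
  fix s assume s: "s \<in> carrier (tpow R d V)"
  show "linear_map R (tpow R d W) (tpow R d VW) (\<lambda>t. outer s t)"
  proof (rule linear_mapI)
    show "outer s t \<in> carrier (tpow R d VW)" if "t \<in> carrier (tpow R d W)" for t
      using linear_mapD(1)[OF outer_linear1[OF that] s] .
    show "outer s (t \<oplus>\<^bsub>tpow R d W\<^esub> u) = outer s t \<oplus>\<^bsub>tpow R d VW\<^esub> outer s u"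
      if tu: "t \<in> carrier (tpow R d W)" "u \<in> carrier (tpow R d W)" for t u
      by (rule tpow_linear_eqI[OF V mod_T outer_linear1 linear_map_add[OF mod_T outer_linear1 outer_linear1] _ s])
        (use tu in \<open>auto simp: outer_pure linear_mapD(2)[OF inner(1)]\<close>)
    show "outer s (a \<odot>\<^bsub>tpow R d W\<^esub> t) = a \<odot>\<^bsub>tpow R d VW\<^esub> outer s t"
      if at: "a \<in> carrier R" "t \<in> carrier (tpow R d W)" for a t
      by (rule tpow_linear_eqI[OF V mod_T outer_linear1 linear_map_smult[OF mod_T outer_linear1] _ s])
        (use at in \<open>auto simp: outer_pure linear_mapD(3)[OF inner(1)]\<close>)
  qed
qed

private lemmas interchange_lift = tensor_lift[OF mod_TV mod_TW mod_T outer_bilinear]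

lemma interchange_linear:
  "linear_map R (tensor_module R (tpow R d V) (tpow R d W)) (tpow R d VW) (interchange R d V W)"
  using interchange_lift(1) by (simp add: interchange_def Let_def)

private lemma tpow_pair_outer:
  "\<lbrakk>s \<in> carrier (tpow R d V); t \<in> carrier (tpow R d W)\<rbrakk> \<Longrightarrow> tpow_pair s t = outer s t"
  using interchange_lift(2) by (simp add: tpow_pair_def interchange_def Let_def)

lemma tpow_pair_bilinear: "bilinear_map R (tpow R d V) (tpow R d W) (tpow R d VW) tpow_pair"
  unfolding tpow_pair_def
  by (rule bilinear_map_comp[OF pure_tensor_bilinear[OF mod_TV mod_TW] linear_map_id linear_map_id interchange_linear])

lemma tpow_pair_pure:
  "\<lbrakk>v \<in> tpow_gens d V; w \<in> tpow_gens d W\<rbrakk> \<Longrightarrow>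
    tpow_pair (tpow_pure R d V v) (tpow_pure R d W w) =
    tpow_pure R d VW (\<lambda>i\<in>{1..d}. pure_tensor R V W (v i) (w i))"
  by (simp add: tpow_pair_outer tpow_pure_closed[OF V] tpow_pure_closed[OF W] outer_pure inner)

lemma bilinear_tpow_eqI:
  assumes P: "module R P" and b: "bilinear_map R (tpow R d V) (tpow R d W) P b"
    and b': "bilinear_map R (tpow R d V) (tpow R d W) P b'"
    and eq: "\<And>v w. \<lbrakk>v \<in> tpow_gens d V; w \<in> tpow_gens d W\<rbrakk> \<Longrightarrow>
      b (tpow_pure R d V v) (tpow_pure R d W w) = b' (tpow_pure R d V v) (tpow_pure R d W w)"
    and s: "s \<in> carrier (tpow R d V)" and t: "t \<in> carrier (tpow R d W)"
  shows "b s t = b' s t"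
proof (rule tpow_linear_eqI[OF V P bilinear_mapD(2)[OF b t] bilinear_mapD(2)[OF b' t] _ s])
  fix v assume v: "v \<in> tpow_gens d V"
  note pv = tpow_pure_closed[OF V v]
  show "b (tpow_pure R d V v) t = b' (tpow_pure R d V v) t"
    by (rule tpow_linear_eqI[OF W P bilinear_mapD(1)[OF b pv] bilinear_mapD(1)[OF b' pv] eq[OF v] t])
qed

text \<open>On pure tensors a permutation reindexes both families at once. Thanks to this
  compatibility, equivariant bilinear data such as a pair of morphisms define a morphism out of V
  \<otimes> W.\<close>

lemma tpow_pair_perm:
  assumes \<sigma>: "\<sigma> permutes {1..d}" and "s \<in> carrier (tpow R d V)" "t \<in> carrier (tpow R d W)"
  shows "tpow_pair (tpow_perm R d V \<sigma> s) (tpow_perm R d W \<sigma> t) = tpow_perm R d VW \<sigma> (tpow_pair s t)"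
proof (rule bilinear_tpow_eqI[OF mod_T _ _ _ assms(2,3)])
  note p = tpow_perm_linear_pure[OF V \<sigma>] tpow_perm_linear_pure[OF W \<sigma>] tpow_perm_linear_pure[OF mod_VW \<sigma>]
  show "bilinear_map R (tpow R d V) (tpow R d W) (tpow R d VW)
      (\<lambda>s t. tpow_pair (tpow_perm R d V \<sigma> s) (tpow_perm R d W \<sigma> t))"
    by (rule bilinear_map_comp[OF tpow_pair_bilinear p(1) p(3) linear_map_id])
  show "bilinear_map R (tpow R d V) (tpow R d W) (tpow R d VW) (\<lambda>s t. tpow_perm R d VW \<sigma> (tpow_pair s t))"
    by (rule bilinear_map_comp[OF tpow_pair_bilinear linear_map_id linear_map_id p(5)])
  fix v w assume vw: "v \<in> tpow_gens d V" "w \<in> tpow_gens d W"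
  have "vw (v \<circ> \<sigma>) (w \<circ> \<sigma>) = vw v w \<circ> \<sigma>"
    using permutes_in_image[OF \<sigma>] by (auto simp: fun_eq_iff)
  then show "tpow_pair (tpow_perm R d V \<sigma> (tpow_pure R d V v)) (tpow_perm R d W \<sigma> (tpow_pure R d W w)) =
      tpow_perm R d VW \<sigma> (tpow_pair (tpow_pure R d V v) (tpow_pure R d W w))"
    using vw by (simp add: p tpow_pair_pure tpow_gens_perm[OF _ \<sigma>] vw_closed)
qed

section \<open>Bijectivity of the interchange map\<close>

context
  fixes n m :: nat and p \<xi> q \<zeta>
  assumes A: "dual_basis R V {..<n} p \<xi>" and B: "dual_basis R W {..<m} q \<zeta>"
begin

private abbreviation "JA \<equiv> {1..d} \<rightarrow>\<^sub>E {..<n}"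
private abbreviation "JB \<equiv> {1..d} \<rightarrow>\<^sub>E {..<m}"

private lemmas tA = dual_basis_tpow[OF V A, of d]
private lemmas tB = dual_basis_tpow[OF W B, of d]

text \<open>The coordinate form of T^d V \<otimes> T^d W with index (J, K) is the pullback along
  \<open>interchange\<close> of the form with index i \<mapsto> (J i, K i) on the tensor power of V
  \<otimes> W. So \<open>dual_basis_injective\<close> applies.\<close>

private lemma interchange_inj: "inj_on (interchange R d V W) (carrier (tensor_module R (tpow R d V) (tpow R d W)))"
proof (rule dual_basis_injective[OF tensor_module_module[OF mod_TV mod_TW] dual_basis_tensor[OF mod_TV mod_TW tA tB]])
  let ?c = "\<lambda>J K i. pres_lift R VW (self_module R) (\<lambda>(x, y). \<xi> (J i) x \<otimes>\<^bsub>R\<^esub> \<zeta> (K i) y)"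
  fix c t assume c: "c \<in> JA \<times> JB" and t: "t \<in> carrier (tensor_module R (tpow R d V) (tpow R d W))"
  obtain J K where JK: "c = (J, K)" "J \<in> JA" "K \<in> JB" using c by blast
  have J: "J i \<in> {..<n}" if "i \<in> {1..d}" for i using JK(2) that by blast
  have K: "K i \<in> {..<m}" if "i \<in> {1..d}" for i using JK(3) that by blast
  note S = self_module_module[OF pair_cring]
  have c: "linear_map R VW (self_module R) (?c J K i)"
    "\<And>x y. \<lbrakk>x \<in> carrier V; y \<in> carrier W\<rbrakk> \<Longrightarrow>
      ?c J K i (pure_tensor R V W x y) = \<xi> (J i) x \<otimes>\<^bsub>R\<^esub> \<zeta> (K i) y" if "i \<in> {1..d}" for i
    using tensor_lift[OF V W S bilinear_map_mult[OF pair_cring dual_basisD(3)[OF A J[OF that]]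
          dual_basisD(3)[OF B K[OF that]]]] by blast+
  let ?f = "\<lambda>J. pres_lift R (tpow R d V) (self_module R) (\<lambda>v. \<Otimes>\<^bsub>R\<^esub>i\<in>{1..d}. \<xi> (J i) (v i))"
  let ?g = "\<lambda>K. pres_lift R (tpow R d W) (self_module R) (\<lambda>v. \<Otimes>\<^bsub>R\<^esub>i\<in>{1..d}. \<zeta> (K i) (v i))"
  \<comment> \<open>The form on the target: the product over all slots of the forms \<xi>_{J i}
    \<otimes> \<zeta>_{K i}. Commutativity of \<open>R\<close> will split its value on a pair into
    the product of the values of \<open>?f\<close> and \<open>?g\<close>.\<close>
  let ?h = "\<lambda>(J, K). pres_lift R (tpow R d VW) (self_module R) (\<lambda>v. \<Otimes>\<^bsub>R\<^esub>i\<in>{1..d}. ?c J K i (v i))"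
  have f: "linear_map R (tpow R d V) (self_module R) (?f J)"
    "\<And>v. v \<in> tpow_gens d V \<Longrightarrow> ?f J (tpow_pure R d V v) = (\<Otimes>\<^bsub>R\<^esub>i\<in>{1..d}. \<xi> (J i) (v i))"
    using tpow_functional[OF V, of d "\<lambda>i. \<xi> (J i)"] dual_basisD(3)[OF A J] by blast+
  have g: "linear_map R (tpow R d W) (self_module R) (?g K)"
    "\<And>v. v \<in> tpow_gens d W \<Longrightarrow> ?g K (tpow_pure R d W v) = (\<Otimes>\<^bsub>R\<^esub>i\<in>{1..d}. \<zeta> (K i) (v i))"
    using tpow_functional[OF W, of d "\<lambda>i. \<zeta> (K i)"] dual_basisD(3)[OF B K] by blast+
  have h: "linear_map R (tpow R d VW) (self_module R) (?h c)"
    "\<And>v. v \<in> tpow_gens d VW \<Longrightarrow> ?h c (tpow_pure R d VW v) = (\<Otimes>\<^bsub>R\<^esub>i\<in>{1..d}. ?c J K i (v i))"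
    using tpow_functional[OF mod_VW, of d "?c J K"] c(1) unfolding JK(1) prod.case by blast+
  note lift = tensor_lift[OF mod_TV mod_TW S bilinear_map_mult[OF pair_cring f(1) g(1)]]
  have "?h c (interchange R d V W t) = pres_lift R (tensor_module R (tpow R d V) (tpow R d W)) (self_module R)
      (\<lambda>(x, y). ?f J x \<otimes>\<^bsub>R\<^esub> ?g K y) t"
  proof (rule tensor_linear_eqI[where f = "\<lambda>t. ?h c (interchange R d V W t)",
        OF mod_TV mod_TW S linear_map_comp[OF interchange_linear h(1)] lift(1) _ t])
    fix s t assume st: "s \<in> carrier (tpow R d V)" "t \<in> carrier (tpow R d W)"
    have "?h c (tpow_pair s t) = ?f J s \<otimes>\<^bsub>R\<^esub> ?g K t"
    proof (rule bilinear_tpow_eqI[OF S _ bilinear_map_mult[OF pair_cring f(1) g(1)] _ st])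
      show "bilinear_map R (tpow R d V) (tpow R d W) (self_module R) (\<lambda>s t. ?h c (tpow_pair s t))"
        by (rule bilinear_map_comp[OF tpow_pair_bilinear linear_map_id linear_map_id h(1)])
      fix v w assume v: "v \<in> tpow_gens d V" and w: "w \<in> tpow_gens d W"
      have xv: "\<xi> (J i) (v i) \<in> carrier R" if "i \<in> {1..d}" for i
        using dual_basis_value_closed[OF A J[OF that] tpow_gens_value[OF v that]] .
      have zw: "\<zeta> (K i) (w i) \<in> carrier R" if "i \<in> {1..d}" for i
        using dual_basis_value_closed[OF B K[OF that] tpow_gens_value[OF w that]] .
      have "?h c (tpow_pair (tpow_pure R d V v) (tpow_pure R d W w)) = (\<Otimes>\<^bsub>R\<^esub>i\<in>{1..d}. ?c J K i (vw v w i))"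
        using v w by (simp add: tpow_pair_pure h(2) vw_closed del: restrict_apply)
      also have "\<dots> = (\<Otimes>\<^bsub>R\<^esub>i\<in>{1..d}. \<xi> (J i) (v i) \<otimes>\<^bsub>R\<^esub> \<zeta> (K i) (w i))"
        using c(2) tpow_gens_value[OF v] tpow_gens_value[OF w] xv zw
        by (intro V.R.finprod_cong') (auto simp del: atLeastAtMost_iff)
      also have "\<dots> = (\<Otimes>\<^bsub>R\<^esub>i\<in>{1..d}. \<xi> (J i) (v i)) \<otimes>\<^bsub>R\<^esub> (\<Otimes>\<^bsub>R\<^esub>i\<in>{1..d}. \<zeta> (K i) (w i))"
        using xv zw by (intro V.R.finprod_multf) auto
      finally show "?h c (tpow_pair (tpow_pure R d V v) (tpow_pure R d W w)) =
          ?f J (tpow_pure R d V v) \<otimes>\<^bsub>R\<^esub> ?g K (tpow_pure R d W w)"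
        using f(2)[OF v] g(2)[OF w] by simp
    qed
    then show "?h c (interchange R d V W (pure_tensor R (tpow R d V) (tpow R d W) s t)) =
      pres_lift R (tensor_module R (tpow R d V) (tpow R d W)) (self_module R) (\<lambda>(x, y). ?f J x \<otimes>\<^bsub>R\<^esub> ?g K y)
        (pure_tensor R (tpow R d V) (tpow R d W) s t)"
      using lift(2)[OF st] by (simp add: tpow_pair_def)
  qed
  then show "?h c (interchange R d V W t) =
    (case c of (J, K) \<Rightarrow> pres_lift R (tensor_module R (tpow R d V) (tpow R d W)) (self_module R)
      (\<lambda>(x, y). ?f J x \<otimes>\<^bsub>R\<^esub> ?g K y)) t"
    by (simp add: JK(1))
qed

text \<open>The generators of the target supplied by the dual bases are pure tensors of pure
  tensors; collecting their left and their right factors gives a preimage.\<close>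

private lemma interchange_surj:
  "interchange R d V W ` carrier (tensor_module R (tpow R d V) (tpow R d W)) = carrier (tpow R d VW)"
proof (rule dual_basis_surjective[OF tensor_module_module[OF mod_TV mod_TW] mod_T
      dual_basis_tpow[OF mod_VW dual_basis_tensor[OF V W A B]] interchange_linear])
  fix J assume J: "J \<in> {1..d} \<rightarrow>\<^sub>E {..<n} \<times> {..<m}"
  let ?v = "\<lambda>i\<in>{1..d}. p (fst (J i))" and ?w = "\<lambda>i\<in>{1..d}. q (snd (J i))"
  have Ji: "fst (J i) < n" "snd (J i) < m" if "i \<in> {1..d}" for i using PiE_mem[OF J that] by auto
  have v: "?v \<in> tpow_gens d V" and w: "?w \<in> tpow_gens d W"
    using Ji dual_basisD(2)[OF A] dual_basisD(2)[OF B] by (auto intro!: tpow_gens_restrict)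
  have "tpow_pure R d VW (\<lambda>i\<in>{1..d}. case J i of (a, b) \<Rightarrow> pure_tensor R V W (p a) (q b)) =
      tpow_pure R d VW (vw ?v ?w)"
    by (rule arg_cong[of _ _ "tpow_pure R d VW"]) (auto simp: fun_eq_iff split: prod.split)
  also have "\<dots> = interchange R d V W (pure_tensor R (tpow R d V) (tpow R d W) (tpow_pure R d V ?v) (tpow_pure R d W ?w))"
    using tpow_pair_pure[OF v w] by (simp add: tpow_pair_def)
  finally show "tpow_pure R d VW (\<lambda>i\<in>{1..d}. case J i of (a, b) \<Rightarrow> pure_tensor R V W (p a) (q b)) \<in>
      interchange R d V W ` carrier (tensor_module R (tpow R d V) (tpow R d W))"
    using pure_tensor_closed[OF mod_TV mod_TW tpow_pure_closed[OF V v] tpow_pure_closed[OF W w]] by blast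
qed

lemma interchange_bij_aux:
  "bij_betw (interchange R d V W) (carrier (tensor_module R (tpow R d V) (tpow R d W))) (carrier (tpow R d VW))"
  using interchange_inj interchange_surj by (simp add: bij_betw_def)

end

end

text \<open>Since \<open>gam_tensor\<close> uses \<open>inv_into\<close> of
  \<open>interchange\<close>, the coend relations of the Day convolution can be evaluated only after
  this map is known to be bijective.\<close>

lemma interchange_iso:
  assumes "fg_projective R V" "fg_projective R W"
  shows "linear_iso R (tensor_module R (tpow R d V) (tpow R d W)) (tpow R d (tensor_module R V W)) (interchange R d V W)"
proof -
  have V: "module R V" and W: "module R W" using assms by (auto simp: fg_projective_def)
  obtain n p \<xi> where A: "dual_basis R V {..<n::nat} p \<xi>" using fg_projective_dual_basis[OF assms(1)] .
  obtain m q \<zeta> where B: "dual_basis R W {..<m::nat} q \<zeta>" using fg_projective_dual_basis[OF assms(2)] .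
  show ?thesis
    using interchange_bij_aux[OF V W A B] interchange_linear[OF V W] by (simp add: linear_iso_def)
qed

section \<open>Strict polynomial functors\<close>

lemma fgprojD: "V \<in> fgproj R \<Longrightarrow> fg_projective R V" "V \<in> fgproj R \<Longrightarrow> module R V"
  by (auto simp: fgproj_def fg_projective_def)

lemma gam_hom_simps [simp]:
  "\<zero>\<^bsub>gam_hom R d V W\<^esub> = \<zero>\<^bsub>hom_module R (tpow R d V) (tpow R d W)\<^esub>"
  "f \<oplus>\<^bsub>gam_hom R d V W\<^esub> g = f \<oplus>\<^bsub>hom_module R (tpow R d V) (tpow R d W)\<^esub> g"
  "a \<odot>\<^bsub>gam_hom R d V W\<^esub> f = a \<odot>\<^bsub>hom_module R (tpow R d V) (tpow R d W)\<^esub> f"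
  by (simp_all add: gam_hom_def)

lemma gam_hom_carrier:
  "f \<in> carrier (gam_hom R d V W) \<longleftrightarrow> f \<in> extensional (carrier (tpow R d V)) \<and>
    linear_map R (tpow R d V) (tpow R d W) f \<and>
    (\<forall>\<sigma>. \<sigma> permutes {1..d} \<longrightarrow> (\<forall>t\<in>carrier (tpow R d V). f (tpow_perm R d V \<sigma> t) = tpow_perm R d W \<sigma> (f t)))"
  by (auto simp: gam_hom_def hom_module_carrier sym_group_carrier)

lemma gam_homD:
  assumes "f \<in> carrier (gam_hom R d V W)"
  shows "f \<in> extensional (carrier (tpow R d V))" "linear_map R (tpow R d V) (tpow R d W) f"
    "\<lbrakk>\<sigma> permutes {1..d}; t \<in> carrier (tpow R d V)\<rbrakk> \<Longrightarrow> f (tpow_perm R d V \<sigma> t) = tpow_perm R d W \<sigma> (f t)"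
    "t \<in> carrier (tpow R d V) \<Longrightarrow> f t \<in> carrier (tpow R d W)"
  using assms linear_mapD(1) by (auto simp: gam_hom_carrier)

lemma gam_homI:
  assumes "module R V"
    and "linear_map R (tpow R d V) (tpow R d W) f"
    and "\<And>\<sigma> t. \<lbrakk>\<sigma> permutes {1..d}; t \<in> carrier (tpow R d V)\<rbrakk> \<Longrightarrow>
      f (tpow_perm R d V \<sigma> t) = tpow_perm R d W \<sigma> (f t)"
  shows "restrict f (carrier (tpow R d V)) \<in> carrier (gam_hom R d V W)"
  using assms linear_map_cong[OF tpow_module[OF assms(1)] assms(2)] tpow_perm_closed[OF assms(1)]
  by (auto simp: gam_hom_carrier)

lemma gam_hom_eqI:
  assumes "f \<in> carrier (gam_hom R d V W)" "g \<in> carrier (gam_hom R d V W)"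
    and "\<And>t. t \<in> carrier (tpow R d V) \<Longrightarrow> f t = g t"
  shows "f = g"
  using gam_homD(1)[OF assms(1)] gam_homD(1)[OF assms(2)] assms(3) by (rule extensionalityI)

text \<open>Permutations act linearly, so equivariance is preserved by the pointwise operations and
  cuts out a submodule of the Hom module.\<close>

lemma gam_hom_module:
  assumes "module R V" "module R W"
  shows "module R (gam_hom R d V W)"
proof -
  note TV = tpow_module[OF assms(1), of d] and TW = tpow_module[OF assms(2), of d]
  let ?H = "hom_module R (tpow R d V) (tpow R d W)"
  interpret H: module R ?H by (rule hom_module_module[OF TV TW])
  interpret TW: module R "tpow R d W" by (rule TW)
  have sub: "submodule (carrier (gam_hom R d V W)) R ?H"
  proof (rule H.submoduleI)
    note perm = linear_mapD[OF tpow_perm_linear_pure(1)[OF assms(2)]]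
      linear_map_zero[OF TW TW tpow_perm_linear_pure(1)[OF assms(2)]]
    show sub: "carrier (gam_hom R d V W) \<subseteq> carrier ?H" by (auto simp: gam_hom_def)
    show "\<zero>\<^bsub>?H\<^esub> \<in> carrier (gam_hom R d V W)"
      using H.zero_closed perm tpow_perm_closed[OF assms(1)]
      by (auto simp: gam_hom_carrier hom_module_carrier)
    show add: "f \<oplus>\<^bsub>?H\<^esub> g \<in> carrier (gam_hom R d V W)"
      if "f \<in> carrier (gam_hom R d V W)" "g \<in> carrier (gam_hom R d V W)" for f g
      using H.a_closed[of f g] sub that perm tpow_perm_closed[OF assms(1)] gam_homD(4)[OF that(1)] gam_homD(4)[OF that(2)]
      by (auto simp: gam_hom_carrier hom_module_carrier)
    show smult: "a \<odot>\<^bsub>?H\<^esub> f \<in> carrier (gam_hom R d V W)"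
      if "a \<in> carrier R" "f \<in> carrier (gam_hom R d V W)" for a f
      using H.smult_closed[of a f] sub that perm tpow_perm_closed[OF assms(1)] gam_homD(4)[OF that(2)]
      by (auto simp: gam_hom_carrier hom_module_carrier)
    show "\<ominus>\<^bsub>?H\<^esub> f \<in> carrier (gam_hom R d V W)" if "f \<in> carrier (gam_hom R d V W)" for f
      using smult[OF _ that, of "\<ominus>\<^bsub>R\<^esub> \<one>\<^bsub>R\<^esub>"] sub that H.smult_minus_one[of f] by auto
  qed
  have "gam_hom R d V W = ?H\<lparr>carrier := carrier (gam_hom R d V W)\<rparr>"
    by (simp add: gam_hom_def)
  then show ?thesis
    using submodule.submodule_is_module[OF sub] H.module_axioms by metis
qed

lemma gam_comp_apply: "t \<in> carrier (tpow R d U) \<Longrightarrow> gam_comp R d U g f t = g (f t)"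
  by (simp add: gam_comp_def compose_eq)

lemma gam_id_apply: "t \<in> carrier (tpow R d V) \<Longrightarrow> gam_id R d V t = t"
  by (simp add: gam_id_def)

lemma gam_comp_closed:
  assumes "module R U" "f \<in> carrier (gam_hom R d U V)" "g \<in> carrier (gam_hom R d V W)"
  shows "gam_comp R d U g f \<in> carrier (gam_hom R d U W)"
  unfolding gam_comp_def compose_def
  using gam_homD[OF assms(2)] gam_homD[OF assms(3)]
  by (intro gam_homI assms(1) linear_map_comp[OF gam_homD(2)[OF assms(2)] gam_homD(2)[OF assms(3)]]) auto

lemma gam_id_closed: "module R V \<Longrightarrow> gam_id R d V \<in> carrier (gam_hom R d V V)"
  unfolding gam_id_def by (intro gam_homI linear_map_id) auto

lemma gam_comp_assoc:
  assumes "f \<in> carrier (gam_hom R d U V)"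
  shows "gam_comp R d U h (gam_comp R d U g f) = gam_comp R d U (gam_comp R d V h g) f"
  using gam_homD(4)[OF assms] by (auto simp: gam_comp_def compose_def fun_eq_iff)

lemma gam_comp_id:
  assumes "f \<in> carrier (gam_hom R d V W)"
  shows "gam_comp R d V (gam_id R d W) f = f" "gam_comp R d V f (gam_id R d V) = f"
  using gam_homD(1,4)[OF assms]
  by (auto simp: gam_comp_def compose_def gam_id_def fun_eq_iff extensional_def)

lemma gam_comp_linear:
  assumes "module R U" "module R V" "module R W"
  shows "bilinear_map R (gam_hom R d V W) (gam_hom R d U V) (gam_hom R d U W) (gam_comp R d U)"
proof -
  interpret TV: module R "tpow R d V" by (rule tpow_module[OF assms(2)])
  have 1: "gam_comp R d U g (f \<oplus>\<^bsub>gam_hom R d U V\<^esub> f') = gam_comp R d U g f \<oplus>\<^bsub>gam_hom R d U W\<^esub> gam_comp R d U g f'"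
    if "f \<in> carrier (gam_hom R d U V)" "f' \<in> carrier (gam_hom R d U V)" "g \<in> carrier (gam_hom R d V W)" for f f' g
    using gam_homD(4)[OF that(1)] gam_homD(4)[OF that(2)] linear_mapD(2)[OF gam_homD(2)[OF that(3)]]
    by (auto simp: fun_eq_iff gam_comp_def compose_def)
  have 2: "gam_comp R d U g (a \<odot>\<^bsub>gam_hom R d U V\<^esub> f) = a \<odot>\<^bsub>gam_hom R d U W\<^esub> gam_comp R d U g f"
    if "f \<in> carrier (gam_hom R d U V)" "a \<in> carrier R" "g \<in> carrier (gam_hom R d V W)" for f a g
    using gam_homD(4)[OF that(1)] that(2) linear_mapD(3)[OF gam_homD(2)[OF that(3)]]
    by (auto simp: fun_eq_iff gam_comp_def compose_def)
  have 3: "gam_comp R d U (g \<oplus>\<^bsub>gam_hom R d V W\<^esub> g') f = gam_comp R d U g f \<oplus>\<^bsub>gam_hom R d U W\<^esub> gam_comp R d U g' f"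
    "gam_comp R d U (a \<odot>\<^bsub>gam_hom R d V W\<^esub> g) f = a \<odot>\<^bsub>gam_hom R d U W\<^esub> gam_comp R d U g f"
    if "f \<in> carrier (gam_hom R d U V)" for f g g' a
    using gam_homD(4)[OF that] by (auto simp: fun_eq_iff gam_comp_def compose_def)
  show ?thesis
    by (intro bilinear_mapI linear_mapI 1 2 3 gam_comp_closed[OF assms(1)])
qed

text \<open>The same shape as \<open>gam_tensor\<close>, with an arbitrary bilinear \<open>b\<close>
  in place of a pair of morphisms; equivariance and the values on pairs are then shown once.\<close>

definition pair_ext ::
  "('a, 'r) ring_scheme \<Rightarrow> nat \<Rightarrow> ('a, 'v, 's) module_scheme \<Rightarrow> ('a, 'w, 't) module_scheme
    \<Rightarrow> ('a, 'u, 'z) module_scheme \<Rightarrow> (((nat \<Rightarrow> 'v) \<Rightarrow> 'a) set \<Rightarrow> ((nat \<Rightarrow> 'w) \<Rightarrow> 'a) set \<Rightarrow> ((nat \<Rightarrow> 'u) \<Rightarrow> 'a) set)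
    \<Rightarrow> ((nat \<Rightarrow> ('v \<times> 'w \<Rightarrow> 'a) set) \<Rightarrow> 'a) set \<Rightarrow> ((nat \<Rightarrow> 'u) \<Rightarrow> 'a) set"
  where "pair_ext R d V W U b = (\<lambda>u\<in>carrier (tpow R d (tensor_module R V W)).
    pres_lift R (tensor_module R (tpow R d V) (tpow R d W)) (tpow R d U) (\<lambda>(s, t). b s t)
      (inv_into (carrier (tensor_module R (tpow R d V) (tpow R d W))) (interchange R d V W) u))"

context
  fixes R :: "('a, 'r) ring_scheme" and d :: nat
    and V :: "('a, 'v, 's) module_scheme" and W :: "('a, 'w, 't) module_scheme"
  assumes pV: "fg_projective R V" and pW: "fg_projective R W"
begin

private lemma mod: "module R V" "module R W"
  using pV pW by (auto simp: fg_projective_def)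

private lemmas TV = tpow_module[OF mod(1), of d]
private lemmas TW = tpow_module[OF mod(2), of d]
private lemmas TT = tensor_module_module[OF TV TW]
private lemmas iso = interchange_iso[OF pV pW, of d]

lemma tpow_pair_closed:
  "\<lbrakk>s \<in> carrier (tpow R d V); t \<in> carrier (tpow R d W)\<rbrakk> \<Longrightarrow>
    tpow_pair R d V W s t \<in> carrier (tpow R d (tensor_module R V W))"
  using bilinear_map_closed[OF tpow_pair_bilinear[OF mod]] .

text \<open>\<open>interchange\<close> is surjective and pure tensors span its source, so the
  elements \<open>tpow_pair R d V W s t\<close> span the tensor power of V \<otimes> W.\<close>

lemma tpow_pair_linear_eqI:
  assumes "module R P"
    and "linear_map R (tpow R d (tensor_module R V W)) P f" "linear_map R (tpow R d (tensor_module R V W)) P g"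
    and "\<And>s t. \<lbrakk>s \<in> carrier (tpow R d V); t \<in> carrier (tpow R d W)\<rbrakk> \<Longrightarrow>
      f (tpow_pair R d V W s t) = g (tpow_pair R d V W s t)"
    and "u \<in> carrier (tpow R d (tensor_module R V W))"
  shows "f u = g u"
proof -
  obtain x where x: "x \<in> carrier (tensor_module R (tpow R d V) (tpow R d W))" "u = interchange R d V W x"
    using assms(5) linear_isoD(2)[OF iso] by (auto simp: bij_betw_def)
  show ?thesis
    unfolding x(2)
    by (rule tensor_linear_eqI[OF TV TW assms(1) linear_map_comp[OF linear_isoD(1)[OF iso] assms(2)]
          linear_map_comp[OF linear_isoD(1)[OF iso] assms(3)] _ x(1)])
      (use assms(4) in \<open>simp add: tpow_pair_def[OF mod]\<close>)
qed

lemma gam_hom_pair_eqI: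
  assumes "module R U"
    and f: "f \<in> carrier (gam_hom R d (tensor_module R V W) U)" and g: "g \<in> carrier (gam_hom R d (tensor_module R V W) U)"
    and "\<And>s t. \<lbrakk>s \<in> carrier (tpow R d V); t \<in> carrier (tpow R d W)\<rbrakk> \<Longrightarrow>
      f (tpow_pair R d V W s t) = g (tpow_pair R d V W s t)"
  shows "f = g"
  by (rule gam_hom_eqI[OF f g])
    (rule tpow_pair_linear_eqI[OF tpow_module[OF assms(1)] gam_homD(2)[OF f] gam_homD(2)[OF g] assms(4)])

lemma pair_ext:
  assumes U: "module R U" and b: "bilinear_map R (tpow R d V) (tpow R d W) (tpow R d U) b"
    and equivariant: "\<And>\<sigma> s t. \<lbrakk>\<sigma> permutes {1..d}; s \<in> carrier (tpow R d V); t \<in> carrier (tpow R d W)\<rbrakk> \<Longrightarrow>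
      b (tpow_perm R d V \<sigma> s) (tpow_perm R d W \<sigma> t) = tpow_perm R d U \<sigma> (b s t)"
  shows "pair_ext R d V W U b \<in> carrier (gam_hom R d (tensor_module R V W) U)"
    and "\<And>s t. \<lbrakk>s \<in> carrier (tpow R d V); t \<in> carrier (tpow R d W)\<rbrakk> \<Longrightarrow>
      pair_ext R d V W U b (tpow_pair R d V W s t) = b s t"
proof -
  note TU = tpow_module[OF U, of d]
  let ?TT = "tensor_module R (tpow R d V) (tpow R d W)"
  let ?l = "pres_lift R ?TT (tpow R d U) (\<lambda>(s, t). b s t)"
  let ?f = "\<lambda>u. ?l (inv_into (carrier ?TT) (interchange R d V W) u)"
  note l = tensor_lift[OF TV TW TU b]
  have lin: "linear_map R (tpow R d (tensor_module R V W)) (tpow R d U) ?f"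
    using linear_map_comp[OF linear_isoD(1)[OF linear_iso_inv_into[OF TT iso]] l(1)] .
  have f: "?f (tpow_pair R d V W s t) = b s t"
    if "s \<in> carrier (tpow R d V)" "t \<in> carrier (tpow R d W)" for s t
    using that l(2)[OF that] bij_betw_inv_into_left[OF linear_isoD(2)[OF iso] pure_tensor_closed[OF TV TW that]]
    by (simp add: tpow_pair_def[OF mod])
  show "pair_ext R d V W U b \<in> carrier (gam_hom R d (tensor_module R V W) U)"
    unfolding pair_ext_def
  proof (rule gam_homI[OF tensor_module_module[OF mod] lin])
    fix \<sigma> t assume \<sigma>: "\<sigma> permutes {1..d}" and t: "t \<in> carrier (tpow R d (tensor_module R V W))"
    show "?f (tpow_perm R d (tensor_module R V W) \<sigma> t) = tpow_perm R d U \<sigma> (?f t)"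
    proof (rule tpow_pair_linear_eqI[where f = "\<lambda>t. ?f (tpow_perm R d (tensor_module R V W) \<sigma> t)",
          OF TU linear_map_comp[OF tpow_perm_linear_pure(1)[OF tensor_module_module[OF mod] \<sigma>] lin]
            linear_map_comp[OF lin tpow_perm_linear_pure(1)[OF U \<sigma>]] _ t])
      fix s t assume st: "s \<in> carrier (tpow R d V)" "t \<in> carrier (tpow R d W)"
      show "?f (tpow_perm R d (tensor_module R V W) \<sigma> (tpow_pair R d V W s t)) =
          tpow_perm R d U \<sigma> (?f (tpow_pair R d V W s t))"
        using st by (simp add: f equivariant[OF \<sigma>] tpow_perm_closed[OF _ \<sigma>] mod flip: tpow_pair_perm[OF mod \<sigma>])
    qed
  qed
  show "pair_ext R d V W U b (tpow_pair R d V W s t) = b s t"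
    if "s \<in> carrier (tpow R d V)" "t \<in> carrier (tpow R d W)" for s t
    using f[OF that] tpow_pair_closed[OF that] by (simp add: pair_ext_def)
qed

end

context
  fixes R :: "('a, 'r) ring_scheme" and d :: nat
    and V :: "('a, 'v, 's) module_scheme" and W :: "('a, 'w, 't) module_scheme"
    and V' :: "('a, 'v2, 's2) module_scheme" and W' :: "('a, 'w2, 't2) module_scheme" and f g
  assumes p: "fg_projective R V" "fg_projective R W" "fg_projective R V'" "fg_projective R W'"
    and f: "f \<in> carrier (gam_hom R d V V')" and g: "g \<in> carrier (gam_hom R d W W')"
begin

private lemma mods: "module R V" "module R W" "module R V'" "module R W'"
  using p by (auto simp: fg_projective_def)

text \<open>\<open>tensor_map\<close> followed by the interchange agrees on pure tensors with the
  lift of the bilinear map. Afterwards a tensor product of morphisms is known through its values on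
  pairs alone.\<close>

private lemma gam_tensor_eq_pair_ext:
  "gam_tensor R d V W V' W' f g =
    pair_ext R d V W (tensor_module R V' W') (\<lambda>s t. tpow_pair R d V' W' (f s) (g t))"
proof -
  note TV = tpow_module[OF mods(1), of d] and TW = tpow_module[OF mods(2), of d]
  note TV' = tpow_module[OF mods(3), of d] and TW' = tpow_module[OF mods(4), of d]
  let ?TT = "tensor_module R (tpow R d V) (tpow R d W)"
  have b: "bilinear_map R (tpow R d V) (tpow R d W) (tpow R d (tensor_module R V' W'))
      (\<lambda>s t. tpow_pair R d V' W' (f s) (g t))"
    by (rule bilinear_map_comp[OF tpow_pair_bilinear[OF mods(3,4)] gam_homD(2)[OF f] gam_homD(2)[OF g] linear_map_id])
  note T' = tpow_module[OF tensor_module_module[OF mods(3,4)], of d]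
  note l = tensor_lift[OF TV TW T' b]
  note m = tensor_map_pure[OF TV TW TV' TW' gam_homD(2)[OF f] gam_homD(2)[OF g]]
  have "interchange R d V' W' (tensor_map R (tpow R d V) (tpow R d W) (tpow R d V') (tpow R d W') f g x) =
      pres_lift R ?TT (tpow R d (tensor_module R V' W')) (\<lambda>(s, t). tpow_pair R d V' W' (f s) (g t)) x"
    if "x \<in> carrier ?TT" for x
    by (rule tensor_linear_eqI[OF TV TW T' linear_map_comp[OF m(1) interchange_linear[OF mods(3,4)]] l(1) _ that])
      (simp add: m(2) l(2) flip: tpow_pair_def[OF mods(3,4)])
  moreover have "inv_into (carrier ?TT) (interchange R d V W) u \<in> carrier ?TT"
    if "u \<in> carrier (tpow R d (tensor_module R V W))" for u
    using that linear_mapD(1)[OF linear_isoD(1)[OF linear_iso_inv_into[OF tensor_module_module[OF TV TW]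
            interchange_iso[OF p(1,2)]]]] by blast
  ultimately show ?thesis by (auto simp: gam_tensor_def pair_ext_def fun_eq_iff)
qed

lemma gam_tensor_closed:
  "gam_tensor R d V W V' W' f g \<in> carrier (gam_hom R d (tensor_module R V W) (tensor_module R V' W'))"
  and gam_tensor_pair:
  "\<And>s t. \<lbrakk>s \<in> carrier (tpow R d V); t \<in> carrier (tpow R d W)\<rbrakk> \<Longrightarrow>
    gam_tensor R d V W V' W' f g (tpow_pair R d V W s t) = tpow_pair R d V' W' (f s) (g t)"
proof -
  have b: "bilinear_map R (tpow R d V) (tpow R d W) (tpow R d (tensor_module R V' W'))
      (\<lambda>s t. tpow_pair R d V' W' (f s) (g t))"
    by (rule bilinear_map_comp[OF tpow_pair_bilinear[OF mods(3,4)] gam_homD(2)[OF f] gam_homD(2)[OF g] linear_map_id])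
  have eq: "tpow_pair R d V' W' (f (tpow_perm R d V \<sigma> s)) (g (tpow_perm R d W \<sigma> t)) =
      tpow_perm R d (tensor_module R V' W') \<sigma> (tpow_pair R d V' W' (f s) (g t))"
    if "\<sigma> permutes {1..d}" "s \<in> carrier (tpow R d V)" "t \<in> carrier (tpow R d W)" for \<sigma> s t
    using that gam_homD[OF f] gam_homD[OF g] by (simp add: tpow_pair_perm[OF mods(3,4)])
  note * = pair_ext[OF p(1,2) tensor_module_module[OF mods(3,4)] b eq]
  show "gam_tensor R d V W V' W' f g \<in> carrier (gam_hom R d (tensor_module R V W) (tensor_module R V' W'))"
    unfolding gam_tensor_eq_pair_ext using *(1) .
  show "gam_tensor R d V W V' W' f g (tpow_pair R d V W s t) = tpow_pair R d V' W' (f s) (g t)"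
    if "s \<in> carrier (tpow R d V)" "t \<in> carrier (tpow R d W)" for s t
    unfolding gam_tensor_eq_pair_ext using *(2)[OF _ _ _ that] .
qed

end

subsection \<open>Natural transformations\<close>

lemma spf_ar:
  assumes "strict_polynomial_functor R d F" "V \<in> fgproj R" "W \<in> fgproj R"
  shows "f \<in> carrier (gam_hom R d V W) \<Longrightarrow> linear_map R (ob F V) (ob F W) (ar F V W f)"
    and "f \<in> carrier (gam_hom R d V W) \<Longrightarrow> x \<in> carrier (ob F V) \<Longrightarrow> ar F V W f x \<in> carrier (ob F W)"
    and "x \<in> carrier (ob F V) \<Longrightarrow> linear_map R (gam_hom R d V W) (ob F W) (\<lambda>f. ar F V W f x)"
proof -
  note l = linear_mapD[OF strict_polynomial_functor.ar_linear[OF assms]]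
  show *: "linear_map R (ob F V) (ob F W) (ar F V W f)" if "f \<in> carrier (gam_hom R d V W)" for f
    using l(1)[OF that] by (simp add: hom_module_carrier)
  show cl: "f \<in> carrier (gam_hom R d V W) \<Longrightarrow> x \<in> carrier (ob F V) \<Longrightarrow> ar F V W f x \<in> carrier (ob F W)" for f x
    using linear_mapD(1)[OF *] .
  show "linear_map R (gam_hom R d V W) (ob F W) (\<lambda>f. ar F V W f x)" if "x \<in> carrier (ob F V)"
    using that l(2,3) cl by (intro linear_mapI) (auto simp del: gam_hom_simps)
qed

lemma nat_module_carrier:
  "\<eta> \<in> carrier (nat_module R d F G) \<longleftrightarrow> \<eta> \<in> extensional (fgproj R) \<and>
    (\<forall>V\<in>fgproj R. \<eta> V \<in> extensional (carrier (ob F V)) \<and> linear_map R (ob F V) (ob G V) (\<eta> V)) \<and>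
    (\<forall>V\<in>fgproj R. \<forall>W\<in>fgproj R. \<forall>f\<in>carrier (gam_hom R d V W). \<forall>x\<in>carrier (ob F V).
       \<eta> W (ar F V W f x) = ar G V W f (\<eta> V x))"
  by (auto simp: nat_module_def PiE_iff hom_module_carrier)

lemma nat_moduleI:
  assumes "\<And>V. V \<in> fgproj R \<Longrightarrow> module R (ob F V)"
    and "\<And>V. V \<in> fgproj R \<Longrightarrow> linear_map R (ob F V) (ob G V) (\<eta> V)"
    and "\<And>V W f x. \<lbrakk>V \<in> fgproj R; W \<in> fgproj R; f \<in> carrier (gam_hom R d V W); x \<in> carrier (ob F V)\<rbrakk> \<Longrightarrow>
      ar F V W f x \<in> carrier (ob F W) \<and> \<eta> W (ar F V W f x) = ar G V W f (\<eta> V x)"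
  shows "(\<lambda>V\<in>fgproj R. restrict (\<eta> V) (carrier (ob F V))) \<in> carrier (nat_module R d F G)"
  using assms by (auto simp: nat_module_carrier intro!: linear_map_cong[OF assms(1,2)])

lemma nat_moduleD:
  assumes "\<eta> \<in> carrier (nat_module R d F G)"
  shows "\<eta> \<in> extensional (fgproj R)"
    and "V \<in> fgproj R \<Longrightarrow> \<eta> V \<in> extensional (carrier (ob F V))"
    and "V \<in> fgproj R \<Longrightarrow> linear_map R (ob F V) (ob G V) (\<eta> V)"
    and "\<lbrakk>V \<in> fgproj R; W \<in> fgproj R; f \<in> carrier (gam_hom R d V W); x \<in> carrier (ob F V)\<rbrakk> \<Longrightarrow>
       \<eta> W (ar F V W f x) = ar G V W f (\<eta> V x)"
    and "V \<in> fgproj R \<Longrightarrow> x \<in> carrier (ob F V) \<Longrightarrow> \<eta> V x \<in> carrier (ob G V)"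
  using assms by (auto simp: nat_module_carrier linear_mapD(1))

lemma nat_trans_eqI:
  assumes "\<eta> \<in> carrier (nat_module R d F G)" "\<theta> \<in> carrier (nat_module R d F G)"
    and "\<And>V x. \<lbrakk>V \<in> fgproj R; x \<in> carrier (ob F V)\<rbrakk> \<Longrightarrow> \<eta> V x = \<theta> V x"
  shows "\<eta> = \<theta>"
proof (rule extensionalityI[OF nat_moduleD(1)[OF assms(1)] nat_moduleD(1)[OF assms(2)]])
  show "\<eta> V = \<theta> V" if "V \<in> fgproj R" for V
    using extensionalityI[OF nat_moduleD(2)[OF assms(1) that] nat_moduleD(2)[OF assms(2) that] assms(3)[OF that]] .
qed

lemma nat_module_apply:
  "\<lbrakk>V \<in> fgproj R; x \<in> carrier (ob F V)\<rbrakk> \<Longrightarrow> \<zero>\<^bsub>nat_module R d F G\<^esub> V x = \<zero>\<^bsub>ob G V\<^esub>"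
  "\<lbrakk>V \<in> fgproj R; x \<in> carrier (ob F V)\<rbrakk> \<Longrightarrow> (\<eta> \<oplus>\<^bsub>nat_module R d F G\<^esub> \<theta>) V x = \<eta> V x \<oplus>\<^bsub>ob G V\<^esub> \<theta> V x"
  "\<lbrakk>V \<in> fgproj R; x \<in> carrier (ob F V)\<rbrakk> \<Longrightarrow> (a \<odot>\<^bsub>nat_module R d F G\<^esub> \<eta>) V x = a \<odot>\<^bsub>ob G V\<^esub> \<eta> V x"
  by (simp_all add: nat_module_def)

text \<open>Enough of functoriality for the natural transformations out of \<open>F\<close> to form a module.\<close>

definition prefunctor :: "('a, 'r) ring_scheme \<Rightarrow> nat \<Rightarrow> ('a, 'm) spf \<Rightarrow> bool"
  where "prefunctor R d F \<longleftrightarrow> (\<forall>V\<in>fgproj R. module R (ob F V)) \<and>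
    (\<forall>V\<in>fgproj R. \<forall>W\<in>fgproj R. \<forall>f\<in>carrier (gam_hom R d V W). \<forall>x\<in>carrier (ob F V).
      ar F V W f x \<in> carrier (ob F W))"

lemma prefunctorD:
  assumes "prefunctor R d F"
  shows "V \<in> fgproj R \<Longrightarrow> module R (ob F V)"
    and "\<lbrakk>V \<in> fgproj R; W \<in> fgproj R; f \<in> carrier (gam_hom R d V W); x \<in> carrier (ob F V)\<rbrakk> \<Longrightarrow>
      ar F V W f x \<in> carrier (ob F W)"
  using assms by (auto simp: prefunctor_def)

lemma spf_prefunctor: "strict_polynomial_functor R d F \<Longrightarrow> prefunctor R d F"
  by (auto simp: prefunctor_def strict_polynomial_functor.ob_module spf_ar(2))

lemma nat_comp_apply:
  "\<lbrakk>V \<in> fgproj R; x \<in> carrier (ob F V)\<rbrakk> \<Longrightarrow> nat_comp R F \<beta> \<alpha> V x = \<beta> V (\<alpha> V x)"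
  by (simp add: nat_comp_def compose_eq)

lemma nat_comp_closed:
  assumes "prefunctor R d F" "\<alpha> \<in> carrier (nat_module R d F G)" "\<beta> \<in> carrier (nat_module R d G H)"
  shows "nat_comp R F \<beta> \<alpha> \<in> carrier (nat_module R d F H)"
  unfolding nat_comp_def compose_def
  using prefunctorD[OF assms(1)] nat_moduleD[OF assms(2)] nat_moduleD[OF assms(3)]
  by (intro nat_moduleI linear_map_comp[OF nat_moduleD(3)[OF assms(2)] nat_moduleD(3)[OF assms(3)]]) auto

lemma nat_id_apply: "\<lbrakk>V \<in> fgproj R; x \<in> carrier (ob F V)\<rbrakk> \<Longrightarrow> nat_id R F V x = x"
  by (simp add: nat_id_def)

lemma nat_id_closed: "prefunctor R d F \<Longrightarrow> nat_id R F \<in> carrier (nat_module R d F F)"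
  unfolding nat_id_def using prefunctorD by (intro nat_moduleI linear_map_id) auto

lemma nat_comp_id_left:
  assumes "prefunctor R d F" "prefunctor R d G" "\<alpha> \<in> carrier (nat_module R d F G)"
  shows "nat_comp R F (nat_id R G) \<alpha> = \<alpha>"
  using nat_moduleD(5)[OF assms(3)]
  by (intro nat_trans_eqI[OF nat_comp_closed[OF assms(1,3) nat_id_closed[OF assms(2)]] assms(3)])
    (simp add: nat_comp_apply nat_id_apply)

lemma nat_module_module:
  assumes R: "cring R" and F: "prefunctor R d F" and G: "strict_polynomial_functor R d G"
  shows "module R (nat_module R d F G)"
proof -
  interpret R: cring R by (fact R)
  have mG: "module R (ob G V)" if "V \<in> fgproj R" for V
    using strict_polynomial_functor.ob_module[OF G that] .
  note mF = prefunctorD[OF F] and arG = linear_mapD[OF spf_ar(1)[OF G]]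
  let ?N = "nat_module R d F G"
  have cl_add: "\<eta> \<oplus>\<^bsub>?N\<^esub> \<theta> \<in> carrier ?N" if "\<eta> \<in> carrier ?N" "\<theta> \<in> carrier ?N" for \<eta> \<theta>
  proof -
    have "\<eta> \<oplus>\<^bsub>?N\<^esub> \<theta> = (\<lambda>V\<in>fgproj R. \<lambda>x\<in>carrier (ob F V). \<eta> V x \<oplus>\<^bsub>ob G V\<^esub> \<theta> V x)"
      by (simp add: nat_module_def)
    also have "\<dots> \<in> carrier ?N"
      using nat_moduleD[OF that(1)] nat_moduleD[OF that(2)] mF arG
      by (intro nat_moduleI linear_map_add mG) auto
    finally show ?thesis .
  qed
  have cl_smult: "a \<odot>\<^bsub>?N\<^esub> \<eta> \<in> carrier ?N" if "a \<in> carrier R" "\<eta> \<in> carrier ?N" for a \<eta>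
  proof -
    have "a \<odot>\<^bsub>?N\<^esub> \<eta> = (\<lambda>V\<in>fgproj R. \<lambda>x\<in>carrier (ob F V). a \<odot>\<^bsub>ob G V\<^esub> \<eta> V x)"
      by (simp add: nat_module_def)
    also have "\<dots> \<in> carrier ?N"
      using nat_moduleD[OF that(2)] mF arG that(1)
      by (intro nat_moduleI linear_map_smult mG) auto
    finally show ?thesis .
  qed
  have cl_zero: "\<zero>\<^bsub>?N\<^esub> \<in> carrier ?N"
  proof -
    have "\<zero>\<^bsub>?N\<^esub> = (\<lambda>V\<in>fgproj R. \<lambda>x\<in>carrier (ob F V). \<zero>\<^bsub>ob G V\<^esub>)"
      by (simp add: nat_module_def)
    also have "\<dots> \<in> carrier ?N"
      using mF linear_map_zero[OF mG mG spf_ar(1)[OF G]]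
      by (intro nat_moduleI linear_map_const_zero mG) auto
    finally show ?thesis .
  qed
  note cl = cl_add cl_smult cl_zero
  note app = nat_module_apply nat_moduleD(5)
  note G = mG[THEN module.axioms(2)]
  show ?thesis
  proof (intro moduleI abelian_groupI R cl)
    fix \<eta> assume \<eta>: "\<eta> \<in> carrier ?N"
    show "\<exists>\<theta>\<in>carrier ?N. \<theta> \<oplus>\<^bsub>?N\<^esub> \<eta> = \<zero>\<^bsub>?N\<^esub>"
    proof (rule bexI[of _ "(\<ominus>\<^bsub>R\<^esub> \<one>\<^bsub>R\<^esub>) \<odot>\<^bsub>?N\<^esub> \<eta>"])
      show "(\<ominus>\<^bsub>R\<^esub> \<one>\<^bsub>R\<^esub>) \<odot>\<^bsub>?N\<^esub> \<eta> \<in> carrier ?N" using \<eta> by (intro cl) auto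
      then show "(\<ominus>\<^bsub>R\<^esub> \<one>\<^bsub>R\<^esub>) \<odot>\<^bsub>?N\<^esub> \<eta> \<oplus>\<^bsub>?N\<^esub> \<eta> = \<zero>\<^bsub>?N\<^esub>"
        using \<eta> by (intro nat_trans_eqI[OF cl(1) cl(3)])
          (auto simp: app module.smult_minus_one[OF mG] abelian_group.l_neg[OF G])
    qed
    show "\<one>\<^bsub>R\<^esub> \<odot>\<^bsub>?N\<^esub> \<eta> = \<eta>"
      using \<eta> by (intro nat_trans_eqI[OF cl(2)]) (auto simp: app module.smult_one[OF mG])
    show "\<zero>\<^bsub>?N\<^esub> \<oplus>\<^bsub>?N\<^esub> \<eta> = \<eta>"
      using \<eta> by (intro nat_trans_eqI[OF cl(1)] cl) (auto simp: app abelian_monoid.l_zero[OF abelian_group.axioms(1)[OF G]])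
    fix \<theta> assume \<theta>: "\<theta> \<in> carrier ?N"
    show "\<eta> \<oplus>\<^bsub>?N\<^esub> \<theta> = \<theta> \<oplus>\<^bsub>?N\<^esub> \<eta>"
      using \<eta> \<theta> by (intro nat_trans_eqI[OF cl(1) cl(1)]) (auto simp: app abelian_monoid.a_comm[OF abelian_group.axioms(1)[OF G]])
    show "\<eta> \<oplus>\<^bsub>?N\<^esub> \<theta> \<oplus>\<^bsub>?N\<^esub> \<zeta> = \<eta> \<oplus>\<^bsub>?N\<^esub> (\<theta> \<oplus>\<^bsub>?N\<^esub> \<zeta>)" if "\<zeta> \<in> carrier ?N" for \<zeta>
      using \<eta> \<theta> that by (intro nat_trans_eqI[OF cl(1) cl(1)] cl)
        (auto simp: app abelian_monoid.a_assoc[OF abelian_group.axioms(1)[OF G]])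
    fix a assume a: "a \<in> carrier R"
    show "a \<odot>\<^bsub>?N\<^esub> (\<eta> \<oplus>\<^bsub>?N\<^esub> \<theta>) = a \<odot>\<^bsub>?N\<^esub> \<eta> \<oplus>\<^bsub>?N\<^esub> a \<odot>\<^bsub>?N\<^esub> \<theta>"
      using \<eta> \<theta> a by (intro nat_trans_eqI[OF cl(2) cl(1)] cl) (auto simp: app module.smult_r_distr[OF mG])
    fix b assume b: "b \<in> carrier R"
    show "(a \<oplus>\<^bsub>R\<^esub> b) \<odot>\<^bsub>?N\<^esub> \<eta> = a \<odot>\<^bsub>?N\<^esub> \<eta> \<oplus>\<^bsub>?N\<^esub> b \<odot>\<^bsub>?N\<^esub> \<eta>"
      using \<eta> a b by (intro nat_trans_eqI[OF cl(2) cl(1)] cl) (auto simp: app module.smult_l_distr[OF mG])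
    show "(a \<otimes>\<^bsub>R\<^esub> b) \<odot>\<^bsub>?N\<^esub> \<eta> = a \<odot>\<^bsub>?N\<^esub> (b \<odot>\<^bsub>?N\<^esub> \<eta>)"
      using \<eta> a b by (intro nat_trans_eqI[OF cl(2) cl(2)] cl) (auto simp: app module.smult_assoc1[OF mG])
  qed
qed

subsection \<open>The functors of the statement\<close>

lemma gam_repr_spf:
  assumes "V \<in> fgproj R"
  shows "strict_polynomial_functor R d (gam_repr R d V)"
proof (rule strict_polynomial_functor.intro)
  note mV = fgprojD(2)[OF assms]
  show "module R (ob (gam_repr R d V) W)" if "W \<in> fgproj R" for W
    using gam_hom_module[OF mV fgprojD(2)[OF that]] by (simp add: gam_repr_def)
  show "linear_map R (gam_hom R d U W) (hom_module R (ob (gam_repr R d V) U) (ob (gam_repr R d V) W))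
      (ar (gam_repr R d V) U W)" if UW: "U \<in> fgproj R" "W \<in> fgproj R" for U W
  proof -
    note mU = fgprojD(2)[OF UW(1)] and mW = fgprojD(2)[OF UW(2)]
    note b = gam_comp_linear[OF mV mU mW, of d]
    show ?thesis
    proof (rule linear_mapI)
      fix g assume g: "g \<in> carrier (gam_hom R d U W)"
      show "ar (gam_repr R d V) U W g \<in> carrier (hom_module R (ob (gam_repr R d V) U) (ob (gam_repr R d V) W))"
        using linear_map_cong[OF gam_hom_module[OF mV mU] bilinear_mapD(1)[OF b g]]
        by (auto simp: gam_repr_def hom_module_carrier)
    qed (use linear_mapD[OF bilinear_mapD(2)[OF b]] in \<open>auto simp: gam_repr_def fun_eq_iff simp del: gam_hom_simps\<close>)
  qed
  show "ar (gam_repr R d V) W W (gam_id R d W) f = f"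
    if "W \<in> fgproj R" "f \<in> carrier (ob (gam_repr R d V) W)" for W f
    using that gam_comp_id(1) by (simp add: gam_repr_def)
  show "ar (gam_repr R d V) U W' (gam_comp R d U g f) x = ar (gam_repr R d V) W W' g (ar (gam_repr R d V) U W f x)"
    if "U \<in> fgproj R" "W \<in> fgproj R" "W' \<in> fgproj R" "f \<in> carrier (gam_hom R d U W)"
      "g \<in> carrier (gam_hom R d W W')" "x \<in> carrier (ob (gam_repr R d V) U)" for U W W' f g x
    using that gam_comp_closed[OF mV, of x d U f W]
    by (simp add: gam_repr_def gam_comp_assoc[of x R d V U])
qed

lemma gam_repr_simps [simp]:
  "ob (gam_repr R d V) W = gam_hom R d V W"
  "f \<in> carrier (gam_hom R d V W) \<Longrightarrow> ar (gam_repr R d V) W W' g f = gam_comp R d V g f"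
  by (simp_all add: gam_repr_def)

lemma gam_repr_map_apply:
  "\<lbrakk>U \<in> fgproj R; g \<in> carrier (gam_hom R d W U)\<rbrakk> \<Longrightarrow> gam_repr_map R d V W f U g = gam_comp R d V g f"
  by (simp add: gam_repr_map_def)

lemma gam_repr_map_closed:
  assumes "V \<in> fgproj R" "W \<in> fgproj R" "f \<in> carrier (gam_hom R d V W)"
  shows "gam_repr_map R d V W f \<in> carrier (nat_module R d (gam_repr R d W) (gam_repr R d V))"
proof -
  note mV = fgprojD(2)[OF assms(1)] and mW = fgprojD(2)[OF assms(2)]
  have "(\<lambda>U\<in>fgproj R. restrict (\<lambda>g. gam_comp R d V g f) (carrier (ob (gam_repr R d W) U)))
    \<in> carrier (nat_module R d (gam_repr R d W) (gam_repr R d V))"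
  proof (rule nat_moduleI)
    show "module R (ob (gam_repr R d W) U)" if "U \<in> fgproj R" for U
      using gam_hom_module[OF mW fgprojD(2)[OF that]] by simp
    show "linear_map R (ob (gam_repr R d W) U) (ob (gam_repr R d V) U) (\<lambda>g. gam_comp R d V g f)"
      if "U \<in> fgproj R" for U
      using bilinear_mapD(2)[OF gam_comp_linear[OF mV mW fgprojD(2)[OF that]] assms(3)] by simp
    show "ar (gam_repr R d W) U U' g h \<in> carrier (ob (gam_repr R d W) U') \<and>
      gam_comp R d V (ar (gam_repr R d W) U U' g h) f = ar (gam_repr R d V) U U' g (gam_comp R d V h f)"
      if "U \<in> fgproj R" "U' \<in> fgproj R" "g \<in> carrier (gam_hom R d U U')" "h \<in> carrier (ob (gam_repr R d W) U)"
      for U U' g h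
      using that assms(3) gam_comp_closed[OF mW, of h d U g U'] gam_comp_closed[OF mV assms(3), of h U]
      by (simp add: gam_comp_assoc[OF assms(3)])
  qed
  then show ?thesis by (simp add: gam_repr_map_def)
qed

lemma gam_omega_simps [simp]: "ob (gam_omega R d) V = tpow R d V" "ar (gam_omega R d) V W f = f"
  by (simp_all add: gam_omega_def)

lemma gam_omega_prefunctor: "prefunctor R d (gam_omega R d)"
  by (auto simp: prefunctor_def gam_homD(4) intro: tpow_module fgprojD)

lemma gam_omega_perm_apply: "V \<in> fgproj R \<Longrightarrow> gam_omega_perm R d \<sigma> V = tpow_perm R d V \<sigma>"
  by (simp add: gam_omega_perm_def)

text \<open>Naturality in \<open>V\<close> is exactly the equivariance required of the morphisms in
  \<open>gam_hom\<close>.\<close>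

lemma gam_omega_perm_closed:
  assumes "\<sigma> permutes {1..d}"
  shows "gam_omega_perm R d \<sigma> \<in> carrier (nat_module R d (gam_omega R d) (gam_omega R d))"
proof -
  have "tpow_perm R d V \<sigma> \<in> extensional (carrier (tpow R d V))" for V :: "'a obj"
    by (simp add: tpow_perm_def pres_lift_def)
  then show ?thesis
    using assms by (auto simp: nat_module_carrier gam_omega_perm_def gam_homD(3)
        intro: tpow_perm_linear_pure fgprojD)
qed

definition sym_class :: "('a, 'r) ring_scheme \<Rightarrow> nat \<Rightarrow> ('a, 'v, 's) module_scheme
    \<Rightarrow> ((nat \<Rightarrow> 'v) \<Rightarrow> 'a) set \<Rightarrow> ((nat \<Rightarrow> 'v) \<Rightarrow> 'a) set set"
  where "sym_class R d V t = coinv_sub R d V +>\<^bsub>tpow R d V\<^esub> t"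

lemma sym_power_ob: "ob (sym_power R d) V = quot_module (tpow R d V) (coinv_sub R d V)"
  by (simp add: sym_power_def)

context
  fixes R :: "('a, 'r) ring_scheme" and d :: nat and V :: "'a obj"
  assumes V: "V \<in> fgproj R"
begin

private lemmas module_V = fgprojD(2)[OF V]

interpretation T: module R "tpow R d V" by (rule tpow_module[OF module_V])

private lemma coinv_gens: "{tpow_perm R d V \<sigma> t \<ominus>\<^bsub>tpow R d V\<^esub> t |\<sigma> t. \<sigma> \<in> carrier (sym_group d) \<and> t \<in> carrier (tpow R d V)}
    \<subseteq> carrier (tpow R d V)"
  by (auto simp: sym_group_carrier tpow_perm_closed[OF module_V] intro!: T.minus_closed)

private lemma coinv_submodule: "submodule (coinv_sub R d V) R (tpow R d V)"
  unfolding coinv_sub_def by (rule submodule_span_submodule[OF T.module_axioms coinv_gens])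

private lemmas coinv_facts = T.module_axioms coinv_submodule

lemma sym_power_module: "module R (ob (sym_power R d) V)"
  unfolding sym_power_ob by (rule quot_module_module[OF coinv_facts])

lemma sym_power_carrier: "carrier (ob (sym_power R d) V) = sym_class R d V ` carrier (tpow R d V)"
  unfolding sym_power_ob sym_class_def by (rule quot_module_carrier[OF coinv_facts])

lemma sym_class_linear: "linear_map R (tpow R d V) (ob (sym_power R d) V) (sym_class R d V)"
  unfolding sym_power_ob sym_class_def by (rule quot_proj_linear[OF coinv_facts])

lemma linear_map_from_sym_power:
  "linear_map R (tpow R d V) P (\<lambda>t. f (sym_class R d V t)) \<Longrightarrow> linear_map R (ob (sym_power R d) V) P f"
  unfolding sym_power_ob sym_class_def by (rule linear_map_from_quot[OF coinv_facts])

lemma sym_class_perm: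
  assumes "\<sigma> permutes {1..d}" "t \<in> carrier (tpow R d V)"
  shows "sym_class R d V (tpow_perm R d V \<sigma> t) = sym_class R d V t"
proof -
  have "tpow_perm R d V \<sigma> t \<ominus>\<^bsub>tpow R d V\<^esub> t \<in> coinv_sub R d V"
    unfolding coinv_sub_def
    by (rule subsetD[OF submodule_span_superset]) (use assms in \<open>auto simp: sym_group_carrier\<close>)
  then show ?thesis
    using assms by (simp add: sym_class_def quot_coset_eq_iff[OF coinv_facts] tpow_perm_closed[OF module_V])
qed

text \<open>An invariant linear map kills the generators of \<open>coinv_sub\<close>, hence is
  constant on every class. The conclusion has this form so that maps out of the coinvariants can be
  defined with \<open>the_elem\<close>.\<close>

lemma coinv_image_singleton:
  assumes P: "module R P" and f: "linear_map R (tpow R d V) P f"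
    and inv: "\<And>\<sigma> t. \<lbrakk>\<sigma> permutes {1..d}; t \<in> carrier (tpow R d V)\<rbrakk> \<Longrightarrow> f (tpow_perm R d V \<sigma> t) = f t"
    and t: "t \<in> carrier (tpow R d V)"
  shows "f ` sym_class R d V t = {f t}"
  unfolding sym_class_def
proof (rule quot_image_singleton[OF coinv_facts P f _ t])
  interpret P: module R P by (fact P)
  fix x assume "x \<in> coinv_sub R d V"
  then have x: "x \<in> submodule_span R (tpow R d V)
      {tpow_perm R d V \<sigma> t \<ominus>\<^bsub>tpow R d V\<^esub> t |\<sigma> t. \<sigma> \<in> carrier (sym_group d) \<and> t \<in> carrier (tpow R d V)}"
    by (simp only: coinv_sub_def)
  show "f x = \<zero>\<^bsub>P\<^esub>"
  proof (rule linear_map_zero_on_span[OF T.module_axioms P f coinv_gens _ x], clarify)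
    fix \<sigma> t assume "\<sigma> \<in> carrier (sym_group d)" and t: "t \<in> carrier (tpow R d V)"
    then have \<sigma>: "\<sigma> permutes {1..d}" by (simp add: sym_group_carrier)
    have "f (tpow_perm R d V \<sigma> t \<ominus>\<^bsub>tpow R d V\<^esub> t) = f t \<ominus>\<^bsub>P\<^esub> f t"
      using linear_map_minus[OF T.module_axioms P f tpow_perm_closed[OF module_V \<sigma> t] t] inv[OF \<sigma> t] by simp
    then show "f (tpow_perm R d V \<sigma> t \<ominus>\<^bsub>tpow R d V\<^esub> t) = \<zero>\<^bsub>P\<^esub>"
      using linear_mapD(1)[OF f t] by (simp add: P.a_minus_eq_zero_iff)
  qed
qed

end

lemma sym_power_ar:
  assumes V: "V \<in> fgproj R" and W: "W \<in> fgproj R" and f: "f \<in> carrier (gam_hom R d V W)" 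
    and t: "t \<in> carrier (tpow R d V)"
  shows "ar (sym_power R d) V W f (sym_class R d V t) = sym_class R d W (f t)"
proof -
  have "(\<lambda>x. sym_class R d W (f x)) ` sym_class R d V t = {sym_class R d W (f t)}"
    using gam_homD[OF f]
    by (intro coinv_image_singleton[OF V sym_power_module[OF W]
          linear_map_comp[OF gam_homD(2)[OF f] sym_class_linear[OF W]] _ t]) (simp add: sym_class_perm[OF W])
  then show ?thesis
    using sym_power_carrier[OF V, of d] t by (simp add: sym_power_def quot_map_def sym_class_def)
qed

lemma sym_power_spf: "strict_polynomial_functor R d (sym_power R d)"
proof (rule strict_polynomial_functor.intro)
  show "module R (ob (sym_power R d) V)" if "V \<in> fgproj R" for V
    using sym_power_module[OF that] .
  fix V W assume V: "V \<in> fgproj R" and W: "W \<in> fgproj R"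
  let ?S = "sym_power R d"
  note WS = linear_mapD[OF sym_class_linear[OF W, of d]]
  interpret TV: module R "tpow R d V" by (rule tpow_module[OF fgprojD(2)[OF V]])
  interpret SV: module R "ob ?S V" by (rule sym_power_module[OF V])
  note a = sym_power_ar[OF V W]
  show "linear_map R (gam_hom R d V W) (hom_module R (ob ?S V) (ob ?S W)) (ar ?S V W)"
  proof (rule linear_mapI)
    fix f assume f: "f \<in> carrier (gam_hom R d V W)"
    have "linear_map R (tpow R d V) (ob ?S W) (\<lambda>t. ar ?S V W f (sym_class R d V t))"
      by (rule linear_map_cong[OF TV.module_axioms linear_map_comp[OF gam_homD(2)[OF f] sym_class_linear[OF W]]])
        (simp add: a f)
    then have "linear_map R (ob ?S V) (ob ?S W) (ar ?S V W f)"
      by (rule linear_map_from_sym_power[OF V])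
    moreover have "ar ?S V W f \<in> extensional (carrier (ob ?S V))"
      by (simp add: sym_power_def quot_map_def)
    ultimately show "ar ?S V W f \<in> carrier (hom_module R (ob ?S V) (ob ?S W))"
      by (simp add: hom_module_carrier)
  next
    interpret G: module R "gam_hom R d V W" by (rule gam_hom_module[OF fgprojD(2)[OF V] fgprojD(2)[OF W]])
    have ext: "ar ?S V W f \<in> extensional (carrier (ob ?S V))" for f
      by (simp add: sym_power_def quot_map_def)
    fix f g assume f: "f \<in> carrier (gam_hom R d V W)" and g: "g \<in> carrier (gam_hom R d V W)"
    show "ar ?S V W (f \<oplus>\<^bsub>gam_hom R d V W\<^esub> g) = ar ?S V W f \<oplus>\<^bsub>hom_module R (ob ?S V) (ob ?S W)\<^esub> ar ?S V W g"
    proof (rule extensionalityI[OF ext])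
      fix K assume K: "K \<in> carrier (ob ?S V)"
      then obtain t where t: "t \<in> carrier (tpow R d V)" "K = sym_class R d V t"
        using sym_power_carrier[OF V, of d] by blast
      show "ar ?S V W (f \<oplus>\<^bsub>gam_hom R d V W\<^esub> g) K = (ar ?S V W f \<oplus>\<^bsub>hom_module R (ob ?S V) (ob ?S W)\<^esub> ar ?S V W g) K"
        using K a[OF G.a_closed[OF f g] t(1)] a[OF f t(1)] a[OF g t(1)] t gam_homD(4)[OF f t(1)] gam_homD(4)[OF g t(1)]
        by (simp add: WS)
    qed simp
  next
    interpret G: module R "gam_hom R d V W" by (rule gam_hom_module[OF fgprojD(2)[OF V] fgprojD(2)[OF W]])
    have ext: "ar ?S V W f \<in> extensional (carrier (ob ?S V))" for f
      by (simp add: sym_power_def quot_map_def)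
    fix c f assume c: "c \<in> carrier R" and f: "f \<in> carrier (gam_hom R d V W)"
    show "ar ?S V W (c \<odot>\<^bsub>gam_hom R d V W\<^esub> f) = c \<odot>\<^bsub>hom_module R (ob ?S V) (ob ?S W)\<^esub> ar ?S V W f"
    proof (rule extensionalityI[OF ext])
      fix K assume K: "K \<in> carrier (ob ?S V)"
      then obtain t where t: "t \<in> carrier (tpow R d V)" "K = sym_class R d V t"
        using sym_power_carrier[OF V, of d] by blast
      show "ar ?S V W (c \<odot>\<^bsub>gam_hom R d V W\<^esub> f) K = (c \<odot>\<^bsub>hom_module R (ob ?S V) (ob ?S W)\<^esub> ar ?S V W f) K"
        using K a[OF G.smult_closed[OF c f] t(1)] a[OF f t(1)] t gam_homD(4)[OF f t(1)] c
        by (simp add: WS)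
    qed simp
  qed
next
  show "ar (sym_power R d) V V (gam_id R d V) x = x"
    if "V \<in> fgproj R" "x \<in> carrier (ob (sym_power R d) V)" for V x
    using that by (auto simp: sym_power_carrier sym_power_ar gam_id_closed[OF fgprojD(2)] gam_id_apply)
  show "ar (sym_power R d) U W (gam_comp R d U g f) x = ar (sym_power R d) V W g (ar (sym_power R d) U V f x)"
    if "U \<in> fgproj R" "V \<in> fgproj R" "W \<in> fgproj R" "f \<in> carrier (gam_hom R d U V)"
      "g \<in> carrier (gam_hom R d V W)" "x \<in> carrier (ob (sym_power R d) U)" for U V W f g x
    using that by (auto simp: sym_power_carrier sym_power_ar gam_comp_closed[OF fgprojD(2)] gam_comp_apply gam_homD(4))
qed

section \<open>Day convolution\<close>

text \<open>The data of a linear map from the coend to \<open>N\<close>: the linearity clauses match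
  \<open>day_multilinear_rels\<close>, and the last clause, dinaturality, matches
  \<open>day_coend_rels\<close>.\<close>

definition day_cocone ::
  "('a, 'r) ring_scheme \<Rightarrow> nat \<Rightarrow> ('a, 'x) spf \<Rightarrow> ('a, 'y) spf \<Rightarrow> 'a obj \<Rightarrow> ('a, 'n, 't) module_scheme
    \<Rightarrow> ('a obj \<Rightarrow> 'a obj \<Rightarrow> 'a tmor \<Rightarrow> 'x \<Rightarrow> 'y \<Rightarrow> 'n) \<Rightarrow> bool"
  where "day_cocone R d X Y U N G \<longleftrightarrow>
    (\<forall>V\<in>fgproj R. \<forall>W\<in>fgproj R. \<forall>x\<in>carrier (ob X V). \<forall>y\<in>carrier (ob Y W).
      linear_map R (gam_hom R d (tensor_module R V W) U) N (\<lambda>f. G V W f x y)) \<and>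
    (\<forall>V\<in>fgproj R. \<forall>W\<in>fgproj R. \<forall>f\<in>carrier (gam_hom R d (tensor_module R V W) U).
      bilinear_map R (ob X V) (ob Y W) N (G V W f)) \<and>
    (\<forall>V\<in>fgproj R. \<forall>W\<in>fgproj R. \<forall>V'\<in>fgproj R. \<forall>W'\<in>fgproj R.
      \<forall>f\<in>carrier (gam_hom R d (tensor_module R V' W') U).
      \<forall>g\<in>carrier (gam_hom R d V V'). \<forall>h\<in>carrier (gam_hom R d W W').
      \<forall>x\<in>carrier (ob X V). \<forall>y\<in>carrier (ob Y W).
      G V W (gam_comp R d (tensor_module R V W) f (gam_tensor R d V W V' W' g h)) x y =
      G V' W' f (ar X V V' g x) (ar Y W W' h y))"

lemma day_coconeI:
  assumes "\<And>V W x y. \<lbrakk>V \<in> fgproj R; W \<in> fgproj R; x \<in> carrier (ob X V); y \<in> carrier (ob Y W)\<rbrakk> \<Longrightarrow>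
      linear_map R (gam_hom R d (tensor_module R V W) U) N (\<lambda>f. G V W f x y)"
    and "\<And>V W f. \<lbrakk>V \<in> fgproj R; W \<in> fgproj R; f \<in> carrier (gam_hom R d (tensor_module R V W) U)\<rbrakk> \<Longrightarrow>
      bilinear_map R (ob X V) (ob Y W) N (G V W f)"
    and "\<And>V W V' W' f g h x y. \<lbrakk>V \<in> fgproj R; W \<in> fgproj R; V' \<in> fgproj R; W' \<in> fgproj R;
      f \<in> carrier (gam_hom R d (tensor_module R V' W') U);
      g \<in> carrier (gam_hom R d V V'); h \<in> carrier (gam_hom R d W W');
      x \<in> carrier (ob X V); y \<in> carrier (ob Y W)\<rbrakk> \<Longrightarrow>
      G V W (gam_comp R d (tensor_module R V W) f (gam_tensor R d V W V' W' g h)) x y =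
      G V' W' f (ar X V V' g x) (ar Y W W' h y)"
  shows "day_cocone R d X Y U N G"
  unfolding day_cocone_def using assms by blast

lemma day_coconeD:
  assumes "day_cocone R d X Y U N G"
  shows "\<lbrakk>V \<in> fgproj R; W \<in> fgproj R; x \<in> carrier (ob X V); y \<in> carrier (ob Y W)\<rbrakk> \<Longrightarrow>
      linear_map R (gam_hom R d (tensor_module R V W) U) N (\<lambda>f. G V W f x y)"
    and "\<lbrakk>V \<in> fgproj R; W \<in> fgproj R; f \<in> carrier (gam_hom R d (tensor_module R V W) U)\<rbrakk> \<Longrightarrow>
      bilinear_map R (ob X V) (ob Y W) N (G V W f)"
    and "\<lbrakk>V \<in> fgproj R; W \<in> fgproj R; V' \<in> fgproj R; W' \<in> fgproj R;
      f \<in> carrier (gam_hom R d (tensor_module R V' W') U);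
      g \<in> carrier (gam_hom R d V V'); h \<in> carrier (gam_hom R d W W');
      x \<in> carrier (ob X V); y \<in> carrier (ob Y W)\<rbrakk> \<Longrightarrow>
      G V W (gam_comp R d (tensor_module R V W) f (gam_tensor R d V W V' W' g h)) x y =
      G V' W' f (ar X V V' g x) (ar Y W W' h y)"
  using assms unfolding day_cocone_def by blast+

context
  fixes R :: "('a, 'r) ring_scheme" and d :: nat and X :: "('a, 'x) spf" and Y :: "('a, 'y) spf"
    and U :: "'a obj"
  assumes R: "cring R"
    and X: "strict_polynomial_functor R d X" and Y: "strict_polynomial_functor R d Y"
    and U: "U \<in> fgproj R"
begin

private abbreviation "dS \<equiv> day_gens R d X Y U"
private abbreviation "dF \<equiv> free_module R dS"
private abbreviation "HU V W \<equiv> gam_hom R d (tensor_module R V W) U"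

interpretation F: module R dF by (rule free_module_module[OF R])

private lemma gens_iff: "(V, W, f, x, y) \<in> dS \<longleftrightarrow> V \<in> fgproj R \<and> W \<in> fgproj R \<and>
    f \<in> carrier (HU V W) \<and> x \<in> carrier (ob X V) \<and> y \<in> carrier (ob Y W)"
  by (simp add: day_gens_def)

private lemma HU_module: "\<lbrakk>V \<in> fgproj R; W \<in> fgproj R\<rbrakk> \<Longrightarrow> module R (HU V W)"
  by (intro gam_hom_module tensor_module_module fgprojD U)

private lemma module_X: "V \<in> fgproj R \<Longrightarrow> module R (ob X V)"
  and module_Y: "V \<in> fgproj R \<Longrightarrow> module R (ob Y V)"
  using strict_polynomial_functor.ob_module[OF X] strict_polynomial_functor.ob_module[OF Y] by auto

private lemma gens_closed:
  assumes "(V, W, f, x, y) \<in> dS"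
  shows "f' \<in> carrier (HU V W) \<Longrightarrow> (V, W, f', x, y) \<in> dS"
    "x' \<in> carrier (ob X V) \<Longrightarrow> (V, W, f, x', y) \<in> dS"
    "y' \<in> carrier (ob Y W) \<Longrightarrow> (V, W, f, x, y') \<in> dS"
    "f' \<in> carrier (HU V W) \<Longrightarrow> (V, W, f \<oplus>\<^bsub>HU V W\<^esub> f', x, y) \<in> dS"
    "x' \<in> carrier (ob X V) \<Longrightarrow> (V, W, f, x \<oplus>\<^bsub>ob X V\<^esub> x', y) \<in> dS"
    "y' \<in> carrier (ob Y W) \<Longrightarrow> (V, W, f, x, y \<oplus>\<^bsub>ob Y W\<^esub> y') \<in> dS"
    "a \<in> carrier R \<Longrightarrow> (V, W, a \<odot>\<^bsub>HU V W\<^esub> f, x, y) \<in> dS"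
    "a \<in> carrier R \<Longrightarrow> (V, W, f, a \<odot>\<^bsub>ob X V\<^esub> x, y) \<in> dS"
    "a \<in> carrier R \<Longrightarrow> (V, W, f, x, a \<odot>\<^bsub>ob Y W\<^esub> y) \<in> dS"
proof -
  have VW: "V \<in> fgproj R" "W \<in> fgproj R" using assms by (auto simp: gens_iff)
  interpret H: module R "HU V W" by (rule HU_module[OF VW])
  interpret X: module R "ob X V" by (rule module_X[OF VW(1)])
  interpret Y: module R "ob Y W" by (rule module_Y[OF VW(2)])
  show "f' \<in> carrier (HU V W) \<Longrightarrow> (V, W, f', x, y) \<in> dS"
    "x' \<in> carrier (ob X V) \<Longrightarrow> (V, W, f, x', y) \<in> dS"
    "y' \<in> carrier (ob Y W) \<Longrightarrow> (V, W, f, x, y') \<in> dS"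
    "f' \<in> carrier (HU V W) \<Longrightarrow> (V, W, f \<oplus>\<^bsub>HU V W\<^esub> f', x, y) \<in> dS"
    "x' \<in> carrier (ob X V) \<Longrightarrow> (V, W, f, x \<oplus>\<^bsub>ob X V\<^esub> x', y) \<in> dS"
    "y' \<in> carrier (ob Y W) \<Longrightarrow> (V, W, f, x, y \<oplus>\<^bsub>ob Y W\<^esub> y') \<in> dS"
    "a \<in> carrier R \<Longrightarrow> (V, W, a \<odot>\<^bsub>HU V W\<^esub> f, x, y) \<in> dS"
    "a \<in> carrier R \<Longrightarrow> (V, W, f, a \<odot>\<^bsub>ob X V\<^esub> x, y) \<in> dS"
    "a \<in> carrier R \<Longrightarrow> (V, W, f, x, a \<odot>\<^bsub>ob Y W\<^esub> y) \<in> dS"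
    using assms by (auto simp: gens_iff simp del: gam_hom_simps)
qed

private lemma gens_op:
  "\<lbrakk>(V, W, f, x, y) \<in> dS; (V, W, f', x, y) \<in> dS\<rbrakk> \<Longrightarrow> (V, W, f \<oplus>\<^bsub>HU V W\<^esub> f', x, y) \<in> dS"
  "\<lbrakk>(V, W, f, x, y) \<in> dS; (V, W, f, x', y) \<in> dS\<rbrakk> \<Longrightarrow> (V, W, f, x \<oplus>\<^bsub>ob X V\<^esub> x', y) \<in> dS"
  "\<lbrakk>(V, W, f, x, y) \<in> dS; (V, W, f, x, y') \<in> dS\<rbrakk> \<Longrightarrow> (V, W, f, x, y \<oplus>\<^bsub>ob Y W\<^esub> y') \<in> dS"
  "\<lbrakk>a \<in> carrier R; (V, W, f, x, y) \<in> dS\<rbrakk> \<Longrightarrow> (V, W, a \<odot>\<^bsub>HU V W\<^esub> f, x, y) \<in> dS"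
  "\<lbrakk>a \<in> carrier R; (V, W, f, x, y) \<in> dS\<rbrakk> \<Longrightarrow> (V, W, f, a \<odot>\<^bsub>ob X V\<^esub> x, y) \<in> dS"
  "\<lbrakk>a \<in> carrier R; (V, W, f, x, y) \<in> dS\<rbrakk> \<Longrightarrow> (V, W, f, x, a \<odot>\<^bsub>ob Y W\<^esub> y) \<in> dS"
  by (rule gens_closed, assumption, simp only: gens_iff)+

private lemma coend_gens:
  assumes "V \<in> fgproj R" "W \<in> fgproj R" "V' \<in> fgproj R" "W' \<in> fgproj R"
    "f \<in> carrier (HU V' W')" "g \<in> carrier (gam_hom R d V V')" "h \<in> carrier (gam_hom R d W W')"
    "x \<in> carrier (ob X V)" "y \<in> carrier (ob Y W)"
  shows "(V, W, gam_comp R d (tensor_module R V W) f (gam_tensor R d V W V' W' g h), x, y) \<in> dS"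
    "(V', W', f, ar X V V' g x, ar Y W W' h y) \<in> dS"
  using assms
  by (auto simp: gens_iff spf_ar(2)[OF X] spf_ar(2)[OF Y]
      intro!: gam_comp_closed gam_tensor_closed tensor_module_module fgprojD)

private lemma day_rels_closed: "day_rels R d X Y U \<subseteq> carrier dF"
proof -
  note b = basis_vec_closed[OF R]
  have "day_multilinear_rels R d X Y U \<subseteq> carrier dF"
    unfolding day_multilinear_rels_def Let_def
    by (intro Un_least; clarify; intro F.minus_closed F.a_closed F.smult_closed b)
      (assumption | rule gens_op)+
  moreover have "day_coend_rels R d X Y U \<subseteq> carrier dF"
    unfolding day_coend_rels_def Let_def
    by (clarify, intro F.minus_closed b) (auto intro: coend_gens)
  ultimately show ?thesis by (simp add: day_rels_def)
qed

private lemmas day_pres = R day_rels_closed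

lemma day_module_module: "module R (day_module R d X Y U)"
  unfolding day_module_def by (rule pres_module_module[OF day_pres])

lemma day_linear_eqI:
  assumes "module R N" "linear_map R (day_module R d X Y U) N f" "linear_map R (day_module R d X Y U) N g"
    and "\<And>V W h x y. \<lbrakk>V \<in> fgproj R; W \<in> fgproj R; h \<in> carrier (HU V W);
      x \<in> carrier (ob X V); y \<in> carrier (ob Y W)\<rbrakk> \<Longrightarrow>
      f (day_gen R d X Y U (V, W, h, x, y)) = g (day_gen R d X Y U (V, W, h, x, y))"
    and "K \<in> carrier (day_module R d X Y U)"
  shows "f K = g K"
  using assms(2-) unfolding day_module_def day_gen_def
  by (intro pres_module_linear_eqI[OF day_pres assms(1), of f g K]) (auto simp: gens_iff)

lemma day_gen_closed:
  "\<lbrakk>V \<in> fgproj R; W \<in> fgproj R; f \<in> carrier (HU V W); x \<in> carrier (ob X V); y \<in> carrier (ob Y W)\<rbrakk> \<Longrightarrow>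
    day_gen R d X Y U (V, W, f, x, y) \<in> carrier (day_module R d X Y U)"
  unfolding day_module_def day_gen_def by (rule pres_gen_closed[OF day_pres]) (simp add: gens_iff)

text \<open>Universal property of the coend: the clauses of \<open>day_cocone\<close> are what
  \<open>free_ext\<close> needs in order to kill the multilinear and the coend relations.\<close>

lemma day_lift:
  assumes N: "module R N" and G: "day_cocone R d X Y U N G"
  shows "linear_map R (day_module R d X Y U) N
      (pres_lift R (day_module R d X Y U) N (\<lambda>(V, W, f, x, y). G V W f x y))"
    and "\<And>V W f x y. \<lbrakk>V \<in> fgproj R; W \<in> fgproj R; f \<in> carrier (HU V W);
      x \<in> carrier (ob X V); y \<in> carrier (ob Y W)\<rbrakk> \<Longrightarrow>
      pres_lift R (day_module R d X Y U) N (\<lambda>(V, W, f, x, y). G V W f x y)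
        (day_gen R d X Y U (V, W, f, x, y)) = G V W f x y"
proof -
  let ?g = "\<lambda>(V, W, f, x, y). G V W f x y"
  note G1 = linear_mapD[OF day_coconeD(1)[OF G]]
    and G2 = linear_mapD[OF bilinear_mapD(2)[OF day_coconeD(2)[OF G]]]
    and G3 = linear_mapD[OF bilinear_mapD(1)[OF day_coconeD(2)[OF G]]]
  have cl: "?g s \<in> carrier N" if "s \<in> dS" for s
    using that G1(1) by (cases s) (auto simp: gens_iff)
  have "\<And>r. r \<in> day_multilinear_rels R d X Y U \<Longrightarrow> free_ext R N ?g r = \<zero>\<^bsub>N\<^esub>"
    unfolding day_multilinear_rels_def Let_def
    by (elim UnE CollectE exE conjE; hypsubst;
        intro free_ext_add_rel[OF R N cl] free_ext_smult_rel[OF R N cl];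
        (((assumption | rule gens_op)+; fail) | simp only: prod.case gens_iff G1(2,3) G2(2,3) G3(2,3)))
  moreover have "\<And>r. r \<in> day_coend_rels R d X Y U \<Longrightarrow> free_ext R N ?g r = \<zero>\<^bsub>N\<^esub>"
    unfolding day_coend_rels_def Let_def
    by (elim CollectE exE conjE; hypsubst; intro free_ext_eq_rel[OF R N cl])
      (auto intro: coend_gens simp: day_coconeD(3)[OF G])
  ultimately have rel: "free_ext R N ?g r = \<zero>\<^bsub>N\<^esub>" if "r \<in> day_rels R d X Y U" for r
    using that by (auto simp: day_rels_def)
  note * = pres_lift_linear_gen[OF day_pres N cl rel]
  show "linear_map R (day_module R d X Y U) N (pres_lift R (day_module R d X Y U) N ?g)"
    unfolding day_module_def using *(1) .
  show "pres_lift R (day_module R d X Y U) N ?g (day_gen R d X Y U (V, W, f, x, y)) = G V W f x y"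
    if "V \<in> fgproj R" "W \<in> fgproj R" "f \<in> carrier (HU V W)" "x \<in> carrier (ob X V)" "y \<in> carrier (ob Y W)"
    for V W f x y
    using *(2)[of "(V, W, f, x, y)"] that by (simp add: gens_iff day_module_def day_gen_def)
qed

text \<open>The universal cocone. Its last clause moves a pair of morphisms from the two functor
  values into the morphism out of the tensor product; the later rewriting of generators rests on
  it.\<close>

lemma day_gen_cocone:
  "day_cocone R d X Y U (day_module R d X Y U) (\<lambda>V W f x y. day_gen R d X Y U (V, W, f, x, y))"
proof (intro day_coconeI bilinear_mapI linear_mapI day_gen_closed)
  let ?m = "day_multilinear_rels R d X Y U"
  have sub: "?m \<subseteq> day_rels R d X Y U" "day_coend_rels R d X Y U \<subseteq> day_rels R d X Y U"
    by (auto simp: day_rels_def)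
  fix V W f x y
  assume *: "V \<in> fgproj R" "W \<in> fgproj R" "x \<in> carrier (ob X V)" "y \<in> carrier (ob Y W)" "f \<in> carrier (HU V W)"
  then have S: "(V, W, f, x, y) \<in> dS" by (simp add: gens_iff)
  show "day_gen R d X Y U (V, W, f \<oplus>\<^bsub>HU V W\<^esub> f', x, y) =
      day_gen R d X Y U (V, W, f, x, y) \<oplus>\<^bsub>day_module R d X Y U\<^esub> day_gen R d X Y U (V, W, f', x, y)"
    if f': "f' \<in> carrier (HU V W)" for f'
    unfolding day_module_def day_gen_def
    by (rule pres_gen_add[OF day_pres subsetD[OF sub(1)]])
      (unfold day_multilinear_rels_def Let_def, rule UnI1, rule UnI1, rule UnI1, rule UnI1, rule UnI1,
        use S gens_closed(1,4)[OF S f'] in \<open>blast+\<close>)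
  show "day_gen R d X Y U (V, W, f, x \<oplus>\<^bsub>ob X V\<^esub> x', y) =
      day_gen R d X Y U (V, W, f, x, y) \<oplus>\<^bsub>day_module R d X Y U\<^esub> day_gen R d X Y U (V, W, f, x', y)"
    if f': "x' \<in> carrier (ob X V)" for x'
    unfolding day_module_def day_gen_def
    by (rule pres_gen_add[OF day_pres subsetD[OF sub(1)]])
      (unfold day_multilinear_rels_def Let_def, rule UnI1, rule UnI1, rule UnI1, rule UnI1, rule UnI2,
        use S gens_closed(2,5)[OF S f'] in \<open>blast+\<close>)
  show "day_gen R d X Y U (V, W, f, x, y \<oplus>\<^bsub>ob Y W\<^esub> y') =
      day_gen R d X Y U (V, W, f, x, y) \<oplus>\<^bsub>day_module R d X Y U\<^esub> day_gen R d X Y U (V, W, f, x, y')"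
    if f': "y' \<in> carrier (ob Y W)" for y'
    unfolding day_module_def day_gen_def
    by (rule pres_gen_add[OF day_pres subsetD[OF sub(1)]])
      (unfold day_multilinear_rels_def Let_def, rule UnI1, rule UnI1, rule UnI1, rule UnI2,
        use S gens_closed(3,6)[OF S f'] in \<open>blast+\<close>)
  fix a assume a: "a \<in> carrier R"
  show "day_gen R d X Y U (V, W, a \<odot>\<^bsub>HU V W\<^esub> f, x, y) =
      a \<odot>\<^bsub>day_module R d X Y U\<^esub> day_gen R d X Y U (V, W, f, x, y)"
    unfolding day_module_def day_gen_def
    by (rule pres_gen_smult[OF day_pres subsetD[OF sub(1)]])
      (unfold day_multilinear_rels_def Let_def, rule UnI1, rule UnI1, rule UnI2,
        use S a gens_closed(7)[OF S a] in \<open>blast+\<close>)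
  show "day_gen R d X Y U (V, W, f, a \<odot>\<^bsub>ob X V\<^esub> x, y) =
      a \<odot>\<^bsub>day_module R d X Y U\<^esub> day_gen R d X Y U (V, W, f, x, y)"
    unfolding day_module_def day_gen_def
    by (rule pres_gen_smult[OF day_pres subsetD[OF sub(1)]])
      (unfold day_multilinear_rels_def Let_def, rule UnI1, rule UnI2,
        use S a gens_closed(8)[OF S a] in \<open>blast+\<close>)
  show "day_gen R d X Y U (V, W, f, x, a \<odot>\<^bsub>ob Y W\<^esub> y) =
      a \<odot>\<^bsub>day_module R d X Y U\<^esub> day_gen R d X Y U (V, W, f, x, y)"
    unfolding day_module_def day_gen_def
    by (rule pres_gen_smult[OF day_pres subsetD[OF sub(1)]])
      (unfold day_multilinear_rels_def Let_def, rule UnI2,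
        use S a gens_closed(9)[OF S a] in \<open>blast+\<close>)
next
  have sub: "day_coend_rels R d X Y U \<subseteq> day_rels R d X Y U" by (auto simp: day_rels_def)
  fix V W V' W' f g h x y
  assume *: "V \<in> fgproj R" "W \<in> fgproj R" "V' \<in> fgproj R" "W' \<in> fgproj R"
    "f \<in> carrier (HU V' W')" "g \<in> carrier (gam_hom R d V V')" "h \<in> carrier (gam_hom R d W W')"
    "x \<in> carrier (ob X V)" "y \<in> carrier (ob Y W)"
  show "day_gen R d X Y U (V, W, gam_comp R d (tensor_module R V W) f (gam_tensor R d V W V' W' g h), x, y) =
      day_gen R d X Y U (V', W', f, ar X V V' g x, ar Y W W' h y)"
    unfolding day_gen_def
    by (rule pres_gen_eq[OF day_pres subsetD[OF sub]])
      (unfold day_coend_rels_def Let_def, use * coend_gens[OF *] in \<open>blast+\<close>)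
qed

end

lemma day_tensor_ob [simp]: "ob (day_tensor R d X Y) U = day_module R d X Y U"
  by (simp add: day_tensor_def)

context
  fixes R :: "('a, 'r) ring_scheme" and d :: nat and X :: "('a, 'x) spf" and Y :: "('a, 'y) spf"
  assumes R: "cring R"
    and X: "strict_polynomial_functor R d X" and Y: "strict_polynomial_functor R d Y"
begin

lemma day_tensor_ar:
  assumes U: "U \<in> fgproj R" and U': "U' \<in> fgproj R" and g: "g \<in> carrier (gam_hom R d U U')"
  shows "linear_map R (day_module R d X Y U) (day_module R d X Y U') (ar (day_tensor R d X Y) U U' g)"
    and "\<And>V W f x y. \<lbrakk>V \<in> fgproj R; W \<in> fgproj R; f \<in> carrier (gam_hom R d (tensor_module R V W) U);
      x \<in> carrier (ob X V); y \<in> carrier (ob Y W)\<rbrakk> \<Longrightarrow>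
      ar (day_tensor R d X Y) U U' g (day_gen R d X Y U (V, W, f, x, y)) =
      day_gen R d X Y U' (V, W, gam_comp R d (tensor_module R V W) g f, x, y)"
proof -
  let ?G = "\<lambda>V W f x y. day_gen R d X Y U' (V, W, gam_comp R d (tensor_module R V W) g f, x, y)"
  note gen = day_coconeD[OF day_gen_cocone[OF R X Y U']]
  have TVW: "module R (tensor_module R V W)" if "V \<in> fgproj R" "W \<in> fgproj R" for V W :: "'a obj"
    using that by (intro tensor_module_module fgprojD)
  have gf: "gam_comp R d (tensor_module R V W) g f \<in> carrier (gam_hom R d (tensor_module R V W) U')"
    if "V \<in> fgproj R" "W \<in> fgproj R" "f \<in> carrier (gam_hom R d (tensor_module R V W) U)" for V W :: "'a obj" and f
    using gam_comp_closed[OF TVW[OF that(1,2)] that(3) g] .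
  have "day_cocone R d X Y U (day_module R d X Y U') ?G"
  proof (rule day_coconeI)
    show "linear_map R (gam_hom R d (tensor_module R V W) U) (day_module R d X Y U') (\<lambda>f. ?G V W f x y)"
      if "V \<in> fgproj R" "W \<in> fgproj R" "x \<in> carrier (ob X V)" "y \<in> carrier (ob Y W)" for V W x y
      using linear_map_comp[OF bilinear_mapD(1)[OF gam_comp_linear[OF TVW[OF that(1,2)] fgprojD(2)[OF U] fgprojD(2)[OF U']] g]
          gen(1)[OF that]] .
    show "bilinear_map R (ob X V) (ob Y W) (day_module R d X Y U') (?G V W f)"
      if "V \<in> fgproj R" "W \<in> fgproj R" "f \<in> carrier (gam_hom R d (tensor_module R V W) U)" for V W f
      using gen(2)[OF that(1,2) gf[OF that]] .
    fix V W V' W' f k h x y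
    assume *: "V \<in> fgproj R" "W \<in> fgproj R" "V' \<in> fgproj R" "W' \<in> fgproj R"
      "f \<in> carrier (gam_hom R d (tensor_module R V' W') U)" "k \<in> carrier (gam_hom R d V V')"
      "h \<in> carrier (gam_hom R d W W')" "x \<in> carrier (ob X V)" "y \<in> carrier (ob Y W)"
    have t: "gam_tensor R d V W V' W' k h \<in> carrier (gam_hom R d (tensor_module R V W) (tensor_module R V' W'))"
      by (rule gam_tensor_closed) (use * fgprojD in auto)
    show "?G V W (gam_comp R d (tensor_module R V W) f (gam_tensor R d V W V' W' k h)) x y =
        ?G V' W' f (ar X V V' k x) (ar Y W W' h y)"
      unfolding gam_comp_assoc[OF t]
      by (rule gen(3)[OF *(1-4) gf[OF *(3,4,5)] *(6-)])
  qed
  note l = day_lift[OF R X Y U day_module_module[OF R X Y U'] this]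
  show "linear_map R (day_module R d X Y U) (day_module R d X Y U') (ar (day_tensor R d X Y) U U' g)"
    using l(1) by (simp add: day_tensor_def)
  show "ar (day_tensor R d X Y) U U' g (day_gen R d X Y U (V, W, f, x, y)) = ?G V W f x y"
    if "V \<in> fgproj R" "W \<in> fgproj R" "f \<in> carrier (gam_hom R d (tensor_module R V W) U)"
      "x \<in> carrier (ob X V)" "y \<in> carrier (ob Y W)" for V W f x y
    using l(2)[OF that] by (simp add: day_tensor_def)
qed

lemma day_tensor_prefunctor: "prefunctor R d (day_tensor R d X Y)"
  using day_module_module[OF R X Y] linear_mapD(1)[OF day_tensor_ar(1)]
  by (auto simp: prefunctor_def)

text \<open>A family of cocones compatible with composition in the first component induces a natural
  transformation out of the Day convolution. The preimages under the comparison map are produced in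
  this way.\<close>

lemma day_trans:
  assumes Z: "\<And>U. U \<in> fgproj R \<Longrightarrow> module R (ob Z U)"
    "\<And>U U' g. \<lbrakk>U \<in> fgproj R; U' \<in> fgproj R; g \<in> carrier (gam_hom R d U U')\<rbrakk> \<Longrightarrow>
      linear_map R (ob Z U) (ob Z U') (ar Z U U' g)"
    and G: "\<And>U. U \<in> fgproj R \<Longrightarrow> day_cocone R d X Y U (ob Z U) (G U)"
    and nat: "\<And>U U' g V W f x y. \<lbrakk>U \<in> fgproj R; U' \<in> fgproj R; g \<in> carrier (gam_hom R d U U');
      V \<in> fgproj R; W \<in> fgproj R; f \<in> carrier (gam_hom R d (tensor_module R V W) U);
      x \<in> carrier (ob X V); y \<in> carrier (ob Y W)\<rbrakk> \<Longrightarrow>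
      G U' V W (gam_comp R d (tensor_module R V W) g f) x y = ar Z U U' g (G U V W f x y)"
  defines "\<phi> \<equiv> \<lambda>U\<in>fgproj R. pres_lift R (day_module R d X Y U) (ob Z U) (\<lambda>(V, W, f, x, y). G U V W f x y)"
  shows "\<phi> \<in> carrier (nat_module R d (day_tensor R d X Y) Z)"
    and "\<And>U V W f x y. \<lbrakk>U \<in> fgproj R; V \<in> fgproj R; W \<in> fgproj R;
      f \<in> carrier (gam_hom R d (tensor_module R V W) U); x \<in> carrier (ob X V); y \<in> carrier (ob Y W)\<rbrakk> \<Longrightarrow>
      \<phi> U (day_gen R d X Y U (V, W, f, x, y)) = G U V W f x y"
proof -
  have l: "linear_map R (day_module R d X Y U) (ob Z U) (\<phi> U)" if "U \<in> fgproj R" for U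
    using day_lift(1)[OF R X Y that Z(1)[OF that] G[OF that]] that by (simp add: \<phi>_def)
  show v: "\<phi> U (day_gen R d X Y U (V, W, f, x, y)) = G U V W f x y"
    if "U \<in> fgproj R" "V \<in> fgproj R" "W \<in> fgproj R"
      "f \<in> carrier (gam_hom R d (tensor_module R V W) U)" "x \<in> carrier (ob X V)" "y \<in> carrier (ob Y W)"
    for U V W f x y
    using day_lift(2)[OF R X Y that(1) Z(1)[OF that(1)] G[OF that(1)] that(2-)] that by (simp add: \<phi>_def)
  have e: "\<phi> U \<in> extensional (carrier (day_module R d X Y U))" if "U \<in> fgproj R" for U
    using that by (simp add: \<phi>_def pres_lift_def)
  have n: "\<phi> U' (ar (day_tensor R d X Y) U U' g K) = ar Z U U' g (\<phi> U K)"
    if U: "U \<in> fgproj R" "U' \<in> fgproj R" and g: "g \<in> carrier (gam_hom R d U U')" and K: "K \<in> carrier (day_module R d X Y U)"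
    for U U' g K
  proof (rule day_linear_eqI[where f = "\<lambda>K. \<phi> U' (ar (day_tensor R d X Y) U U' g K)",
        OF R X Y U(1) Z(1)[OF U(2)] linear_map_comp[OF day_tensor_ar(1)[OF U g] l[OF U(2)]]
        linear_map_comp[OF l[OF U(1)] Z(2)[OF U g]] _ K])
    fix V W f x y
    assume *: "V \<in> fgproj R" "W \<in> fgproj R" "f \<in> carrier (gam_hom R d (tensor_module R V W) U)"
      "x \<in> carrier (ob X V)" "y \<in> carrier (ob Y W)"
    have "gam_comp R d (tensor_module R V W) g f \<in> carrier (gam_hom R d (tensor_module R V W) U')"
      using * by (intro gam_comp_closed[OF _ _ g] tensor_module_module fgprojD)
    then show "\<phi> U' (ar (day_tensor R d X Y) U U' g (day_gen R d X Y U (V, W, f, x, y))) =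
        ar Z U U' g (\<phi> U (day_gen R d X Y U (V, W, f, x, y)))"
      using * U g by (simp add: day_tensor_ar(2) v nat)
  qed
  show "\<phi> \<in> carrier (nat_module R d (day_tensor R d X Y) Z)"
    using l e n by (auto simp: nat_module_carrier \<phi>_def)
qed

end

lemma day_tensor_map:
  fixes X :: "('a, 'x) spf" and Y :: "('a, 'y) spf" and X' :: "('a, 'x2) spf" and Y' :: "('a, 'y2) spf"
  assumes R: "cring R"
    and X: "strict_polynomial_functor R d X" and Y: "strict_polynomial_functor R d Y"
    and X': "strict_polynomial_functor R d X'" and Y': "strict_polynomial_functor R d Y'"
    and \<xi>: "\<xi> \<in> carrier (nat_module R d X X')" and \<upsilon>: "\<upsilon> \<in> carrier (nat_module R d Y Y')"
  shows "day_tensor_map R d X Y X' Y' \<xi> \<upsilon> \<in> carrier (nat_module R d (day_tensor R d X Y) (day_tensor R d X' Y'))"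
    and "\<And>U V W f x y. \<lbrakk>U \<in> fgproj R; V \<in> fgproj R; W \<in> fgproj R;
      f \<in> carrier (gam_hom R d (tensor_module R V W) U); x \<in> carrier (ob X V); y \<in> carrier (ob Y W)\<rbrakk> \<Longrightarrow>
      day_tensor_map R d X Y X' Y' \<xi> \<upsilon> U (day_gen R d X Y U (V, W, f, x, y)) =
      day_gen R d X' Y' U (V, W, f, \<xi> V x, \<upsilon> W y)"
proof -
  let ?G = "\<lambda>U V W f x y. day_gen R d X' Y' U (V, W, f, \<xi> V x, \<upsilon> W y)"
  note gen = day_coconeD[OF day_gen_cocone[OF R X' Y']]
  note \<xi>D = nat_moduleD[OF \<xi>] and \<upsilon>D = nat_moduleD[OF \<upsilon>]
  have G: "day_cocone R d X Y U (day_module R d X' Y' U) (?G U)" if U: "U \<in> fgproj R" for U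
  proof (rule day_coconeI)
    show "linear_map R (gam_hom R d (tensor_module R V W) U) (day_module R d X' Y' U) (\<lambda>f. ?G U V W f x y)"
      if "V \<in> fgproj R" "W \<in> fgproj R" "x \<in> carrier (ob X V)" "y \<in> carrier (ob Y W)" for V W x y
      using gen(1)[OF U that(1,2)] \<xi>D(5)[OF that(1,3)] \<upsilon>D(5)[OF that(2,4)] by blast
    show "bilinear_map R (ob X V) (ob Y W) (day_module R d X' Y' U) (?G U V W f)"
      if "V \<in> fgproj R" "W \<in> fgproj R" "f \<in> carrier (gam_hom R d (tensor_module R V W) U)" for V W f
      by (rule bilinear_map_comp[OF gen(2)[OF U that] \<xi>D(3)[OF that(1)] \<upsilon>D(3)[OF that(2)] linear_map_id])
    fix V W V' W' f k h x y
    assume *: "V \<in> fgproj R" "W \<in> fgproj R" "V' \<in> fgproj R" "W' \<in> fgproj R"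
      "f \<in> carrier (gam_hom R d (tensor_module R V' W') U)" "k \<in> carrier (gam_hom R d V V')"
      "h \<in> carrier (gam_hom R d W W')" "x \<in> carrier (ob X V)" "y \<in> carrier (ob Y W)"
    show "?G U V W (gam_comp R d (tensor_module R V W) f (gam_tensor R d V W V' W' k h)) x y =
        ?G U V' W' f (ar X V V' k x) (ar Y W W' h y)"
      using gen(3)[OF U *(1-7) \<xi>D(5)[OF *(1,8)] \<upsilon>D(5)[OF *(2,9)]] \<xi>D(4)[OF *(1,3,6,8)] \<upsilon>D(4)[OF *(2,4,7,9)]
      by simp
  qed
  have nat: "?G U' V W (gam_comp R d (tensor_module R V W) g f) x y = ar (day_tensor R d X' Y') U U' g (?G U V W f x y)"
    if "U \<in> fgproj R" "U' \<in> fgproj R" "g \<in> carrier (gam_hom R d U U')" "V \<in> fgproj R" "W \<in> fgproj R"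
      "f \<in> carrier (gam_hom R d (tensor_module R V W) U)" "x \<in> carrier (ob X V)" "y \<in> carrier (ob Y W)"
    for U U' g V W f x y
    using day_tensor_ar(2)[OF R X' Y' that(1-6) \<xi>D(5)[OF that(4,7)] \<upsilon>D(5)[OF that(5,8)]] by simp
  have mod: "module R (ob (day_tensor R d X' Y') U)" if "U \<in> fgproj R" for U
    using day_module_module[OF R X' Y' that] by simp
  have ar: "linear_map R (ob (day_tensor R d X' Y') U) (ob (day_tensor R d X' Y') U') (ar (day_tensor R d X' Y') U U' g)"
    if "U \<in> fgproj R" "U' \<in> fgproj R" "g \<in> carrier (gam_hom R d U U')" for U U' g
    using day_tensor_ar(1)[OF R X' Y' that] by simp
  have G': "day_cocone R d X Y U (ob (day_tensor R d X' Y') U) (?G U)" if "U \<in> fgproj R" for U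
    using G[OF that] by simp
  show "day_tensor_map R d X Y X' Y' \<xi> \<upsilon> \<in> carrier (nat_module R d (day_tensor R d X Y) (day_tensor R d X' Y'))"
    unfolding day_tensor_map_def using day_trans(1)[where G = ?G, OF R X Y mod ar G' nat] by simp
  show "day_tensor_map R d X Y X' Y' \<xi> \<upsilon> U (day_gen R d X Y U (V, W, f, x, y)) = ?G U V W f x y"
    if "U \<in> fgproj R" "V \<in> fgproj R" "W \<in> fgproj R"
      "f \<in> carrier (gam_hom R d (tensor_module R V W) U)" "x \<in> carrier (ob X V)" "y \<in> carrier (ob Y W)"
    for U V W f x y
    unfolding day_tensor_map_def using day_trans(2)[where G = ?G, OF R X Y mod ar G' nat] that by simp
qed

section \<open>Symmetrisation\<close>

lemma (in abelian_monoid) finsum_swap: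
  assumes "finite A" "finite B" "\<And>a b. a \<in> A \<Longrightarrow> b \<in> B \<Longrightarrow> f a b \<in> carrier G"
  shows "(\<Oplus>a\<in>A. \<Oplus>b\<in>B. f a b) = (\<Oplus>b\<in>B. \<Oplus>a\<in>A. f a b)"
  using assms(1,3)
proof (induction A rule: finite_induct)
  case empty
  then show ?case by (simp add: finsum_zero)
next
  case (insert a A)
  have c: "(\<lambda>b. \<Oplus>a\<in>A. f a b) \<in> B \<rightarrow> carrier G" "(\<lambda>b. f a b) \<in> B \<rightarrow> carrier G"
    "(\<lambda>a. \<Oplus>b\<in>B. f a b) \<in> A \<rightarrow> carrier G" "(\<Oplus>b\<in>B. f a b) \<in> carrier G"
    using insert.prems by (auto intro!: finsum_closed)
  have "(\<Oplus>b\<in>B. \<Oplus>a\<in>insert a A. f a b) = (\<Oplus>b\<in>B. f a b \<oplus> (\<Oplus>a\<in>A. f a b))"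
    using insert c by (intro finsum_cong') (auto simp: Pi_def)
  also have "\<dots> = (\<Oplus>b\<in>B. f a b) \<oplus> (\<Oplus>b\<in>B. \<Oplus>a\<in>A. f a b)"
    using c by (intro finsum_addf) auto
  also have "(\<Oplus>b\<in>B. \<Oplus>a\<in>A. f a b) = (\<Oplus>a\<in>A. \<Oplus>b\<in>B. f a b)"
    using insert by simp
  finally show ?case using insert.hyps c by simp
qed

lemma (in abelian_monoid) finsum_permutes_shift:
  assumes "\<tau> permutes S" "\<And>\<sigma>. \<sigma> permutes S \<Longrightarrow> f \<sigma> \<in> carrier G"
  shows "(\<Oplus>\<sigma>\<in>{\<sigma>. \<sigma> permutes S}. f (\<tau> \<circ> \<sigma>)) = (\<Oplus>\<sigma>\<in>{\<sigma>. \<sigma> permutes S}. f \<sigma>)"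
    and "(\<Oplus>\<sigma>\<in>{\<sigma>. \<sigma> permutes S}. f (\<sigma> \<circ> \<tau>)) = (\<Oplus>\<sigma>\<in>{\<sigma>. \<sigma> permutes S}. f \<sigma>)"
proof -
  let ?P = "{\<sigma>. \<sigma> permutes S}"
  have i: "inv' \<tau> \<circ> (\<tau> \<circ> \<sigma>) = \<sigma>" for \<sigma> :: "'c \<Rightarrow> 'c"
    using permutes_inv_o(2)[OF assms(1)] by (simp flip: comp_assoc)
  have b: "inj_on (\<lambda>\<sigma>. \<tau> \<circ> \<sigma>) ?P" "(\<lambda>\<sigma>. \<tau> \<circ> \<sigma>) ` ?P = ?P"
    using i image_compose_permutations_left[OF assms(1)] unfolding setcompr_eq_image
    by - (rule inj_onI, metis, assumption)
  have "finsum G f ((\<lambda>\<sigma>. \<tau> \<circ> \<sigma>) ` ?P) = (\<Oplus>\<sigma>\<in>?P. f (\<tau> \<circ> \<sigma>))"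
    using assms(2) b by (intro finsum_reindex) auto
  then show "(\<Oplus>\<sigma>\<in>?P. f (\<tau> \<circ> \<sigma>)) = (\<Oplus>\<sigma>\<in>?P. f \<sigma>)" using b(2) by simp
  have i: "(\<sigma> \<circ> \<tau>) \<circ> inv' \<tau> = \<sigma>" for \<sigma> :: "'c \<Rightarrow> 'c"
    using permutes_inv_o(1)[OF assms(1)] by (simp add: comp_assoc)
  have b: "inj_on (\<lambda>\<sigma>. \<sigma> \<circ> \<tau>) ?P" "(\<lambda>\<sigma>. \<sigma> \<circ> \<tau>) ` ?P = ?P"
    using i image_compose_permutations_right[OF assms(1)] unfolding setcompr_eq_image
    by - (rule inj_onI, metis, assumption)
  have "finsum G f ((\<lambda>\<sigma>. \<sigma> \<circ> \<tau>) ` ?P) = (\<Oplus>\<sigma>\<in>?P. f (\<sigma> \<circ> \<tau>))"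
    using assms(2) b by (intro finsum_reindex) auto
  then show "(\<Oplus>\<sigma>\<in>?P. f (\<sigma> \<circ> \<tau>)) = (\<Oplus>\<sigma>\<in>?P. f \<sigma>)" using b(2) by simp
qed

lemma (in abelian_monoid) finsum_single:
  assumes "finite A" "i \<in> A" "f i \<in> carrier G" "\<And>j. j \<in> A \<Longrightarrow> j \<noteq> i \<Longrightarrow> f j = \<zero>"
  shows "(\<Oplus>j\<in>A. f j) = f i"
proof -
  have "(\<Oplus>j\<in>A. f j) = (\<Oplus>j\<in>A. if i = j then f j else \<zero>)"
    using assms by (intro finsum_cong') auto
  also have "\<dots> = (\<Oplus>j\<in>A. if i = j then (\<lambda>_. f i) j else \<zero>)"
    by (intro arg_cong[where f = "\<lambda>h. finsum G h A"]) auto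
  also have "\<dots> = f i"
    using assms finsum_singleton[of i A "\<lambda>_. f i"] by auto
  finally show ?thesis .
qed

text \<open>The equivariant map corresponding to \<open>c \<otimes> u\<close>, where \<open>c\<close> is a linear form on the
  \<open>d\<close>-th tensor power of \<open>V\<close> and \<open>u\<close> is an element of that of \<open>U\<close>.\<close>

definition symmetrize ::
  "('a, 'r) ring_scheme \<Rightarrow> nat \<Rightarrow> ('a, 'v, 's) module_scheme \<Rightarrow> ('a, 'u, 't) module_scheme
    \<Rightarrow> (((nat \<Rightarrow> 'v) \<Rightarrow> 'a) set \<Rightarrow> 'a) \<Rightarrow> ((nat \<Rightarrow> 'u) \<Rightarrow> 'a) set
    \<Rightarrow> ((nat \<Rightarrow> 'v) \<Rightarrow> 'a) set \<Rightarrow> ((nat \<Rightarrow> 'u) \<Rightarrow> 'a) set"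
  where "symmetrize R d V U c u = (\<lambda>v\<in>carrier (tpow R d V).
    \<Oplus>\<^bsub>tpow R d U\<^esub>\<sigma>\<in>{\<sigma>. \<sigma> permutes {1..d}}. c (tpow_perm R d V (inv' \<sigma>) v) \<odot>\<^bsub>tpow R d U\<^esub> tpow_perm R d U \<sigma> u)"

context
  fixes R :: "('a, 'r) ring_scheme" and d :: nat
    and V :: "('a, 'v, 's) module_scheme" and U :: "('a, 'u, 't) module_scheme" and c
  assumes V: "module R V" and U: "module R U" and c: "linear_map R (tpow R d V) (self_module R) c"
begin

interpretation TU: module R "tpow R d U" by (rule tpow_module[OF U])

private abbreviation "Sd \<equiv> {\<sigma>. \<sigma> permutes {1..d}}"
private abbreviation "pV \<equiv> tpow_perm R d V"
private abbreviation "pU \<equiv> tpow_perm R d U"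

private lemma finite_Sd: "finite Sd" by (simp add: finite_permutations)

private lemma c_closed: "v \<in> carrier (tpow R d V) \<Longrightarrow> c v \<in> carrier R"
  using linear_mapD(1)[OF c] by simp

private lemma term_linear_v:
  assumes "u \<in> carrier (tpow R d U)" "\<sigma> \<in> Sd"
  shows "linear_map R (tpow R d V) (tpow R d U) (\<lambda>v. c (pV (inv' \<sigma>) v) \<odot>\<^bsub>tpow R d U\<^esub> pU \<sigma> u)"
  using assms
  by (intro linear_map_smult_vector TU.module_axioms tpow_perm_closed[OF U]
      linear_map_comp[OF tpow_perm_linear_pure(1)[OF V] c] permutes_inv) auto

private lemma term_linear_u:
  assumes "v \<in> carrier (tpow R d V)" "\<sigma> \<in> Sd"
  shows "linear_map R (tpow R d U) (tpow R d U) (\<lambda>u. c (pV (inv' \<sigma>) v) \<odot>\<^bsub>tpow R d U\<^esub> pU \<sigma> u)"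
  using assms
  by (intro linear_map_smult TU.module_axioms tpow_perm_linear_pure(1)[OF U] c_closed
      tpow_perm_closed[OF V] permutes_inv) auto

lemma symmetrize_apply:
  "v \<in> carrier (tpow R d V) \<Longrightarrow> symmetrize R d V U c u v =
    (\<Oplus>\<^bsub>tpow R d U\<^esub>\<sigma>\<in>{\<sigma>. \<sigma> permutes {1..d}}. c (tpow_perm R d V (inv' \<sigma>) v) \<odot>\<^bsub>tpow R d U\<^esub> tpow_perm R d U \<sigma> u)"
  by (simp add: symmetrize_def)

text \<open>Acting with \<tau> on the value turns the summand of \<sigma> at \<open>v\<close> into
  the summand of \<open>\<sigma> \<circ> \<tau>\<close> at the permuted argument, because \<tau>
  cancels in \<open>\<tau> \<circ> inv' (\<sigma> \<circ> \<tau>)\<close>. The sum over the group is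
  then reindexed.\<close>

lemma symmetrize_closed:
  assumes u: "u \<in> carrier (tpow R d U)"
  shows "symmetrize R d V U c u \<in> carrier (gam_hom R d V U)"
  unfolding symmetrize_def
proof (rule gam_homI[OF V linear_map_sum[OF TU.module_axioms finite_Sd term_linear_v[OF u]]])
  fix \<tau> v assume \<tau>: "\<tau> permutes {1..d}" and v: "v \<in> carrier (tpow R d V)"
  have cl: "c (pV (inv' \<sigma>) v) \<odot>\<^bsub>tpow R d U\<^esub> pU \<sigma> u \<in> carrier (tpow R d U)" if "\<sigma> permutes {1..d}" for \<sigma>
    using linear_mapD(1)[OF term_linear_v[OF u] v] that by blast
  have cl': "c (pV (inv' \<sigma>) (pV \<tau> v)) \<odot>\<^bsub>tpow R d U\<^esub> pU \<sigma> u \<in> carrier (tpow R d U)" if "\<sigma> permutes {1..d}" for \<sigma>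
    using linear_mapD(1)[OF term_linear_v[OF u] tpow_perm_closed[OF V \<tau> v]] that by blast
  note lin = tpow_perm_linear_pure(1)[OF U \<tau>]
  have "pU \<tau> (\<Oplus>\<^bsub>tpow R d U\<^esub>\<sigma>\<in>Sd. c (pV (inv' \<sigma>) v) \<odot>\<^bsub>tpow R d U\<^esub> pU \<sigma> u) =
    (\<Oplus>\<^bsub>tpow R d U\<^esub>\<sigma>\<in>Sd. pU \<tau> (c (pV (inv' \<sigma>) v) \<odot>\<^bsub>tpow R d U\<^esub> pU \<sigma> u))"
    using cl by (intro linear_map_finsum[OF TU.module_axioms TU.module_axioms lin finite_Sd]) auto
  also have "\<dots> = (\<Oplus>\<^bsub>tpow R d U\<^esub>\<sigma>\<in>Sd. c (pV (inv' (\<sigma> \<circ> \<tau>)) (pV \<tau> v)) \<odot>\<^bsub>tpow R d U\<^esub> pU (\<sigma> \<circ> \<tau>) u)"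
  proof (rule TU.finsum_cong', simp)
    show "(\<lambda>\<sigma>. c (pV (inv' (\<sigma> \<circ> \<tau>)) (pV \<tau> v)) \<odot>\<^bsub>tpow R d U\<^esub> pU (\<sigma> \<circ> \<tau>) u) \<in> Sd \<rightarrow> carrier (tpow R d U)"
      using cl'[OF permutes_compose[OF \<tau>]] by auto
    fix \<sigma> assume "\<sigma> \<in> Sd"
    then have \<sigma>: "\<sigma> permutes {1..d}" by simp
    have "inv' (\<sigma> \<circ> \<tau>) = inv' \<tau> \<circ> inv' \<sigma>"
      using permutes_bij[OF \<sigma>] permutes_bij[OF \<tau>] by (simp add: o_inv_distrib)
    then have "\<tau> \<circ> inv' (\<sigma> \<circ> \<tau>) = inv' \<sigma>"
      using permutes_inv_o(1)[OF \<tau>] by (simp flip: comp_assoc)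
    then show "pU \<tau> (c (pV (inv' \<sigma>) v) \<odot>\<^bsub>tpow R d U\<^esub> pU \<sigma> u) =
        c (pV (inv' (\<sigma> \<circ> \<tau>)) (pV \<tau> v)) \<odot>\<^bsub>tpow R d U\<^esub> pU (\<sigma> \<circ> \<tau>) u"
      using linear_mapD(3)[OF lin] \<sigma> \<tau> u v
      by (simp add: tpow_perm_perm[OF V] tpow_perm_perm[OF U] c_closed tpow_perm_closed[OF V]
          tpow_perm_closed[OF U] permutes_inv permutes_compose)
  qed
  also have "\<dots> = (\<Oplus>\<^bsub>tpow R d U\<^esub>\<sigma>\<in>Sd. c (pV (inv' \<sigma>) (pV \<tau> v)) \<odot>\<^bsub>tpow R d U\<^esub> pU \<sigma> u)"
    by (rule TU.finsum_permutes_shift(2)[OF \<tau> cl'])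
  finally show "(\<Oplus>\<^bsub>tpow R d U\<^esub>\<sigma>\<in>Sd. c (pV (inv' \<sigma>) (pV \<tau> v)) \<odot>\<^bsub>tpow R d U\<^esub> pU \<sigma> u) =
    pU \<tau> (\<Oplus>\<^bsub>tpow R d U\<^esub>\<sigma>\<in>Sd. c (pV (inv' \<sigma>) v) \<odot>\<^bsub>tpow R d U\<^esub> pU \<sigma> u)" by simp
qed

lemma symmetrize_linear: "linear_map R (tpow R d U) (gam_hom R d V U) (symmetrize R d V U c)"
proof (rule linear_mapI[OF symmetrize_closed])
  note l = linear_mapD[OF linear_map_sum[OF TU.module_axioms finite_Sd term_linear_u]]
  show "symmetrize R d V U c (u \<oplus>\<^bsub>tpow R d U\<^esub> u') =
      symmetrize R d V U c u \<oplus>\<^bsub>gam_hom R d V U\<^esub> symmetrize R d V U c u'"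
    if "u \<in> carrier (tpow R d U)" "u' \<in> carrier (tpow R d U)" for u u'
    using l(2)[OF _ _ that] by (auto simp: symmetrize_def fun_eq_iff)
  show "symmetrize R d V U c (a \<odot>\<^bsub>tpow R d U\<^esub> u) = a \<odot>\<^bsub>gam_hom R d V U\<^esub> symmetrize R d V U c u"
    if "a \<in> carrier R" "u \<in> carrier (tpow R d U)" for a u
    using l(3)[OF _ _ that] by (auto simp: symmetrize_def fun_eq_iff)
qed

text \<open>A morphism \<open>g\<close> is linear and commutes with permutations, so it passes
  through the sum to \<open>u\<close>. For \<eta>_c this is naturality, for D_u compatibility with
  composition.\<close>

lemma symmetrize_natural:
  assumes U': "module R U'" and g: "g \<in> carrier (gam_hom R d U U')" and u: "u \<in> carrier (tpow R d U)"
  shows "gam_comp R d V g (symmetrize R d V U c u) = symmetrize R d V U' c (g u)"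
proof
  fix v
  interpret TU': module R "tpow R d U'" by (rule tpow_module[OF U'])
  note gD = gam_homD[OF g]
  show "gam_comp R d V g (symmetrize R d V U c u) v = symmetrize R d V U' c (g u) v"
  proof (cases "v \<in> carrier (tpow R d V)")
    case v: True
    have cl: "c (pV (inv' \<sigma>) v) \<odot>\<^bsub>tpow R d U\<^esub> pU \<sigma> u \<in> carrier (tpow R d U)" if "\<sigma> permutes {1..d}" for \<sigma>
      using linear_mapD(1)[OF term_linear_v[OF u] v] that by blast
    have "g (symmetrize R d V U c u v) = (\<Oplus>\<^bsub>tpow R d U'\<^esub>\<sigma>\<in>Sd. g (c (pV (inv' \<sigma>) v) \<odot>\<^bsub>tpow R d U\<^esub> pU \<sigma> u))"
      unfolding symmetrize_apply[OF v] using cl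
      by (intro linear_map_finsum[OF TU.module_axioms TU'.module_axioms gD(2) finite_Sd]) auto
    also have "\<dots> = symmetrize R d V U' c (g u) v"
      unfolding symmetrize_def restrict_apply'[OF v] using v u linear_mapD(3)[OF gD(2)] gD(3,4)
      by (intro TU'.finsum_cong')
        (auto simp: c_closed tpow_perm_closed[OF V] tpow_perm_closed[OF U] tpow_perm_closed[OF U'] permutes_inv)
    finally show ?thesis using v by (simp add: gam_comp_apply)
  qed (simp add: gam_comp_def compose_def symmetrize_def)
qed

end

text \<open>The predicate \<open>fg_projective\<close> compares with free modules on
  \<open>{..<n}\<close>, while the tensor factors carry the numbers \<open>1\<close> to
  \<open>d\<close>. The index set \<open>{..<Suc d}\<close> accommodates them without a
  shift.\<close>

definition omega_obj :: "('a, 'r) ring_scheme \<Rightarrow> nat \<Rightarrow> 'a obj"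
  where "omega_obj R d = free_module R {..<Suc d}"

text \<open>The weight vector \<open>e\<^sub>1 \<otimes> \<dots> \<otimes> e\<^sub>d\<close> and the corresponding coordinate form; \<open>e\<^sub>0\<close> is unused.\<close>

definition omega_vec :: "('a, 'r) ring_scheme \<Rightarrow> nat \<Rightarrow> 'a opow"
  where "omega_vec R d = tpow_pure R d (omega_obj R d) (\<lambda>i\<in>{1..d}. basis_vec R i)"

definition omega_coeff :: "('a, 'r) ring_scheme \<Rightarrow> nat \<Rightarrow> 'a opow \<Rightarrow> 'a"
  where "omega_coeff R d = pres_lift R (tpow R d (omega_obj R d)) (self_module R) (\<lambda>v. \<Otimes>\<^bsub>R\<^esub>i\<in>{1..d}. v i i)"

text \<open>The coordinate form of (e_1 \<otimes> e_1) \<otimes> ... \<otimes> (e_d \<otimes> e_d).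
  It is transported from T^d E \<otimes> T^d E, so that its value on the pair of \<open>s\<close>
  and \<open>t\<close> is \<epsilon>(s) \<epsilon>(t).\<close>

definition omega_coeff2 :: "('a, 'r) ring_scheme \<Rightarrow> nat \<Rightarrow> ((nat \<Rightarrow> ((nat \<Rightarrow> 'a) \<times> (nat \<Rightarrow> 'a) \<Rightarrow> 'a) set) \<Rightarrow> 'a) set \<Rightarrow> 'a"
  where "omega_coeff2 R d u = (let T = tpow R d (omega_obj R d) in
    pres_lift R (tensor_module R T T) (self_module R) (\<lambda>(s, t). omega_coeff R d s \<otimes>\<^bsub>R\<^esub> omega_coeff R d t)
      (inv_into (carrier (tensor_module R T T)) (interchange R d (omega_obj R d) (omega_obj R d)) u))"

text \<open>\<open>omega_point U u\<close> is the morphism sending the weight vector to \<open>u\<close>, and \<open>omega_diag U u\<close> is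
  its composite with the \<open>d\<close>-th power of the map \<open>e\<^sub>i \<otimes> e\<^sub>j \<mapsto> \<delta>\<^sub>i\<^sub>j e\<^sub>i\<close>.\<close>

definition omega_point :: "('a, 'r) ring_scheme \<Rightarrow> nat \<Rightarrow> 'a obj \<Rightarrow> 'a opow \<Rightarrow> 'a mor"
  where "omega_point R d U u = symmetrize R d (omega_obj R d) U (omega_coeff R d) u"

definition omega_diag :: "('a, 'r) ring_scheme \<Rightarrow> nat \<Rightarrow> 'a obj \<Rightarrow> 'a opow \<Rightarrow> 'a tmor"
  where "omega_diag R d U u = symmetrize R d (tensor_module R (omega_obj R d) (omega_obj R d)) U (omega_coeff2 R d) u"

section \<open>The Schur functor\<close>

lemma schur_simps [simp]:
  "carrier (schur R d X) = carrier (nat_module R d (gam_omega R d) X)"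
  "\<zero>\<^bsub>schur R d X\<^esub> = \<zero>\<^bsub>nat_module R d (gam_omega R d) X\<^esub>"
  "\<eta> \<oplus>\<^bsub>schur R d X\<^esub> \<theta> = \<eta> \<oplus>\<^bsub>nat_module R d (gam_omega R d) X\<^esub> \<theta>"
  "a \<odot>\<^bsub>schur R d X\<^esub> \<eta> = a \<odot>\<^bsub>nat_module R d (gam_omega R d) X\<^esub> \<eta>"
  "act (schur R d X) \<sigma> \<eta> = nat_comp R (gam_omega R d) \<eta> (gam_omega_perm R d \<sigma>)"
  by (simp_all add: schur_def module.defs sym_module.defs)

lemma linear_map_schur [simp]:
  "linear_map R (schur R d X) (schur R d Y) f \<longleftrightarrow>
    linear_map R (nat_module R d (gam_omega R d) X) (nat_module R d (gam_omega R d) Y) f"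
  by (simp add: linear_map_def)

lemma g_hom_ob_carrier:
  "h \<in> carrier (ob (g_hom R d (schur R d X)) V) \<longleftrightarrow>
    h \<in> extensional (carrier (nat_module R d (gam_omega R d) (gam_repr R d V))) \<and>
    linear_map R (nat_module R d (gam_omega R d) (gam_repr R d V)) (nat_module R d (gam_omega R d) X) h \<and>
    (\<forall>\<sigma>. \<sigma> permutes {1..d} \<longrightarrow> (\<forall>\<eta>\<in>carrier (nat_module R d (gam_omega R d) (gam_repr R d V)).
      h (nat_comp R (gam_omega R d) \<eta> (gam_omega_perm R d \<sigma>)) =
      nat_comp R (gam_omega R d) (h \<eta>) (gam_omega_perm R d \<sigma>)))"
  by (auto simp: g_hom_def sym_hom_module_def hom_module_carrier sym_group_carrier)

lemma g_hom_ob_simps: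
  "(h \<oplus>\<^bsub>ob (g_hom R d (schur R d X)) V\<^esub> h') =
    (\<lambda>\<eta>\<in>carrier (nat_module R d (gam_omega R d) (gam_repr R d V)). h \<eta> \<oplus>\<^bsub>nat_module R d (gam_omega R d) X\<^esub> h' \<eta>)"
  "(a \<odot>\<^bsub>ob (g_hom R d (schur R d X)) V\<^esub> h) =
    (\<lambda>\<eta>\<in>carrier (nat_module R d (gam_omega R d) (gam_repr R d V)). a \<odot>\<^bsub>nat_module R d (gam_omega R d) X\<^esub> h \<eta>)"
  by (simp_all add: g_hom_def sym_hom_module_def)

definition symmetrize_trans ::
  "('a, 'r) ring_scheme \<Rightarrow> nat \<Rightarrow> 'a obj \<Rightarrow> ('a opow \<Rightarrow> 'a) \<Rightarrow> ('a, 'a opow, 'a mor) trans"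
  where "symmetrize_trans R d V c = (\<lambda>U\<in>fgproj R. \<lambda>u\<in>carrier (tpow R d U). symmetrize R d V U c u)"

lemma nat_module_eval_linear:
  assumes "U \<in> fgproj R" "u \<in> carrier (ob F U)"
  shows "linear_map R (nat_module R d F G) (ob G U) (\<lambda>\<eta>. \<eta> U u)"
  using assms by (intro linear_mapI) (auto simp: nat_module_apply nat_moduleD(5))

lemma gam_hom_eval_linear:
  "v \<in> carrier (tpow R d V) \<Longrightarrow> linear_map R (gam_hom R d V W) (tpow R d W) (\<lambda>f. f v)"
  by (intro linear_mapI) (auto simp: gam_homD(4))

text \<open>For fixed \<phi> this is \<eta> \<mapsto> \<phi> \<circ> (\<eta> \<otimes> S^d) \<circ>
  \<delta>, where \<delta>(u) = D_u \<otimes> e \<otimes> [e] is one fixed transformation from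
  \<Gamma>^\<omega> to \<Gamma>^\<omega> \<otimes> S^d. This explains why it is natural in
  \<open>V\<close> and in the target of \<phi>.\<close>

definition day_schur ::
  "('a, 'r) ring_scheme \<Rightarrow> nat \<Rightarrow> 'a obj \<Rightarrow> ('a, ('a, 'a mor, 'a opow set) day, 'm) trans
    \<Rightarrow> ('a, 'a opow, 'a mor) trans \<Rightarrow> ('a, 'a opow, 'm) trans"
  where "day_schur R d V \<phi> = (\<lambda>\<eta>\<in>carrier (nat_module R d (gam_omega R d) (gam_repr R d V)).
    \<lambda>U\<in>fgproj R. \<lambda>u\<in>carrier (tpow R d U).
      \<phi> U (day_gen R d (gam_repr R d V) (sym_power R d) U
        (omega_obj R d, omega_obj R d, omega_diag R d U u, \<eta> (omega_obj R d) (omega_vec R d),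
         sym_class R d (omega_obj R d) (omega_vec R d))))"

text \<open>The law \<open>adj_natural\<close> varies all three arguments at once; when only the
  third one moves, the Day convolution of two identities has to be removed.\<close>

lemma day_tensor_map_id:
  fixes X :: "('a, 'x) spf" and Y :: "('a, 'y) spf"
  assumes R: "cring R"
    and X: "strict_polynomial_functor R d X" and Y: "strict_polynomial_functor R d Y"
    and \<phi>: "\<phi> \<in> carrier (nat_module R d (day_tensor R d X Y) Z)"
  shows "nat_comp R (day_tensor R d X Y) \<phi> (day_tensor_map R d X Y X Y (nat_id R X) (nat_id R Y)) = \<phi>"
proof -
  note m = day_tensor_map[OF R X Y X Y nat_id_closed[OF spf_prefunctor[OF X]] nat_id_closed[OF spf_prefunctor[OF Y]]]
  have "day_tensor_map R d X Y X Y (nat_id R X) (nat_id R Y) U K = K"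
    if U: "U \<in> fgproj R" and K: "K \<in> carrier (day_module R d X Y U)" for U K
  proof (rule day_linear_eqI[OF R X Y U day_module_module[OF R X Y U] _ linear_map_id _ K])
    show "linear_map R (day_module R d X Y U) (day_module R d X Y U)
        (day_tensor_map R d X Y X Y (nat_id R X) (nat_id R Y) U)"
      using nat_moduleD(3)[OF m(1) U] by simp
  qed (simp add: m(2)[OF U] nat_id_apply)
  then show ?thesis
    by (intro nat_trans_eqI[OF nat_comp_closed[OF day_tensor_prefunctor[OF R X Y] m(1) \<phi>] \<phi>])
      (simp add: nat_comp_apply)
qed

lemma yoneda_iso:
  assumes V: "V \<in> fgproj R" and H: "strict_polynomial_functor R d H"
  shows "linear_iso R (nat_module R d (gam_repr R d V) H) (ob H V) (\<lambda>\<psi>. \<psi> V (gam_id R d V))"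
proof -
  let ?\<Gamma> = "gam_repr R d V"
  note mV = fgprojD(2)[OF V]
  have id: "gam_id R d V \<in> carrier (gam_hom R d V V)" by (rule gam_id_closed[OF mV])
  have eval: "\<psi> W f = ar H V W f (\<psi> V (gam_id R d V))"
    if "\<psi> \<in> carrier (nat_module R d ?\<Gamma> H)" "W \<in> fgproj R" "f \<in> carrier (gam_hom R d V W)" for \<psi> W f
    using nat_moduleD(4)[OF that(1) V that(2,3), of "gam_id R d V"] id gam_comp_id(2)[OF that(3)] by simp
  have inj: "inj_on (\<lambda>\<psi>. \<psi> V (gam_id R d V)) (carrier (nat_module R d ?\<Gamma> H))"
  proof (rule inj_onI)
    fix \<psi> \<psi>' assume *: "\<psi> \<in> carrier (nat_module R d ?\<Gamma> H)" "\<psi>' \<in> carrier (nat_module R d ?\<Gamma> H)"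
      "\<psi> V (gam_id R d V) = \<psi>' V (gam_id R d V)"
    show "\<psi> = \<psi>'"
      by (rule nat_trans_eqI[OF *(1,2)]) (simp add: eval[OF *(1)] eval[OF *(2)] *(3))
  qed
  have surj: "\<exists>\<psi>\<in>carrier (nat_module R d ?\<Gamma> H). \<psi> V (gam_id R d V) = x" if x: "x \<in> carrier (ob H V)" for x
  proof
    let ?\<psi> = "\<lambda>W\<in>fgproj R. restrict (\<lambda>f. ar H V W f x) (carrier (ob ?\<Gamma> W))"
    show "?\<psi> \<in> carrier (nat_module R d ?\<Gamma> H)"
    proof (rule nat_moduleI)
      show "module R (ob ?\<Gamma> W)" if "W \<in> fgproj R" for W
        using gam_hom_module[OF mV fgprojD(2)[OF that]] by simp
      show "linear_map R (ob ?\<Gamma> W) (ob H W) (\<lambda>f. ar H V W f x)" if "W \<in> fgproj R" for W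
        using spf_ar(3)[OF H V that x] by simp
      show "ar ?\<Gamma> W W' g f \<in> carrier (ob ?\<Gamma> W') \<and> ar H V W' (ar ?\<Gamma> W W' g f) x = ar H W W' g (ar H V W f x)"
        if "W \<in> fgproj R" "W' \<in> fgproj R" "g \<in> carrier (gam_hom R d W W')" "f \<in> carrier (ob ?\<Gamma> W)" for W W' g f
        using that gam_comp_closed[OF mV _ that(3)] strict_polynomial_functor.ar_comp[OF H V that(1,2) _ that(3) x] by simp
    qed
    show "?\<psi> V (gam_id R d V) = x"
      using V id strict_polynomial_functor.ar_id[OF H V x] by simp
  qed
  have lin: "linear_map R (nat_module R d ?\<Gamma> H) (ob H V) (\<lambda>\<psi>. \<psi> V (gam_id R d V))"
    using id by (intro nat_module_eval_linear[OF V]) simp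
  show ?thesis
    using lin inj surj linear_mapD(1)[OF lin] by (auto simp: linear_iso_def bij_betw_def image_iff)
qed

section \<open>The comparison map\<close>

context
  fixes R :: "('a, 'r) ring_scheme" and d :: nat
  assumes R: "cring R"
begin

interpretation R: cring R by (fact R)

private abbreviation "E \<equiv> omega_obj R d"
private abbreviation "TE \<equiv> tpow R d E"
private abbreviation "pE \<equiv> tpow_perm R d E"
private abbreviation "e \<equiv> omega_vec R d"
private abbreviation "\<epsilon> \<equiv> omega_coeff R d"
private abbreviation "Perms \<equiv> {\<sigma>::nat \<Rightarrow> nat. \<sigma> permutes {1..d}}"

private lemma fin: "finite Perms" by (simp add: finite_permutations)

lemma omega_obj_fgproj: "E \<in> fgproj R"
  using free_module_module[OF R] linear_map_id
  unfolding fgproj_def fg_projective_def omega_obj_def by fast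

private lemmas mE = fgprojD(2)[OF omega_obj_fgproj]
private lemmas proj_E = fgprojD(1)[OF omega_obj_fgproj]

private lemma e_gens: "(\<lambda>i\<in>{1..d}. basis_vec R i) \<in> tpow_gens d E"
  using basis_vec_closed[OF R, of _ "{..<Suc d}"] by (auto simp: omega_obj_def intro!: tpow_gens_restrict)

lemma omega_vec_closed: "e \<in> carrier TE"
  unfolding omega_vec_def by (rule tpow_pure_closed[OF mE e_gens])

private lemma coord_linear: "linear_map R E (self_module R) (\<lambda>x. x i)"
  using free_module_value_closed[OF R, of _ "{..<Suc d}"] by (intro linear_mapI) (auto simp: omega_obj_def)

lemma omega_coeff_linear: "linear_map R TE (self_module R) \<epsilon>"
  unfolding omega_coeff_def using tpow_functional(1)[OF mE, of d "\<lambda>i x. x i"] coord_linear by blast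

lemma omega_coeff_closed: "t \<in> carrier TE \<Longrightarrow> \<epsilon> t \<in> carrier R"
  using linear_mapD(1)[OF omega_coeff_linear] by simp

text \<open>The permuted weight vector has e_{\<sigma> i} in slot \<open>i\<close>. Its i-th
  coordinate is 1 if \<sigma> fixes \<open>i\<close> and 0 otherwise, so a single moved index makes
  the product vanish.\<close>

lemma omega_coeff_perm:
  assumes \<sigma>: "\<sigma> permutes {1..d}"
  shows "\<epsilon> (pE \<sigma> e) = (if \<sigma> = id then \<one>\<^bsub>R\<^esub> else \<zero>\<^bsub>R\<^esub>)"
proof -
  let ?v = "\<lambda>i\<in>{1..d}. basis_vec R i"
  have "\<epsilon> (pE \<sigma> e) = (\<Otimes>\<^bsub>R\<^esub>i\<in>{1..d}. (?v \<circ> \<sigma>) i i)"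
    using tpow_functional(2)[OF mE, of d "\<lambda>i x. x i" "?v \<circ> \<sigma>"] coord_linear tpow_gens_perm[OF e_gens \<sigma>]
    unfolding omega_vec_def omega_coeff_def tpow_perm_linear_pure(2)[OF mE \<sigma> e_gens] by blast
  also have "\<dots> = (\<Otimes>\<^bsub>R\<^esub>i\<in>{1..d}. if \<sigma> i = i then \<one>\<^bsub>R\<^esub> else \<zero>\<^bsub>R\<^esub>)"
    using permutes_in_image[OF \<sigma>] by (intro R.finprod_cong') (auto simp: basis_vec_def)
  also have "\<dots> = (if \<sigma> = id then \<one>\<^bsub>R\<^esub> else \<zero>\<^bsub>R\<^esub>)"
  proof (cases "\<sigma> = id")
    case True
    then show ?thesis by (simp add: R.finprod_one_eqI)
  next
    case False
    then obtain j where j: "\<sigma> j \<noteq> j" by (auto simp: fun_eq_iff)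
    then have "j \<in> {1..d}" using permutes_not_in[OF \<sigma>] by blast
    then have "(\<Otimes>\<^bsub>R\<^esub>i\<in>{1..d}. if \<sigma> i = i then \<one>\<^bsub>R\<^esub> else \<zero>\<^bsub>R\<^esub>) =
        (\<Otimes>\<^bsub>R\<^esub>i\<in>insert j ({1..d} - {j}). if \<sigma> i = i then \<one>\<^bsub>R\<^esub> else \<zero>\<^bsub>R\<^esub>)"
      by (simp add: insert_absorb)
    also have "\<dots> = \<zero>\<^bsub>R\<^esub>"
      using j by (subst R.finprod_insert) (auto intro!: R.l_null R.finprod_closed)
    finally show ?thesis using False by simp
  qed
  finally show ?thesis .
qed

lemma omega_coeff2:
  shows "linear_map R (tpow R d (tensor_module R E E)) (self_module R) (omega_coeff2 R d)"
    and "\<And>s t. \<lbrakk>s \<in> carrier TE; t \<in> carrier TE\<rbrakk> \<Longrightarrow> omega_coeff2 R d (tpow_pair R d E E s t) = \<epsilon> s \<otimes>\<^bsub>R\<^esub> \<epsilon> t"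
proof -
  note TE = tpow_module[OF mE, of d]
  note iso = interchange_iso[OF proj_E proj_E, of d]
  note l = tensor_lift[OF TE TE self_module_module[OF R] bilinear_map_mult[OF R omega_coeff_linear omega_coeff_linear]]
  show "linear_map R (tpow R d (tensor_module R E E)) (self_module R) (omega_coeff2 R d)"
    unfolding omega_coeff2_def Let_def
    by (rule linear_map_comp[OF linear_isoD(1)[OF linear_iso_inv_into[OF tensor_module_module[OF TE TE] iso]] l(1)])
  show "omega_coeff2 R d (tpow_pair R d E E s t) = \<epsilon> s \<otimes>\<^bsub>R\<^esub> \<epsilon> t"
    if "s \<in> carrier TE" "t \<in> carrier TE" for s t
    using l(2)[OF that] bij_betw_inv_into_left[OF linear_isoD(2)[OF iso] pure_tensor_closed[OF TE TE that]]
    by (simp add: omega_coeff2_def tpow_pair_def[OF mE mE])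
qed

private abbreviation "D \<equiv> omega_diag R d"

text \<open>In the sum over \<rho> only \<open>inv' \<sigma>\<close> survives, which carries the
  permuted weight vector back to \<open>e\<close>. So \<epsilon> reads the form \<open>c\<close> off
  from its symmetrisation.\<close>

private lemma symmetrize_shift:
  assumes V: "module R V" and c: "linear_map R (tpow R d V) (self_module R) c"
    and v: "v \<in> carrier (tpow R d V)" and \<sigma>: "\<sigma> permutes {1..d}"
  shows "\<epsilon> (symmetrize R d V E c (pE \<sigma> e) v) = c (tpow_perm R d V \<sigma> v)"
proof -
  interpret TE: module R TE by (rule tpow_module[OF mE])
  have cv: "c (tpow_perm R d V \<tau> v) \<in> carrier R" if "\<tau> permutes {1..d}" for \<tau>
    using linear_mapD(1)[OF c tpow_perm_closed[OF V that v]] by simp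
  have \<sigma>e: "pE \<sigma> e \<in> carrier TE" using tpow_perm_closed[OF mE \<sigma> omega_vec_closed] .
  have t: "pE \<rho> (pE \<sigma> e) \<in> carrier TE" if "\<rho> permutes {1..d}" for \<rho>
    using tpow_perm_closed[OF mE that \<sigma>e] .
  have "\<epsilon> (symmetrize R d V E c (pE \<sigma> e) v) =
      (\<Oplus>\<^bsub>self_module R\<^esub>\<rho>\<in>Perms. \<epsilon> (c (tpow_perm R d V (inv' \<rho>) v) \<odot>\<^bsub>TE\<^esub> pE \<rho> (pE \<sigma> e)))"
    unfolding symmetrize_apply[OF V mE c v]
    by (intro linear_map_finsum[OF TE.module_axioms self_module_module[OF R] omega_coeff_linear fin]
        TE.smult_closed cv t permutes_inv) auto
  also have "\<dots> = (\<Oplus>\<^bsub>R\<^esub>\<rho>\<in>Perms. \<epsilon> (c (tpow_perm R d V (inv' \<rho>) v) \<odot>\<^bsub>TE\<^esub> pE \<rho> (pE \<sigma> e)))"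
    by (simp add: finsum_self_module)
  also have "\<dots> = \<epsilon> (c (tpow_perm R d V (inv' (inv' \<sigma>)) v) \<odot>\<^bsub>TE\<^esub> pE (inv' \<sigma>) (pE \<sigma> e))"
  proof (rule R.finsum_single[OF fin])
    show "inv' \<sigma> \<in> Perms" using permutes_inv[OF \<sigma>] by simp
    show "\<epsilon> (c (tpow_perm R d V (inv' (inv' \<sigma>)) v) \<odot>\<^bsub>TE\<^esub> pE (inv' \<sigma>) (pE \<sigma> e)) \<in> carrier R"
      using cv t permutes_inv[OF \<sigma>] permutes_inv by (intro omega_coeff_closed TE.smult_closed) blast+
    fix \<rho> assume "\<rho> \<in> Perms" "\<rho> \<noteq> inv' \<sigma>"
    then have \<rho>: "\<rho> permutes {1..d}" and ne: "\<rho> \<noteq> inv' \<sigma>" by auto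
    have "\<sigma> \<circ> \<rho> \<noteq> id"
    proof
      assume *: "\<sigma> \<circ> \<rho> = id"
      have "\<rho> = (inv' \<sigma> \<circ> \<sigma>) \<circ> \<rho>" using permutes_inv_o(2)[OF \<sigma>] by simp
      also have "\<dots> = inv' \<sigma>" using * by (simp add: comp_assoc)
      finally show False using ne by simp
    qed
    then have "\<epsilon> (pE \<rho> (pE \<sigma> e)) = \<zero>\<^bsub>R\<^esub>"
      using omega_coeff_perm[OF permutes_compose[OF \<rho> \<sigma>]] tpow_perm_perm[OF mE \<sigma> \<rho> omega_vec_closed] by simp
    then show "\<epsilon> (c (tpow_perm R d V (inv' \<rho>) v) \<odot>\<^bsub>TE\<^esub> pE \<rho> (pE \<sigma> e)) = \<zero>\<^bsub>R\<^esub>"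
      using linear_mapD(3)[OF omega_coeff_linear cv[OF permutes_inv[OF \<rho>]] t[OF \<rho>]] cv[OF permutes_inv[OF \<rho>]] by simp
  qed
  also have "\<dots> = c (tpow_perm R d V \<sigma> v)"
  proof -
    have 1: "pE (inv' \<sigma>) (pE \<sigma> e) = e" by (rule tpow_perm_inv(2)[OF mE \<sigma> omega_vec_closed])
    have 2: "\<epsilon> e = \<one>\<^bsub>R\<^esub>" using omega_coeff_perm[OF permutes_id] tpow_perm_id[OF mE omega_vec_closed] by simp
    show ?thesis
      using cv[OF \<sigma>] linear_mapD(3)[OF omega_coeff_linear cv[OF \<sigma>] omega_vec_closed]
      by (simp add: 1 2 inv_inv_eq permutes_bij[OF \<sigma>])
  qed
  finally show ?thesis .
qed

text \<open>Together with \<open>symmetrize_trans_coeff\<close> this makes c \<mapsto> \<eta>_c and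
  \<eta> \<mapsto> \<epsilon> \<circ> \<eta>(e) inverse to each other.\<close>

lemma symmetrize_coeff:
  assumes V: "module R V" and c: "linear_map R (tpow R d V) (self_module R) c"
    and v: "v \<in> carrier (tpow R d V)"
  shows "\<epsilon> (symmetrize R d V E c e v) = c v"
  using symmetrize_shift[OF assms permutes_id] tpow_perm_id[OF mE omega_vec_closed] tpow_perm_id[OF V v] by simp

section \<open>Morphisms out of the weight object and out of its tensor square\<close>

context
  fixes U :: "'a obj"
  assumes U: "U \<in> fgproj R"
begin

private lemmas mU = fgprojD(2)[OF U]

interpretation TU: module R "tpow R d U" by (rule tpow_module[OF mU])

lemma omega_point_closed: "u \<in> carrier (tpow R d U) \<Longrightarrow> omega_point R d U u \<in> carrier (gam_hom R d E U)"
  unfolding omega_point_def by (rule symmetrize_closed[OF mE mU omega_coeff_linear])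

lemma omega_diag_closed: "u \<in> carrier (tpow R d U) \<Longrightarrow> D U u \<in> carrier (gam_hom R d (tensor_module R E E) U)"
  unfolding omega_diag_def by (rule symmetrize_closed[OF tensor_module_module[OF mE mE] mU omega_coeff2(1)])

lemma omega_diag_linear: "linear_map R (tpow R d U) (gam_hom R d (tensor_module R E E) U) (D U)"
  unfolding omega_diag_def by (rule symmetrize_linear[OF tensor_module_module[OF mE mE] mU omega_coeff2(1)])

lemma omega_diag_natural:
  assumes "U' \<in> fgproj R" "g \<in> carrier (gam_hom R d U U')" "u \<in> carrier (tpow R d U)"
  shows "gam_comp R d (tensor_module R E E) g (D U u) = D U' (g u)"
  unfolding omega_diag_def
  by (rule symmetrize_natural[OF tensor_module_module[OF mE mE] mU omega_coeff2(1) fgprojD(2)[OF assms(1)] assms(2,3)])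

lemma omega_point_apply:
  "t \<in> carrier TE \<Longrightarrow> omega_point R d U u t = (\<Oplus>\<^bsub>tpow R d U\<^esub>\<sigma>\<in>Perms. \<epsilon> (pE (inv' \<sigma>) t) \<odot>\<^bsub>tpow R d U\<^esub> tpow_perm R d U \<sigma> u)"
  unfolding omega_point_def by (rule symmetrize_apply[OF mE mU omega_coeff_linear])

lemma omega_diag_apply:
  assumes "s \<in> carrier TE" "t \<in> carrier TE" and u: "u \<in> carrier (tpow R d U)"
  shows "D U u (tpow_pair R d E E s t) =
    (\<Oplus>\<^bsub>tpow R d U\<^esub>\<sigma>\<in>Perms. (\<epsilon> (pE (inv' \<sigma>) s) \<otimes>\<^bsub>R\<^esub> \<epsilon> (pE (inv' \<sigma>) t)) \<odot>\<^bsub>tpow R d U\<^esub> tpow_perm R d U \<sigma> u)"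
proof -
  have "D U u (tpow_pair R d E E s t) = (\<Oplus>\<^bsub>tpow R d U\<^esub>\<sigma>\<in>Perms.
      omega_coeff2 R d (tpow_perm R d (tensor_module R E E) (inv' \<sigma>) (tpow_pair R d E E s t)) \<odot>\<^bsub>tpow R d U\<^esub> tpow_perm R d U \<sigma> u)"
    unfolding omega_diag_def
    by (rule symmetrize_apply[OF tensor_module_module[OF mE mE] mU omega_coeff2(1) tpow_pair_closed[OF proj_E proj_E assms(1,2)]])
  also have "\<dots> = (\<Oplus>\<^bsub>tpow R d U\<^esub>\<sigma>\<in>Perms. (\<epsilon> (pE (inv' \<sigma>) s) \<otimes>\<^bsub>R\<^esub> \<epsilon> (pE (inv' \<sigma>) t)) \<odot>\<^bsub>tpow R d U\<^esub> tpow_perm R d U \<sigma> u)"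
    using assms
    by (intro TU.finsum_cong')
      (auto simp: omega_coeff2(2) omega_coeff_closed tpow_perm_closed[OF mE] tpow_perm_closed[OF mU] permutes_inv
        simp flip: tpow_pair_perm[OF mE mE])
  finally show ?thesis .
qed

text \<open>Only \<sigma> = \<open>id\<close> contributes to the sum. Every \<open>u\<close> is thus
  the image of \<open>e\<close> under a morphism out of \<open>E\<close>, so a natural
  transformation on \<Gamma>^\<omega> is determined by its value at \<open>e\<close>.\<close>

lemma omega_point_vec:
  assumes u: "u \<in> carrier (tpow R d U)"
  shows "omega_point R d U u e = u"
proof -
  have *: "\<epsilon> (pE (inv' \<sigma>) e) = (if \<sigma> = id then \<one>\<^bsub>R\<^esub> else \<zero>\<^bsub>R\<^esub>)" if "\<sigma> permutes {1..d}" for \<sigma>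
    using omega_coeff_perm[OF permutes_inv[OF that]] permutes_inv_inv[OF that] by (metis inv_id)
  have "omega_point R d U u e = \<epsilon> (pE (inv' id) e) \<odot>\<^bsub>tpow R d U\<^esub> tpow_perm R d U id u"
    unfolding omega_point_apply[OF omega_vec_closed]
    by (rule TU.finsum_single[OF fin])
      (use u * omega_coeff_closed[OF omega_vec_closed] in \<open>auto simp: permutes_id tpow_perm_id[OF mU] tpow_perm_id[OF mE omega_vec_closed] tpow_perm_closed[OF mU]\<close>)
  then show ?thesis using u *[OF permutes_id] by (simp add: tpow_perm_id[OF mU])
qed

text \<open>The second argument \<open>e\<close> leaves only \<sigma> = \<open>id\<close>, as in
  \<open>omega_point_vec\<close>. This is what makes the comparison map return the given equivariant
  map at the end of \<open>day_schur_surj\<close>.\<close>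

lemma omega_diag_vec:
  assumes s: "s \<in> carrier TE" and u: "u \<in> carrier (tpow R d U)"
  shows "D U u (tpow_pair R d E E s e) = \<epsilon> s \<odot>\<^bsub>tpow R d U\<^esub> u"
proof -
  have *: "\<epsilon> (pE (inv' \<sigma>) e) = (if \<sigma> = id then \<one>\<^bsub>R\<^esub> else \<zero>\<^bsub>R\<^esub>)" if "\<sigma> permutes {1..d}" for \<sigma>
    using omega_coeff_perm[OF permutes_inv[OF that]] permutes_inv_inv[OF that] by (metis inv_id)
  have c: "\<epsilon> (pE (inv' \<sigma>) s) \<in> carrier R" if "\<sigma> permutes {1..d}" for \<sigma>
    using omega_coeff_closed[OF tpow_perm_closed[OF mE permutes_inv[OF that] s]] .
  have "D U u (tpow_pair R d E E s e) =
      (\<epsilon> (pE (inv' id) s) \<otimes>\<^bsub>R\<^esub> \<epsilon> (pE (inv' id) e)) \<odot>\<^bsub>tpow R d U\<^esub> tpow_perm R d U id u"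
    unfolding omega_diag_apply[OF s omega_vec_closed u]
    by (rule TU.finsum_single[OF fin])
      (use u * c c[OF permutes_id] s omega_coeff_closed[OF omega_vec_closed] tpow_perm_id[OF mE omega_vec_closed] in \<open>auto simp: permutes_id tpow_perm_id[OF mU] tpow_perm_closed[OF mU]
        tpow_perm_id[OF mE] omega_coeff_closed\<close>)
  then show ?thesis
    using s u *[OF permutes_id] omega_coeff_closed[OF s] by (simp add: tpow_perm_id[OF mU] tpow_perm_id[OF mE])
qed

text \<open>The endomorphism \<open>a\<close> of \<open>E\<close> sends \<open>e\<close> to the
  permuted weight vector and shifts the arguments of \<epsilon> by \<sigma>. When both factors are
  shifted, the substitution \<tau> = \<open>\<sigma> \<circ> \<rho>\<close> in the sum defining D_u
  undoes the shift and moves \<sigma> onto \<open>u\<close>.\<close>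

lemma omega_diag_perm:
  assumes \<sigma>: "\<sigma> permutes {1..d}" and u: "u \<in> carrier (tpow R d U)"
  defines "a \<equiv> symmetrize R d E E \<epsilon> (pE \<sigma> e)"
  shows "gam_comp R d (tensor_module R E E) (D U u) (gam_tensor R d E E E E a a) = D U (tpow_perm R d U \<sigma> u)"
proof (rule gam_hom_pair_eqI[OF proj_E proj_E mU])
  have \<sigma>e: "pE \<sigma> e \<in> carrier TE" using tpow_perm_closed[OF mE \<sigma> omega_vec_closed] .
  have \<sigma>u: "tpow_perm R d U \<sigma> u \<in> carrier (tpow R d U)" using tpow_perm_closed[OF mU \<sigma> u] .
  have a: "a \<in> carrier (gam_hom R d E E)"
    unfolding a_def by (rule symmetrize_closed[OF mE mE omega_coeff_linear \<sigma>e])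
  have aa: "gam_tensor R d E E E E a a \<in> carrier (gam_hom R d (tensor_module R E E) (tensor_module R E E))"
    by (rule gam_tensor_closed[OF proj_E proj_E proj_E proj_E a a])
  show "gam_comp R d (tensor_module R E E) (D U u) (gam_tensor R d E E E E a a) \<in> carrier (gam_hom R d (tensor_module R E E) U)"
    by (rule gam_comp_closed[OF tensor_module_module[OF mE mE] aa omega_diag_closed[OF u]])
  show "D U (tpow_perm R d U \<sigma> u) \<in> carrier (gam_hom R d (tensor_module R E E) U)"
    by (rule omega_diag_closed[OF \<sigma>u])
  fix s t assume st: "s \<in> carrier TE" "t \<in> carrier TE"
  have as: "\<epsilon> (pE (inv' \<tau>) (a s)) = \<epsilon> (pE (inv' \<tau> \<circ> \<sigma>) s)" if "\<tau> permutes {1..d}" "s \<in> carrier TE" for \<tau> s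
  proof -
    note \<tau> = permutes_inv[OF that(1)]
    have "\<epsilon> (pE (inv' \<tau>) (a s)) = \<epsilon> (a (pE (inv' \<tau>) s))"
      using gam_homD(3)[OF a \<tau> that(2)] by simp
    also have "\<dots> = \<epsilon> (pE \<sigma> (pE (inv' \<tau>) s))"
      unfolding a_def by (rule symmetrize_shift[OF mE omega_coeff_linear tpow_perm_closed[OF mE \<tau> that(2)] \<sigma>])
    finally show ?thesis using tpow_perm_perm[OF mE \<tau> \<sigma> that(2)] by simp
  qed
  let ?F = "\<lambda>\<tau>. (\<epsilon> (pE (inv' \<tau> \<circ> \<sigma>) s) \<otimes>\<^bsub>R\<^esub> \<epsilon> (pE (inv' \<tau> \<circ> \<sigma>) t)) \<odot>\<^bsub>tpow R d U\<^esub> tpow_perm R d U \<tau> u"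
  have F: "?F \<tau> \<in> carrier (tpow R d U)" if "\<tau> permutes {1..d}" for \<tau>
    using st tpow_perm_closed[OF mU that u] permutes_compose[OF \<sigma> permutes_inv[OF that]]
    by (auto intro!: omega_coeff_closed tpow_perm_closed[OF mE])
  have "gam_comp R d (tensor_module R E E) (D U u) (gam_tensor R d E E E E a a) (tpow_pair R d E E s t) =
      D U u (tpow_pair R d E E (a s) (a t))"
    by (simp add: gam_comp_apply[OF tpow_pair_closed[OF proj_E proj_E st]] gam_tensor_pair[OF proj_E proj_E proj_E proj_E a a st])
  also have "\<dots> = (\<Oplus>\<^bsub>tpow R d U\<^esub>\<tau>\<in>Perms. ?F \<tau>)"
    unfolding omega_diag_apply[OF gam_homD(4)[OF a st(1)] gam_homD(4)[OF a st(2)] u]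
    using F st by (intro TU.finsum_cong') (auto simp: as)
  also have "\<dots> = (\<Oplus>\<^bsub>tpow R d U\<^esub>\<tau>\<in>Perms. ?F (\<sigma> \<circ> \<tau>))"
    by (rule TU.finsum_permutes_shift(1)[OF \<sigma> F, symmetric])
  also have "\<dots> = (\<Oplus>\<^bsub>tpow R d U\<^esub>\<rho>\<in>Perms. (\<epsilon> (pE (inv' \<rho>) s) \<otimes>\<^bsub>R\<^esub> \<epsilon> (pE (inv' \<rho>) t)) \<odot>\<^bsub>tpow R d U\<^esub>
      tpow_perm R d U \<rho> (tpow_perm R d U \<sigma> u))"
  proof (rule TU.finsum_cong', simp)
    show "(\<lambda>\<rho>. (\<epsilon> (pE (inv' \<rho>) s) \<otimes>\<^bsub>R\<^esub> \<epsilon> (pE (inv' \<rho>) t)) \<odot>\<^bsub>tpow R d U\<^esub> tpow_perm R d U \<rho> (tpow_perm R d U \<sigma> u))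
        \<in> Perms \<rightarrow> carrier (tpow R d U)"
      using st \<sigma>u by (auto intro!: TU.smult_closed R.m_closed omega_coeff_closed tpow_perm_closed[OF mE]
          tpow_perm_closed[OF mU] permutes_inv)
    fix \<rho> assume "\<rho> \<in> Perms"
    then have \<rho>: "\<rho> permutes {1..d}" by simp
    have "inv' (\<sigma> \<circ> \<rho>) \<circ> \<sigma> = inv' \<rho>"
      using permutes_bij[OF \<sigma>] permutes_bij[OF \<rho>] permutes_inv_o(2)[OF \<sigma>] by (simp add: o_inv_distrib comp_assoc)
    then show "?F (\<sigma> \<circ> \<rho>) = (\<epsilon> (pE (inv' \<rho>) s) \<otimes>\<^bsub>R\<^esub> \<epsilon> (pE (inv' \<rho>) t)) \<odot>\<^bsub>tpow R d U\<^esub>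
        tpow_perm R d U \<rho> (tpow_perm R d U \<sigma> u)"
      using tpow_perm_perm[OF mU \<sigma> \<rho> u] by simp
  qed
  also have "\<dots> = D U (tpow_perm R d U \<sigma> u) (tpow_pair R d E E s t)"
    by (rule omega_diag_apply[OF st \<sigma>u, symmetric])
  finally show "gam_comp R d (tensor_module R E E) (D U u) (gam_tensor R d E E E E a a) (tpow_pair R d E E s t) =
      D U (tpow_perm R d U \<sigma> u) (tpow_pair R d E E s t)" .
qed

end

private abbreviation "\<Omega> \<equiv> gam_omega R d"
private abbreviation "S \<equiv> sym_power R d"
private abbreviation "\<Gamma> \<equiv> gam_repr R d"
private abbreviation "ecl \<equiv> sym_class R d E e"

private lemmas symp = sym_power_spf[of R d]

private lemma ecl_closed: "ecl \<in> carrier (ob S E)"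
  using sym_power_carrier[OF omega_obj_fgproj, of d] omega_vec_closed by blast

private lemma x_closed: "\<eta> \<in> carrier (nat_module R d \<Omega> (\<Gamma> V)) \<Longrightarrow> \<eta> E e \<in> carrier (gam_hom R d V E)"
  using nat_moduleD(5)[of \<eta> R d \<Omega> "\<Gamma> V" E e] omega_obj_fgproj omega_vec_closed by simp

private lemma x_closed': "\<eta> \<in> carrier (nat_module R d \<Omega> (\<Gamma> V)) \<Longrightarrow> \<eta> E e \<in> carrier (ob (\<Gamma> V) E)"
  using x_closed by simp

private lemma gen_closed:
  assumes "V \<in> fgproj R" "\<eta> \<in> carrier (nat_module R d \<Omega> (\<Gamma> V))" "U \<in> fgproj R" "u \<in> carrier (tpow R d U)"
  shows "day_gen R d (\<Gamma> V) S U (E, E, D U u, \<eta> E e, ecl) \<in> carrier (day_module R d (\<Gamma> V) S U)"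
  using day_gen_closed[OF R gam_repr_spf[OF assms(1)] symp assms(3) omega_obj_fgproj omega_obj_fgproj
      omega_diag_closed[OF assms(3,4)] x_closed'[OF assms(2)] ecl_closed] .

section \<open>Linear forms on a tensor power and the Schur functor of a representable
  functor\<close>

context
  fixes V :: "'a obj"
  assumes V: "V \<in> fgproj R"
begin

private abbreviation "TV \<equiv> tpow R d V"
private abbreviation "\<Gamma>\<^sub>V \<equiv> \<Gamma> V"
private abbreviation "F\<Gamma> \<equiv> nat_module R d \<Omega> \<Gamma>\<^sub>V"
private abbreviation "\<eta>c \<equiv> symmetrize_trans R d V"

private lemmas mV = fgprojD(2)[OF V]
private lemmas repr = gam_repr_spf[OF V, of d]

private lemma F\<Gamma>_module: "module R F\<Gamma>"
  by (rule nat_module_module[OF R gam_omega_prefunctor repr])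

interpretation F\<Gamma>: module R F\<Gamma> by (rule F\<Gamma>_module)
interpretation TV: module R TV by (rule tpow_module[OF mV])

private lemma symmetrize_trans_apply:
  "\<lbrakk>U \<in> fgproj R; u \<in> carrier (tpow R d U)\<rbrakk> \<Longrightarrow> \<eta>c c U u = symmetrize R d V U c u"
  by (simp add: symmetrize_trans_def)

lemma symmetrize_trans_closed:
  assumes c: "linear_map R TV (self_module R) c"
  shows "\<eta>c c \<in> carrier F\<Gamma>"
proof -
  have "(\<lambda>U\<in>fgproj R. restrict (symmetrize R d V U c) (carrier (ob \<Omega> U))) \<in> carrier F\<Gamma>"
    by (rule nat_moduleI)
      (auto simp: gam_homD(4) symmetrize_closed[OF mV fgprojD(2) c]
        symmetrize_natural[OF mV fgprojD(2) c fgprojD(2)] intro: tpow_module fgprojD symmetrize_linear[OF mV _ c])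
  then show ?thesis by (simp add: symmetrize_trans_def)
qed

private lemma F\<Gamma>_apply_closed:
  "\<lbrakk>\<eta> \<in> carrier F\<Gamma>; U \<in> fgproj R; u \<in> carrier (tpow R d U)\<rbrakk> \<Longrightarrow> \<eta> U u \<in> carrier (gam_hom R d V U)"
  using nat_moduleD(5)[of \<eta> R d \<Omega> \<Gamma>\<^sub>V U u] by simp

private lemma F\<Gamma>_eqI:
  assumes "\<eta> \<in> carrier F\<Gamma>" "\<theta> \<in> carrier F\<Gamma>"
    and "\<And>U u v. \<lbrakk>U \<in> fgproj R; u \<in> carrier (tpow R d U); v \<in> carrier TV\<rbrakk> \<Longrightarrow> \<eta> U u v = \<theta> U u v"
  shows "\<eta> = \<theta>"
  using assms by (intro nat_trans_eqI[OF assms(1,2)] gam_hom_eqI[where V = V]) (auto intro: F\<Gamma>_apply_closed)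

private lemma F\<Gamma>_natural:
  assumes "\<eta> \<in> carrier F\<Gamma>" "U \<in> fgproj R" "U' \<in> fgproj R" "f \<in> carrier (gam_hom R d U U')" "u \<in> carrier (tpow R d U)"
  shows "\<eta> U' (f u) = gam_comp R d V f (\<eta> U u)"
  using nat_moduleD(4)[OF assms(1-4), of u] F\<Gamma>_apply_closed[OF assms(1,2,5)] assms(5) by simp

private lemma coeff_linear:
  assumes "\<eta> \<in> carrier F\<Gamma>"
  shows "linear_map R TV (self_module R) (\<lambda>v. \<epsilon> (\<eta> E e v))"
  by (rule linear_map_comp[OF gam_homD(2)[OF F\<Gamma>_apply_closed[OF assms omega_obj_fgproj omega_vec_closed]] omega_coeff_linear])

text \<open>Naturality along \<open>omega_point R d U u\<close>, which sends \<open>e\<close> to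
  \<open>u\<close>, gives \<eta>(u) as the composite of this morphism with \<eta>(e). Expanding the
  symmetrisation and using equivariance of \<eta>(e) turns it into \<eta>_c with c = \<epsilon>
  \<circ> \<eta>(e).\<close>

lemma symmetrize_trans_coeff:
  assumes \<eta>: "\<eta> \<in> carrier F\<Gamma>"
  shows "\<eta>c (\<lambda>v. \<epsilon> (\<eta> E e v)) = \<eta>"
proof (rule F\<Gamma>_eqI[OF symmetrize_trans_closed[OF coeff_linear[OF \<eta>]] \<eta>])
  fix U u v assume U: "U \<in> fgproj R" and u: "u \<in> carrier (tpow R d U)" and v: "v \<in> carrier TV"
  interpret TU: module R "tpow R d U" by (rule tpow_module[OF fgprojD(2)[OF U]])
  have x: "\<eta> E e \<in> carrier (gam_hom R d V E)" by (rule F\<Gamma>_apply_closed[OF \<eta> omega_obj_fgproj omega_vec_closed])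
  note p = omega_point_closed[OF U u]
  have "\<eta> U u = \<eta> U (omega_point R d U u e)" by (simp add: omega_point_vec[OF U u])
  also have "\<dots> = gam_comp R d V (omega_point R d U u) (\<eta> E e)" by (rule F\<Gamma>_natural[OF \<eta> omega_obj_fgproj U p omega_vec_closed])
  finally have "\<eta> U u v = omega_point R d U u (\<eta> E e v)" using v by (simp add: gam_comp_apply)
  also have "\<dots> = symmetrize R d V U (\<lambda>v. \<epsilon> (\<eta> E e v)) u v"
    unfolding omega_point_apply[OF U gam_homD(4)[OF x v]] symmetrize_apply[OF mV fgprojD(2)[OF U] coeff_linear[OF \<eta>] v]
    using v u gam_homD(3)[OF x] gam_homD(4)[OF x]
    by (intro TU.finsum_cong') (auto simp: permutes_inv tpow_perm_closed[OF mV] tpow_perm_closed[OF fgprojD(2)[OF U]]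
        tpow_perm_closed[OF mE] omega_coeff_closed)
  finally show "\<eta>c (\<lambda>v. \<epsilon> (\<eta> E e v)) U u v = \<eta> U u v" by (simp add: symmetrize_trans_apply[OF U u])
qed

text \<open>Reindexing the sum by \<open>\<sigma> \<circ> \<tau>\<close> moves a permutation of
  \<open>u\<close> to the argument of \<open>c\<close>. On linear forms the left action of \<sigma>
  on \<F>(\<Gamma>^{d,V}) is therefore c \<mapsto> c \<circ> \<sigma>.\<close>

lemma symmetrize_trans_perm:
  assumes c: "linear_map R TV (self_module R) c" and \<sigma>: "\<sigma> permutes {1..d}"
  shows "nat_comp R \<Omega> (\<eta>c c) (gam_omega_perm R d \<sigma>) = \<eta>c (\<lambda>v. c (tpow_perm R d V \<sigma> v))"
proof (rule F\<Gamma>_eqI)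
  have c': "linear_map R TV (self_module R) (\<lambda>v. c (tpow_perm R d V \<sigma> v))"
    by (rule linear_map_comp[OF tpow_perm_linear_pure(1)[OF mV \<sigma>] c])
  show "nat_comp R \<Omega> (\<eta>c c) (gam_omega_perm R d \<sigma>) \<in> carrier F\<Gamma>"
    by (rule nat_comp_closed[OF gam_omega_prefunctor gam_omega_perm_closed[OF \<sigma>] symmetrize_trans_closed[OF c]])
  show "\<eta>c (\<lambda>v. c (tpow_perm R d V \<sigma> v)) \<in> carrier F\<Gamma>" by (rule symmetrize_trans_closed[OF c'])
  fix U u v assume U: "U \<in> fgproj R" and u: "u \<in> carrier (tpow R d U)" and v: "v \<in> carrier TV"
  note mU = fgprojD(2)[OF U]
  interpret TU: module R "tpow R d U" by (rule tpow_module[OF mU])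
  have cl: "c v \<in> carrier R" if "v \<in> carrier TV" for v using linear_mapD(1)[OF c that] by simp
  let ?f = "\<lambda>\<rho>. c (tpow_perm R d V (inv' \<rho> \<circ> \<sigma>) v) \<odot>\<^bsub>tpow R d U\<^esub> tpow_perm R d U \<rho> u"
  have f: "?f \<rho> \<in> carrier (tpow R d U)" if "\<rho> permutes {1..d}" for \<rho>
    by (intro TU.smult_closed cl tpow_perm_closed[OF mV] tpow_perm_closed[OF mU] permutes_compose[OF \<sigma>] permutes_inv that u v)
  have "nat_comp R \<Omega> (\<eta>c c) (gam_omega_perm R d \<sigma>) U u = symmetrize R d V U c (tpow_perm R d U \<sigma> u)"
    using U u by (simp add: nat_comp_apply gam_omega_perm_apply symmetrize_trans_apply tpow_perm_closed[OF mU \<sigma>])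
  then have "nat_comp R \<Omega> (\<eta>c c) (gam_omega_perm R d \<sigma>) U u v =
      (\<Oplus>\<^bsub>tpow R d U\<^esub>\<tau>\<in>{\<tau>. \<tau> permutes {1..d}}. c (tpow_perm R d V (inv' \<tau>) v) \<odot>\<^bsub>tpow R d U\<^esub> tpow_perm R d U \<tau> (tpow_perm R d U \<sigma> u))"
    by (simp add: symmetrize_apply[OF mV mU c v])
  also have "\<dots> = (\<Oplus>\<^bsub>tpow R d U\<^esub>\<tau>\<in>{\<tau>. \<tau> permutes {1..d}}. ?f (\<sigma> \<circ> \<tau>))"
  proof (rule TU.finsum_cong', simp)
    show "(\<lambda>\<tau>. ?f (\<sigma> \<circ> \<tau>)) \<in> {\<tau>. \<tau> permutes {1..d}} \<rightarrow> carrier (tpow R d U)"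
      using f permutes_compose[OF _ \<sigma>] by blast
    fix \<tau> assume "\<tau> \<in> {\<tau>. \<tau> permutes {1..d}}"
    then have \<tau>: "\<tau> permutes {1..d}" by simp
    have "inv' (\<sigma> \<circ> \<tau>) \<circ> \<sigma> = inv' \<tau>"
      using permutes_bij[OF \<sigma>] permutes_bij[OF \<tau>] permutes_inv_o(2)[OF \<sigma>] by (simp add: o_inv_distrib comp_assoc)
    then show "c (tpow_perm R d V (inv' \<tau>) v) \<odot>\<^bsub>tpow R d U\<^esub> tpow_perm R d U \<tau> (tpow_perm R d U \<sigma> u) = ?f (\<sigma> \<circ> \<tau>)"
      using tpow_perm_perm[OF mU \<sigma> \<tau> u] by simp
  qed
  also have "\<dots> = (\<Oplus>\<^bsub>tpow R d U\<^esub>\<rho>\<in>{\<rho>. \<rho> permutes {1..d}}. ?f \<rho>)"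
    by (rule TU.finsum_permutes_shift(1)[OF \<sigma> f])
  also have "\<dots> = symmetrize R d V U (\<lambda>v. c (tpow_perm R d V \<sigma> v)) u v"
    unfolding symmetrize_apply[OF mV mU c' v] using f v
    by (intro TU.finsum_cong') (auto simp: tpow_perm_perm[OF mV _ \<sigma>] permutes_inv)
  finally show "nat_comp R \<Omega> (\<eta>c c) (gam_omega_perm R d \<sigma>) U u v = \<eta>c (\<lambda>v. c (tpow_perm R d V \<sigma> v)) U u v"
    by (simp add: symmetrize_trans_apply[OF U u])
qed

text \<open>The reason is c = \<Sum>_k c(p_k) \<xi>_k. Pointwise, after exchanging the two sums, the
  dual basis is applied for each \<sigma> to the linear map v \<mapsto> c(v) u\<sigma>. An arbitrary
  linear map on \<F>(\<Gamma>^{d,V}) can then be evaluated at \<eta>_c through finitely many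
  values.\<close>

lemma symmetrize_trans_expansion:
  assumes B: "dual_basis R TV A p \<xi>" and c: "linear_map R TV (self_module R) c"
  shows "\<eta>c c = (\<Oplus>\<^bsub>F\<Gamma>\<^esub>k\<in>A. c (p k) \<odot>\<^bsub>F\<Gamma>\<^esub> \<eta>c (\<xi> k))"
proof (rule F\<Gamma>_eqI[OF symmetrize_trans_closed[OF c]])
  note BD = dual_basisD[OF B]
  have cl: "c v \<in> carrier R" if "v \<in> carrier TV" for v using linear_mapD(1)[OF c that] by simp
  have t: "c (p k) \<odot>\<^bsub>F\<Gamma>\<^esub> \<eta>c (\<xi> k) \<in> carrier F\<Gamma>" if "k \<in> A" for k
    using that BD(2,3) by (intro F\<Gamma>.smult_closed cl symmetrize_trans_closed) auto
  show "(\<Oplus>\<^bsub>F\<Gamma>\<^esub>k\<in>A. c (p k) \<odot>\<^bsub>F\<Gamma>\<^esub> \<eta>c (\<xi> k)) \<in> carrier F\<Gamma>"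
    using t by (intro F\<Gamma>.finsum_closed) auto
  fix U u v assume U: "U \<in> fgproj R" and u: "u \<in> carrier (tpow R d U)" and v: "v \<in> carrier TV"
  note mU = fgprojD(2)[OF U]
  interpret TU: module R "tpow R d U" by (rule tpow_module[OF mU])
  let ?P = "{\<sigma>::nat \<Rightarrow> nat. \<sigma> permutes {1..d}}"
  have fin: "finite ?P" by (simp add: finite_permutations)
  have vp: "tpow_perm R d V (inv' \<sigma>) v \<in> carrier TV" if "\<sigma> permutes {1..d}" for \<sigma>
    by (rule tpow_perm_closed[OF mV permutes_inv[OF that] v])
  have up: "tpow_perm R d U \<sigma> u \<in> carrier (tpow R d U)" if "\<sigma> permutes {1..d}" for \<sigma>
    by (rule tpow_perm_closed[OF mU that u])
  have uo: "u \<in> carrier (ob \<Omega> U)" using u by simp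
  have "linear_map R F\<Gamma> (gam_hom R d V U) (\<lambda>\<eta>. \<eta> U u)"
    using nat_module_eval_linear[OF U uo, of d \<Gamma>\<^sub>V] by simp
  note ev = linear_map_comp[OF this gam_hom_eval_linear[OF v]]
  note \<xi>cl = dual_basis_value_closed[OF B]
  have "(\<Oplus>\<^bsub>F\<Gamma>\<^esub>k\<in>A. c (p k) \<odot>\<^bsub>F\<Gamma>\<^esub> \<eta>c (\<xi> k)) U u v = (\<Oplus>\<^bsub>tpow R d U\<^esub>k\<in>A. (c (p k) \<odot>\<^bsub>F\<Gamma>\<^esub> \<eta>c (\<xi> k)) U u v)"
    by (rule linear_map_finsum[OF F\<Gamma>_module TU.module_axioms ev BD(1) t])
  also have "\<dots> = (\<Oplus>\<^bsub>tpow R d U\<^esub>k\<in>A. \<Oplus>\<^bsub>tpow R d U\<^esub>\<sigma>\<in>?P.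
      \<xi> k (tpow_perm R d V (inv' \<sigma>) v) \<odot>\<^bsub>tpow R d U\<^esub> (c (p k) \<odot>\<^bsub>tpow R d U\<^esub> tpow_perm R d U \<sigma> u))"
  proof (rule TU.finsum_cong', simp)
    show "(\<lambda>k. \<Oplus>\<^bsub>tpow R d U\<^esub>\<sigma>\<in>?P. \<xi> k (tpow_perm R d V (inv' \<sigma>) v) \<odot>\<^bsub>tpow R d U\<^esub>
        (c (p k) \<odot>\<^bsub>tpow R d U\<^esub> tpow_perm R d U \<sigma> u)) \<in> A \<rightarrow> carrier (tpow R d U)"
      using \<xi>cl vp up cl BD(2) by (intro Pi_I TU.finsum_closed) auto
    fix k assume k: "k \<in> A"
    have "(c (p k) \<odot>\<^bsub>F\<Gamma>\<^esub> \<eta>c (\<xi> k)) U u v = c (p k) \<odot>\<^bsub>tpow R d U\<^esub> \<eta>c (\<xi> k) U u v"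
      using linear_mapD(3)[OF ev cl[OF BD(2)[OF k]] symmetrize_trans_closed[OF BD(3)[OF k]]] .
    also have "\<eta>c (\<xi> k) U u v = (\<Oplus>\<^bsub>tpow R d U\<^esub>\<sigma>\<in>?P. \<xi> k (tpow_perm R d V (inv' \<sigma>) v) \<odot>\<^bsub>tpow R d U\<^esub> tpow_perm R d U \<sigma> u)"
      by (simp add: symmetrize_trans_apply[OF U u] symmetrize_apply[OF mV mU BD(3)[OF k] v])
    also have "c (p k) \<odot>\<^bsub>tpow R d U\<^esub> \<dots> =
        (\<Oplus>\<^bsub>tpow R d U\<^esub>\<sigma>\<in>?P. c (p k) \<odot>\<^bsub>tpow R d U\<^esub> (\<xi> k (tpow_perm R d V (inv' \<sigma>) v) \<odot>\<^bsub>tpow R d U\<^esub> tpow_perm R d U \<sigma> u))"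
      using \<xi>cl[OF k] vp up cl[OF BD(2)[OF k]] by (intro TU.finsum_smult_ldistr fin) auto
    also have "\<dots> = (\<Oplus>\<^bsub>tpow R d U\<^esub>\<sigma>\<in>?P. \<xi> k (tpow_perm R d V (inv' \<sigma>) v) \<odot>\<^bsub>tpow R d U\<^esub>
        (c (p k) \<odot>\<^bsub>tpow R d U\<^esub> tpow_perm R d U \<sigma> u))"
      using \<xi>cl[OF k] vp up cl[OF BD(2)[OF k]]
      by (intro TU.finsum_cong') (auto simp: R.m_comm simp flip: TU.smult_assoc1)
    finally show "(c (p k) \<odot>\<^bsub>F\<Gamma>\<^esub> \<eta>c (\<xi> k)) U u v = \<dots>" .
  qed
  also have "\<dots> = (\<Oplus>\<^bsub>tpow R d U\<^esub>\<sigma>\<in>?P. \<Oplus>\<^bsub>tpow R d U\<^esub>k\<in>A.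
      \<xi> k (tpow_perm R d V (inv' \<sigma>) v) \<odot>\<^bsub>tpow R d U\<^esub> (c (p k) \<odot>\<^bsub>tpow R d U\<^esub> tpow_perm R d U \<sigma> u))"
    using \<xi>cl vp up cl BD(2) by (intro TU.finsum_swap BD(1) fin) auto
  also have "\<dots> = (\<Oplus>\<^bsub>tpow R d U\<^esub>\<sigma>\<in>?P. c (tpow_perm R d V (inv' \<sigma>) v) \<odot>\<^bsub>tpow R d U\<^esub> tpow_perm R d U \<sigma> u)"
  proof (rule TU.finsum_cong', simp)
    show "(\<lambda>\<sigma>. c (tpow_perm R d V (inv' \<sigma>) v) \<odot>\<^bsub>tpow R d U\<^esub> tpow_perm R d U \<sigma> u) \<in> ?P \<rightarrow> carrier (tpow R d U)"
      using vp up cl by auto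
    fix \<sigma> assume "\<sigma> \<in> ?P"
    then have \<sigma>: "\<sigma> permutes {1..d}" by simp
    show "(\<Oplus>\<^bsub>tpow R d U\<^esub>k\<in>A. \<xi> k (tpow_perm R d V (inv' \<sigma>) v) \<odot>\<^bsub>tpow R d U\<^esub> (c (p k) \<odot>\<^bsub>tpow R d U\<^esub> tpow_perm R d U \<sigma> u)) =
        c (tpow_perm R d V (inv' \<sigma>) v) \<odot>\<^bsub>tpow R d U\<^esub> tpow_perm R d U \<sigma> u"
      by (rule dual_basis_linear[OF TV.module_axioms TU.module_axioms B
            linear_map_smult_vector[OF TU.module_axioms c up[OF \<sigma>]] vp[OF \<sigma>], symmetric])
  qed
  also have "\<dots> = \<eta>c c U u v"
    by (simp add: symmetrize_trans_apply[OF U u] symmetrize_apply[OF mV mU c v])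
  finally show "\<eta>c c U u v = (\<Oplus>\<^bsub>F\<Gamma>\<^esub>k\<in>A. c (p k) \<odot>\<^bsub>F\<Gamma>\<^esub> \<eta>c (\<xi> k)) U u v" by simp
qed

section \<open>The comparison map for a fixed target functor\<close>

context
  fixes X :: "('a, 'm) spf"
  assumes X: "strict_polynomial_functor R d X"
begin

private abbreviation "FX \<equiv> nat_module R d \<Omega> X"
private abbreviation "DX \<equiv> nat_module R d (day_tensor R d \<Gamma>\<^sub>V S) X"
private abbreviation "gen \<equiv> day_gen R d \<Gamma>\<^sub>V S"
private abbreviation "\<Phi> \<equiv> day_schur R d V"
private abbreviation "EE \<equiv> tensor_module R E E"

private lemmas pV = fgprojD(1)[OF V]
private lemmas mX = strict_polynomial_functor.ob_module[OF X]

private lemma FX_module: "module R FX"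
  by (rule nat_module_module[OF R gam_omega_prefunctor X])

private lemma F_eval_linear:
  assumes "U \<in> fgproj R" "u \<in> carrier (tpow R d U)"
  shows "linear_map R (nat_module R d \<Omega> Y) (ob Y U) (\<lambda>\<eta>. \<eta> U u)"
  using nat_module_eval_linear[OF assms(1), of u \<Omega> d Y] assms(2) by simp

private lemma F_closed:
  "\<lbrakk>\<eta> \<in> carrier (nat_module R d \<Omega> Y); U \<in> fgproj R; u \<in> carrier (tpow R d U)\<rbrakk> \<Longrightarrow> \<eta> U u \<in> carrier (ob Y U)"
  using nat_moduleD(5)[of \<eta> R d \<Omega> Y U u] by simp

private lemma F_eqI:
  assumes "\<eta> \<in> carrier (nat_module R d \<Omega> Y)" "\<theta> \<in> carrier (nat_module R d \<Omega> Y)"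
    and "\<And>U u. \<lbrakk>U \<in> fgproj R; u \<in> carrier (tpow R d U)\<rbrakk> \<Longrightarrow> \<eta> U u = \<theta> U u"
  shows "\<eta> = \<theta>"
  using assms by (intro nat_trans_eqI[OF assms(1,2)]) auto

private lemma act_apply:
  "\<lbrakk>U \<in> fgproj R; u \<in> carrier (tpow R d U)\<rbrakk> \<Longrightarrow>
    nat_comp R \<Omega> \<eta> (gam_omega_perm R d \<sigma>) U u = \<eta> U (tpow_perm R d U \<sigma> u)"
  by (simp add: nat_comp_apply gam_omega_perm_apply)

private lemma act_closed:
  "\<lbrakk>\<eta> \<in> carrier (nat_module R d \<Omega> Y); \<sigma> permutes {1..d}\<rbrakk> \<Longrightarrow>
    nat_comp R \<Omega> \<eta> (gam_omega_perm R d \<sigma>) \<in> carrier (nat_module R d \<Omega> Y)"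
  by (rule nat_comp_closed[OF gam_omega_prefunctor gam_omega_perm_closed])

private lemmas cocone = day_coconeD[OF day_gen_cocone[OF R repr symp]]

lemma day_schur_apply:
  "\<lbrakk>\<eta> \<in> carrier F\<Gamma>; U \<in> fgproj R; u \<in> carrier (tpow R d U)\<rbrakk> \<Longrightarrow>
    \<Phi> \<phi> \<eta> U u = \<phi> U (gen U (E, E, D U u, \<eta> E e, ecl))"
  by (simp add: day_schur_def)

text \<open>Naturality in \<open>U\<close> comes from \<open>omega_diag_natural\<close>: the Day
  convolution acts by composition on the morphism of a generator, and composing D_u with
  \<open>g\<close> gives D_{g(u)}.\<close>

lemma day_schur_value_closed:
  assumes \<phi>: "\<phi> \<in> carrier DX" and \<eta>: "\<eta> \<in> carrier F\<Gamma>"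
  shows "\<Phi> \<phi> \<eta> \<in> carrier FX"
proof -
  let ?t = "\<lambda>U u. \<phi> U (gen U (E, E, D U u, \<eta> E e, ecl))"
  have "(\<lambda>U\<in>fgproj R. restrict (?t U) (carrier (ob \<Omega> U))) \<in> carrier FX"
  proof (rule nat_moduleI)
    show "module R (ob \<Omega> U)" if "U \<in> fgproj R" for U
      using tpow_module[OF fgprojD(2)[OF that]] by simp
    show "linear_map R (ob \<Omega> U) (ob X U) (?t U)" if U: "U \<in> fgproj R" for U
      using linear_map_comp[OF linear_map_comp[OF omega_diag_linear[OF U] cocone(1)[OF U omega_obj_fgproj omega_obj_fgproj x_closed'[OF \<eta>] ecl_closed]]]
        nat_moduleD(3)[OF \<phi> U] by simp
    fix U U' g u assume U: "U \<in> fgproj R" and U': "U' \<in> fgproj R" and g: "g \<in> carrier (gam_hom R d U U')"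
      and u: "u \<in> carrier (ob \<Omega> U)"
    have u': "u \<in> carrier (tpow R d U)" using u by simp
    have "?t U' (g u) = \<phi> U' (ar (day_tensor R d \<Gamma>\<^sub>V S) U U' g (gen U (E, E, D U u, \<eta> E e, ecl)))"
      by (simp only: day_tensor_ar(2)[OF R repr symp U U' g omega_obj_fgproj omega_obj_fgproj omega_diag_closed[OF U u'] x_closed'[OF \<eta>] ecl_closed]
          omega_diag_natural[OF U U' g u'])
    also have "\<dots> = ar X U U' g (?t U u)"
      using nat_moduleD(4)[OF \<phi> U U' g] gen_closed[OF V \<eta> U u'] by simp
    finally show "ar \<Omega> U U' g u \<in> carrier (ob \<Omega> U') \<and> ?t U' (ar \<Omega> U U' g u) = ar X U U' g (?t U u)"
      using gam_homD(4)[OF g u'] by simp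
  qed
  then show ?thesis using \<eta> by (simp add: day_schur_def)
qed

text \<open>Acting by \<sigma> replaces \<eta>(e) by \<eta>(e\<sigma>) = a \<circ> \<eta>(e), where
  \<open>a\<close> is an endomorphism of \<open>E\<close> with a(e) = e\<sigma>. In the coinvariants
  also [e] = S^d(a)[e], so the coend relation moves \<open>a\<close> from both values into D_u, and
  \<open>omega_diag_perm\<close> turns the result into D_{u\<sigma>}. This is the step for which the
  second factor has to be S^d.\<close>

private lemma day_schur_equivariant:
  assumes \<phi>: "\<phi> \<in> carrier DX" and \<sigma>: "\<sigma> permutes {1..d}" and \<eta>: "\<eta> \<in> carrier F\<Gamma>"
  shows "\<Phi> \<phi> (nat_comp R \<Omega> \<eta> (gam_omega_perm R d \<sigma>)) = nat_comp R \<Omega> (\<Phi> \<phi> \<eta>) (gam_omega_perm R d \<sigma>)"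
proof (rule F_eqI[OF day_schur_value_closed[OF \<phi> act_closed[OF \<eta> \<sigma>]] act_closed[OF day_schur_value_closed[OF \<phi> \<eta>] \<sigma>]])
  fix U u assume U: "U \<in> fgproj R" and u: "u \<in> carrier (tpow R d U)"
  note mU = fgprojD(2)[OF U]
  have \<sigma>e: "tpow_perm R d E \<sigma> e \<in> carrier TE" by (rule tpow_perm_closed[OF mE \<sigma> omega_vec_closed])
  have \<sigma>u: "tpow_perm R d U \<sigma> u \<in> carrier (tpow R d U)" by (rule tpow_perm_closed[OF mU \<sigma> u])
  define a where "a = symmetrize R d E E \<epsilon> (tpow_perm R d E \<sigma> e)"
  have a_eq: "a = omega_point R d E (tpow_perm R d E \<sigma> e)" by (simp add: a_def omega_point_def)
  have a: "a \<in> carrier (gam_hom R d E E)" unfolding a_eq by (rule omega_point_closed[OF omega_obj_fgproj \<sigma>e])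
  have ae: "a e = tpow_perm R d E \<sigma> e" unfolding a_eq by (rule omega_point_vec[OF omega_obj_fgproj \<sigma>e])
  have "nat_comp R \<Omega> \<eta> (gam_omega_perm R d \<sigma>) E e = \<eta> E (ar \<Omega> E E a e)"
    using omega_obj_fgproj omega_vec_closed by (simp add: act_apply ae)
  also have "\<dots> = ar \<Gamma>\<^sub>V E E a (\<eta> E e)"
    using nat_moduleD(4)[OF \<eta> omega_obj_fgproj omega_obj_fgproj a, of e] omega_vec_closed by simp
  finally have x: "nat_comp R \<Omega> \<eta> (gam_omega_perm R d \<sigma>) E e = ar \<Gamma>\<^sub>V E E a (\<eta> E e)" .
  have ec: "ar S E E a ecl = ecl"
    by (simp add: sym_power_ar[OF omega_obj_fgproj omega_obj_fgproj a omega_vec_closed] ae sym_class_perm[OF omega_obj_fgproj \<sigma> omega_vec_closed])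
  have "\<Phi> \<phi> (nat_comp R \<Omega> \<eta> (gam_omega_perm R d \<sigma>)) U u = \<phi> U (gen U (E, E, D U u, ar \<Gamma>\<^sub>V E E a (\<eta> E e), ar S E E a ecl))"
    by (simp only: day_schur_apply[OF act_closed[OF \<eta> \<sigma>] U u] x ec)
  also have "\<dots> = \<phi> U (gen U (E, E, gam_comp R d EE (D U u) (gam_tensor R d E E E E a a), \<eta> E e, ecl))"
    by (simp only: cocone(3)[OF U omega_obj_fgproj omega_obj_fgproj omega_obj_fgproj omega_obj_fgproj omega_diag_closed[OF U u] a a x_closed'[OF \<eta>] ecl_closed])
  also have "\<dots> = \<phi> U (gen U (E, E, D U (tpow_perm R d U \<sigma> u), \<eta> E e, ecl))"
    unfolding a_def by (simp only: omega_diag_perm[OF U \<sigma> u])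
  also have "\<dots> = nat_comp R \<Omega> (\<Phi> \<phi> \<eta>) (gam_omega_perm R d \<sigma>) U u"
    by (simp add: act_apply[OF U u] day_schur_apply[OF \<eta> U \<sigma>u])
  finally show "\<Phi> \<phi> (nat_comp R \<Omega> \<eta> (gam_omega_perm R d \<sigma>)) U u =
      nat_comp R \<Omega> (\<Phi> \<phi> \<eta>) (gam_omega_perm R d \<sigma>) U u" .
qed

lemma day_schur_closed:
  assumes \<phi>: "\<phi> \<in> carrier DX"
  shows "\<Phi> \<phi> \<in> carrier (ob (g_hom R d (schur R d X)) V)"
  unfolding g_hom_ob_carrier
proof (intro conjI allI impI ballI)
  interpret FX: module R FX by (rule FX_module)
  show "\<Phi> \<phi> \<in> extensional (carrier F\<Gamma>)" by (simp add: day_schur_def)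
  note vc = day_schur_value_closed[OF \<phi>]
  show "linear_map R F\<Gamma> FX (\<Phi> \<phi>)"
  proof (rule linear_mapI[OF vc])
    have lin: "linear_map R F\<Gamma> (ob X U) (\<lambda>\<eta>. \<phi> U (gen U (E, E, D U u, \<eta> E e, ecl)))"
      if U: "U \<in> fgproj R" and u: "u \<in> carrier (tpow R d U)" for U u
      using linear_map_comp[OF linear_map_comp[OF F_eval_linear[OF omega_obj_fgproj omega_vec_closed]
          bilinear_mapD(2)[OF cocone(2)[OF U omega_obj_fgproj omega_obj_fgproj omega_diag_closed[OF U u]] ecl_closed]]]
        nat_moduleD(3)[OF \<phi> U] by simp
    show "\<Phi> \<phi> (\<eta> \<oplus>\<^bsub>F\<Gamma>\<^esub> \<eta>') = \<Phi> \<phi> \<eta> \<oplus>\<^bsub>FX\<^esub> \<Phi> \<phi> \<eta>'" if "\<eta> \<in> carrier F\<Gamma>" "\<eta>' \<in> carrier F\<Gamma>" for \<eta> \<eta>'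
    proof (rule F_eqI[OF vc[OF F\<Gamma>.a_closed[OF that]] FX.a_closed[OF vc[OF that(1)] vc[OF that(2)]]])
      fix U u assume U: "U \<in> fgproj R" and u: "u \<in> carrier (tpow R d U)"
      show "\<Phi> \<phi> (\<eta> \<oplus>\<^bsub>F\<Gamma>\<^esub> \<eta>') U u = (\<Phi> \<phi> \<eta> \<oplus>\<^bsub>FX\<^esub> \<Phi> \<phi> \<eta>') U u"
        using linear_mapD(2)[OF lin[OF U u] that] linear_mapD(2)[OF F_eval_linear[OF U u] vc[OF that(1)] vc[OF that(2)]]
        by (simp add: day_schur_apply[OF _ U u] that)
    qed
    show "\<Phi> \<phi> (a \<odot>\<^bsub>F\<Gamma>\<^esub> \<eta>) = a \<odot>\<^bsub>FX\<^esub> \<Phi> \<phi> \<eta>" if "a \<in> carrier R" "\<eta> \<in> carrier F\<Gamma>" for a \<eta>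
    proof (rule F_eqI[OF vc[OF F\<Gamma>.smult_closed[OF that]] FX.smult_closed[OF that(1) vc[OF that(2)]]])
      fix U u assume U: "U \<in> fgproj R" and u: "u \<in> carrier (tpow R d U)"
      show "\<Phi> \<phi> (a \<odot>\<^bsub>F\<Gamma>\<^esub> \<eta>) U u = (a \<odot>\<^bsub>FX\<^esub> \<Phi> \<phi> \<eta>) U u"
        using linear_mapD(3)[OF lin[OF U u] that] linear_mapD(3)[OF F_eval_linear[OF U u] that(1) vc[OF that(2)]]
        by (simp add: day_schur_apply[OF _ U u] that)
    qed
  qed
qed (rule day_schur_equivariant[OF \<phi>])

lemma day_schur_linear: "linear_map R DX (ob (g_hom R d (schur R d X)) V) \<Phi>"
proof (rule linear_mapI[OF day_schur_closed])
  interpret FX: module R FX by (rule FX_module)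
  interpret DX: module R DX by (rule nat_module_module[OF R day_tensor_prefunctor[OF R repr symp] X])
  have ev: "linear_map R DX (ob X U) (\<lambda>\<phi>. \<phi> U (gen U (E, E, D U u, \<eta> E e, ecl)))"
    if "\<eta> \<in> carrier F\<Gamma>" "U \<in> fgproj R" "u \<in> carrier (tpow R d U)" for \<eta> U u
    by (rule nat_module_eval_linear[OF that(2)]) (simp add: gen_closed[OF V that])
  note vc = day_schur_value_closed
  show "\<Phi> (\<phi> \<oplus>\<^bsub>DX\<^esub> \<phi>') = \<Phi> \<phi> \<oplus>\<^bsub>ob (g_hom R d (schur R d X)) V\<^esub> \<Phi> \<phi>'"
    if "\<phi> \<in> carrier DX" "\<phi>' \<in> carrier DX" for \<phi> \<phi>'
  proof (rule extensionalityI[where A = "carrier F\<Gamma>"])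
    fix \<eta> assume \<eta>: "\<eta> \<in> carrier F\<Gamma>"
    have "\<Phi> (\<phi> \<oplus>\<^bsub>DX\<^esub> \<phi>') \<eta> = \<Phi> \<phi> \<eta> \<oplus>\<^bsub>FX\<^esub> \<Phi> \<phi>' \<eta>"
    proof (rule F_eqI[OF vc[OF DX.a_closed[OF that] \<eta>] FX.a_closed[OF vc[OF that(1) \<eta>] vc[OF that(2) \<eta>]]])
      fix U u assume U: "U \<in> fgproj R" and u: "u \<in> carrier (tpow R d U)"
      show "\<Phi> (\<phi> \<oplus>\<^bsub>DX\<^esub> \<phi>') \<eta> U u = (\<Phi> \<phi> \<eta> \<oplus>\<^bsub>FX\<^esub> \<Phi> \<phi>' \<eta>) U u"
        using linear_mapD(2)[OF ev[OF \<eta> U u] that] linear_mapD(2)[OF F_eval_linear[OF U u] vc[OF that(1) \<eta>] vc[OF that(2) \<eta>]]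
        by (simp add: day_schur_apply[OF \<eta> U u])
    qed
    then show "\<Phi> (\<phi> \<oplus>\<^bsub>DX\<^esub> \<phi>') \<eta> = (\<Phi> \<phi> \<oplus>\<^bsub>ob (g_hom R d (schur R d X)) V\<^esub> \<Phi> \<phi>') \<eta>"
      using \<eta> by (simp add: g_hom_ob_simps)
  qed (simp_all add: day_schur_def g_hom_ob_simps)
  show "\<Phi> (a \<odot>\<^bsub>DX\<^esub> \<phi>) = a \<odot>\<^bsub>ob (g_hom R d (schur R d X)) V\<^esub> \<Phi> \<phi>"
    if "a \<in> carrier R" "\<phi> \<in> carrier DX" for a \<phi>
  proof (rule extensionalityI[where A = "carrier F\<Gamma>"])
    fix \<eta> assume \<eta>: "\<eta> \<in> carrier F\<Gamma>"
    have "\<Phi> (a \<odot>\<^bsub>DX\<^esub> \<phi>) \<eta> = a \<odot>\<^bsub>FX\<^esub> \<Phi> \<phi> \<eta>"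
    proof (rule F_eqI[OF vc[OF DX.smult_closed[OF that] \<eta>] FX.smult_closed[OF that(1) vc[OF that(2) \<eta>]]])
      fix U u assume U: "U \<in> fgproj R" and u: "u \<in> carrier (tpow R d U)"
      show "\<Phi> (a \<odot>\<^bsub>DX\<^esub> \<phi>) \<eta> U u = (a \<odot>\<^bsub>FX\<^esub> \<Phi> \<phi> \<eta>) U u"
        using linear_mapD(3)[OF ev[OF \<eta> U u] that] linear_mapD(3)[OF F_eval_linear[OF U u] that(1) vc[OF that(2) \<eta>]]
        by (simp add: day_schur_apply[OF \<eta> U u])
    qed
    then show "\<Phi> (a \<odot>\<^bsub>DX\<^esub> \<phi>) \<eta> = (a \<odot>\<^bsub>ob (g_hom R d (schur R d X)) V\<^esub> \<Phi> \<phi>) \<eta>"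
      using \<eta> by (simp add: g_hom_ob_simps)
  qed (simp_all add: day_schur_def g_hom_ob_simps)
qed

private lemma x_symmetrize:
  assumes "linear_map R TV (self_module R) c"
  shows "\<eta>c c E e = symmetrize R d V E c e"
  using omega_obj_fgproj omega_vec_closed by (simp add: symmetrize_trans_def)

text \<open>The form in which a generator (V', W, f, g, [w]) is used from here on: its two morphisms
  enter through this equivariant bilinear map.\<close>

private lemma pair_morphism:
  assumes V': "V' \<in> fgproj R" and W: "W \<in> fgproj R"
    and f: "f \<in> carrier (gam_hom R d (tensor_module R V' W) U)" and g: "g \<in> carrier (gam_hom R d V V')"
  shows "bilinear_map R TV (tpow R d W) (tpow R d U) (\<lambda>v w. f (tpow_pair R d V' W (g v) w))"
    and "\<And>\<sigma> v w. \<lbrakk>\<sigma> permutes {1..d}; v \<in> carrier TV; w \<in> carrier (tpow R d W)\<rbrakk> \<Longrightarrow>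
      f (tpow_pair R d V' W (g (tpow_perm R d V \<sigma> v)) (tpow_perm R d W \<sigma> w)) =
      tpow_perm R d U \<sigma> (f (tpow_pair R d V' W (g v) w))"
proof -
  note mV' = fgprojD(2)[OF V'] and mW = fgprojD(2)[OF W]
  show "bilinear_map R TV (tpow R d W) (tpow R d U) (\<lambda>v w. f (tpow_pair R d V' W (g v) w))"
    by (rule bilinear_map_comp[OF tpow_pair_bilinear[OF mV' mW] gam_homD(2)[OF g] linear_map_id gam_homD(2)[OF f]])
  show "f (tpow_pair R d V' W (g (tpow_perm R d V \<sigma> v)) (tpow_perm R d W \<sigma> w)) =
      tpow_perm R d U \<sigma> (f (tpow_pair R d V' W (g v) w))"
    if "\<sigma> permutes {1..d}" "v \<in> carrier TV" "w \<in> carrier (tpow R d W)" for \<sigma> v w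
    using that gam_homD(3)[OF f that(1) tpow_pair_closed[OF fgprojD(1)[OF V'] fgprojD(1)[OF W] gam_homD(4)[OF g that(2)] that(3)]]
    by (simp add: gam_homD(3)[OF g] tpow_pair_perm[OF mV' mW that(1) gam_homD(4)[OF g that(2)] that(3)])
qed

text \<open>Hence \<open>\<Gamma>\<^bsup>d,V\<^esup> \<otimes> S\<^sup>d\<close> is generated by the classes of \<open>(E, E, D U u, x, ecl)\<close>, on which
  \<^const>\<open>day_schur\<close> is defined.\<close>

private lemma diag_decomposition:
  assumes B: "dual_basis R TV A p \<xi>"
    and V': "V' \<in> fgproj R" and W: "W \<in> fgproj R" and U: "U \<in> fgproj R"
    and f: "f \<in> carrier (gam_hom R d (tensor_module R V' W) U)" and g: "g \<in> carrier (gam_hom R d V V')"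
    and w: "w \<in> carrier (tpow R d W)"
  defines "G \<equiv> \<lambda>j. gam_comp R d (tensor_module R V E) (D U (f (tpow_pair R d V' W (g (p j)) w)))
      (gam_tensor R d V E E E (\<eta>c (\<xi> j) E e) (gam_id R d E))"
  shows "gam_comp R d (tensor_module R V E) f (gam_tensor R d V E V' W g (omega_point R d W w)) =
    (\<Oplus>\<^bsub>gam_hom R d (tensor_module R V E) U\<^esub>j\<in>A. G j)"
    and "\<And>j. j \<in> A \<Longrightarrow> G j \<in> carrier (gam_hom R d (tensor_module R V E) U)"
    and "\<And>j. j \<in> A \<Longrightarrow> f (tpow_pair R d V' W (g (p j)) w) \<in> carrier (tpow R d U)"
proof -
  note mU = fgprojD(2)[OF U] and mV' = fgprojD(2)[OF V'] and mW = fgprojD(2)[OF W]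
  note pV' = fgprojD(1)[OF V'] and pW = fgprojD(1)[OF W]
  note BD = dual_basisD[OF B] and \<xi>cl = dual_basis_value_closed[OF B]
  let ?H = "gam_hom R d (tensor_module R V E) U"
  have mVE: "module R (tensor_module R V E)" by (rule tensor_module_module[OF mV mE])
  interpret H: module R ?H by (rule gam_hom_module[OF mVE mU])
  interpret TU: module R "tpow R d U" by (rule tpow_module[OF mU])
  interpret TW: module R "tpow R d W" by (rule tpow_module[OF mW])
  let ?P = "{\<sigma>::nat \<Rightarrow> nat. \<sigma> permutes {1..d}}"
  have fin: "finite ?P" by (simp add: finite_permutations)
  \<comment> \<open>The equivariant bilinear map of the generator; its values
    \<open>L (p j) w\<close> are the elements at which the D_u in \<open>G j\<close> are
    taken.\<close>
  define L where "L = (\<lambda>v w. f (tpow_pair R d V' W (g v) w))"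
  have L: "bilinear_map R TV (tpow R d W) (tpow R d U) L"
    unfolding L_def by (rule pair_morphism(1)[OF V' W f g])
  note Lcl = bilinear_map_closed[OF L]
  have L_perm: "L (tpow_perm R d V \<sigma> v) (tpow_perm R d W \<sigma> w) = tpow_perm R d U \<sigma> (L v w)"
    if "\<sigma> permutes {1..d}" "v \<in> carrier TV" "w \<in> carrier (tpow R d W)" for \<sigma> v w
    unfolding L_def by (rule pair_morphism(2)[OF V' W f g that])
  show u: "f (tpow_pair R d V' W (g (p j)) w) \<in> carrier (tpow R d U)" if "j \<in> A" for j
    using Lcl[OF BD(2)[OF that] w] by (simp add: L_def)
  have \<eta>: "\<eta>c (\<xi> j) \<in> carrier F\<Gamma>" if "j \<in> A" for j
    by (rule symmetrize_trans_closed[OF BD(3)[OF that]])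
  have t: "gam_tensor R d V E E E (\<eta>c (\<xi> j) E e) (gam_id R d E) \<in> carrier (gam_hom R d (tensor_module R V E) EE)"
    if "j \<in> A" for j
    by (rule gam_tensor_closed[OF pV proj_E proj_E proj_E x_closed[OF \<eta>[OF that]] gam_id_closed[OF mE]])
  show G: "G j \<in> carrier ?H" if "j \<in> A" for j
    unfolding G_def by (rule gam_comp_closed[OF mVE t[OF that] omega_diag_closed[OF U u[OF that]]])
  have a: "omega_point R d W w \<in> carrier (gam_hom R d E W)" by (rule omega_point_closed[OF W w])
  have ga: "gam_tensor R d V E V' W g (omega_point R d W w) \<in> carrier (gam_hom R d (tensor_module R V E) (tensor_module R V' W))"
    by (rule gam_tensor_closed[OF pV proj_E pV' pW g a])
  show "gam_comp R d (tensor_module R V E) f (gam_tensor R d V E V' W g (omega_point R d W w)) = (\<Oplus>\<^bsub>?H\<^esub>j\<in>A. G j)"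
  proof (rule gam_hom_pair_eqI[OF pV proj_E mU])
    show "gam_comp R d (tensor_module R V E) f (gam_tensor R d V E V' W g (omega_point R d W w)) \<in> carrier ?H"
      by (rule gam_comp_closed[OF mVE ga f])
    show "(\<Oplus>\<^bsub>?H\<^esub>j\<in>A. G j) \<in> carrier ?H" using G by (intro H.finsum_closed) auto
    fix v t assume v: "v \<in> carrier TV" and tt: "t \<in> carrier TE"
    have vt: "tpow_pair R d V E v t \<in> carrier (tpow R d (tensor_module R V E))"
      by (rule tpow_pair_closed[OF pV proj_E v tt])
    have vp: "tpow_perm R d V (inv' \<sigma>) v \<in> carrier TV" if "\<sigma> permutes {1..d}" for \<sigma>
      by (rule tpow_perm_closed[OF mV permutes_inv[OF that] v])
    have tp: "\<epsilon> (tpow_perm R d E (inv' \<sigma>) t) \<in> carrier R" if "\<sigma> permutes {1..d}" for \<sigma>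
      by (rule omega_coeff_closed[OF tpow_perm_closed[OF mE permutes_inv[OF that] tt]])
    \<comment> \<open>The summand of \<sigma>, written as a linear function of the element of T^d V
      so that \<open>dual_basis_linear\<close> can contract the sum over \<open>j\<close>.\<close>
    define M where "M = (\<lambda>\<sigma> x. \<epsilon> (tpow_perm R d E (inv' \<sigma>) t) \<odot>\<^bsub>tpow R d U\<^esub> tpow_perm R d U \<sigma> (L x w))"
    have M: "linear_map R TV (tpow R d U) (M \<sigma>)" if "\<sigma> permutes {1..d}" for \<sigma>
      unfolding M_def
      by (rule linear_map_smult[OF TU.module_axioms linear_map_comp[OF bilinear_mapD(2)[OF L w] tpow_perm_linear_pure(1)[OF mU that]] tp[OF that]])
    note Mcl = linear_mapD(1)[OF M]
    have Gj: "G j (tpow_pair R d V E v t) =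
        (\<Oplus>\<^bsub>tpow R d U\<^esub>\<sigma>\<in>?P. \<xi> j (tpow_perm R d V (inv' \<sigma>) v) \<odot>\<^bsub>tpow R d U\<^esub> M \<sigma> (p j))" if j: "j \<in> A" for j
    proof -
      let ?x = "\<eta>c (\<xi> j) E e"
      have x: "?x \<in> carrier (gam_hom R d V E)" by (rule x_closed[OF \<eta>[OF j]])
      \<comment> \<open>The permutation first passes through the equivariant map \<open>?x\<close>;
        then \<epsilon> recovers the form \<xi>_j from its symmetrisation.\<close>
      have xe: "\<epsilon> (tpow_perm R d E (inv' \<sigma>) (?x v)) = \<xi> j (tpow_perm R d V (inv' \<sigma>) v)" if \<sigma>: "\<sigma> permutes {1..d}" for \<sigma>
      proof -
        have "tpow_perm R d E (inv' \<sigma>) (?x v) = ?x (tpow_perm R d V (inv' \<sigma>) v)"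
          using gam_homD(3)[OF x permutes_inv[OF \<sigma>] v] by simp
        then show ?thesis
          by (simp add: x_symmetrize[OF BD(3)[OF j]] symmetrize_coeff[OF mV BD(3)[OF j] vp[OF \<sigma>]])
      qed
      have "G j (tpow_pair R d V E v t) = D U (L (p j) w) (tpow_pair R d E E (?x v) t)"
        by (simp add: G_def L_def gam_comp_apply[OF vt] gam_tensor_pair[OF pV proj_E proj_E proj_E x gam_id_closed[OF mE] v tt] gam_id_apply[OF tt])
      also have "\<dots> = (\<Oplus>\<^bsub>tpow R d U\<^esub>\<sigma>\<in>?P. (\<epsilon> (tpow_perm R d E (inv' \<sigma>) (?x v)) \<otimes>\<^bsub>R\<^esub> \<epsilon> (tpow_perm R d E (inv' \<sigma>) t))
          \<odot>\<^bsub>tpow R d U\<^esub> tpow_perm R d U \<sigma> (L (p j) w))"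
        by (rule omega_diag_apply[OF U gam_homD(4)[OF x v] tt Lcl[OF BD(2)[OF j] w]])
      also have "\<dots> = (\<Oplus>\<^bsub>tpow R d U\<^esub>\<sigma>\<in>?P. \<xi> j (tpow_perm R d V (inv' \<sigma>) v) \<odot>\<^bsub>tpow R d U\<^esub> M \<sigma> (p j))"
        using xe \<xi>cl[OF j vp] tp Mcl[OF _ BD(2)[OF j]] tpow_perm_closed[OF mU _ Lcl[OF BD(2)[OF j] w]]
        by (intro TU.finsum_cong') (auto simp: M_def TU.smult_assoc1)
      finally show ?thesis .
    qed
    have cl: "\<xi> j (tpow_perm R d V (inv' \<sigma>) v) \<odot>\<^bsub>tpow R d U\<^esub> M \<sigma> (p j) \<in> carrier (tpow R d U)"
      if "j \<in> A" "\<sigma> \<in> ?P" for j \<sigma>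
      using that by (intro TU.smult_closed \<xi>cl vp Mcl BD(2)) auto
    have "(\<Oplus>\<^bsub>?H\<^esub>j\<in>A. G j) (tpow_pair R d V E v t) = (\<Oplus>\<^bsub>tpow R d U\<^esub>j\<in>A. G j (tpow_pair R d V E v t))"
      by (rule linear_map_finsum[OF H.module_axioms TU.module_axioms gam_hom_eval_linear[OF vt] BD(1) G])
    also have "\<dots> = (\<Oplus>\<^bsub>tpow R d U\<^esub>j\<in>A. \<Oplus>\<^bsub>tpow R d U\<^esub>\<sigma>\<in>?P. \<xi> j (tpow_perm R d V (inv' \<sigma>) v) \<odot>\<^bsub>tpow R d U\<^esub> M \<sigma> (p j))"
      using Gj cl by (intro TU.finsum_cong') (auto intro!: TU.finsum_closed)
    also have "\<dots> = (\<Oplus>\<^bsub>tpow R d U\<^esub>\<sigma>\<in>?P. \<Oplus>\<^bsub>tpow R d U\<^esub>j\<in>A. \<xi> j (tpow_perm R d V (inv' \<sigma>) v) \<odot>\<^bsub>tpow R d U\<^esub> M \<sigma> (p j))"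
      by (rule TU.finsum_swap[OF BD(1) fin cl])
    also have "\<dots> = (\<Oplus>\<^bsub>tpow R d U\<^esub>\<sigma>\<in>?P. M \<sigma> (tpow_perm R d V (inv' \<sigma>) v))"
      using Mcl[OF _ vp] dual_basis_linear[OF tpow_module[OF mV] TU.module_axioms B M vp]
      by (intro TU.finsum_cong') auto
    \<comment> \<open>By equivariance of \<open>L\<close>, permuting the value of \<open>L\<close>
      at \<open>v\<close> permuted by \<open>inv' \<sigma>\<close> and \<open>w\<close> gives the
      value at \<open>v\<close> and the permuted \<open>w\<close>. All permutations now sit in the
      second argument, where their sum is \<open>omega_point R d W w\<close> applied to
      \<open>t\<close>.\<close>
    also have "\<dots> = (\<Oplus>\<^bsub>tpow R d U\<^esub>\<sigma>\<in>?P. L v (\<epsilon> (tpow_perm R d E (inv' \<sigma>) t) \<odot>\<^bsub>tpow R d W\<^esub> tpow_perm R d W \<sigma> w))"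
    proof (rule TU.finsum_cong', simp)
      have wp: "tpow_perm R d W \<sigma> w \<in> carrier (tpow R d W)" if "\<sigma> permutes {1..d}" for \<sigma>
        by (rule tpow_perm_closed[OF mW that w])
      show "(\<lambda>\<sigma>. L v (\<epsilon> (tpow_perm R d E (inv' \<sigma>) t) \<odot>\<^bsub>tpow R d W\<^esub> tpow_perm R d W \<sigma> w)) \<in> ?P \<rightarrow> carrier (tpow R d U)"
        using Lcl[OF v] tp wp by auto
      fix \<sigma> assume "\<sigma> \<in> ?P"
      then have \<sigma>: "\<sigma> permutes {1..d}" by simp
      show "M \<sigma> (tpow_perm R d V (inv' \<sigma>) v) = L v (\<epsilon> (tpow_perm R d E (inv' \<sigma>) t) \<odot>\<^bsub>tpow R d W\<^esub> tpow_perm R d W \<sigma> w)"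
        using linear_mapD(3)[OF bilinear_mapD(1)[OF L v] tp[OF \<sigma>] wp[OF \<sigma>]] L_perm[OF \<sigma> vp[OF \<sigma>] w] tpow_perm_inv(1)[OF mV \<sigma> v]
        by (simp add: M_def)
    qed
    also have "\<dots> = L v (\<Oplus>\<^bsub>tpow R d W\<^esub>\<sigma>\<in>?P. \<epsilon> (tpow_perm R d E (inv' \<sigma>) t) \<odot>\<^bsub>tpow R d W\<^esub> tpow_perm R d W \<sigma> w)"
      using tp tpow_perm_closed[OF mW _ w]
      by (intro linear_map_finsum[OF TW.module_axioms TU.module_axioms bilinear_mapD(1)[OF L v] fin, symmetric] TW.smult_closed) auto
    also have "\<dots> = gam_comp R d (tensor_module R V E) f (gam_tensor R d V E V' W g (omega_point R d W w)) (tpow_pair R d V E v t)"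
      by (simp add: L_def gam_comp_apply[OF vt] gam_tensor_pair[OF pV proj_E pV' pW g a v tt] omega_point_apply[OF W tt])
    finally show "gam_comp R d (tensor_module R V E) f (gam_tensor R d V E V' W g (omega_point R d W w)) (tpow_pair R d V E v t) =
        (\<Oplus>\<^bsub>?H\<^esub>j\<in>A. G j) (tpow_pair R d V E v t)" by simp
  qed
qed

text \<open>Writing \<open>g\<close> as the image of \<open>gam_id R d V\<close> under
  \<open>g\<close>, and [w] as the image of [e] under \<open>omega_point R d W w\<close>, a first
  coend relation moves the generator to the objects V, E. There \<open>diag_decomposition\<close>
  splits its morphism, and a second coend relation moves each term to E, E, where the value of
  \<phi> is a value of its image under the comparison map.\<close>

lemma day_schur_recover:
  assumes \<phi>: "\<phi> \<in> carrier DX" and B: "dual_basis R TV A p \<xi>"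
    and V': "V' \<in> fgproj R" and W: "W \<in> fgproj R" and U: "U \<in> fgproj R"
    and f: "f \<in> carrier (gam_hom R d (tensor_module R V' W) U)" and g: "g \<in> carrier (gam_hom R d V V')"
    and w: "w \<in> carrier (tpow R d W)"
  shows "\<phi> U (gen U (V', W, f, g, sym_class R d W w)) =
    (\<Oplus>\<^bsub>ob X U\<^esub>j\<in>A. \<Phi> \<phi> (\<eta>c (\<xi> j)) U (f (tpow_pair R d V' W (g (p j)) w)))"
proof -
  note mU = fgprojD(2)[OF U]
  let ?H = "gam_hom R d (tensor_module R V E) U"
  let ?u = "\<lambda>j. f (tpow_pair R d V' W (g (p j)) w)"
  let ?G = "\<lambda>j. gam_comp R d (tensor_module R V E) (D U (?u j)) (gam_tensor R d V E E E (\<eta>c (\<xi> j) E e) (gam_id R d E))"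
  note dec = diag_decomposition[OF B V' W U f g w]
  note BD = dual_basisD[OF B]
  have \<eta>: "\<eta>c (\<xi> j) \<in> carrier F\<Gamma>" if "j \<in> A" for j
    by (rule symmetrize_trans_closed[OF BD(3)[OF that]])
  have a: "omega_point R d W w \<in> carrier (gam_hom R d E W)" by (rule omega_point_closed[OF W w])
  have id: "gam_id R d V \<in> carrier (gam_hom R d V V)" by (rule gam_id_closed[OF mV])
  have id': "gam_id R d V \<in> carrier (ob \<Gamma>\<^sub>V V)" using id by simp
  have 1: "ar \<Gamma>\<^sub>V V V' g (gam_id R d V) = g" using id gam_comp_id(2)[OF g] by simp
  have 2: "ar S E W (omega_point R d W w) ecl = sym_class R d W w"
    by (simp add: sym_power_ar[OF omega_obj_fgproj W a omega_vec_closed] omega_point_vec[OF W w])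
  have "gen U (V', W, f, g, sym_class R d W w) =
      gen U (V, E, gam_comp R d (tensor_module R V E) f (gam_tensor R d V E V' W g (omega_point R d W w)), gam_id R d V, ecl)"
    using cocone(3)[OF U V omega_obj_fgproj V' W f g a id' ecl_closed] unfolding 1 2 by simp
  also have "\<dots> = gen U (V, E, (\<Oplus>\<^bsub>?H\<^esub>j\<in>A. ?G j), gam_id R d V, ecl)" by (simp only: dec(1))
  finally have *: "\<phi> U (gen U (V', W, f, g, sym_class R d W w)) = \<phi> U (gen U (V, E, (\<Oplus>\<^bsub>?H\<^esub>j\<in>A. ?G j), gam_id R d V, ecl))"
    by simp
  have lin: "linear_map R ?H (ob X U) (\<lambda>h. \<phi> U (gen U (V, E, h, gam_id R d V, ecl)))"
    using linear_map_comp[OF cocone(1)[OF U V omega_obj_fgproj id' ecl_closed]] nat_moduleD(3)[OF \<phi> U] by simp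
  interpret XU: module R "ob X U" by (rule mX[OF U])
  have "\<phi> U (gen U (V, E, (\<Oplus>\<^bsub>?H\<^esub>j\<in>A. ?G j), gam_id R d V, ecl)) =
      (\<Oplus>\<^bsub>ob X U\<^esub>j\<in>A. \<phi> U (gen U (V, E, ?G j, gam_id R d V, ecl)))"
    by (rule linear_map_finsum[OF gam_hom_module[OF tensor_module_module[OF mV mE] mU] XU.module_axioms lin BD(1) dec(2)])
  also have "\<dots> = (\<Oplus>\<^bsub>ob X U\<^esub>j\<in>A. \<Phi> \<phi> (\<eta>c (\<xi> j)) U (?u j))"
  proof (rule XU.finsum_cong', simp)
    show "(\<lambda>j. \<Phi> \<phi> (\<eta>c (\<xi> j)) U (?u j)) \<in> A \<rightarrow> carrier (ob X U)"
      using F_closed[OF day_schur_value_closed[OF \<phi> \<eta>] U dec(3)] by blast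
    fix j assume j: "j \<in> A"
    have x: "\<eta>c (\<xi> j) E e \<in> carrier (gam_hom R d V E)" by (rule x_closed[OF \<eta>[OF j]])
    have 3: "ar \<Gamma>\<^sub>V V E (\<eta>c (\<xi> j) E e) (gam_id R d V) = \<eta>c (\<xi> j) E e" using id gam_comp_id(2)[OF x] by simp
    have 4: "ar S E E (gam_id R d E) ecl = ecl"
      by (rule strict_polynomial_functor.ar_id[OF symp omega_obj_fgproj ecl_closed])
    have "gen U (V, E, ?G j, gam_id R d V, ecl) = gen U (E, E, D U (?u j), \<eta>c (\<xi> j) E e, ecl)"
      using cocone(3)[OF U V omega_obj_fgproj omega_obj_fgproj omega_obj_fgproj omega_diag_closed[OF U dec(3)[OF j]] x gam_id_closed[OF mE] id' ecl_closed]
      unfolding 3 4 .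
    then show "\<phi> U (gen U (V, E, ?G j, gam_id R d V, ecl)) = \<Phi> \<phi> (\<eta>c (\<xi> j)) U (?u j)"
      by (simp add: day_schur_apply[OF \<eta>[OF j] U dec(3)[OF j]])
  qed
  finally show ?thesis using * by simp
qed

private lemma TV_dual_basis:
  obtains A :: "(nat \<Rightarrow> nat) set" and p \<xi> where "dual_basis R TV A p \<xi>"
proof -
  obtain n :: nat and p \<xi> where "dual_basis R V {..<n} p \<xi>" using fg_projective_dual_basis[OF pV] .
  from dual_basis_tpow[OF mV this] show thesis by (rule that)
qed

text \<open>The right side of \<open>day_schur_recover\<close> involves \<phi> only through its
  image under the comparison map, and the generators span.\<close>

lemma day_schur_inj: "inj_on \<Phi> (carrier DX)"
proof (rule inj_onI)
  fix \<phi> \<phi>' assume \<phi>: "\<phi> \<in> carrier DX" and \<phi>': "\<phi>' \<in> carrier DX" and eq: "\<Phi> \<phi> = \<Phi> \<phi>'"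
  obtain A :: "(nat \<Rightarrow> nat) set" and p \<xi> where B: "dual_basis R TV A p \<xi>" by (rule TV_dual_basis)
  show "\<phi> = \<phi>'"
  proof (rule nat_trans_eqI[OF \<phi> \<phi>'])
    fix U K assume U: "U \<in> fgproj R" and K: "K \<in> carrier (ob (day_tensor R d \<Gamma>\<^sub>V S) U)"
    show "\<phi> U K = \<phi>' U K"
    proof (rule day_linear_eqI[OF R repr symp U mX[OF U]])
      show "linear_map R (day_module R d \<Gamma>\<^sub>V S U) (ob X U) (\<phi> U)" "linear_map R (day_module R d \<Gamma>\<^sub>V S U) (ob X U) (\<phi>' U)"
        using nat_moduleD(3)[OF \<phi> U] nat_moduleD(3)[OF \<phi>' U] by simp_all
      show "K \<in> carrier (day_module R d \<Gamma>\<^sub>V S U)" using K by simp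
      fix V' W f g k assume *: "V' \<in> fgproj R" "W \<in> fgproj R" "f \<in> carrier (gam_hom R d (tensor_module R V' W) U)"
        "g \<in> carrier (ob \<Gamma>\<^sub>V V')" "k \<in> carrier (ob S W)"
      obtain w where w: "w \<in> carrier (tpow R d W)" "k = sym_class R d W w"
        using *(5) sym_power_carrier[OF *(2), of d] by blast
      have g: "g \<in> carrier (gam_hom R d V V')" using *(4) by simp
      show "\<phi> U (gen U (V', W, f, g, k)) = \<phi>' U (gen U (V', W, f, g, k))"
        unfolding w(2) day_schur_recover[OF \<phi> B *(1,2) U *(3) g w(1)] day_schur_recover[OF \<phi>' B *(1,2) U *(3) g w(1)] eq ..
    qed
  qed
qed

text \<open>The formula of \<open>day_schur_recover\<close>, with \<open>h\<close> in place of the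
  image, is the only possible definition of a preimage. The main point is that it depends on
  \<open>w\<close> only through its class.\<close>

lemma day_schur_surj:
  assumes h: "h \<in> carrier (ob (g_hom R d (schur R d X)) V)"
  shows "h \<in> \<Phi> ` carrier DX"
proof -
  have h_ext: "h \<in> extensional (carrier F\<Gamma>)" and h_lin: "linear_map R F\<Gamma> FX h"
    and h_act: "\<And>\<sigma> \<eta>. \<lbrakk>\<sigma> permutes {1..d}; \<eta> \<in> carrier F\<Gamma>\<rbrakk> \<Longrightarrow>
      h (nat_comp R \<Omega> \<eta> (gam_omega_perm R d \<sigma>)) = nat_comp R \<Omega> (h \<eta>) (gam_omega_perm R d \<sigma>)"
    using h by (auto simp: g_hom_ob_carrier)
  obtain A :: "(nat \<Rightarrow> nat) set" and p \<xi> where B: "dual_basis R TV A p \<xi>" by (rule TV_dual_basis)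
  note BD = dual_basisD[OF B] and \<xi>cl = dual_basis_value_closed[OF B]
  note TV = tpow_module[OF mV, of d]
  define K where "K = (\<lambda>j. h (\<eta>c (\<xi> j)))"
  have \<eta>: "\<eta>c (\<xi> j) \<in> carrier F\<Gamma>" if "j \<in> A" for j
    by (rule symmetrize_trans_closed[OF BD(3)[OF that]])
  have K: "K j \<in> carrier FX" if "j \<in> A" for j
    unfolding K_def by (rule linear_mapD(1)[OF h_lin \<eta>[OF that]])
  have Klin: "linear_map R (tpow R d U) (ob X U) (K j U)" if "j \<in> A" "U \<in> fgproj R" for j U
    using nat_moduleD(3)[OF K[OF that(1)] that(2)] by simp
  \<comment> \<open>Being linear, \<open>h\<close> is known on all \<eta>_c through the finitely
    many transformations \<open>K k\<close>.\<close>
  have h_exp: "h (\<eta>c c) U t = (\<Oplus>\<^bsub>ob X U\<^esub>k\<in>A. c (p k) \<odot>\<^bsub>ob X U\<^esub> K k U t)"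
    if c: "linear_map R TV (self_module R) c" and U: "U \<in> fgproj R" and t: "t \<in> carrier (tpow R d U)" for c U t
  proof -
    interpret XU: module R "ob X U" by (rule mX[OF U])
    have cp: "c (p k) \<in> carrier R" if "k \<in> A" for k using linear_mapD(1)[OF c BD(2)[OF that]] by simp
    note lin = linear_map_comp[OF h_lin F_eval_linear[OF U t]]
    have "h (\<eta>c c) U t = (\<Oplus>\<^bsub>ob X U\<^esub>k\<in>A. h (c (p k) \<odot>\<^bsub>F\<Gamma>\<^esub> \<eta>c (\<xi> k)) U t)"
      unfolding symmetrize_trans_expansion[OF B c]
      by (rule linear_map_finsum[OF F\<Gamma>_module XU.module_axioms lin BD(1) F\<Gamma>.smult_closed[OF cp \<eta>]])
    also have "\<dots> = (\<Oplus>\<^bsub>ob X U\<^esub>k\<in>A. c (p k) \<odot>\<^bsub>ob X U\<^esub> K k U t)"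
      using cp F_closed[OF K U t] linear_mapD(3)[OF lin cp \<eta>]
      by (intro XU.finsum_cong') (auto simp: K_def)
    finally show ?thesis .
  qed
  \<comment> \<open>\<open>Q\<close> is the right side of \<open>day_schur_recover\<close> on
    representatives \<open>w\<close>; \<open>G\<close> passes to classes with
    \<open>the_elem\<close>, which is justified by \<open>Q_perm\<close>.\<close>
  define Q where "Q = (\<lambda>U (V' :: 'a obj) (W :: 'a obj) f g w. \<Oplus>\<^bsub>ob X U\<^esub>j\<in>A. K j U (f (tpow_pair R d V' W (g (p j)) w)))"
  define G where "G = (\<lambda>U (V' :: 'a obj) (W :: 'a obj) f g k. the_elem (Q U V' W f g ` k))"
  have Q_w: "linear_map R (tpow R d W) (ob X U) (Q U V' W f g)"
    if "U \<in> fgproj R" "V' \<in> fgproj R" "W \<in> fgproj R" "f \<in> carrier (gam_hom R d (tensor_module R V' W) U)"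
      "g \<in> carrier (gam_hom R d V V')" for U V' W f g
    unfolding Q_def
    by (rule linear_map_sum[OF mX[OF that(1)] BD(1)
          linear_map_comp[OF bilinear_mapD(1)[OF pair_morphism(1)[OF that(2-5)] BD(2)] Klin[OF _ that(1)]]])
  have Q_g: "linear_map R (gam_hom R d V V') (ob X U) (\<lambda>g. Q U V' W f g w)"
    if "U \<in> fgproj R" "V' \<in> fgproj R" "W \<in> fgproj R" "f \<in> carrier (gam_hom R d (tensor_module R V' W) U)"
      "w \<in> carrier (tpow R d W)" for U V' W f w
    unfolding Q_def
    by (rule linear_map_sum[OF mX[OF that(1)] BD(1)
          linear_map_comp[OF linear_map_comp[OF linear_map_comp[OF gam_hom_eval_linear[OF BD(2)]
            bilinear_mapD(2)[OF tpow_pair_bilinear[OF fgprojD(2)[OF that(2)] fgprojD(2)[OF that(3)]] that(5)]]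
            gam_homD(2)[OF that(4)]] Klin[OF _ that(1)]]])
  have Q_f: "linear_map R (gam_hom R d (tensor_module R V' W) U) (ob X U) (\<lambda>f. Q U V' W f g w)"
    if "U \<in> fgproj R" "V' \<in> fgproj R" "W \<in> fgproj R" "g \<in> carrier (gam_hom R d V V')"
      "w \<in> carrier (tpow R d W)" for U V' W g w
    unfolding Q_def
    by (rule linear_map_sum[OF mX[OF that(1)] BD(1)
          linear_map_comp[OF gam_hom_eval_linear[OF tpow_pair_closed[OF fgprojD(1)[OF that(2)] fgprojD(1)[OF that(3)]
            gam_homD(4)[OF that(4) BD(2)] that(5)]] Klin[OF _ that(1)]]])
  \<comment> \<open>Invariance of \<Sum>_j \<xi>_j \<otimes> p_j. A permutation of \<open>w\<close>
    is traded for the inverse permutation of p_j and a permutation of the value in T^d U. The latter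
    acts on \<open>K j\<close>, and by equivariance of \<open>h\<close> this replaces \<xi>_j by
    \<xi>_j \<circ> \<sigma>. Expanding in the \<xi>_k and exchanging the sums, the sum over
    \<open>j\<close> contracts, and the two permutations of p_k cancel.\<close>
  have Q_perm: "Q U V' W f g (tpow_perm R d W \<sigma> w) = Q U V' W f g w"
    if U: "U \<in> fgproj R" and V': "V' \<in> fgproj R" and W: "W \<in> fgproj R"
      and f: "f \<in> carrier (gam_hom R d (tensor_module R V' W) U)" and g: "g \<in> carrier (gam_hom R d V V')"
      and \<sigma>: "\<sigma> permutes {1..d}" and w: "w \<in> carrier (tpow R d W)" for U V' W f g \<sigma> w
  proof -
    interpret XU: module R "ob X U" by (rule mX[OF U])
    define L where "L = (\<lambda>v w. f (tpow_pair R d V' W (g v) w))"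
    have L: "bilinear_map R TV (tpow R d W) (tpow R d U) L"
      unfolding L_def by (rule pair_morphism(1)[OF V' W f g])
    have Lcl: "L v w \<in> carrier (tpow R d U)" if "v \<in> carrier TV" for v by (rule bilinear_map_closed[OF L that w])
    let ?i = "tpow_perm R d V (inv' \<sigma>)" and ?s = "tpow_perm R d V \<sigma>"
    have s: "?s v \<in> carrier TV" if "v \<in> carrier TV" for v by (rule tpow_perm_closed[OF mV \<sigma> that])
    have i: "?i v \<in> carrier TV" if "v \<in> carrier TV" for v by (rule tpow_perm_closed[OF mV permutes_inv[OF \<sigma>] that])
    \<comment> \<open>Separated out as a linear function of \<open>x\<close>: the sum over
      \<open>j\<close> of \<xi>_j(p_k\<sigma>) N_k(p_j) is then the dual basis expansion of N_k at
      p_k\<sigma>.\<close>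
    define N where "N = (\<lambda>k x. K k U (L (?i x) w))"
    have N: "linear_map R TV (ob X U) (N k)" if "k \<in> A" for k
      unfolding N_def
      by (rule linear_map_comp[OF linear_map_comp[OF tpow_perm_linear_pure(1)[OF mV permutes_inv[OF \<sigma>]]
            bilinear_mapD(2)[OF L w]] Klin[OF that U]])
    note Ncl = linear_mapD(1)[OF N]
    have step: "K j U (L (p j) (tpow_perm R d W \<sigma> w)) = (\<Oplus>\<^bsub>ob X U\<^esub>k\<in>A. \<xi> j (?s (p k)) \<odot>\<^bsub>ob X U\<^esub> N k (p j))"
      if j: "j \<in> A" for j
    proof -
      have t: "L (?i (p j)) w \<in> carrier (tpow R d U)" by (rule Lcl[OF i[OF BD(2)[OF j]]])
      have "L (p j) (tpow_perm R d W \<sigma> w) = L (?s (?i (p j))) (tpow_perm R d W \<sigma> w)"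
        by (simp add: tpow_perm_inv(1)[OF mV \<sigma> BD(2)[OF j]])
      also have "\<dots> = tpow_perm R d U \<sigma> (L (?i (p j)) w)"
        unfolding L_def by (rule pair_morphism(2)[OF V' W f g \<sigma> i[OF BD(2)[OF j]] w])
      finally have "K j U (L (p j) (tpow_perm R d W \<sigma> w)) = nat_comp R \<Omega> (K j) (gam_omega_perm R d \<sigma>) U (L (?i (p j)) w)"
        by (simp add: act_apply[OF U t])
      also have "nat_comp R \<Omega> (K j) (gam_omega_perm R d \<sigma>) = h (\<eta>c (\<lambda>v. \<xi> j (?s v)))"
        unfolding K_def h_act[OF \<sigma> \<eta>[OF j], symmetric] symmetrize_trans_perm[OF BD(3)[OF j] \<sigma>] ..
      also have "h (\<eta>c (\<lambda>v. \<xi> j (?s v))) U (L (?i (p j)) w) = (\<Oplus>\<^bsub>ob X U\<^esub>k\<in>A. \<xi> j (?s (p k)) \<odot>\<^bsub>ob X U\<^esub> N k (p j))"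
        unfolding N_def
        by (rule h_exp[OF linear_map_comp[OF tpow_perm_linear_pure(1)[OF mV \<sigma>] BD(3)[OF j]] U t])
      finally show ?thesis .
    qed
    have cl: "\<xi> j (?s (p k)) \<odot>\<^bsub>ob X U\<^esub> N k (p j) \<in> carrier (ob X U)" if "j \<in> A" "k \<in> A" for j k
      by (intro XU.smult_closed \<xi>cl s Ncl BD(2) that)
    have "Q U V' W f g (tpow_perm R d W \<sigma> w) = (\<Oplus>\<^bsub>ob X U\<^esub>j\<in>A. \<Oplus>\<^bsub>ob X U\<^esub>k\<in>A. \<xi> j (?s (p k)) \<odot>\<^bsub>ob X U\<^esub> N k (p j))"
      unfolding Q_def using step cl by (intro XU.finsum_cong') (auto simp: L_def intro!: XU.finsum_closed)
    also have "\<dots> = (\<Oplus>\<^bsub>ob X U\<^esub>k\<in>A. \<Oplus>\<^bsub>ob X U\<^esub>j\<in>A. \<xi> j (?s (p k)) \<odot>\<^bsub>ob X U\<^esub> N k (p j))"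
      by (rule XU.finsum_swap[OF BD(1) BD(1) cl])
    also have "\<dots> = (\<Oplus>\<^bsub>ob X U\<^esub>k\<in>A. N k (?s (p k)))"
      using Ncl[OF _ s[OF BD(2)]] dual_basis_linear[OF TV XU.module_axioms B N s[OF BD(2)]]
      by (intro XU.finsum_cong') auto
    also have "\<dots> = Q U V' W f g w"
      unfolding Q_def using linear_mapD(1)[OF Klin[OF _ U] Lcl[OF BD(2)]] tpow_perm_inv(2)[OF mV \<sigma> BD(2)]
      by (intro XU.finsum_cong') (auto simp: N_def L_def)
    finally show ?thesis .
  qed
  have G_val: "G U V' W f g (sym_class R d W w) = Q U V' W f g w"
    if "U \<in> fgproj R" "V' \<in> fgproj R" "W \<in> fgproj R" "f \<in> carrier (gam_hom R d (tensor_module R V' W) U)"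
      "g \<in> carrier (gam_hom R d V V')" "w \<in> carrier (tpow R d W)" for U V' W f g w
    unfolding G_def using coinv_image_singleton[OF that(3) mX[OF that(1)] Q_w[OF that(1-5)] Q_perm[OF that(1-5)] that(6)]
    by simp
  have S_cases: "\<exists>w\<in>carrier (tpow R d W). k = sym_class R d W w" if "W \<in> fgproj R" "k \<in> carrier (ob S W)" for W k
    using that sym_power_carrier[of W R d] by blast
  have cocG: "day_cocone R d \<Gamma>\<^sub>V S U (ob X U) (G U)" if U: "U \<in> fgproj R" for U
  proof (intro day_coconeI bilinear_mapI)
    fix V' W g k assume *: "V' \<in> fgproj R" "W \<in> fgproj R" "g \<in> carrier (ob \<Gamma>\<^sub>V V')" "k \<in> carrier (ob S W)"
    have g: "g \<in> carrier (gam_hom R d V V')" using *(3) by simp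
    obtain w where w: "w \<in> carrier (tpow R d W)" "k = sym_class R d W w" using S_cases[OF *(2,4)] by blast
    show "linear_map R (gam_hom R d (tensor_module R V' W) U) (ob X U) (\<lambda>f. G U V' W f g k)"
      unfolding w(2)
      by (rule linear_map_cong[OF gam_hom_module[OF tensor_module_module[OF fgprojD(2)[OF *(1)] fgprojD(2)[OF *(2)]] fgprojD(2)[OF U]]
            Q_f[OF U *(1,2) g w(1)] G_val[OF U *(1,2) _ g w(1)]])
  next
    fix V' W f g assume *: "V' \<in> fgproj R" "W \<in> fgproj R" "f \<in> carrier (gam_hom R d (tensor_module R V' W) U)"
      "g \<in> carrier (ob \<Gamma>\<^sub>V V')"
    have g: "g \<in> carrier (gam_hom R d V V')" using *(4) by simp
    show "linear_map R (ob S W) (ob X U) (G U V' W f g)"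
      by (rule linear_map_from_sym_power[OF *(2)
            linear_map_cong[OF tpow_module[OF fgprojD(2)[OF *(2)]] Q_w[OF U *(1-3) g] G_val[OF U *(1-3) g]]])
  next
    fix V' W f k assume *: "V' \<in> fgproj R" "W \<in> fgproj R" "f \<in> carrier (gam_hom R d (tensor_module R V' W) U)"
      "k \<in> carrier (ob S W)"
    obtain w where w: "w \<in> carrier (tpow R d W)" "k = sym_class R d W w" using S_cases[OF *(2,4)] by blast
    show "linear_map R (ob \<Gamma>\<^sub>V V') (ob X U) (\<lambda>g. G U V' W f g k)"
      unfolding w(2) gam_repr_simps(1)
      by (rule linear_map_cong[OF gam_hom_module[OF mV fgprojD(2)[OF *(1)]] Q_g[OF U *(1-3) w(1)] G_val[OF U *(1-3) _ w(1)]])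
  next
    fix V1 W1 V2 W2 f g1 k1 g k
    assume *: "V1 \<in> fgproj R" "W1 \<in> fgproj R" "V2 \<in> fgproj R" "W2 \<in> fgproj R"
      "f \<in> carrier (gam_hom R d (tensor_module R V2 W2) U)" "g1 \<in> carrier (gam_hom R d V1 V2)"
      "k1 \<in> carrier (gam_hom R d W1 W2)" "g \<in> carrier (ob \<Gamma>\<^sub>V V1)" "k \<in> carrier (ob S W1)"
    have g: "g \<in> carrier (gam_hom R d V V1)" using *(8) by simp
    obtain w where w: "w \<in> carrier (tpow R d W1)" "k = sym_class R d W1 w" using S_cases[OF *(2,9)] by blast
    note pr = fgprojD(1)[OF *(1)] fgprojD(1)[OF *(2)] fgprojD(1)[OF *(3)] fgprojD(1)[OF *(4)]
    have t: "gam_tensor R d V1 W1 V2 W2 g1 k1 \<in> carrier (gam_hom R d (tensor_module R V1 W1) (tensor_module R V2 W2))"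
      by (rule gam_tensor_closed[OF pr *(6,7)])
    have ft: "gam_comp R d (tensor_module R V1 W1) f (gam_tensor R d V1 W1 V2 W2 g1 k1) \<in> carrier (gam_hom R d (tensor_module R V1 W1) U)"
      by (rule gam_comp_closed[OF tensor_module_module[OF fgprojD(2)[OF *(1)] fgprojD(2)[OF *(2)]] t *(5)])
    interpret XU: module R "ob X U" by (rule mX[OF U])
    have gg: "gam_comp R d V g1 g \<in> carrier (gam_hom R d V V2)" by (rule gam_comp_closed[OF mV g *(6)])
    have kw: "k1 w \<in> carrier (tpow R d W2)" by (rule gam_homD(4)[OF *(7) w(1)])
    have "G U V1 W1 (gam_comp R d (tensor_module R V1 W1) f (gam_tensor R d V1 W1 V2 W2 g1 k1)) g k =
        Q U V1 W1 (gam_comp R d (tensor_module R V1 W1) f (gam_tensor R d V1 W1 V2 W2 g1 k1)) g w"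
      unfolding w(2) by (rule G_val[OF U *(1,2) ft g w(1)])
    also have "\<dots> = Q U V2 W2 f (gam_comp R d V g1 g) (k1 w)"
    proof -
      \<comment> \<open>On a pair, \<open>gam_tensor\<close> applies \<open>g1\<close> and
        \<open>k1\<close> separately, so both sides feed the same elements to the
        \<open>K j\<close>.\<close>
      have "gam_comp R d (tensor_module R V1 W1) f (gam_tensor R d V1 W1 V2 W2 g1 k1) (tpow_pair R d V1 W1 (g (p j)) w) =
          f (tpow_pair R d V2 W2 (gam_comp R d V g1 g (p j)) (k1 w))" if "j \<in> A" for j
        using gam_homD(4)[OF g BD(2)[OF that]] BD(2)[OF that]
        by (simp add: gam_comp_apply tpow_pair_closed[OF pr(1,2) _ w(1)] gam_tensor_pair[OF pr *(6,7) _ w(1)])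
      moreover have "K j U (f (tpow_pair R d V2 W2 (gam_comp R d V g1 g (p j)) (k1 w))) \<in> carrier (ob X U)" if "j \<in> A" for j
        using linear_mapD(1)[OF Klin[OF that U] bilinear_map_closed[OF pair_morphism(1)[OF *(3-5) gg] BD(2)[OF that] kw]] .
      ultimately show ?thesis unfolding Q_def by (intro XU.finsum_cong') auto
    qed
    also have "\<dots> = G U V2 W2 f (gam_comp R d V g1 g) (sym_class R d W2 (k1 w))"
      by (rule G_val[OF U *(3-5) gg kw, symmetric])
    also have "\<dots> = G U V2 W2 f (ar \<Gamma>\<^sub>V V1 V2 g1 g) (ar S W1 W2 k1 k)"
      using g by (simp add: w(2) sym_power_ar[OF *(2,4,7) w(1)])
    finally show "G U V1 W1 (gam_comp R d (tensor_module R V1 W1) f (gam_tensor R d V1 W1 V2 W2 g1 k1)) g k =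
        G U V2 W2 f (ar \<Gamma>\<^sub>V V1 V2 g1 g) (ar S W1 W2 k1 k)" .
  qed
  have nat: "G U' V' W (gam_comp R d (tensor_module R V' W) q f) g k = ar X U U' q (G U V' W f g k)"
    if *: "U \<in> fgproj R" "U' \<in> fgproj R" "q \<in> carrier (gam_hom R d U U')" "V' \<in> fgproj R" "W \<in> fgproj R"
      "f \<in> carrier (gam_hom R d (tensor_module R V' W) U)" "g \<in> carrier (ob \<Gamma>\<^sub>V V')" "k \<in> carrier (ob S W)"
    for U U' q V' W f g k
  proof -
    have g: "g \<in> carrier (gam_hom R d V V')" using *(7) by simp
    obtain w where w: "w \<in> carrier (tpow R d W)" "k = sym_class R d W w" using S_cases[OF *(5,8)] by blast
    have qf: "gam_comp R d (tensor_module R V' W) q f \<in> carrier (gam_hom R d (tensor_module R V' W) U')"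
      by (rule gam_comp_closed[OF tensor_module_module[OF fgprojD(2)[OF *(4)] fgprojD(2)[OF *(5)]] *(6,3)])
    interpret XU': module R "ob X U'" by (rule mX[OF *(2)])
    have t: "f (tpow_pair R d V' W (g (p j)) w) \<in> carrier (tpow R d U)" if "j \<in> A" for j
      by (rule bilinear_map_closed[OF pair_morphism(1)[OF *(4-6) g] BD(2)[OF that] w(1)])
    note arq = spf_ar(1)[OF X *(1,2,3)]
    have Kt: "K j U (f (tpow_pair R d V' W (g (p j)) w)) \<in> carrier (ob X U)" if "j \<in> A" for j
      by (rule linear_mapD(1)[OF Klin[OF that *(1)] t[OF that]])
    have "ar X U U' q (Q U V' W f g w) = (\<Oplus>\<^bsub>ob X U'\<^esub>j\<in>A. ar X U U' q (K j U (f (tpow_pair R d V' W (g (p j)) w))))"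
      unfolding Q_def by (rule linear_map_finsum[OF mX[OF *(1)] XU'.module_axioms arq BD(1) Kt])
    also have "\<dots> = Q U' V' W (gam_comp R d (tensor_module R V' W) q f) g w"
    proof -
      have "K j U' (gam_comp R d (tensor_module R V' W) q f (tpow_pair R d V' W (g (p j)) w)) =
          ar X U U' q (K j U (f (tpow_pair R d V' W (g (p j)) w)))" if "j \<in> A" for j
        using nat_moduleD(4)[OF K[OF that] *(1-3), of "f (tpow_pair R d V' W (g (p j)) w)"] t[OF that]
        by (simp add: gam_comp_apply tpow_pair_closed[OF fgprojD(1)[OF *(4)] fgprojD(1)[OF *(5)] gam_homD(4)[OF g BD(2)[OF that]] w(1)])
      then show ?thesis unfolding Q_def using linear_mapD(1)[OF arq Kt] by (intro XU'.finsum_cong') auto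
    qed
    finally show ?thesis
      unfolding w(2) G_val[OF *(1,4,5,6) g w(1)] G_val[OF *(2,4,5) qf g w(1)] by simp
  qed
  define \<phi> where "\<phi> = (\<lambda>U\<in>fgproj R. pres_lift R (day_module R d \<Gamma>\<^sub>V S U) (ob X U) (\<lambda>(V', W, f, g, k). G U V' W f g k))"
  have \<phi>: "\<phi> \<in> carrier DX"
    unfolding \<phi>_def
    by (rule day_trans(1)[where G = G, OF R repr symp]) (assumption | rule mX spf_ar(1)[OF X] cocG nat)+
  have \<phi>_gen: "\<phi> U (gen U (V', W, f, g, k)) = G U V' W f g k"
    if "U \<in> fgproj R" "V' \<in> fgproj R" "W \<in> fgproj R" "f \<in> carrier (gam_hom R d (tensor_module R V' W) U)"
      "g \<in> carrier (ob \<Gamma>\<^sub>V V')" "k \<in> carrier (ob S W)" for U V' W f g k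
    unfolding \<phi>_def
    by (rule day_trans(2)[where G = G, OF R repr symp]) (assumption | rule mX spf_ar(1)[OF X] cocG nat that)+
  have "\<Phi> \<phi> = h"
  proof (rule extensionalityI[OF _ h_ext])
    show "\<Phi> \<phi> \<in> extensional (carrier F\<Gamma>)" by (simp add: day_schur_def)
    fix \<eta>' assume \<eta>': "\<eta>' \<in> carrier F\<Gamma>"
    show "\<Phi> \<phi> \<eta>' = h \<eta>'"
    proof (rule F_eqI[OF day_schur_value_closed[OF \<phi> \<eta>'] linear_mapD(1)[OF h_lin \<eta>']])
      fix U u assume U: "U \<in> fgproj R" and u: "u \<in> carrier (tpow R d U)"
      interpret XU: module R "ob X U" by (rule mX[OF U])
      let ?x = "\<eta>' E e"
      have x: "?x \<in> carrier (gam_hom R d V E)" by (rule x_closed[OF \<eta>'])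
      have c: "linear_map R TV (self_module R) (\<lambda>v. \<epsilon> (?x v))"
        by (rule linear_map_comp[OF gam_homD(2)[OF x] omega_coeff_linear])
      have cp: "\<epsilon> (?x (p j)) \<in> carrier R" if "j \<in> A" for j using linear_mapD(1)[OF c BD(2)[OF that]] by simp
      have "\<Phi> \<phi> \<eta>' U u = Q U E E (D U u) ?x e"
        by (simp add: day_schur_apply[OF \<eta>' U u] \<phi>_gen[OF U omega_obj_fgproj omega_obj_fgproj omega_diag_closed[OF U u] x_closed'[OF \<eta>'] ecl_closed]
            G_val[OF U omega_obj_fgproj omega_obj_fgproj omega_diag_closed[OF U u] x omega_vec_closed])
      \<comment> \<open>By \<open>omega_diag_vec\<close> the argument of \<open>K j\<close> is the
        multiple of \<open>u\<close> by \<epsilon>(\<eta>'(e)(p_j)). The sum is thus the expansion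
        \<open>h_exp\<close> for the form c = \<epsilon> \<circ> \<eta>'(e), and \<eta>_c =
        \<eta>'.\<close>
      also have "\<dots> = (\<Oplus>\<^bsub>ob X U\<^esub>j\<in>A. \<epsilon> (?x (p j)) \<odot>\<^bsub>ob X U\<^esub> K j U u)"
        unfolding Q_def
        using linear_mapD[OF Klin[OF _ U]] cp u omega_diag_vec[OF U gam_homD(4)[OF x BD(2)] u]
        by (intro XU.finsum_cong') auto
      also have "\<dots> = h (\<eta>c (\<lambda>v. \<epsilon> (?x v))) U u" by (rule h_exp[OF c U u, symmetric])
      also have "\<dots> = h \<eta>' U u" by (simp add: symmetrize_trans_coeff[OF \<eta>'])
      finally show "\<Phi> \<phi> \<eta>' U u = h \<eta>' U u" .
    qed
  qed
  then show ?thesis using \<phi> by blast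
qed

lemma day_schur_iso: "linear_iso R DX (ob (g_hom R d (schur R d X)) V) \<Phi>"
  using day_schur_linear day_schur_inj day_schur_surj day_schur_closed
  by (auto simp: linear_iso_def bij_betw_def)

end

end

section \<open>Naturality of the comparison map in the object and in the functor\<close>

private abbreviation "GF X \<equiv> g_hom R d (schur R d X)"

text \<open>Both sides evaluate \<phi> at D_u \<otimes> (\<eta>(e) \<circ> f) \<otimes> [e]: the
  transformation induced by \<open>f\<close> changes only the second component of the
  generator.\<close>

lemma day_schur_natural_left:
  assumes X: "strict_polynomial_functor R d X"
    and V: "V \<in> fgproj R" and W: "W \<in> fgproj R" and f: "f \<in> carrier (gam_hom R d V W)"
    and \<phi>: "\<phi> \<in> carrier (nat_module R d (day_tensor R d (\<Gamma> V) S) X)"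
  defines "\<psi> \<equiv> nat_comp R (day_tensor R d (\<Gamma> W) S) \<phi>
    (day_tensor_map R d (\<Gamma> W) S (\<Gamma> V) S (gam_repr_map R d V W f) (nat_id R S))"
  shows "\<psi> \<in> carrier (nat_module R d (day_tensor R d (\<Gamma> W) S) X)"
    and "day_schur R d W \<psi> = ar (GF X) V W f (day_schur R d V \<phi>)"
proof -
  note rV = gam_repr_spf[OF V, of d] and rW = gam_repr_spf[OF W, of d]
  note map = gam_repr_map_closed[OF V W f]
  note m = day_tensor_map[OF R rW symp rV symp map nat_id_closed[OF spf_prefunctor[OF symp]]]
  show \<psi>: "\<psi> \<in> carrier (nat_module R d (day_tensor R d (\<Gamma> W) S) X)"
    unfolding \<psi>_def by (rule nat_comp_closed[OF day_tensor_prefunctor[OF R rW symp] m(1) \<phi>])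
  have S: "schur_map R d (\<Gamma> W) (gam_repr_map R d V W f) \<eta> = nat_comp R \<Omega> (gam_repr_map R d V W f) \<eta>"
    "nat_comp R \<Omega> (gam_repr_map R d V W f) \<eta> \<in> carrier (nat_module R d \<Omega> (\<Gamma> V))"
    if "\<eta> \<in> carrier (nat_module R d \<Omega> (\<Gamma> W))" for \<eta>
    using that nat_comp_closed[OF gam_omega_prefunctor that map] by (simp_all add: schur_map_def)
  have "ar (GF X) V W f (day_schur R d V \<phi>) =
    compose (carrier (nat_module R d \<Omega> (\<Gamma> W))) (day_schur R d V \<phi>) (schur_map R d (\<Gamma> W) (gam_repr_map R d V W f))"
    using day_schur_closed[OF V X \<phi>] by (simp add: g_hom_def)
  also have "\<dots> = day_schur R d W \<psi>"
  proof
    fix \<eta>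
    show "compose (carrier (nat_module R d \<Omega> (\<Gamma> W))) (day_schur R d V \<phi>) (schur_map R d (\<Gamma> W) (gam_repr_map R d V W f)) \<eta> =
        day_schur R d W \<psi> \<eta>"
    proof (cases "\<eta> \<in> carrier (nat_module R d \<Omega> (\<Gamma> W))")
      case \<eta>: True
      have "day_schur R d V \<phi> (nat_comp R \<Omega> (gam_repr_map R d V W f) \<eta>) = day_schur R d W \<psi> \<eta>"
      proof (rule nat_trans_eqI[OF day_schur_value_closed[OF V X \<phi> S(2)[OF \<eta>]] day_schur_value_closed[OF W X \<psi> \<eta>]])
        fix U u assume U: "U \<in> fgproj R" and "u \<in> carrier (ob \<Omega> U)"
        then have u: "u \<in> carrier (tpow R d U)" by simp
        have x: "nat_comp R \<Omega> (gam_repr_map R d V W f) \<eta> E (e) = gam_repr_map R d V W f E (\<eta> E (e))"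
          using omega_obj_fgproj omega_vec_closed by (simp add: nat_comp_apply)
        show "day_schur R d V \<phi> (nat_comp R \<Omega> (gam_repr_map R d V W f) \<eta>) U u = day_schur R d W \<psi> \<eta> U u"
          unfolding day_schur_apply[OF V X S(2)[OF \<eta>] U u] day_schur_apply[OF W X \<eta> U u] \<psi>_def
            nat_comp_apply[OF U gen_closed[OF W \<eta> U u, folded day_tensor_ob]]
            m(2)[OF U omega_obj_fgproj omega_obj_fgproj omega_diag_closed[OF U u] x_closed'[OF \<eta>] ecl_closed] x nat_id_apply[OF omega_obj_fgproj ecl_closed] ..
      qed
      then show ?thesis using \<eta> by (simp add: compose_eq S(1))
    qed (simp add: compose_def day_schur_def)
  qed
  finally show "day_schur R d W \<psi> = ar (GF X) V W f (day_schur R d V \<phi>)" by simp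
qed

text \<open>On both sides \<alpha> is applied after \<phi>, to the value at the same
  generator.\<close>

lemma day_schur_natural_right:
  assumes X: "strict_polynomial_functor R d X" and X': "strict_polynomial_functor R d X'"
    and \<alpha>: "\<alpha> \<in> carrier (nat_module R d X X')" and V: "V \<in> fgproj R"
    and \<phi>: "\<phi> \<in> carrier (nat_module R d (day_tensor R d (\<Gamma> V) S) X)"
  defines "\<psi> \<equiv> nat_comp R (day_tensor R d (\<Gamma> V) S) \<alpha> \<phi>"
  shows "\<psi> \<in> carrier (nat_module R d (day_tensor R d (\<Gamma> V) S) X')"
    and "day_schur R d V \<psi> = g_hom_map R d (schur R d X) (schur_map R d X \<alpha>) V (day_schur R d V \<phi>)"
proof -
  note rV = gam_repr_spf[OF V, of d]
  show \<psi>: "\<psi> \<in> carrier (nat_module R d (day_tensor R d (\<Gamma> V) S) X')"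
    unfolding \<psi>_def by (rule nat_comp_closed[OF day_tensor_prefunctor[OF R rV symp] \<phi> \<alpha>])
  have "g_hom_map R d (schur R d X) (schur_map R d X \<alpha>) V (day_schur R d V \<phi>) =
    compose (carrier (nat_module R d \<Omega> (\<Gamma> V))) (schur_map R d X \<alpha>) (day_schur R d V \<phi>)"
    using day_schur_closed[OF V X \<phi>] V by (simp add: g_hom_map_def)
  also have "\<dots> = day_schur R d V \<psi>"
  proof
    fix \<eta>
    show "compose (carrier (nat_module R d \<Omega> (\<Gamma> V))) (schur_map R d X \<alpha>) (day_schur R d V \<phi>) \<eta> = day_schur R d V \<psi> \<eta>"
    proof (cases "\<eta> \<in> carrier (nat_module R d \<Omega> (\<Gamma> V))")
      case \<eta>: True
      note c = day_schur_value_closed[OF V X \<phi> \<eta>]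
      have "nat_comp R \<Omega> \<alpha> (day_schur R d V \<phi> \<eta>) = day_schur R d V \<psi> \<eta>"
      proof (rule nat_trans_eqI[OF nat_comp_closed[OF gam_omega_prefunctor c \<alpha>] day_schur_value_closed[OF V X' \<psi> \<eta>]])
        fix U u assume U: "U \<in> fgproj R" and u': "u \<in> carrier (ob \<Omega> U)"
        then have u: "u \<in> carrier (tpow R d U)" by simp
        show "nat_comp R \<Omega> \<alpha> (day_schur R d V \<phi> \<eta>) U u = day_schur R d V \<psi> \<eta> U u"
          unfolding nat_comp_apply[OF U u'] day_schur_apply[OF V X \<eta> U u] day_schur_apply[OF V X' \<eta> U u] \<psi>_def nat_comp_apply[OF U gen_closed[OF V \<eta> U u, folded day_tensor_ob]] ..
      qed
      then show ?thesis using \<eta> c by (simp add: compose_eq schur_map_def)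
    qed (simp add: compose_def day_schur_def)
  qed
  finally show "day_schur R d V \<psi> = g_hom_map R d (schur R d X) (schur_map R d X \<alpha>) V (day_schur R d V \<phi>)" by simp
qed

end

text \<open>The isomorphism is the inverse of \<open>day_schur R d V\<close>, followed by the
  adjunction bijection at \<Gamma>^{d,V} and by evaluation at the identity of \<open>V\<close>.
  Naturality is checked on elements \<open>day_schur R d V \<phi>\<close>, which exhaust the
  source.\<close>

theorem theorem5p4:
  fixes R :: "('a, 'r) ring_scheme" and d :: nat
    and ihom :: "('a, 'a opow set) spf \<Rightarrow> ('a, 'm) spf \<Rightarrow> ('a, 'h) spf"
    and ihom_map :: "('a, 'a opow set) spf \<Rightarrow> ('a, 'a opow set) spf \<Rightarrow> ('a, 'm) spf \<Rightarrow> ('a, 'm) spf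
      \<Rightarrow> ('a, 'a opow set, 'a opow set) trans \<Rightarrow> ('a, 'm, 'm) trans \<Rightarrow> ('a, 'h, 'h) trans"
    and adj :: "('a, 'a mor) spf \<Rightarrow> ('a, 'a opow set) spf \<Rightarrow> ('a, 'm) spf
      \<Rightarrow> ('a, ('a, 'a mor, 'a opow set) day, 'm) trans \<Rightarrow> ('a, 'a mor, 'h) trans"
  assumes "cring R" and "d \<ge> 1"
    and "internal_hom R d ihom ihom_map adj"
  shows "\<exists>\<theta>.
    (\<forall>X. strict_polynomial_functor R d X \<longrightarrow>
       nat_iso R d (g_hom R d (schur R d X)) (ihom (sym_power R d) X) (\<theta> X)) \<and>
    (\<forall>X X' \<alpha>. strict_polynomial_functor R d X \<longrightarrow> strict_polynomial_functor R d X' \<longrightarrow>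
       \<alpha> \<in> carrier (nat_module R d X X') \<longrightarrow>
       nat_comp R (g_hom R d (schur R d X)) (\<theta> X')
         (g_hom_map R d (schur R d X) (schur_map R d X \<alpha>)) =
       nat_comp R (g_hom R d (schur R d X))
         (ihom_map (sym_power R d) (sym_power R d) X X' (nat_id R (sym_power R d)) \<alpha>) (\<theta> X))"
proof -
  note R = assms(1)
  interpret I: internal_hom R d ihom ihom_map adj by (fact assms(3))
  let ?\<Gamma> = "gam_repr R d" and ?S = "sym_power R d"
  let ?GF = "\<lambda>X :: ('a, 'm) spf. g_hom R d (schur R d X)"
  let ?D = "\<lambda>V X. nat_module R d (day_tensor R d (?\<Gamma> V) ?S) X"
  define \<theta>0 where "\<theta>0 = (\<lambda>X V h. adj (?\<Gamma> V) ?S X (inv_into (carrier (?D V X)) (day_schur R d V) h) V (gam_id R d V))"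
  define \<theta> where "\<theta> = (\<lambda>X. \<lambda>V\<in>fgproj R. \<lambda>h\<in>carrier (ob (?GF X) V). \<theta>0 X V h)"
  note S = sym_power_spf[of R d]
  note nS = nat_id_closed[OF spf_prefunctor[OF S]]
  have D_module: "module R (?D V X)" if "V \<in> fgproj R" "strict_polynomial_functor R d X" for V and X :: "('a, 'm) spf"
    by (rule nat_module_module[OF R day_tensor_prefunctor[OF R gam_repr_spf[OF that(1)] S] that(2)])
  have \<theta>0_iso: "linear_iso R (ob (?GF X) V) (ob (ihom ?S X) V) (\<theta>0 X V)"
    if V: "V \<in> fgproj R" and X: "strict_polynomial_functor R d X" for V X
    unfolding \<theta>0_def
    by (rule linear_iso_comp[OF linear_iso_comp[OF linear_iso_inv_into[OF D_module[OF V X] day_schur_iso[OF R V X]]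
          I.adj_iso[OF gam_repr_spf[OF V] S X]] yoneda_iso[OF V I.ihom_functor[OF S X]]])
  \<comment> \<open>This removes the \<open>inv_into\<close>; naturality of \<theta> only needs its
    values on images under \<open>day_schur\<close>.\<close>
  have \<theta>_day: "\<theta> X V (day_schur R d V \<phi>) = adj (?\<Gamma> V) ?S X \<phi> V (gam_id R d V)"
    if V: "V \<in> fgproj R" and X: "strict_polynomial_functor R d X" and \<phi>: "\<phi> \<in> carrier (?D V X)" for V X \<phi>
    using V day_schur_closed[OF R V X \<phi>] bij_betw_inv_into_left[OF linear_isoD(2)[OF day_schur_iso[OF R V X]] \<phi>]
    by (simp add: \<theta>_def \<theta>0_def)
  have adj_closed: "adj (?\<Gamma> V) ?S X \<phi> \<in> carrier (nat_module R d (?\<Gamma> V) (ihom ?S X))"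
    if V: "V \<in> fgproj R" and X: "strict_polynomial_functor R d X" and \<phi>: "\<phi> \<in> carrier (?D V X)" for V X \<phi>
    using linear_mapD(1)[OF linear_isoD(1)[OF I.adj_iso[OF gam_repr_spf[OF V] S X]] \<phi>] .
  \<comment> \<open>\<theta> is the restriction of \<open>\<theta>0\<close> to the carrier, so its
    linearity needs sums and multiples of carrier elements to stay inside. Closure is transported
    along the surjective linear map \<open>day_schur R d V\<close>.\<close>
  have GF_a_closed: "h \<oplus>\<^bsub>ob (?GF X) V\<^esub> h' \<in> carrier (ob (?GF X) V)"
    if V: "V \<in> fgproj R" and X: "strict_polynomial_functor R d X" and h: "h \<in> carrier (ob (?GF X) V)"
      and h': "h' \<in> carrier (ob (?GF X) V)" for V X h h'
  proof -
    interpret D: module R "?D V X" by (rule D_module[OF V X])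
    note lin = linear_mapD[OF day_schur_linear[OF R V X]]
    obtain \<phi> \<phi>' where *: "\<phi> \<in> carrier (?D V X)" "h = day_schur R d V \<phi>" "\<phi>' \<in> carrier (?D V X)" "h' = day_schur R d V \<phi>'"
      using day_schur_surj[OF R V X h] day_schur_surj[OF R V X h'] by blast
    show ?thesis
      using lin(1)[OF D.a_closed[OF *(1,3)]] lin(2)[OF *(1,3)] *(2,4) by simp
  qed
  have GF_smult_closed: "a \<odot>\<^bsub>ob (?GF X) V\<^esub> h \<in> carrier (ob (?GF X) V)"
    if V: "V \<in> fgproj R" and X: "strict_polynomial_functor R d X" and a: "a \<in> carrier R"
      and h: "h \<in> carrier (ob (?GF X) V)" for V X h a
  proof -
    interpret D: module R "?D V X" by (rule D_module[OF V X])
    note lin = linear_mapD[OF day_schur_linear[OF R V X]]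
    obtain \<phi> where *: "\<phi> \<in> carrier (?D V X)" "h = day_schur R d V \<phi>"
      using day_schur_surj[OF R V X h] by blast
    show ?thesis
      using lin(1)[OF D.smult_closed[OF a *(1)]] lin(3)[OF a *(1)] *(2) by simp
  qed
  have \<theta>_linear: "linear_map R (ob (?GF X) V) (ob (ihom ?S X) V) (\<theta> X V)"
    if V: "V \<in> fgproj R" and X: "strict_polynomial_functor R d X" for V X
    using linear_mapD[OF linear_isoD(1)[OF \<theta>0_iso[OF V X]]] GF_a_closed[OF V X] GF_smult_closed[OF V X] V
    by (intro linear_mapI) (simp_all add: \<theta>_def)
  \<comment> \<open>Naturality in \<open>V\<close> is \<open>adj_natural\<close> for the
    transformation of representable functors induced by \<open>f\<close>, combined with naturality
    along \<open>f\<close> of the adjoint of \<phi>, evaluated at the identity of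
    \<open>V\<close>.\<close>
  have \<theta>_natural: "\<theta> X W (ar (?GF X) V W f h) = ar (ihom ?S X) V W f (\<theta> X V h)"
    if X: "strict_polynomial_functor R d X" and V: "V \<in> fgproj R" and W: "W \<in> fgproj R"
      and f: "f \<in> carrier (gam_hom R d V W)" and h: "h \<in> carrier (ob (?GF X) V)" for X V W f h
  proof -
    note rV = gam_repr_spf[OF V, of d] and rW = gam_repr_spf[OF W, of d]
    note map = gam_repr_map_closed[OF V W f]
    obtain \<phi> where \<phi>: "\<phi> \<in> carrier (?D V X)" "h = day_schur R d V \<phi>" using day_schur_surj[OF R V X h] by blast
    let ?m = "day_tensor_map R d (?\<Gamma> W) ?S (?\<Gamma> V) ?S (gam_repr_map R d V W f) (nat_id R ?S)"
    let ?\<psi> = "nat_comp R (day_tensor R d (?\<Gamma> W) ?S) \<phi> ?m"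
    note \<psi> = day_schur_natural_left[OF R X V W f \<phi>(1)]
    have idV: "gam_id R d V \<in> carrier (gam_hom R d V V)" and idW: "gam_id R d W \<in> carrier (gam_hom R d W W)"
      using gam_id_closed fgprojD(2) V W by blast+
    note pH = spf_prefunctor[OF I.ihom_functor[OF S X]]
    note a = adj_closed[OF V X \<phi>(1)]
    \<comment> \<open>In \<open>adj_natural\<close> the third argument also moves, here by the
      identity of \<open>X\<close>; the composites with identities are cancelled on both
      sides.\<close>
    have "nat_comp R (day_tensor R d (?\<Gamma> V) ?S) (nat_id R X) \<phi> = \<phi>"
      by (rule nat_comp_id_left[OF day_tensor_prefunctor[OF R rV S] spf_prefunctor[OF X] \<phi>(1)])
    then have "adj (?\<Gamma> W) ?S X ?\<psi> = nat_comp R (?\<Gamma> W) (nat_id R (ihom ?S X))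
        (nat_comp R (?\<Gamma> W) (adj (?\<Gamma> V) ?S X \<phi>) (gam_repr_map R d V W f))"
      using I.adj_natural[OF rV rW S S X X map nS nat_id_closed[OF spf_prefunctor[OF X]] \<phi>(1)]
      by (simp add: I.ihom_map_id[OF S X])
    also have "\<dots> = nat_comp R (?\<Gamma> W) (adj (?\<Gamma> V) ?S X \<phi>) (gam_repr_map R d V W f)"
      by (rule nat_comp_id_left[OF spf_prefunctor[OF rW] pH nat_comp_closed[OF spf_prefunctor[OF rW] map a]])
    finally have "adj (?\<Gamma> W) ?S X ?\<psi> W (gam_id R d W) = adj (?\<Gamma> V) ?S X \<phi> W (gam_repr_map R d V W f W (gam_id R d W))"
      using W idW by (simp add: nat_comp_apply)
    also have "\<dots> = adj (?\<Gamma> V) ?S X \<phi> W (ar (?\<Gamma> V) V W f (gam_id R d V))"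
      using idV by (simp add: gam_repr_map_apply[OF W idW] gam_comp_id[OF f])
    also have "\<dots> = ar (ihom ?S X) V W f (adj (?\<Gamma> V) ?S X \<phi> V (gam_id R d V))"
      using nat_moduleD(4)[OF a V W f] idV by simp
    finally show ?thesis
      unfolding \<phi>(2) \<psi>(2)[symmetric] \<theta>_day[OF W X \<psi>(1)] \<theta>_day[OF V X \<phi>(1)] .
  qed
  have 1: "nat_iso R d (?GF X) (ihom ?S X) (\<theta> X)" if X: "strict_polynomial_functor R d X" for X
  proof -
    have "bij_betw (\<theta> X V) (carrier (ob (?GF X) V)) (carrier (ob (ihom ?S X) V))" if "V \<in> fgproj R" for V
      using linear_isoD(2)[OF \<theta>0_iso[OF that X]] that by (simp add: \<theta>_def cong: bij_betw_cong)
    moreover have "\<theta> X \<in> carrier (nat_module R d (?GF X) (ihom ?S X))"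
      using \<theta>_linear[OF _ X] \<theta>_natural[OF X] by (auto simp: nat_module_carrier \<theta>_def)
    ultimately show ?thesis by (simp add: nat_iso_def)
  qed
  \<comment> \<open>Naturality in \<open>X\<close>: now the third argument of
    \<open>adj_natural\<close> moves along \<alpha>, and the first two stay fixed, which is where
    \<open>day_tensor_map_id\<close> enters.\<close>
  have 2: "nat_comp R (?GF X) (\<theta> X') (g_hom_map R d (schur R d X) (schur_map R d X \<alpha>)) =
      nat_comp R (?GF X) (ihom_map ?S ?S X X' (nat_id R ?S) \<alpha>) (\<theta> X)"
    if X: "strict_polynomial_functor R d X" and X': "strict_polynomial_functor R d X'"
      and \<alpha>: "\<alpha> \<in> carrier (nat_module R d X X')" for X X' \<alpha>
  proof -
    have "\<theta> X' V (g_hom_map R d (schur R d X) (schur_map R d X \<alpha>) V h) = ihom_map ?S ?S X X' (nat_id R ?S) \<alpha> V (\<theta> X V h)"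
      if V: "V \<in> fgproj R" and h: "h \<in> carrier (ob (?GF X) V)" for V h
    proof -
      note rV = gam_repr_spf[OF V, of d]
      note nV = nat_id_closed[OF spf_prefunctor[OF rV]]
      obtain \<phi> where \<phi>: "\<phi> \<in> carrier (?D V X)" "h = day_schur R d V \<phi>" using day_schur_surj[OF R V X h] by blast
      let ?\<psi> = "nat_comp R (day_tensor R d (?\<Gamma> V) ?S) \<alpha> \<phi>"
      note \<psi> = day_schur_natural_right[OF R X X' \<alpha> V \<phi>(1)]
      have id: "gam_id R d V \<in> carrier (ob (?\<Gamma> V) V)" using gam_id_closed[OF fgprojD(2)[OF V]] by simp
      have "adj (?\<Gamma> V) ?S X' ?\<psi> =
          nat_comp R (?\<Gamma> V) (ihom_map ?S ?S X X' (nat_id R ?S) \<alpha>) (nat_comp R (?\<Gamma> V) (adj (?\<Gamma> V) ?S X \<phi>) (nat_id R (?\<Gamma> V)))"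
        using I.adj_natural[OF rV rV S S X X' nV nS \<alpha> \<phi>(1)] by (simp add: day_tensor_map_id[OF R rV S \<psi>(1)])
      then have "adj (?\<Gamma> V) ?S X' ?\<psi> V (gam_id R d V) =
          ihom_map ?S ?S X X' (nat_id R ?S) \<alpha> V (adj (?\<Gamma> V) ?S X \<phi> V (gam_id R d V))"
        by (simp add: nat_comp_apply[OF V id] nat_id_apply[OF V id])
      then show ?thesis
        unfolding \<phi>(2) \<psi>(2)[symmetric] \<theta>_day[OF V X' \<psi>(1)] \<theta>_day[OF V X \<phi>(1)] .
    qed
    then show ?thesis by (auto simp: nat_comp_def compose_def fun_eq_iff)
  qed
  show ?thesis using 1 2 by blast
qed

end
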